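(* Let $Z>0$. There exist constants $M_1,M_2$ with $0<Z\le M_1\le M_2<\infty$ such that, for $M\ge 0$: (i) if $M\le M_1$, then the variational problem $I_Z(M)$ has a minimizer, i.e. there is $u\in\hat H_M$ with $E_Z(u)=I_Z(M)$; (ii) if $M\ge M_2$, then the variational problem $I_Z(M)$ has no minimizer.
   Context: Let $\hat H^1(\mathbb{R}^3)$ be the closure of $C_c^\infty(\mathbb{R}^3)$ (real-valued functions) with respect to the norm $\|u\|_{L^1(\mathbb{R}^3)}+\|\nabla u\|_{L^2(\mathbb{R}^3)}$. For $Z>0$ put $V(x)=Z/|x|$ on $\mathbb{R}^3$ and, for $u\in\hat H^1(\mathbb{R}^3)$, $$E_Z(u)=\int_{\mathbb{R}^3}\Big[\tfrac12|\nabla u|^2+\tfrac12u^2(1-u)^2-Vu\Big]dx+\frac12\int_{\mathbb{R}^3}\int_{\mathbb{R}^3}\frac{u(x)u(y)}{|x-y|}\,dx\,dy.$$ For $M\ge 0$ let $\hat H_M=\{u\in\hat H^1(\mathbb{R}^3): u\ge 0 \text{ a.e. in }\mathbb{R}^3,\ \|u\|_{L^1(\mathbb{R}^3)}=M\}$ and $I_Z(M)=\inf\{E_Z(u):u\in\hat H_M\}$. *)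

theory Defs
  imports "HOL-Analysis.Analysis"
begin

definition grad :: "(real^3 \<Rightarrow> real) \<Rightarrow> real^3 \<Rightarrow> real^3" where
  "grad f x = (\<chi> i. frechet_derivative f (at x) (axis i 1))"

primrec Ck :: "nat \<Rightarrow> (real^3 \<Rightarrow> real) \<Rightarrow> bool" where
  "Ck 0 f \<longleftrightarrow> continuous_on UNIV f"
| "Ck (Suc k) f \<longleftrightarrow> (\<forall>x. f differentiable (at x)) \<and> (\<forall>i. Ck k (\<lambda>x. grad f x $ i))"

definition Cc_infinity :: "(real^3 \<Rightarrow> real) set" where
  "Cc_infinity = {f. (\<forall>k. Ck k f) \<and> compact (closure {x. f x \<noteq> 0})}"

definition locally_integrable :: "(real^3 \<Rightarrow> 'b::euclidean_space) \<Rightarrow> bool" where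
  "locally_integrable f \<longleftrightarrow> (\<forall>K. compact K \<longrightarrow> set_integrable lborel K f)"

definition has_weak_grad :: "(real^3 \<Rightarrow> real) \<Rightarrow> (real^3 \<Rightarrow> real^3) \<Rightarrow> bool" where
  "has_weak_grad u G \<longleftrightarrow> locally_integrable u \<and> locally_integrable G \<and>
     (\<forall>\<phi>\<in>Cc_infinity. \<forall>i.
        (LINT x|lborel. u x * grad \<phi> x $ i) = - (LINT x|lborel. G x $ i * \<phi> x))"

text \<open>A weak gradient is unique up to a null set; one is chosen. It is only used under
  integrals, and only for functions that have a weak gradient.\<close>

definition weak_grad :: "(real^3 \<Rightarrow> real) \<Rightarrow> real^3 \<Rightarrow> real^3" where
  "weak_grad u = (SOME G. has_weak_grad u G)"

text \<open>The closure of \<^const>\<open>Cc_infinity\<close> is formed in the space of all functions on which the norm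
  is meaningful and finite: integrable functions with a square-integrable weak gradient. Functions
  are not identified when they agree almost everywhere; Borel representatives (integrability with
  respect to \<^const>\<open>lborel\<close>) stand for the classes.\<close>

definition L1_grad_L2 :: "(real^3 \<Rightarrow> real) set" where
  "L1_grad_L2 = {u. integrable lborel u \<and> (\<exists>G. has_weak_grad u G) \<and>
     integrable lborel (\<lambda>x. (norm (weak_grad u x))\<^sup>2)}"

definition L1_norm :: "(real^3 \<Rightarrow> real) \<Rightarrow> real" where
  "L1_norm u = (LINT x|lborel. \<bar>u x\<bar>)"

definition hat_norm :: "(real^3 \<Rightarrow> real) \<Rightarrow> real" where
  "hat_norm u = L1_norm u + sqrt (LINT x|lborel. (norm (weak_grad u x))\<^sup>2)"

definition hat_H1 :: "(real^3 \<Rightarrow> real) set" where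
  "hat_H1 = {u \<in> L1_grad_L2. \<exists>\<phi>. (\<forall>n. \<phi> n \<in> Cc_infinity) \<and>
     (\<lambda>n. hat_norm (\<lambda>x. u x - \<phi> n x)) \<longlonglongrightarrow> 0}"

definition V :: "real \<Rightarrow> real^3 \<Rightarrow> real" where
  "V Z x = Z / norm x"

text \<open>All the integrals below converge absolutely on \<^const>\<open>hat_H1\<close>, because such functions lie in
  \<open>L\<^sup>1 \<inter> L\<^sup>6\<close> by the Sobolev inequality, so the value 0 of the Bochner integral on
  non-integrable functions plays no role. The division by 0 at \<open>x = 0\<close> and at \<open>x = y\<close> concerns null
  sets only.\<close>

definition energy :: "real \<Rightarrow> (real^3 \<Rightarrow> real) \<Rightarrow> real" where
  "energy Z u =
     (LINT x|lborel. (1/2) * (norm (weak_grad u x))\<^sup>2 + (1/2) * (u x)\<^sup>2 * (1 - u x)\<^sup>2 - V Z x * u x)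
     + (1/2) * (LINT x|lborel. (LINT y|lborel. u x * u y / norm (x - y)))"

definition hat_H :: "real \<Rightarrow> (real^3 \<Rightarrow> real) set" where
  "hat_H M = {u \<in> hat_H1. (AE x in lborel. u x \<ge> 0) \<and> L1_norm u = M}"

text \<open>The infimum is taken in the extended reals, so that it is the true infimum without any
  appeal to boundedness from below.\<close>

definition I_inf :: "real \<Rightarrow> real \<Rightarrow> ereal" where
  "I_inf Z M = (INF u \<in> hat_H M. ereal (energy Z u))"

definition has_minimizer :: "real \<Rightarrow> real \<Rightarrow> bool" where
  "has_minimizer Z M \<longleftrightarrow> (\<exists>u \<in> hat_H M. ereal (energy Z u) = I_inf Z M)"

end

theory Submission
  imports Defs "HOL-Complex_Analysis.Great_Picard"
begin

text \<open>Existence for \<open>M \<le> Z\<close>: the energy is bounded below on masses at most \<open>M\<close>, and a minimising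
  sequence converges locally in mean with weakly convergent gradients, so that the relaxed problem
  \<open>\<integral>u \<le> M\<close> has a minimiser \<open>u\<close>, the energy being lower semicontinuous. If \<open>\<integral>u < Z\<close>, the nucleus is not fully screened, and
  adding a small mass spread over a ball of large radius \<open>R\<close> changes the energy by a negative term
  of order \<open>1 / R\<close> and by terms of smaller order; hence \<open>\<integral>u = M\<close>.

  Nonexistence for large \<open>M\<close>: a minimiser \<open>u\<close> is cut along the smoothed half-space
  \<open>c = logistic (\<plusminus> x\<^sub>i - l)\<close> into \<open>(1 - c) u\<close> and \<open>c u\<close>, and the second piece is moved to infinity. Minimality bounds
  the Coulomb interaction of the two pieces by the interface terms and by the attraction of the
  second piece. Integrating over \<open>l \<ge> 0\<close> produces a factor \<open>\<bar>x\<^sub>i - y\<^sub>i\<bar>\<close> against \<open>1 / \<bar>x - y\<bar>\<close> on the left, and summing over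
  the six half-space directions gives \<open>M\<^sup>2 \<le> 48 (\<alpha> M + \<beta>)\<close>.\<close>

subsection \<open>Smooth functions of compact support\<close>

text \<open>Compactness can fail only through mass that escapes to infinity, and for this reason
  existence starts from the constraint with an inequality. The self-repulsion of the added mass is
  of order 1 / R like the gain, but quadratic in that mass, so a small amount still lowers the
  energy. The double well grows like \<open>s ^ 4 / 2\<close>; together with the mass it controls
  all powers of \<open>u\<close> up to the fourth, while averages over grid cubes supply the L2
  bound and local compactness. Restricting the offsets of the cut to \<open>l \<ge> 0\<close> keeps
  the attraction finite: the factor \<open>c\<close> integrates to at most
  \<open>\<bar>x $ i\<bar> + ln 2\<close>, and against \<open>u x / norm x\<close> this is linear in
  the mass, whereas the repulsion produces the square of the mass. The constant 48 is 4 times 12: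
  between the two coordinates both cut factors are at least 1 / 2, and each of the six directions is
  counted for both orders of the pair.\<close>

lemma grad_has_derivative:
  assumes "(f has_derivative f') (at x)"
  shows "grad f x $ i = f' (axis i 1)"
  using frechet_derivative_at[OF assms] by (simp add: grad_def)

lemma has_derivative_grad:
  assumes "f differentiable (at x)"
  shows "(f has_derivative (\<lambda>h. grad f x \<bullet> h)) (at x)"
proof -
  obtain f' where f': "(f has_derivative f') (at x)"
    using assms by (auto simp: differentiable_def)
  interpret bounded_linear f' by (rule has_derivative_bounded_linear[OF f'])
  have "f' h = grad f x \<bullet> h" for h
  proof -
    have "f' h = f' (\<Sum>i\<in>UNIV. h $ i *\<^sub>R axis i 1)"
      using basis_expansion[of h] by (simp add: scalar_mult_eq_scaleR)
    also have "\<dots> = (\<Sum>i\<in>UNIV. grad f x $ i * h $ i)"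
      by (simp add: sum scaleR grad_has_derivative[OF f'] mult.commute)
    finally show ?thesis by (simp add: inner_vec_def)
  qed
  then show ?thesis using f' by (metis (no_types, lifting) ext)
qed

lemma grad_eqI:
  assumes "(f has_derivative (\<lambda>h. v \<bullet> h)) (at x)"
  shows "grad f x = v"
  by (simp add: vec_eq_iff grad_has_derivative[OF assms] inner_axis)

definition smooth :: "(real^3 \<Rightarrow> real) \<Rightarrow> bool" where
  "smooth f \<longleftrightarrow> (\<forall>k. Ck k f)"

text \<open>\<open>Ck (Suc k)\<close> does not mention continuity of the function itself; it comes
  from differentiability at the bottom of the recursion.\<close>

lemma Ck_SucD: "Ck (Suc k) f \<Longrightarrow> Ck k f"
proof (induction k arbitrary: f)
  case 0
  then show ?case
    by (simp add: continuous_on_eq_continuous_within differentiable_imp_continuous_within)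
next
  case (Suc k)
  show ?case using Suc.prems Suc.IH by (metis Ck.simps(2))
qed

lemma smooth_differentiable: "smooth f \<Longrightarrow> f differentiable (at x)"
  unfolding smooth_def by (metis Ck.simps(2))

lemma smooth_grad: "smooth f \<Longrightarrow> smooth (\<lambda>x. grad f x $ i)"
  unfolding smooth_def by (metis Ck.simps(2))

lemma smoothI:
  assumes "\<And>x. f differentiable (at x)" "\<And>i. smooth (\<lambda>x. grad f x $ i)"
  shows "smooth f"
proof -
  have S: "Ck (Suc k) f" for k using assms unfolding smooth_def by simp
  show ?thesis unfolding smooth_def using S Ck_SucD by blast
qed

lemma smooth_has_derivative:
  "smooth f \<Longrightarrow> (f has_derivative (\<lambda>h. grad f x \<bullet> h)) (at x)"
  by (simp add: has_derivative_grad smooth_differentiable)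

lemma smooth_continuous_on: "smooth f \<Longrightarrow> continuous_on S f"
  unfolding smooth_def by (metis Ck.simps(1) continuous_on_subset subset_UNIV)

lemma smooth_continuous_on_grad: "smooth f \<Longrightarrow> continuous_on S (grad f)"
  by (simp add: continuous_on_vec_lambda[of S "\<lambda>i x. grad f x $ i", simplified vec_lambda_eta]
      smooth_continuous_on smooth_grad)

lemma grad_const: "grad (\<lambda>x. c) x = 0"
  by (rule grad_eqI) simp

lemma smooth_const: "smooth (\<lambda>x. c)"
proof -
  have "Ck k (\<lambda>x. c)" for k c
    by (induction k arbitrary: c) (simp_all add: grad_const)
  then show ?thesis by (simp add: smooth_def)
qed

lemma grad_add:
  assumes "f differentiable (at x)" "g differentiable (at x)"
  shows "grad (\<lambda>x. f x + g x) x = grad f x + grad g x"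
  by (rule grad_eqI)
     (auto intro!: derivative_eq_intros has_derivative_grad assms simp: inner_add_left)

lemma grad_mult:
  assumes "f differentiable (at x)" "g differentiable (at x)"
  shows "grad (\<lambda>x. f x * g x) x = f x *\<^sub>R grad g x + g x *\<^sub>R grad f x"
  by (rule grad_eqI)
     (auto intro!: derivative_eq_intros has_derivative_grad assms simp: inner_add_left)

lemma Ck_add: "Ck k f \<Longrightarrow> Ck k g \<Longrightarrow> Ck k (\<lambda>x. f x + g x)"
proof (induction k arbitrary: f g)
  case 0
  then show ?case by (simp add: continuous_on_add)
next
  case (Suc k)
  then show ?case by (simp add: grad_add)
qed

text \<open>The product rule pairs a factor with a gradient, one order apart; \<open>Ck_SucD\<close>
  brings the factor down to order \<open>k\<close>.\<close>

lemma Ck_mult: "Ck k f \<Longrightarrow> Ck k g \<Longrightarrow> Ck k (\<lambda>x. f x * g x)"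
proof (induction k arbitrary: f g)
  case 0
  then show ?case by (simp add: continuous_on_mult)
next
  case (Suc k)
  have "Ck k f" "Ck k g" using Suc.prems Ck_SucD by blast+
  with Suc show ?case by (simp add: grad_mult Ck_add)
qed

lemma smooth_add: "smooth f \<Longrightarrow> smooth g \<Longrightarrow> smooth (\<lambda>x. f x + g x)"
  and smooth_mult: "smooth f \<Longrightarrow> smooth g \<Longrightarrow> smooth (\<lambda>x. f x * g x)"
  by (simp_all add: smooth_def Ck_add Ck_mult)

lemma smooth_cmult: "smooth f \<Longrightarrow> smooth (\<lambda>x. c * f x)"
  by (simp add: smooth_mult smooth_const)

lemma smooth_diff: "smooth f \<Longrightarrow> smooth g \<Longrightarrow> smooth (\<lambda>x. f x - g x)"
  using smooth_add[of f "\<lambda>x. (-1) * g x"] smooth_cmult[of g "-1"] by simp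

lemma smooth_power: "smooth f \<Longrightarrow> smooth (\<lambda>x. f x ^ n)"
  by (induction n) (simp_all add: smooth_const smooth_mult)

lemma smooth_prod: "finite A \<Longrightarrow> (\<And>i. i \<in> A \<Longrightarrow> smooth (f i)) \<Longrightarrow> smooth (\<lambda>x. \<Prod>i\<in>A. f i x)"
  by (induction A rule: finite_induct) (simp_all add: smooth_const smooth_mult)

lemma smooth_coord: "smooth (\<lambda>x. x $ i)"
proof (rule smoothI)
  show "(\<lambda>x::real^3. x $ i) differentiable (at x)" for x
    by (simp add: bounded_linear_imp_differentiable bounded_linear_vec_nth)
  have "grad (\<lambda>x. x $ i) x = axis i 1" for x
    by (rule grad_eqI) (auto intro!: derivative_eq_intros bounded_linear_imp_has_derivative
        bounded_linear_vec_nth simp: inner_axis')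
  then show "smooth (\<lambda>x. grad (\<lambda>x. x $ i) x $ j)" for j by (simp add: smooth_const)
qed

lemma grad_compose:
  assumes "(h has_field_derivative d) (at (p x))" "p differentiable (at x)"
  shows "grad (\<lambda>x. h (p x)) x = d *\<^sub>R grad p x"
proof (rule grad_eqI)
  have "((h \<circ> p) has_derivative ((\<lambda>s. d * s) \<circ> (\<lambda>y. grad p x \<bullet> y))) (at x)"
    using assms by (intro diff_chain_at has_derivative_grad) (auto simp: has_field_derivative_def)
  then show "((\<lambda>x. h (p x)) has_derivative (\<lambda>y. (d *\<^sub>R grad p x) \<bullet> y)) (at x)"
    by (simp add: comp_def)
qed

text \<open>The derivatives of the outer function come as a family \<open>h n\<close>, so that the
  induction over the order can pass from \<open>h n\<close> to \<open>h (Suc n)\<close>. It serves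
  \<open>flat_exp\<close> and \<open>logistic\<close>, whose families of derivatives are
  explicit.\<close>

lemma smooth_compose:
  fixes h :: "nat \<Rightarrow> real \<Rightarrow> real"
  assumes h: "\<And>n t. (h n has_field_derivative h (Suc n) t) (at t)" and p: "smooth p"
  shows "smooth (\<lambda>x. h n (p x))"
proof -
  have d: "(\<lambda>x. h n (p x)) differentiable (at x)" for n x
    using differentiable_chain_at[OF smooth_differentiable[OF p], of "h n"] h
    by (metis comp_def ext field_differentiable_def field_differentiable_imp_differentiable)
  have "Ck k (\<lambda>x. h n (p x))" for k
  proof (induction k arbitrary: n)
    case 0
    show ?case using d
      by (simp add: continuous_on_eq_continuous_within differentiable_imp_continuous_within)
  next
    case (Suc k)
    have "Ck k (\<lambda>x. grad p x $ i)" for i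
      using p unfolding smooth_def by (metis Ck.simps(2))
    with Suc d show ?case
      by (simp add: grad_compose[OF h smooth_differentiable[OF p]] Ck_mult)
  qed
  then show ?thesis by (simp add: smooth_def)
qed

lemma has_derivative_affine:
  fixes f :: "real^3 \<Rightarrow> real"
  assumes "smooth f"
  shows "((\<lambda>x. f (c *\<^sub>R x + a)) has_derivative (\<lambda>h. (c *\<^sub>R grad f (c *\<^sub>R x + a)) \<bullet> h)) (at x)"
proof -
  have "((f \<circ> (\<lambda>x. c *\<^sub>R x + a)) has_derivative
      ((\<lambda>y. grad f (c *\<^sub>R x + a) \<bullet> y) \<circ> (\<lambda>h. c *\<^sub>R h))) (at x)"
    by (intro diff_chain_at) (auto intro!: derivative_eq_intros smooth_has_derivative assms)
  then show ?thesis by (simp add: comp_def)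
qed

lemma grad_affine:
  "smooth f \<Longrightarrow> grad (\<lambda>x. f (c *\<^sub>R x + a)) x = c *\<^sub>R grad f (c *\<^sub>R x + a)"
  by (rule grad_eqI) (rule has_derivative_affine)

lemma smooth_affine: assumes "smooth f" shows "smooth (\<lambda>x. f (c *\<^sub>R x + a))"
proof -
  \<comment> \<open>The factor \<open>b\<close> is part of the claim because every differentiation
    brings out a factor \<open>c\<close>.\<close>
  have "smooth f \<Longrightarrow> Ck k (\<lambda>x. b * f (c *\<^sub>R x + a))" for k b f
  proof (induction k arbitrary: f b)
    case 0
    show ?case
      by (auto intro!: continuous_intros continuous_on_compose2[OF smooth_continuous_on[OF 0, of UNIV]])
  next
    case (Suc k)
    have d: "(\<lambda>x. f (c *\<^sub>R x + a)) differentiable (at x)" for x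
      using has_derivative_affine[OF Suc.prems] unfolding differentiable_def by blast
    have "grad (\<lambda>x. b * f (c *\<^sub>R x + a)) x = b *\<^sub>R c *\<^sub>R grad f (c *\<^sub>R x + a)" for x
      using grad_mult[OF _ d, of "\<lambda>x. b"] by (simp add: grad_affine[OF Suc.prems] grad_const)
    then show ?case
      using Suc.IH[OF smooth_grad[OF Suc.prems], of "b * c"] d by (simp add: algebra_simps)
  qed
  from this[OF assms, of _ 1] show ?thesis by (simp add: smooth_def)
qed

text \<open>The functions \<open>flat_exp p\<close>, with \<open>p\<close> a polynomial in \<open>1 / t\<close>, are closed under
  differentiation, so they are all smooth.\<close>

definition flat_exp :: "real poly \<Rightarrow> real \<Rightarrow> real" where
  "flat_exp p t = (if t > 0 then poly p (1 / t) * exp (- (1 / t)) else 0)"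

lemma poly_times_exp_minus_tendsto_0:
  fixes p :: "real poly"
  shows "((\<lambda>s. poly p s * exp (- s)) \<longlongrightarrow> 0) at_top"
proof -
  have e: "(\<lambda>s. poly p s * exp (- s)) = (\<lambda>s. \<Sum>i\<le>degree p. coeff p i * (s ^ i / exp s))"
    by (simp add: poly_altdef sum_distrib_right exp_minus field_simps sum_divide_distrib)
  show ?thesis unfolding e
    by (rule tendsto_eq_rhs, rule tendsto_sum, rule tendsto_mult[OF tendsto_const tendsto_power_div_exp_0]) simp
qed

lemma flat_exp_tendsto_0: "((\<lambda>t. flat_exp p t) \<longlongrightarrow> 0) (at_right 0)"
proof -
  have "((\<lambda>t. poly p (inverse t) * exp (- inverse t)) \<longlongrightarrow> 0) (at_right 0)"
    by (rule filterlim_compose[OF poly_times_exp_minus_tendsto_0 filterlim_inverse_at_top_right])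
  then show ?thesis
    by (rule Lim_transform_eventually)
       (simp add: eventually_at_right_less flat_exp_def inverse_eq_divide eventually_at_filter)
qed

text \<open>Put \<open>s = 1 / t\<close>, whose derivative is \<open>- s\<^sup>2\<close>. Then
  \<open>p s * exp (- s)\<close> has the derivative
  \<open>s\<^sup>2 * (p s - p' s) * exp (- s)\<close>, and \<open>[:0, 0, 1:]\<close> is the factor
  \<open>s\<^sup>2\<close>.\<close>

lemma flat_exp_deriv:
  "(flat_exp p has_field_derivative flat_exp ([:0, 0, 1:] * (p - pderiv p)) t) (at t)"
proof (cases "t = 0")
  case False
  then consider "t > 0" | "t < 0" by linarith
  then show ?thesis
  proof cases
    case 1
    have "((\<lambda>t. poly p (1 / t) * exp (- (1 / t))) has_field_derivative
        flat_exp ([:0, 0, 1:] * (p - pderiv p)) t) (at t)"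
      using 1 by (auto intro!: derivative_eq_intros DERIV_chain2[OF poly_DERIV]
          simp: flat_exp_def field_simps power2_eq_square)
    then show ?thesis
      by (rule has_field_derivative_transform_within_open[where S="{0<..}"])
         (use 1 in \<open>auto simp: flat_exp_def\<close>)
  next
    case 2
    have "((\<lambda>t. 0) has_field_derivative flat_exp ([:0, 0, 1:] * (p - pderiv p)) t) (at t)"
      using 2 by (simp add: flat_exp_def)
    then show ?thesis
      by (rule has_field_derivative_transform_within_open[where S="{..<0}"])
         (use 2 in \<open>auto simp: flat_exp_def\<close>)
  qed
next
  case True
  have "((\<lambda>h. flat_exp p h / h) \<longlongrightarrow> 0) (at 0)"
  proof (rule filterlim_split_at)
    show "((\<lambda>h. flat_exp p h / h) \<longlongrightarrow> 0) (at_left 0)"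
      by (rule Lim_transform_eventually[OF tendsto_const])
         (simp add: eventually_at_filter flat_exp_def)
    \<comment> \<open>For \<open>h > 0\<close> the quotient by \<open>h\<close> is
      \<open>flat_exp\<close> of the polynomial \<open>[:0, 1:] * p\<close>, so the limit already
      proved applies to it.\<close>
    show "((\<lambda>h. flat_exp p h / h) \<longlongrightarrow> 0) (at_right 0)"
      by (rule Lim_transform_eventually[OF flat_exp_tendsto_0[of "[:0, 1:] * p"]])
         (simp add: eventually_at_filter flat_exp_def)
  qed
  then show ?thesis using True by (simp add: DERIV_def flat_exp_def)
qed

lemma smooth_flat_exp: assumes "smooth p" shows "smooth (\<lambda>x. flat_exp 1 (p x))"
proof -
  define h where "h n = flat_exp (((\<lambda>q. [:0, 0, 1:] * (q - pderiv q)) ^^ n) 1)" for n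
  have "(h n has_field_derivative h (Suc n) t) (at t)" for n t
    unfolding h_def by (simp only: funpow.simps comp_def flat_exp_deriv)
  from smooth_compose[of h p 0, OF this assms] show ?thesis by (simp add: h_def)
qed

lemma flat_exp_1: "0 \<le> flat_exp 1 t" "flat_exp 1 t < 1" "0 < flat_exp 1 t \<longleftrightarrow> t > 0"
  by (auto simp: flat_exp_def)

section \<open>Bumps on boxes and the class of test functions\<close>

definition box_bump :: "real^3 \<Rightarrow> real^3 \<Rightarrow> real^3 \<Rightarrow> real" where
  "box_bump a b x = (\<Prod>i\<in>UNIV. flat_exp 1 (x $ i - a $ i) * flat_exp 1 (b $ i - x $ i))"

lemma smooth_box_bump: "smooth (box_bump a b)"
  unfolding box_bump_def[abs_def]
  by (intro smooth_prod smooth_mult smooth_flat_exp smooth_diff smooth_coord smooth_const) simp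

lemma box_bump_nonneg: "0 \<le> box_bump a b x"
  by (simp add: box_bump_def prod_nonneg flat_exp_1)

text \<open>Keeps the powers of \<open>1 - box_bump a b x\<close> between 0 and 1;
  \<open>fundamental_lemma\<close> uses them to approach the indicator of the box.\<close>

lemma box_bump_less_1: "box_bump a b x < 1"
proof -
  have "box_bump a b x < (\<Prod>i\<in>(UNIV::3 set). 1)"
    unfolding box_bump_def
  \<comment> \<open>One index with a strict inequality is asked for; every index has it, so an
    arbitrary one is given.\<close>
  proof (rule prod_mono_strict[of undefined])
    have "flat_exp 1 (x $ i - a $ i) * flat_exp 1 (b $ i - x $ i) < 1" for i
      using mult_strict_mono'[OF flat_exp_1(2) flat_exp_1(2) flat_exp_1(1) flat_exp_1(1)] by simp
    then show "flat_exp 1 (x $ i - a $ i) * flat_exp 1 (b $ i - x $ i) < 1"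
        "0 \<le> flat_exp 1 (x $ i - a $ i) * flat_exp 1 (b $ i - x $ i) \<and>
        flat_exp 1 (x $ i - a $ i) * flat_exp 1 (b $ i - x $ i) \<le> 1" for i
      by (simp_all add: flat_exp_1 less_imp_le)
  qed auto
  then show ?thesis by simp
qed

lemma box_bump_pos: "0 < box_bump a b x \<longleftrightarrow> x \<in> box a b"
proof -
  have "0 < box_bump a b x \<longleftrightarrow> box_bump a b x \<noteq> 0"
    using box_bump_nonneg[of a b x] by linarith
  also have "\<dots> \<longleftrightarrow> (\<forall>i. x $ i - a $ i > 0 \<and> b $ i - x $ i > 0)"
    by (auto simp: box_bump_def flat_exp_def)
  finally show ?thesis by (auto simp: mem_box_cart)
qed

lemma Cc_infinityD: "\<phi> \<in> Cc_infinity \<Longrightarrow> smooth \<phi>"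
  "\<phi> \<in> Cc_infinity \<Longrightarrow> compact (closure {x. \<phi> x \<noteq> 0})"
  by (simp_all add: Cc_infinity_def smooth_def)

lemma Cc_infinityI:
  assumes "smooth \<phi>" "\<And>x. \<phi> x \<noteq> 0 \<Longrightarrow> x \<in> K" "bounded K"
  shows "\<phi> \<in> Cc_infinity"
proof -
  have "bounded {x. \<phi> x \<noteq> 0}" using assms by (auto intro: bounded_subset)
  then show ?thesis using assms(1) by (simp add: Cc_infinity_def smooth_def compact_closure)
qed

lemma Cc_infinity_bounded_support:
  "\<phi> \<in> Cc_infinity \<Longrightarrow> bounded {x. \<phi> x \<noteq> 0}"
  using Cc_infinityD(2) compact_closure by blast

lemma Cc_infinity_smooth_mult:
  assumes "\<phi> \<in> Cc_infinity" "smooth \<psi>" shows "(\<lambda>x. \<psi> x * \<phi> x) \<in> Cc_infinity"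
proof (rule Cc_infinityI[OF _ _ Cc_infinity_bounded_support[OF assms(1)]])
  show "smooth (\<lambda>x. \<psi> x * \<phi> x)" by (intro smooth_mult assms Cc_infinityD)
qed auto

lemma Cc_infinity_add:
  assumes "\<phi> \<in> Cc_infinity" "\<psi> \<in> Cc_infinity" shows "(\<lambda>x. \<phi> x + \<psi> x) \<in> Cc_infinity"
proof (rule Cc_infinityI)
  show "smooth (\<lambda>x. \<phi> x + \<psi> x)" by (intro smooth_add assms Cc_infinityD)
  show "bounded ({x. \<phi> x \<noteq> 0} \<union> {x. \<psi> x \<noteq> 0})"
    by (simp add: assms Cc_infinity_bounded_support)
qed auto

lemma Cc_infinity_cmult: "\<phi> \<in> Cc_infinity \<Longrightarrow> (\<lambda>x. c * \<phi> x) \<in> Cc_infinity"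
  by (simp add: Cc_infinity_smooth_mult smooth_const)

lemma Cc_infinity_affine:
  assumes "\<phi> \<in> Cc_infinity" "c \<noteq> 0" shows "(\<lambda>x. \<phi> (c *\<^sub>R x + a)) \<in> Cc_infinity"
proof (rule Cc_infinityI)
  show "smooth (\<lambda>x. \<phi> (c *\<^sub>R x + a))" by (intro smooth_affine Cc_infinityD assms)
  show "bounded ((\<lambda>y. (1 / c) *\<^sub>R (y - a)) ` {x. \<phi> x \<noteq> 0})"
    by (intro bounded_scaling bounded_translation_minus Cc_infinity_bounded_support assms
        | simp only: image_image[symmetric, of "\<lambda>y. (1 / c) *\<^sub>R y" "\<lambda>y. y - a"])+
  show "x \<in> (\<lambda>y. (1 / c) *\<^sub>R (y - a)) ` {x. \<phi> x \<noteq> 0}" if "\<phi> (c *\<^sub>R x + a) \<noteq> 0" for x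
    using that assms(2) by (intro image_eqI[of _ _ "c *\<^sub>R x + a"]) auto
qed

lemma box_bump_Cc: "box_bump a b \<in> Cc_infinity"
  by (rule Cc_infinityI[OF smooth_box_bump _ bounded_box[of a b]])
     (metis box_bump_nonneg box_bump_pos less_eq_real_def)

lemma Cc_infinity_continuous:
  "\<phi> \<in> Cc_infinity \<Longrightarrow> continuous_on S \<phi>" "\<phi> \<in> Cc_infinity \<Longrightarrow> continuous_on S (grad \<phi>)"
  by (simp_all add: Cc_infinityD smooth_continuous_on smooth_continuous_on_grad)

lemma Cc_infinity_measurable [measurable]:
  assumes "\<phi> \<in> Cc_infinity"
  shows "\<phi> \<in> borel_measurable borel" "grad \<phi> \<in> borel_measurable borel"
  using assms by (auto intro!: borel_measurable_continuous_onI Cc_infinity_continuous)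

lemma grad_outside_support:
  assumes "x \<notin> closure {x. f x \<noteq> 0}" shows "grad f x = 0"
proof (rule grad_eqI)
  have "(f has_derivative (\<lambda>h. 0)) (at x)"
    by (rule has_derivative_transform_within_open[of "\<lambda>x. 0" _ _ _ "- closure {x. f x \<noteq> 0}"])
       (use assms closure_subset[of "{x. f x \<noteq> 0}"] in auto)
  moreover have "(\<bullet>) (0::real^3) = (\<lambda>h. 0)" by (rule ext) simp
  ultimately show "(f has_derivative (\<bullet>) 0) (at x)" by simp
qed

lemma Cc_infinity_bounded:
  assumes "\<phi> \<in> Cc_infinity"
  shows "bounded (range \<phi>)" "bounded (range (grad \<phi>))"
proof -
  let ?K = "closure {x. \<phi> x \<noteq> 0}"
  have "range \<phi> \<subseteq> insert 0 (\<phi> ` ?K)" "range (grad \<phi>) \<subseteq> insert 0 (grad \<phi> ` ?K)"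
    using closure_subset[of "{x. \<phi> x \<noteq> 0}"] grad_outside_support[of _ \<phi>] by blast+
  moreover have "bounded (\<phi> ` ?K)" "bounded (grad \<phi> ` ?K)"
    by (auto intro!: compact_imp_bounded compact_continuous_image Cc_infinity_continuous
        Cc_infinityD assms)
  ultimately show "bounded (range \<phi>)" "bounded (range (grad \<phi>))"
    by (meson bounded_insert bounded_subset)+
qed

lemma continuous_compact_support_integrable:
  fixes f :: "real^3 \<Rightarrow> 'a::euclidean_space"
  assumes "continuous_on UNIV f" "compact K" "\<And>x. x \<notin> K \<Longrightarrow> f x = 0"
  shows "integrable lborel f"
proof -
  have "set_integrable lborel K f"
    unfolding set_integrable_def
    by (intro borel_integrable_compact assms continuous_on_subset[OF assms(1)]) simp
  moreover have "(\<lambda>x. indicat_real K x *\<^sub>R f x) = f"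
    using assms(3) by (auto simp: indicator_def)
  ultimately show ?thesis by (simp add: set_integrable_def)
qed

lemma Cc_infinity_zero_outside:
  "x \<notin> closure {x. \<phi> x \<noteq> 0} \<Longrightarrow> \<phi> x = 0"
  using closure_subset[of "{x. \<phi> x \<noteq> 0}"] by blast

lemma Cc_infinity_integrable:
  assumes "\<phi> \<in> Cc_infinity"
  shows "integrable lborel \<phi>" "integrable lborel (grad \<phi>)"
    "integrable lborel (\<lambda>x. (norm (grad \<phi> x))\<^sup>2)"
proof -
  note K = Cc_infinityD(2)[OF assms]
  show "integrable lborel \<phi>"
    by (rule continuous_compact_support_integrable[OF Cc_infinity_continuous(1)[OF assms] K])
       (rule Cc_infinity_zero_outside)
  show "integrable lborel (grad \<phi>)"
    by (rule continuous_compact_support_integrable[OF Cc_infinity_continuous(2)[OF assms] K])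
       (rule grad_outside_support)
  show "integrable lborel (\<lambda>x. (norm (grad \<phi> x))\<^sup>2)"
    by (rule continuous_compact_support_integrable[OF _ K])
       (simp_all add: continuous_on_power continuous_on_norm Cc_infinity_continuous(2)[OF assms]
         grad_outside_support)
qed

abbreviation L1n :: "(real^3 \<Rightarrow> real) \<Rightarrow> ennreal" where
  "L1n f \<equiv> \<integral>\<^sup>+x. ennreal \<bar>f x\<bar> \<partial>lborel"

text \<open>The square of the L2 norm; hence the factors 2 in \<open>L2n_triangle\<close> and the
  factor \<open>c\<^sup>2\<close> in \<open>L2n_cmult\<close>.\<close>

abbreviation L2n :: "(real^3 \<Rightarrow> 'b::real_normed_vector) \<Rightarrow> ennreal" where
  "L2n f \<equiv> \<integral>\<^sup>+x. ennreal ((norm (f x))\<^sup>2) \<partial>lborel"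

subsection \<open>Weak gradients\<close>

lemma borel_measurable_vec_nth [measurable (raw)]:
  fixes f :: "'a \<Rightarrow> real^'n"
  assumes "f \<in> borel_measurable M" shows "(\<lambda>x. f x $ i) \<in> borel_measurable M"
  using borel_measurable_inner[OF assms, of "\<lambda>x. axis i 1"] by (simp add: inner_axis)

section \<open>Integrals and norms under translations, dilations and sums\<close>

lemma nn_integral_lborel_translate:
  fixes f :: "'a::euclidean_space \<Rightarrow> ennreal"
  assumes [measurable]: "f \<in> borel_measurable borel"
  shows "(\<integral>\<^sup>+x. f (x + a) \<partial>lborel) = (\<integral>\<^sup>+x. f x \<partial>lborel)"
proof -
  have "(\<integral>\<^sup>+x. f x \<partial>lborel) = (\<integral>\<^sup>+x. f x \<partial>(distr lborel borel ((+) a)))"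
    by (simp add: lborel_distr_plus)
  also have "\<dots> = (\<integral>\<^sup>+x. f (a + x) \<partial>lborel)"
    by (subst nn_integral_distr) auto
  finally show ?thesis by (simp add: add.commute)
qed

lemma nn_integral_lborel_scale:
  fixes f :: "real^3 \<Rightarrow> ennreal"
  assumes [measurable]: "f \<in> borel_measurable borel" and R: "R > 0"
  shows "(\<integral>\<^sup>+x. f (x /\<^sub>R R) \<partial>lborel) = ennreal (R ^ 3) * (\<integral>\<^sup>+x. f x \<partial>lborel)"
proof -
  have "(\<integral>\<^sup>+x. f x \<partial>lborel)
      = (\<integral>\<^sup>+x. f x \<partial>(density (distr lborel borel (\<lambda>x. 0 + (1 / R) *\<^sub>R x)) (\<lambda>_. \<bar>1 / R\<bar>^DIM(real^3))))"
    using lborel_affine[of "1 / R" "0::real^3"] R by simp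
  also have "\<dots> = (\<integral>\<^sup>+x. ennreal ((1 / R) ^ 3) * f (x /\<^sub>R R) \<partial>lborel)"
    using R by (subst nn_integral_density, simp, simp, subst nn_integral_distr)
       (auto simp: inverse_eq_divide)
  also have "\<dots> = ennreal ((1 / R) ^ 3) * (\<integral>\<^sup>+x. f (x /\<^sub>R R) \<partial>lborel)"
    by (subst nn_integral_cmult) auto
  finally have "ennreal (R ^ 3) * (\<integral>\<^sup>+x. f x \<partial>lborel)
      = (ennreal (R ^ 3) * ennreal ((1 / R) ^ 3)) * (\<integral>\<^sup>+x. f (x /\<^sub>R R) \<partial>lborel)"
    by (simp add: mult.assoc)
  also have "ennreal (R ^ 3) * ennreal ((1 / R) ^ 3) = 1"
    using R by (simp add: ennreal_mult[symmetric] power_mult_distrib[symmetric])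
  finally show ?thesis by simp
qed

lemma L1n_triangle:
  assumes "f \<in> borel_measurable borel" "g \<in> borel_measurable borel"
    and "\<And>x. \<bar>h x\<bar> \<le> \<bar>f x\<bar> + \<bar>g x\<bar>"
  shows "L1n h \<le> L1n f + L1n g"
proof -
  have "L1n h \<le> (\<integral>\<^sup>+x. ennreal \<bar>f x\<bar> + ennreal \<bar>g x\<bar> \<partial>lborel)"
    by (intro nn_integral_mono) (simp add: ennreal_plus[symmetric] assms(3) del: ennreal_plus)
  also have "\<dots> = L1n f + L1n g" using assms(1,2) by (intro nn_integral_add) auto
  finally show ?thesis .
qed

lemma L2n_triangle:
  fixes f g h :: "real^3 \<Rightarrow> 'b::euclidean_space"
  assumes [measurable]: "f \<in> borel_measurable borel" "g \<in> borel_measurable borel"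
    and le: "\<And>x. norm (h x) \<le> norm (f x) + norm (g x)"
  shows "L2n h \<le> 2 * L2n f + 2 * L2n g"
proof -
  have "(norm (h x))\<^sup>2 \<le> 2 * (norm (f x))\<^sup>2 + 2 * (norm (g x))\<^sup>2" for x
  proof -
    have "(norm (h x))\<^sup>2 \<le> (norm (f x) + norm (g x))\<^sup>2" by (intro power_mono le) simp
    also have "\<dots> \<le> 2 * (norm (f x))\<^sup>2 + 2 * (norm (g x))\<^sup>2"
      using sum_squares_bound[of "norm (f x)" "norm (g x)"] by (simp add: power2_sum)
    finally show ?thesis .
  qed
  then have "L2n h \<le> (\<integral>\<^sup>+x. 2 * ennreal ((norm (f x))\<^sup>2) + 2 * ennreal ((norm (g x))\<^sup>2) \<partial>lborel)"
    by (intro nn_integral_mono)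
       (simp add: ennreal_plus[symmetric] ennreal_mult[symmetric]
         ennreal_numeral[symmetric] del: ennreal_plus ennreal_numeral)
  also have "\<dots> = 2 * L2n f + 2 * L2n g"
    by (subst nn_integral_add) (auto simp: nn_integral_cmult)
  finally show ?thesis .
qed

lemma L2n_cmult:
  fixes f :: "real^3 \<Rightarrow> 'b::euclidean_space"
  assumes [measurable]: "f \<in> borel_measurable borel"
  shows "L2n (\<lambda>x. c *\<^sub>R f x) = ennreal (c\<^sup>2) * L2n f"
  by (subst nn_integral_cmult[symmetric]) (auto simp: power_mult_distrib ennreal_mult)

lemma L1n_cmult:
  assumes [measurable]: "f \<in> borel_measurable borel"
  shows "L1n (\<lambda>x. c * f x) = ennreal \<bar>c\<bar> * L1n f"
  by (subst nn_integral_cmult[symmetric]) (auto simp: abs_mult ennreal_mult)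

lemma Cc_infinity_L_finite:
  assumes "\<phi> \<in> Cc_infinity"
  shows "L1n \<phi> < \<infinity>" "L2n (grad \<phi>) < \<infinity>"
  using Cc_infinity_integrable[OF assms] by (auto simp: integrable_iff_bounded)

lemma integrable_L1n: "integrable lborel f \<longleftrightarrow> f \<in> borel_measurable borel \<and> L1n f < \<infinity>"
  by (simp add: integrable_iff_bounded)

lemma integrable_L2n:
  "integrable lborel (\<lambda>x. (norm (f x))\<^sup>2) \<longleftrightarrow> (\<lambda>x. (norm (f x))\<^sup>2) \<in> borel_measurable borel \<and> L2n f < \<infinity>"
  by (simp add: integrable_iff_bounded)

text \<open>Jensen's inequality on the segment from \<open>x\<close> to \<open>x + h\<close>: the
  increment \<open>c\<close> is the mean of the directional derivative \<open>g\<close>, and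
  integrating \<open>2 * c * g t - c\<^sup>2 \<le> (g t)\<^sup>2\<close> leaves
  \<open>c\<^sup>2\<close> on the left.\<close>

lemma square_increment_le_nn_integral:
  assumes "smooth \<phi>"
  shows "ennreal ((\<phi> (x + h) - \<phi> x)\<^sup>2)
    \<le> (\<integral>\<^sup>+t. indicator {0..1} t * ennreal ((norm h)\<^sup>2 * (norm (grad \<phi> (x + t *\<^sub>R h)))\<^sup>2) \<partial>lborel)"
proof -
  define g where "g t = grad \<phi> (x + t *\<^sub>R h) \<bullet> h" for t
  define c where "c = \<phi> (x + h) - \<phi> x"
  have "((\<phi> \<circ> (\<lambda>t. x + t *\<^sub>R h)) has_derivative ((\<lambda>y. grad \<phi> (x + t *\<^sub>R h) \<bullet> y) \<circ> (\<lambda>s. s *\<^sub>R h)))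
      (at t within {0..1})" for t
    by (rule has_derivative_at_withinI, rule diff_chain_at[OF _ smooth_has_derivative[OF assms]])
       (auto intro!: derivative_eq_intros)
  then have d: "((\<lambda>t. \<phi> (x + t *\<^sub>R h)) has_vector_derivative g t) (at t within {0..1})" for t
    by (simp add: has_vector_derivative_def g_def comp_def)
  have i: "(g has_integral c) {0..1}"
    using fundamental_theorem_of_calculus[of 0 1, OF _ d] by (simp add: c_def)
  have cg: "continuous_on {0..1} g"
    unfolding g_def
    by (intro continuous_intros continuous_on_compose2[OF smooth_continuous_on_grad[OF assms, of UNIV]]) auto
  then have "(\<lambda>t. (g t)\<^sup>2) integrable_on {0..1}"
    by (intro integrable_continuous_interval continuous_intros)
  then obtain I where I: "((\<lambda>t. (g t)\<^sup>2) has_integral I) {0..1}" by blast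
  have "((\<lambda>t. (2 * c) * g t - c\<^sup>2) has_integral ((2 * c) * c - c\<^sup>2)) {0..1}"
    using has_integral_diff[OF has_integral_mult_right[OF i] has_integral_const_real[of "c\<^sup>2" 0 1]]
    by simp
  then have "(2 * c) * c - c\<^sup>2 \<le> I"
    by (rule has_integral_le[OF _ I])
       (use sum_squares_bound in \<open>auto simp: algebra_simps\<close>)
  then have "ennreal (c\<^sup>2) \<le> ennreal I" by (simp add: power2_eq_square ennreal_leI)
  also have "ennreal I = (\<integral>\<^sup>+t. ennreal (indicator {0..1} t * (g t)\<^sup>2) \<partial>lborel)"
    by (subst nn_integral_has_integral_lebesgue[OF _ I]) auto
  also have "\<dots> \<le> (\<integral>\<^sup>+t. indicator {0..1} t * ennreal ((norm h)\<^sup>2 * (norm (grad \<phi> (x + t *\<^sub>R h)))\<^sup>2) \<partial>lborel)"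
  proof (intro nn_integral_mono)
    fix t
    have "(g t)\<^sup>2 \<le> (norm h)\<^sup>2 * (norm (grad \<phi> (x + t *\<^sub>R h)))\<^sup>2"
      unfolding g_def using Cauchy_Schwarz_ineq[of "grad \<phi> (x + t *\<^sub>R h)" h]
      by (simp add: power2_norm_eq_inner mult.commute)
    then show "ennreal (indicator {0..1} t * (g t)\<^sup>2)
        \<le> indicator {0..1} t * ennreal ((norm h)\<^sup>2 * (norm (grad \<phi> (x + t *\<^sub>R h)))\<^sup>2)"
      by (auto simp: indicator_def intro!: ennreal_leI)
  qed
  finally show ?thesis by (simp add: c_def)
qed

text \<open>After exchanging the integrals over the segment and over space, every translate of the
  gradient has the same norm.\<close>

lemma Cc_infinity_translation_estimate:
  assumes "\<phi> \<in> Cc_infinity"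
  shows "L2n (\<lambda>x. \<phi> (x + h) - \<phi> x) \<le> ennreal ((norm h)\<^sup>2) * L2n (grad \<phi>)"
proof -
  have [measurable]: "grad \<phi> \<in> borel_measurable borel"
    by (rule Cc_infinity_measurable[OF assms])
  have "L2n (\<lambda>x. \<phi> (x + h) - \<phi> x) \<le> (\<integral>\<^sup>+x. (\<integral>\<^sup>+t. indicator {0..1} t
      * ennreal ((norm h)\<^sup>2 * (norm (grad \<phi> (x + t *\<^sub>R h)))\<^sup>2) \<partial>lborel) \<partial>lborel)"
    using square_increment_le_nn_integral[OF Cc_infinityD(1)[OF assms]]
    by (intro nn_integral_mono) simp
  also have "\<dots> = (\<integral>\<^sup>+t. (\<integral>\<^sup>+x. indicator {0..1} t
      * ennreal ((norm h)\<^sup>2 * (norm (grad \<phi> (x + t *\<^sub>R h)))\<^sup>2) \<partial>lborel) \<partial>lborel)"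
    by (rule lborel_pair.Fubini') measurable
  also have "\<dots> = (\<integral>\<^sup>+t. (indicator {0..1::real} t * ennreal ((norm h)\<^sup>2)) * L2n (grad \<phi>) \<partial>lborel)"
  proof (intro nn_integral_cong)
    fix t
    have "(\<integral>\<^sup>+x. indicator {0..1} t * ennreal ((norm h)\<^sup>2 * (norm (grad \<phi> (x + t *\<^sub>R h)))\<^sup>2) \<partial>lborel)
      = (\<integral>\<^sup>+x. (indicator {0..1} t * ennreal ((norm h)\<^sup>2)) * ennreal ((norm (grad \<phi> (x + t *\<^sub>R h)))\<^sup>2) \<partial>lborel)"
      by (simp add: ennreal_mult mult.assoc)
    also have "\<dots> = (indicator {0..1} t * ennreal ((norm h)\<^sup>2))
        * (\<integral>\<^sup>+x. ennreal ((norm (grad \<phi> (x + t *\<^sub>R h)))\<^sup>2) \<partial>lborel)"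
      by (rule nn_integral_cmult) measurable
    also have "(\<integral>\<^sup>+x. ennreal ((norm (grad \<phi> (x + t *\<^sub>R h)))\<^sup>2) \<partial>lborel) = L2n (grad \<phi>)"
      by (rule nn_integral_lborel_translate) measurable
    finally show "(\<integral>\<^sup>+x. indicator {0..1} t * ennreal ((norm h)\<^sup>2 * (norm (grad \<phi> (x + t *\<^sub>R h)))\<^sup>2) \<partial>lborel)
      = (indicator {0..1} t * ennreal ((norm h)\<^sup>2)) * L2n (grad \<phi>)" .
  qed
  also have "\<dots> = (\<integral>\<^sup>+t. (ennreal ((norm h)\<^sup>2) * L2n (grad \<phi>)) * indicator {0..1::real} t \<partial>lborel)"
    by (simp add: mult_ac)
  also have "\<dots> = ennreal ((norm h)\<^sup>2) * L2n (grad \<phi>)"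
    by (subst nn_integral_cmult_indicator) auto
  finally show ?thesis .
qed

lemma Cc_infinity_increment_bound:
  assumes "\<phi> \<in> Cc_infinity"
  obtains B where "B \<ge> 0" "\<And>x h. \<bar>\<phi> (x + h) - \<phi> x\<bar> \<le> B * norm h"
proof -
  obtain B where B: "\<And>x. norm (grad \<phi> x) \<le> B" "B > 0"
    using Cc_infinity_bounded(2)[OF assms] unfolding bounded_pos by blast
  have "norm (\<phi> (x + h) - \<phi> x) \<le> B * norm (x + h - x)" for x h
  proof (rule differentiable_bound[of UNIV \<phi> "\<lambda>x h. grad \<phi> x \<bullet> h"])
    show "onorm (\<lambda>h. grad \<phi> y \<bullet> h) \<le> B" for y
      using B order_trans[OF Cauchy_Schwarz_ineq2[of "grad \<phi> y"] mult_right_mono[OF B(1)]]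
      by (intro onorm_bound) auto
  qed (auto intro: smooth_has_derivative Cc_infinityD assms B)
  with that[of B] B(2) show ?thesis by simp
qed

lemma integral_lborel_translate:
  fixes f :: "real^3 \<Rightarrow> 'b::{banach, second_countable_topology}"
  assumes [measurable]: "f \<in> borel_measurable borel"
  shows "(LINT x|lborel. f (x + a)) = (LINT x|lborel. f x)"
proof -
  have "(LINT x|lborel. f x) = (LINT x|distr lborel borel ((+) a). f x)"
    by (simp add: lborel_distr_plus)
  also have "\<dots> = (LINT x|lborel. f (a + x))" by (subst integral_distr) auto
  finally show ?thesis by (simp add: add.commute)
qed

text \<open>Difference quotients have integral 0 by translation invariance, and they converge
  dominatedly to the partial derivative.\<close>

lemma integral_grad_eq_0:
  assumes "\<phi> \<in> Cc_infinity"
  shows "(LINT x|lborel. grad \<phi> x $ i) = 0"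
proof -
  note [measurable] = Cc_infinity_measurable[OF assms]
  define e :: "real^3" where "e = axis i 1"
  have ne: "norm e = 1" by (simp add: e_def)
  obtain B where B: "B \<ge> 0" "\<And>x h. \<bar>\<phi> (x + h) - \<phi> x\<bar> \<le> B * norm h"
    using Cc_infinity_increment_bound[OF assms] by blast
  obtain r where r: "\<And>x. \<phi> x \<noteq> 0 \<Longrightarrow> norm x \<le> r"
    using Cc_infinity_bounded_support[OF assms] by (auto simp: bounded_iff)
  define q where "q n x = real (Suc n) * (\<phi> (x + (1 / real (Suc n)) *\<^sub>R e) - \<phi> x)" for n x
  have lim: "(\<lambda>n. q n x) \<longlonglongrightarrow> grad \<phi> x $ i" for x
  proof -
    have "((\<lambda>t. \<phi> (x + t *\<^sub>R e)) has_field_derivative (grad \<phi> x \<bullet> e)) (at 0)"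
    proof -
      have "((\<phi> \<circ> (\<lambda>t. x + t *\<^sub>R e)) has_derivative
          ((\<lambda>y. grad \<phi> (x + 0 *\<^sub>R e) \<bullet> y) \<circ> (\<lambda>s. s *\<^sub>R e))) (at 0)"
        by (rule diff_chain_at[OF _ smooth_has_derivative[OF Cc_infinityD(1)[OF assms]]])
           (auto intro!: derivative_eq_intros)
      then show ?thesis by (simp add: has_field_derivative_def comp_def mult_commute_abs)
    qed
    then have "((\<lambda>h. (\<phi> (x + h *\<^sub>R e) - \<phi> x) / h) \<longlongrightarrow> grad \<phi> x \<bullet> e) (at 0)"
      by (simp add: DERIV_def)
    moreover have "filterlim (\<lambda>n. 1 / real (Suc n)) (at 0) sequentially"
      using LIMSEQ_Suc[OF lim_1_over_n] by (simp add: filterlim_at)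
    ultimately have "(\<lambda>n. (\<phi> (x + (1 / real (Suc n)) *\<^sub>R e) - \<phi> x) / (1 / real (Suc n))) \<longlonglongrightarrow> grad \<phi> x \<bullet> e"
      by (rule filterlim_compose)
    then show ?thesis by (simp add: q_def e_def inner_axis mult.commute)
  qed
  have int0: "(LINT x|lborel. q n x) = 0" for n
  proof -
    have i: "integrable lborel (\<lambda>x. \<phi> (1 *\<^sub>R x + (1 / real (Suc n)) *\<^sub>R e))"
      by (intro Cc_infinity_integrable Cc_infinity_affine assms) simp
    show ?thesis
      unfolding q_def using i Cc_infinity_integrable(1)[OF assms]
      by (simp add: integral_lborel_translate[of \<phi>])
  qed
  have "(\<lambda>n. LINT x|lborel. q n x) \<longlonglongrightarrow> (LINT x|lborel. grad \<phi> x $ i)"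
  \<comment> \<open>All shifts have length at most 1, so the quotients vanish outside the support
    enlarged by 1, and the Lipschitz constant \<open>B\<close> bounds them.\<close>
  proof (rule integral_dominated_convergence[where w="\<lambda>x. B * indicator (cball 0 (r + 1)) x"])
    show "integrable lborel (\<lambda>x::real^3. B * indicator (cball 0 (r + 1)) x)"
      by (intro integrable_mult_right integrable_real_indicator) (auto intro: emeasure_bounded_finite[unfolded infinity_ennreal_def] simp: emeasure_lborel_cball_finite[unfolded infinity_ennreal_def])
    have "\<bar>q n x\<bar> \<le> B * indicator (cball 0 (r + 1)) x" for n x
    proof (cases "norm x \<le> r + 1")
      case True
      have "\<bar>q n x\<bar> \<le> real (Suc n) * (B * (1 / real (Suc n)))"
        using B(2)[of x "(1 / real (Suc n)) *\<^sub>R e"]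
        unfolding q_def abs_mult by (intro mult_mono) (simp_all add: ne)
      then show ?thesis using True by simp
    next
      case False
      define d where "d = (1 / real (Suc n)) *\<^sub>R e"
      have "norm d \<le> 1" by (simp add: d_def ne)
      moreover have "norm x \<le> norm (x + d) + norm d"
        using norm_triangle_ineq4[of "x + d" d] by simp
      ultimately have "norm x - 1 \<le> norm (x + d)" by simp
      with False r[of x] r[of "x + d"] have "\<phi> x = 0" "\<phi> (x + d) = 0" by force+
      then have "q n x = 0" by (simp add: q_def d_def)
      with False show ?thesis by simp
    qed
    then show "AE x in lborel. norm (q n x) \<le> B * indicator (cball 0 (r + 1)) x" for n by simp
    show "q n \<in> borel_measurable lborel" for n unfolding q_def by measurable
  qed (use lim in auto)
  with int0 show ?thesis by (simp add: LIMSEQ_const_iff)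
qed

lemma Cc_infinity_integration_by_parts:
  assumes \<phi>: "\<phi> \<in> Cc_infinity" and \<psi>: "\<psi> \<in> Cc_infinity"
  shows "(LINT x|lborel. \<phi> x * grad \<psi> x $ i) = - (LINT x|lborel. grad \<phi> x $ i * \<psi> x)"
proof -
  have i: "integrable lborel (\<lambda>x. grad f x $ i * g x)" if "f \<in> Cc_infinity" "g \<in> Cc_infinity" for f g
    by (intro Cc_infinity_integrable(1) Cc_infinity_smooth_mult smooth_grad Cc_infinityD that)
  have "0 = (LINT x|lborel. grad (\<lambda>x. \<phi> x * \<psi> x) x $ i)"
    using integral_grad_eq_0[OF Cc_infinity_smooth_mult[OF \<psi> Cc_infinityD(1)[OF \<phi>]]] by simp
  also have "\<dots> = (LINT x|lborel. grad \<psi> x $ i * \<phi> x + grad \<phi> x $ i * \<psi> x)"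
    by (simp add: grad_mult smooth_differentiable Cc_infinityD assms mult.commute)
  also have "\<dots> = (LINT x|lborel. grad \<psi> x $ i * \<phi> x) + (LINT x|lborel. grad \<phi> x $ i * \<psi> x)"
    by (intro Bochner_Integration.integral_add i assms)
  finally show ?thesis by (simp add: mult.commute)
qed

text \<open>Boxes are stable under intersection and generate the Borel sets, so the integral
  vanishes over every Borel set; the total integral takes care of complements. Then \<open>g\<close>
  has the same set integrals as 0.\<close>

lemma integrable_zero_if_boxes:
  fixes g :: "real^3 \<Rightarrow> real"
  assumes g: "integrable lborel g" and all: "(LINT x|lborel. g x) = 0"
    and box: "\<And>a b. (LINT x:box a b|lborel. g x) = 0"
  shows "AE x in lborel. g x = 0"
proof (rule density_unique_real[OF g])
  have si: "set_integrable lborel A g" if "A \<in> sets borel" for A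
    unfolding set_integrable_def using that g by (intro integrable_mult_indicator) auto
  fix A :: "(real^3) set" assume "A \<in> sets lborel"
  then have A: "A \<in> sigma_sets UNIV (range (\<lambda>(a, b). box a b))"
    by (simp add: borel_eq_box)
  have "Int_stable (range (\<lambda>(a, b). box a b :: (real^3) set))"
    by (auto simp: Int_stable_def box_Int_box)
  moreover have "range (\<lambda>(a, b). box a b :: (real^3) set) \<subseteq> Pow UNIV" by simp
  moreover note A
  ultimately have "(LINT x:A|lborel. g x) = 0"
  proof (induction rule: sigma_sets_induct_disjoint)
    case (compl A)
    then have A: "A \<in> sets borel" by (simp add: borel_eq_box)
    have "(LINT x:UNIV|lborel. g x) = (LINT x:A|lborel. g x) + (LINT x:UNIV - A|lborel. g x)"
      using A by (subst set_integral_Un[symmetric]) (auto intro!: si simp: Un_Diff_cancel)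
    then show ?case using compl all by (simp add: set_lebesgue_integral_def)
  next
    case (union A)
    then have A: "\<And>i. A i \<in> sets borel" by (auto simp: borel_eq_box)
    have "(LINT x:(\<Union>i. A i)|lborel. g x) = (\<Sum>i. LINT x:A i|lborel. g x)"
      using union A by (intro lebesgue_integral_countable_add si) (auto simp: disjoint_family_on_def)
    then show ?case using union by simp
  qed (auto simp: set_lebesgue_integral_def[of _ "{}"] box)
  then show "(LINT x:A|lborel. g x) = (LINT x:A|lborel. 0)" by (simp add: set_lebesgue_integral_def)
qed simp

text \<open>The function is the pointwise limit of its truncations to balls, each of which is
  integrable.\<close>

lemma locally_integrable_measurable:
  assumes "locally_integrable f" shows "f \<in> borel_measurable borel"
proof (rule borel_measurable_LIMSEQ_metric)
  show "(\<lambda>x. indicat_real (cball 0 (real n)) x *\<^sub>R f x) \<in> borel_measurable borel" for n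
  proof -
    have "integrable lborel (\<lambda>x. indicat_real (cball 0 (real n)) x *\<^sub>R f x)"
      using assms compact_cball[of 0 "real n"] unfolding locally_integrable_def set_integrable_def
      by blast
    from borel_measurable_integrable[OF this] show ?thesis by simp
  qed
  show "(\<lambda>n. indicat_real (cball 0 (real n)) x *\<^sub>R f x) \<longlonglongrightarrow> f x" for x
  proof (rule tendsto_eventually)
    obtain N where "norm x \<le> real N" using real_arch_simple by blast
    then show "eventually (\<lambda>n. indicat_real (cball 0 (real n)) x *\<^sub>R f x = f x) sequentially"
      by (intro eventually_sequentiallyI[of N]) (auto simp: indicator_def)
  qed
qed

lemma fundamental_lemma:
  fixes f :: "real^3 \<Rightarrow> real"
  assumes f: "locally_integrable f" and z: "\<And>\<phi>. \<phi> \<in> Cc_infinity \<Longrightarrow> (LINT x|lborel. f x * \<phi> x) = 0"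
  shows "AE x in lborel. f x = 0"
proof -
  note [measurable] = locally_integrable_measurable[OF f]
  have box: "(LINT x:box a b|lborel. f x) = 0" for a b
  proof -
    \<comment> \<open>Smooth, zero outside the box, and increasing to the indicator of the open box,
      because \<open>1 - box_bump a b x\<close> is below 1 exactly there.\<close>
    define \<phi> where "\<phi> n x = 1 - (1 - box_bump a b x) ^ Suc n" for n x
    have \<phi>: "\<phi> n \<in> Cc_infinity" for n
    proof (rule Cc_infinityI[OF _ _ bounded_box])
      show "smooth (\<phi> n)" unfolding \<phi>_def
        by (intro smooth_diff smooth_power smooth_const smooth_box_bump)
      show "x \<in> box a b" if "\<phi> n x \<noteq> 0" for x
        using that box_bump_pos[of a b x] box_bump_nonneg[of a b x] by (auto simp: \<phi>_def)
    qed
    have b: "0 \<le> 1 - box_bump a b x" "1 - box_bump a b x \<le> 1" for x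
      using box_bump_less_1[of a b x] box_bump_nonneg[of a b x] by auto
    have lim: "(\<lambda>n. \<phi> n x) \<longlonglongrightarrow> indicator (box a b) x" for x
    proof (cases "x \<in> box a b")
      case True
      then have "(\<lambda>n. (1 - box_bump a b x) ^ Suc n) \<longlonglongrightarrow> 0"
        using box_bump_pos[of a b x] b[of x] by (intro LIMSEQ_Suc LIMSEQ_power_zero) auto
      then have "(\<lambda>n. \<phi> n x) \<longlonglongrightarrow> 1 - 0" unfolding \<phi>_def by (intro tendsto_diff tendsto_const)
      then show ?thesis using True by simp
    next
      case False
      then have "box_bump a b x = 0"
        using box_bump_pos[of a b x] box_bump_nonneg[of a b x] by linarith
      then show ?thesis using False by (simp add: \<phi>_def)
    qed
    have "(\<lambda>n. LINT x|lborel. f x * \<phi> n x) \<longlonglongrightarrow> (LINT x|lborel. f x * indicator (box a b) x)"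
    proof (rule integral_dominated_convergence[where w="\<lambda>x. norm (indicat_real (cbox a b) x *\<^sub>R f x)"])
      show "integrable lborel (\<lambda>x. norm (indicat_real (cbox a b) x *\<^sub>R f x))"
        using f compact_cbox unfolding locally_integrable_def set_integrable_def
        by (intro integrable_norm) blast
      show "AE x in lborel. norm (f x * \<phi> n x) \<le> norm (indicat_real (cbox a b) x *\<^sub>R f x)" for n
      proof (rule AE_I2)
        fix x
        show "norm (f x * \<phi> n x) \<le> norm (indicat_real (cbox a b) x *\<^sub>R f x)"
        proof (cases "x \<in> box a b")
          case True
          then have "x \<in> cbox a b" using box_subset_cbox by blast
          moreover have "\<bar>\<phi> n x\<bar> \<le> 1"
            using zero_le_power[OF b(1)[of x], of "Suc n"] power_le_one[OF b(1,2)[of x], of "Suc n"]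
            unfolding \<phi>_def by linarith
          ultimately show ?thesis by (simp add: abs_mult mult_left_le)
        next
          case False
          then have "box_bump a b x = 0"
            using box_bump_pos[of a b x] box_bump_nonneg[of a b x] by linarith
          then show ?thesis by (simp add: \<phi>_def)
        qed
      qed
      show "(\<lambda>x. f x * \<phi> n x) \<in> borel_measurable lborel" for n
        using Cc_infinity_measurable(1)[OF \<phi>[of n]] by simp
    qed (auto intro!: tendsto_mult lim)
    then show ?thesis
      by (simp add: z[OF \<phi>] LIMSEQ_const_iff set_lebesgue_integral_def mult.commute)
  qed
  \<comment> \<open>Restriction to a large box makes \<open>f\<close> integrable, and integrals over
    another box reduce to integrals over the intersection, again a box.\<close>
  have "AE x in lborel. indicator (box (\<chi> i. - real n) (\<chi> i. real n)) x * f x = 0" for n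
  proof (rule integrable_zero_if_boxes)
    let ?B = "box (\<chi> i. - real n) (\<chi> i. real n) :: (real^3) set"
    have "set_integrable lborel (cbox (\<chi> i. - real n) (\<chi> i. real n)) f"
      using f compact_cbox unfolding locally_integrable_def by blast
    then have "set_integrable lborel ?B f"
      by (rule set_integrable_subset) (auto simp: box_subset_cbox)
    then show "integrable lborel (\<lambda>x. indicator ?B x * f x)" by (simp add: set_integrable_def)
    show "(LINT x|lborel. indicator ?B x * f x) = 0"
      using box unfolding set_lebesgue_integral_def by simp
    fix a b :: "real^3"
    have "(LINT x:box a b|lborel. indicator ?B x * f x) = (LINT x:(box a b \<inter> ?B)|lborel. f x)"
      by (simp add: set_lebesgue_integral_def indicator_inter_arith mult.assoc)
    then show "(LINT x:box a b|lborel. indicator ?B x * f x) = 0"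
      by (simp add: box_Int_box box)
  qed
  then have "AE x in lborel. \<forall>n. indicator (box (\<chi> i. - real n) (\<chi> i. real n)) x * f x = 0"
    by (subst AE_all_countable) blast
  then show ?thesis
  proof (rule AE_mp, intro AE_I2 impI)
    fix x :: "real^3"
    assume *: "\<forall>n. indicator (box (\<chi> i. - real n) (\<chi> i. real n)) x * f x = 0"
    obtain n where n: "norm x < real n" using reals_Archimedean2 by blast
    have "\<bar>x $ i\<bar> < real n" for i using component_le_norm_cart[of x i] n by linarith
    then have "x \<in> box (\<chi> i. - real n) (\<chi> i. real n)"
      by (auto simp: mem_box_cart abs_less_iff) (metis minus_less_iff)
    with *[rule_format, of n] show "f x = 0" by simp
  qed
qed

lemma locally_integrable_vec_nth:
  fixes F :: "real^3 \<Rightarrow> real^3"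
  assumes "locally_integrable F" shows "locally_integrable (\<lambda>x. F x $ i)"
proof -
  have "integrable lborel (\<lambda>x. (indicat_real K x *\<^sub>R F x) $ i)" if "compact K" for K
    using that assms unfolding locally_integrable_def set_integrable_def
    by (intro integrable_bounded_linear[OF bounded_linear_vec_nth]) auto
  then show ?thesis by (simp add: locally_integrable_def set_integrable_def)
qed

lemma locally_integrable_mult:
  fixes f g :: "real^3 \<Rightarrow> real"
  assumes f: "locally_integrable f" and K: "compact K" and g: "\<And>x. x \<notin> K \<Longrightarrow> g x = 0" "\<And>x. \<bar>g x\<bar> \<le> B"
    and [measurable]: "g \<in> borel_measurable borel"
  shows "integrable lborel (\<lambda>x. f x * g x)"
proof (rule Bochner_Integration.integrable_bound)
  note [measurable] = locally_integrable_measurable[OF f]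
  show "integrable lborel (\<lambda>x. B * (indicat_real K x *\<^sub>R f x))"
    using f K unfolding set_integrable_def locally_integrable_def by (intro integrable_mult_right) blast
  show "(\<lambda>x. f x * g x) \<in> borel_measurable lborel" by measurable
  have B: "B \<ge> 0" using g(2)[of 0] by linarith
  have "norm (f x * g x) \<le> norm (B * (indicat_real K x *\<^sub>R f x))" for x
    using g(2)[of x] g(1)[of x] B mult_right_mono[OF g(2)[of x], of "\<bar>f x\<bar>"]
    by (cases "x \<in> K") (auto simp: abs_mult mult.commute)
  then show "AE x in lborel. norm (f x * g x) \<le> norm (B * (indicat_real K x *\<^sub>R f x))" by simp
qed

lemma locally_integrable_mult_Cc:
  assumes f: "locally_integrable f" and \<phi>: "\<phi> \<in> Cc_infinity"
  shows "integrable lborel (\<lambda>x. f x * \<phi> x)"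
proof -
  obtain B where "\<And>x. \<bar>\<phi> x\<bar> \<le> B"
    using Cc_infinity_bounded(1)[OF \<phi>] unfolding bounded_iff by auto
  then show ?thesis
    by (intro locally_integrable_mult[OF f Cc_infinityD(2)[OF \<phi>] Cc_infinity_zero_outside])
       (simp_all add: Cc_infinity_measurable(1)[OF \<phi>])
qed

lemma Cc_infinity_grad_nth: assumes "\<phi> \<in> Cc_infinity" shows "(\<lambda>x. grad \<phi> x $ i) \<in> Cc_infinity"
proof (rule Cc_infinityI[OF smooth_grad[OF Cc_infinityD(1)[OF assms]]])
  show "bounded (closure {x. \<phi> x \<noteq> 0})" using Cc_infinityD(2)[OF assms] compact_imp_bounded by blast
  show "x \<in> closure {x. \<phi> x \<noteq> 0}" if "grad \<phi> x $ i \<noteq> 0" for x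
    using that grad_outside_support[of x \<phi>] by (metis zero_index)
qed

lemma locally_integrable_diff:
  "locally_integrable f \<Longrightarrow> locally_integrable g \<Longrightarrow> locally_integrable (\<lambda>x. f x - g x)"
  by (auto simp: locally_integrable_def intro!: set_integral_diff)

lemma has_weak_grad_diff:
  assumes u: "has_weak_grad u G" and v: "has_weak_grad v H"
  shows "has_weak_grad (\<lambda>x. u x - v x) (\<lambda>x. G x - H x)"
proof -
  have l: "locally_integrable u" "locally_integrable v" "locally_integrable G" "locally_integrable H"
    using assms by (auto simp: has_weak_grad_def)
  have "(LINT x|lborel. (u x - v x) * grad \<phi> x $ i) = - (LINT x|lborel. (G x - H x) $ i * \<phi> x)"
    if \<phi>: "\<phi> \<in> Cc_infinity" for \<phi> i
  proof -
    note m = locally_integrable_mult_Cc[OF _ \<phi>] locally_integrable_mult_Cc[OF _ Cc_infinity_grad_nth[OF \<phi>, of i]]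
    show ?thesis
      using u v \<phi> l m(2)[OF l(1)] m(2)[OF l(2)] m(1)[OF locally_integrable_vec_nth[OF l(3), of i]]
        m(1)[OF locally_integrable_vec_nth[OF l(4), of i]]
      by (simp add: left_diff_distrib has_weak_grad_def)
  qed
  then show ?thesis using l by (auto simp: has_weak_grad_def intro!: locally_integrable_diff)
qed

text \<open>The difference \<open>G - H\<close> is a weak gradient of the zero function, so all its
  pairings with test functions vanish.\<close>

lemma has_weak_grad_unique:
  assumes G: "has_weak_grad u G" and H: "has_weak_grad u H"
  shows "AE x in lborel. G x = H x"
proof -
  have 0: "has_weak_grad (\<lambda>x. u x - u x) (\<lambda>x. G x - H x)"
    by (rule has_weak_grad_diff[OF G H])
  have "AE x in lborel. (G x - H x) $ i = 0" for i
  proof (rule fundamental_lemma)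
    show "locally_integrable (\<lambda>x. (G x - H x) $ i)"
      using 0 unfolding has_weak_grad_def by (intro locally_integrable_vec_nth) blast
    show "(LINT x|lborel. (G x - H x) $ i * \<phi> x) = 0" if "\<phi> \<in> Cc_infinity" for \<phi>
      using 0 that unfolding has_weak_grad_def by force
  qed
  then have "AE x in lborel. \<forall>i\<in>UNIV. (G x - H x) $ i = 0"
    by (subst AE_finite_all) auto
  then show ?thesis by (rule AE_mp) (auto simp: vec_eq_iff)
qed

lemma ennreal_square_tendsto_0:
  fixes f :: "'a \<Rightarrow> ennreal"
  assumes "((\<lambda>n. (f n)\<^sup>2) \<longlongrightarrow> 0) F" shows "(f \<longlongrightarrow> 0) F"
proof (rule order_tendstoI)
  fix a :: ennreal assume a: "0 < a"
  then have "0 < a\<^sup>2" by (simp add: power2_eq_square ennreal_zero_less_mult_iff)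
  with assms have "eventually (\<lambda>n. (f n)\<^sup>2 < a\<^sup>2) F" by (rule order_tendstoD)
  then show "eventually (\<lambda>n. f n < a) F"
    by (rule eventually_mono) (meson not_le power_mono zero_le)
qed simp

lemma L2n_pairing_tendsto_0:
  fixes F :: "nat \<Rightarrow> real^3 \<Rightarrow> 'b::euclidean_space" and g :: "real^3 \<Rightarrow> 'c::euclidean_space"
  assumes [measurable]: "\<And>n. F n \<in> borel_measurable borel" "g \<in> borel_measurable borel"
    and F: "(\<lambda>n. L2n (F n)) \<longlonglongrightarrow> 0" and g: "L2n g < \<infinity>"
  shows "(\<lambda>n. \<integral>\<^sup>+x. ennreal (norm (F n x) * norm (g x)) \<partial>lborel) \<longlonglongrightarrow> 0"
proof (rule ennreal_square_tendsto_0, rule tendsto_sandwich[OF _ _ tendsto_const])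
  have "(\<integral>\<^sup>+x. ennreal (norm (F n x) * norm (g x)) \<partial>lborel)\<^sup>2 \<le> L2n (F n) * L2n g" for n
    using Cauchy_Schwarz_nn_integral[of "\<lambda>x. ennreal (norm (F n x))" lborel "\<lambda>x. ennreal (norm (g x))"]
    by (simp add: ennreal_mult ennreal_power)
  then show "eventually (\<lambda>n. (\<integral>\<^sup>+x. ennreal (norm (F n x) * norm (g x)) \<partial>lborel)\<^sup>2 \<le> L2n (F n) * L2n g) sequentially"
    by simp
  show "(\<lambda>n. L2n (F n) * L2n g) \<longlonglongrightarrow> 0"
    using ennreal_tendsto_cmult[OF _ F, of "L2n g"] g by (simp add: mult.commute)
qed simp

subsection \<open>The space of limits of test functions\<close>

text \<open>\<open>H1 u G\<close> is the closure with the pair \<open>(u, G)\<close> recorded, so that no choice of a weak gradient is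
  involved and limits can be taken in \<open>ennreal\<close>.\<close>

definition H1 :: "(real^3 \<Rightarrow> real) \<Rightarrow> (real^3 \<Rightarrow> real^3) \<Rightarrow> bool" where
  "H1 u G \<longleftrightarrow> u \<in> borel_measurable borel \<and> G \<in> borel_measurable borel \<and>
    (\<forall>\<epsilon>>0. \<exists>\<phi>\<in>Cc_infinity. L1n (\<lambda>x. u x - \<phi> x) \<le> ennreal \<epsilon> \<and> L2n (\<lambda>x. G x - grad \<phi> x) \<le> ennreal \<epsilon>)"

lemma H1_measurable:
  "H1 u G \<Longrightarrow> u \<in> borel_measurable borel" "H1 u G \<Longrightarrow> G \<in> borel_measurable borel"
  by (auto simp: H1_def)

lemma H1_Cc: "\<phi> \<in> Cc_infinity \<Longrightarrow> H1 \<phi> (grad \<phi>)"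
  unfolding H1_def
  by (intro conjI Cc_infinity_measurable allI impI bexI[of _ \<phi>]) simp_all

lemma H1_approx:
  assumes "H1 u G" "\<epsilon> > 0"
  obtains \<phi> where "\<phi> \<in> Cc_infinity" "L1n (\<lambda>x. u x - \<phi> x) \<le> ennreal \<epsilon>"
    "L2n (\<lambda>x. G x - grad \<phi> x) \<le> ennreal \<epsilon>"
  using assms by (auto simp: H1_def)

lemma H1_seq:
  assumes "H1 u G"
  obtains \<phi> where "\<And>n. \<phi> n \<in> Cc_infinity" "(\<lambda>n. L1n (\<lambda>x. u x - \<phi> n x)) \<longlonglongrightarrow> 0"
    "(\<lambda>n. L2n (\<lambda>x. G x - grad (\<phi> n) x)) \<longlonglongrightarrow> 0"
proof -
  have "\<exists>\<phi>. \<phi> \<in> Cc_infinity \<and> L1n (\<lambda>x. u x - \<phi> x) \<le> ennreal (1 / real (Suc n))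
      \<and> L2n (\<lambda>x. G x - grad \<phi> x) \<le> ennreal (1 / real (Suc n))" for n
  proof -
    have "0 < 1 / real (Suc n)" by simp
    with assms show ?thesis unfolding H1_def by blast
  qed
  from choice[OF allI[OF this]] obtain \<phi> where "\<forall>n. \<phi> n \<in> Cc_infinity
      \<and> L1n (\<lambda>x. u x - \<phi> n x) \<le> ennreal (1 / real (Suc n))
      \<and> L2n (\<lambda>x. G x - grad (\<phi> n) x) \<le> ennreal (1 / real (Suc n))" ..
  then have \<phi>: "\<phi> n \<in> Cc_infinity" "L1n (\<lambda>x. u x - \<phi> n x) \<le> ennreal (1 / real (Suc n))"
    "L2n (\<lambda>x. G x - grad (\<phi> n) x) \<le> ennreal (1 / real (Suc n))" for n by blast+
  have "(\<lambda>n. 1 / real (Suc n)) \<longlonglongrightarrow> 0" by (rule LIMSEQ_Suc[OF lim_1_over_n])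
  then have z: "(\<lambda>n. ennreal (1 / real (Suc n))) \<longlonglongrightarrow> 0"
    using tendsto_ennrealI by (metis ennreal_0)
  show ?thesis
  proof (rule that[of \<phi>])
    show "(\<lambda>n. L1n (\<lambda>x. u x - \<phi> n x)) \<longlonglongrightarrow> 0"
      by (rule tendsto_sandwich[OF always_eventually always_eventually tendsto_const z]; intro allI zero_le \<phi>)
    show "(\<lambda>n. L2n (\<lambda>x. G x - grad (\<phi> n) x)) \<longlonglongrightarrow> 0"
      by (rule tendsto_sandwich[OF always_eventually always_eventually tendsto_const z]; intro allI zero_le \<phi>)
  qed (rule \<phi>)
qed

lemma H1_finite:
  assumes "H1 u G" shows "L1n u < \<infinity>" "L2n G < \<infinity>"
proof -
  obtain \<phi> where \<phi>: "\<phi> \<in> Cc_infinity" "L1n (\<lambda>x. u x - \<phi> x) \<le> ennreal 1"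
    "L2n (\<lambda>x. G x - grad \<phi> x) \<le> ennreal 1" by (rule H1_approx[OF assms zero_less_one])
  note [measurable] = H1_measurable[OF assms] Cc_infinity_measurable[OF \<phi>(1)]
  have "L1n u \<le> L1n (\<lambda>x. u x - \<phi> x) + L1n \<phi>" by (rule L1n_triangle) auto
  also have "\<dots> < \<infinity>" using \<phi>(2) Cc_infinity_L_finite[OF \<phi>(1)]
    by (auto simp: ennreal_add_less_top less_top[symmetric] top_unique)
  finally show "L1n u < \<infinity>" .
  have "L2n G \<le> 2 * L2n (\<lambda>x. G x - grad \<phi> x) + 2 * L2n (grad \<phi>)"
    by (rule L2n_triangle) (use norm_triangle_sub in \<open>auto simp: add.commute\<close>)
  also have "\<dots> < \<infinity>" using \<phi>(3) Cc_infinity_L_finite[OF \<phi>(1)]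
    by (auto simp: ennreal_add_less_top ennreal_mult_less_top less_top[symmetric] top_unique
        ennreal_mult_eq_top_iff)
  finally show "L2n G < \<infinity>" .
qed

lemma H1_integrable: "H1 u G \<Longrightarrow> integrable lborel u"
  and H1_integrable_grad: "H1 u G \<Longrightarrow> integrable lborel (\<lambda>x. (norm (G x))\<^sup>2)"
  using H1_finite H1_measurable by (auto simp: integrable_L1n integrable_L2n)

lemma H1_closed:
  assumes [measurable]: "u \<in> borel_measurable borel" "G \<in> borel_measurable borel"
    and approx: "\<And>\<epsilon>. \<epsilon> > 0 \<Longrightarrow>
      \<exists>v H. H1 v H \<and> L1n (\<lambda>x. u x - v x) \<le> ennreal \<epsilon> \<and> L2n (\<lambda>x. G x - H x) \<le> ennreal \<epsilon>"
  shows "H1 u G"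
  unfolding H1_def
proof (intro conjI allI impI assms(1,2))
  fix \<epsilon> :: real assume "\<epsilon> > 0"
  \<comment> \<open>A quarter each, because \<open>L2n_triangle\<close> doubles both
    summands.\<close>
  then have e4: "0 < \<epsilon> / 4" by simp
  from approx[OF this] obtain v H where v: "H1 v H" "L1n (\<lambda>x. u x - v x) \<le> ennreal (\<epsilon> / 4)"
    "L2n (\<lambda>x. G x - H x) \<le> ennreal (\<epsilon> / 4)" by blast
  obtain \<phi> where \<phi>: "\<phi> \<in> Cc_infinity" "L1n (\<lambda>x. v x - \<phi> x) \<le> ennreal (\<epsilon> / 4)"
    "L2n (\<lambda>x. H x - grad \<phi> x) \<le> ennreal (\<epsilon> / 4)"
    by (rule H1_approx[OF v(1) e4])
  note [measurable] = H1_measurable[OF v(1)] Cc_infinity_measurable[OF \<phi>(1)]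
  have "L1n (\<lambda>x. u x - \<phi> x) \<le> L1n (\<lambda>x. u x - v x) + L1n (\<lambda>x. v x - \<phi> x)"
    by (rule L1n_triangle) auto
  also have "\<dots> \<le> ennreal (\<epsilon> / 4) + ennreal (\<epsilon> / 4)" by (intro add_mono v \<phi>)
  also have "\<dots> \<le> ennreal \<epsilon>" using \<open>\<epsilon> > 0\<close> by (simp add: ennreal_plus[symmetric] ennreal_leI del: ennreal_plus)
  finally have 1: "L1n (\<lambda>x. u x - \<phi> x) \<le> ennreal \<epsilon>" .
  have "L2n (\<lambda>x. G x - grad \<phi> x) \<le> 2 * L2n (\<lambda>x. G x - H x) + 2 * L2n (\<lambda>x. H x - grad \<phi> x)"
  proof (rule L2n_triangle)
    show "norm (G x - grad \<phi> x) \<le> norm (G x - H x) + norm (H x - grad \<phi> x)" for x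
      using norm_triangle_ineq[of "G x - H x" "H x - grad \<phi> x"] by simp
  qed auto
  also have "\<dots> \<le> 2 * ennreal (\<epsilon> / 4) + 2 * ennreal (\<epsilon> / 4)" by (intro add_mono mult_left_mono v \<phi>) auto
  also have "\<dots> \<le> ennreal \<epsilon>" using \<open>\<epsilon> > 0\<close>
    by (simp add: ennreal_plus[symmetric] ennreal_mult[symmetric] ennreal_numeral[symmetric] ennreal_leI
        del: ennreal_plus ennreal_numeral)
  finally show "\<exists>\<phi>\<in>Cc_infinity. L1n (\<lambda>x. u x - \<phi> x) \<le> ennreal \<epsilon> \<and> L2n (\<lambda>x. G x - grad \<phi> x) \<le> ennreal \<epsilon>"
    using 1 \<phi>(1) by blast
qed

lemma H1_closed_seq:
  assumes v: "\<And>n. H1 (v n) (H n)" and [measurable]: "u \<in> borel_measurable borel" "G \<in> borel_measurable borel"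
    and 1: "(\<lambda>n. L1n (\<lambda>x. u x - v n x)) \<longlonglongrightarrow> 0" and 2: "(\<lambda>n. L2n (\<lambda>x. G x - H n x)) \<longlonglongrightarrow> 0"
  shows "H1 u G"
proof (rule H1_closed)
  fix \<epsilon> :: real assume "\<epsilon> > 0"
  then have e: "0 < ennreal \<epsilon>" by simp
  have "eventually (\<lambda>n. L1n (\<lambda>x. u x - v n x) < ennreal \<epsilon> \<and> L2n (\<lambda>x. G x - H n x) < ennreal \<epsilon>) sequentially"
    by (intro eventually_conj order_tendstoD(2)[OF 1 e] order_tendstoD(2)[OF 2 e])
  then obtain n where "L1n (\<lambda>x. u x - v n x) < ennreal \<epsilon>" "L2n (\<lambda>x. G x - H n x) < ennreal \<epsilon>"
    by (auto simp: eventually_sequentially)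
  with v[of n] show "\<exists>v H. H1 v H \<and> L1n (\<lambda>x. u x - v x) \<le> ennreal \<epsilon> \<and> L2n (\<lambda>x. G x - H x) \<le> ennreal \<epsilon>"
    by (intro exI[of _ "v n"] exI[of _ "H n"] conjI less_imp_le)
qed fact+

lemma H1_cong_AE:
  assumes u: "H1 u G" and [measurable]: "v \<in> borel_measurable borel" "H \<in> borel_measurable borel"
    and ae: "AE x in lborel. u x = v x" "AE x in lborel. G x = H x"
  shows "H1 v H"
proof (rule H1_closed_seq[of "\<lambda>n. u" "\<lambda>n. G"])
  note [measurable] = H1_measurable[OF u]
  have "L1n (\<lambda>x. v x - u x) = 0" using ae(1) by (subst nn_integral_0_iff_AE) (auto elim!: AE_mp)
  then show "(\<lambda>n. L1n (\<lambda>x. v x - u x)) \<longlonglongrightarrow> 0" by simp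
  have "L2n (\<lambda>x. H x - G x) = 0" using ae(2) by (subst nn_integral_0_iff_AE) (auto elim!: AE_mp)
  then show "(\<lambda>n. L2n (\<lambda>x. H x - G x)) \<longlonglongrightarrow> 0" by simp
qed (use u in auto)

lemma H1_cmult:
  assumes u: "H1 u G" shows "H1 (\<lambda>x. c * u x) (\<lambda>x. c *\<^sub>R G x)"
proof -
  note [measurable] = H1_measurable[OF u]
  obtain \<phi> where \<phi>: "\<And>n. \<phi> n \<in> Cc_infinity" "(\<lambda>n. L1n (\<lambda>x. u x - \<phi> n x)) \<longlonglongrightarrow> 0"
    "(\<lambda>n. L2n (\<lambda>x. G x - grad (\<phi> n) x)) \<longlonglongrightarrow> 0" using H1_seq[OF u] by blast
  note [measurable] = Cc_infinity_measurable[OF \<phi>(1)]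
  show ?thesis
  proof (rule H1_closed_seq[OF H1_Cc[OF Cc_infinity_cmult[OF \<phi>(1)]]])
    have "L1n (\<lambda>x. c * u x - c * \<phi> n x) = ennreal \<bar>c\<bar> * L1n (\<lambda>x. u x - \<phi> n x)" for n
      by (subst L1n_cmult[symmetric]) (auto simp: right_diff_distrib)
    then show "(\<lambda>n. L1n (\<lambda>x. c * u x - c * \<phi> n x)) \<longlonglongrightarrow> 0"
      using ennreal_tendsto_cmult[OF _ \<phi>(2), of "ennreal \<bar>c\<bar>"] by simp
    have "grad (\<lambda>x. c * \<phi> n x) x = c *\<^sub>R grad (\<phi> n) x" for n x
      by (subst grad_mult) (auto simp: grad_const smooth_differentiable Cc_infinityD[OF \<phi>(1)])
    then have "L2n (\<lambda>x. c *\<^sub>R G x - grad (\<lambda>x. c * \<phi> n x) x) = ennreal (c\<^sup>2) * L2n (\<lambda>x. G x - grad (\<phi> n) x)" for n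
      by (subst L2n_cmult[symmetric]) (auto simp: scaleR_right_diff_distrib)
    then show "(\<lambda>n. L2n (\<lambda>x. c *\<^sub>R G x - grad (\<lambda>x. c * \<phi> n x) x)) \<longlonglongrightarrow> 0"
      using ennreal_tendsto_cmult[OF _ \<phi>(3), of "ennreal (c\<^sup>2)"] by simp
  qed auto
qed

lemma H1_add:
  assumes u: "H1 u G" and v: "H1 v H" shows "H1 (\<lambda>x. u x + v x) (\<lambda>x. G x + H x)"
proof -
  note [measurable] = H1_measurable[OF u] H1_measurable[OF v]
  obtain \<phi> where \<phi>: "\<And>n. \<phi> n \<in> Cc_infinity" "(\<lambda>n. L1n (\<lambda>x. u x - \<phi> n x)) \<longlonglongrightarrow> 0"
    "(\<lambda>n. L2n (\<lambda>x. G x - grad (\<phi> n) x)) \<longlonglongrightarrow> 0" using H1_seq[OF u] by blast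
  obtain \<psi> where \<psi>: "\<And>n. \<psi> n \<in> Cc_infinity" "(\<lambda>n. L1n (\<lambda>x. v x - \<psi> n x)) \<longlonglongrightarrow> 0"
    "(\<lambda>n. L2n (\<lambda>x. H x - grad (\<psi> n) x)) \<longlonglongrightarrow> 0" using H1_seq[OF v] by blast
  note [measurable] = Cc_infinity_measurable[OF \<phi>(1)] Cc_infinity_measurable[OF \<psi>(1)]
  show ?thesis
  proof (rule H1_closed_seq[OF H1_Cc[OF Cc_infinity_add[OF \<phi>(1) \<psi>(1)]]])
    show "(\<lambda>n. L1n (\<lambda>x. u x + v x - (\<phi> n x + \<psi> n x))) \<longlonglongrightarrow> 0"
    proof (rule tendsto_sandwich[OF _ _ tendsto_const])
      have "L1n (\<lambda>x. u x + v x - (\<phi> n x + \<psi> n x)) \<le> L1n (\<lambda>x. u x - \<phi> n x) + L1n (\<lambda>x. v x - \<psi> n x)" for n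
        by (rule L1n_triangle) auto
      then show "eventually (\<lambda>n. L1n (\<lambda>x. u x + v x - (\<phi> n x + \<psi> n x))
          \<le> L1n (\<lambda>x. u x - \<phi> n x) + L1n (\<lambda>x. v x - \<psi> n x)) sequentially" by simp
      show "(\<lambda>n. L1n (\<lambda>x. u x - \<phi> n x) + L1n (\<lambda>x. v x - \<psi> n x)) \<longlonglongrightarrow> 0"
        using tendsto_add[OF \<phi>(2) \<psi>(2)] by simp
    qed simp
    have g: "grad (\<lambda>x. \<phi> n x + \<psi> n x) x = grad (\<phi> n) x + grad (\<psi> n) x" for n x
      by (rule grad_add) (auto simp: smooth_differentiable Cc_infinityD[OF \<phi>(1)] Cc_infinityD[OF \<psi>(1)])
    show "(\<lambda>n. L2n (\<lambda>x. G x + H x - grad (\<lambda>x. \<phi> n x + \<psi> n x) x)) \<longlonglongrightarrow> 0"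
    proof (rule tendsto_sandwich[OF _ _ tendsto_const])
      have "L2n (\<lambda>x. G x + H x - grad (\<lambda>x. \<phi> n x + \<psi> n x) x)
          \<le> 2 * L2n (\<lambda>x. G x - grad (\<phi> n) x) + 2 * L2n (\<lambda>x. H x - grad (\<psi> n) x)" for n
      proof (rule L2n_triangle)
        show "norm (G x + H x - grad (\<lambda>x. \<phi> n x + \<psi> n x) x)
            \<le> norm (G x - grad (\<phi> n) x) + norm (H x - grad (\<psi> n) x)" for x
          using norm_triangle_ineq[of "G x - grad (\<phi> n) x" "H x - grad (\<psi> n) x"]
          by (simp add: g algebra_simps)
      qed auto
      then show "eventually (\<lambda>n. L2n (\<lambda>x. G x + H x - grad (\<lambda>x. \<phi> n x + \<psi> n x) x)
          \<le> 2 * L2n (\<lambda>x. G x - grad (\<phi> n) x) + 2 * L2n (\<lambda>x. H x - grad (\<psi> n) x)) sequentially" by simp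
      show "(\<lambda>n. 2 * L2n (\<lambda>x. G x - grad (\<phi> n) x) + 2 * L2n (\<lambda>x. H x - grad (\<psi> n) x)) \<longlonglongrightarrow> 0"
        using tendsto_add[OF ennreal_tendsto_cmult[OF _ \<phi>(3), of 2] ennreal_tendsto_cmult[OF _ \<psi>(3), of 2]]
        by simp
    qed simp
  qed auto
qed

lemma H1_diff:
  assumes "H1 u G" "H1 v H" shows "H1 (\<lambda>x. u x - v x) (\<lambda>x. G x - H x)"
  using H1_add[OF assms(1) H1_cmult[OF assms(2), of "-1"]] by simp

lemma H1_translate:
  assumes u: "H1 u G" shows "H1 (\<lambda>x. u (x + a)) (\<lambda>x. G (x + a))"
proof -
  note [measurable] = H1_measurable[OF u]
  obtain \<phi> where \<phi>: "\<And>n. \<phi> n \<in> Cc_infinity" "(\<lambda>n. L1n (\<lambda>x. u x - \<phi> n x)) \<longlonglongrightarrow> 0"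
    "(\<lambda>n. L2n (\<lambda>x. G x - grad (\<phi> n) x)) \<longlonglongrightarrow> 0" using H1_seq[OF u] by blast
  note [measurable] = Cc_infinity_measurable[OF \<phi>(1)]
  have c: "(\<lambda>x. \<phi> n (x + a)) \<in> Cc_infinity" for n
    using Cc_infinity_affine[OF \<phi>(1), of 1 n a] by simp
  show ?thesis
  proof (rule H1_closed_seq[OF H1_Cc[OF c]])
    have "L1n (\<lambda>x. u (x + a) - \<phi> n (x + a)) = L1n (\<lambda>x. u x - \<phi> n x)" for n
      by (rule nn_integral_lborel_translate) measurable
    with \<phi>(2) show "(\<lambda>n. L1n (\<lambda>x. u (x + a) - \<phi> n (x + a))) \<longlonglongrightarrow> 0" by simp
    have "L2n (\<lambda>x. G (x + a) - grad (\<phi> n) (x + a)) = L2n (\<lambda>x. G x - grad (\<phi> n) x)" for n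
      by (rule nn_integral_lborel_translate) measurable
    moreover have "grad (\<lambda>x. \<phi> n (x + a)) x = grad (\<phi> n) (x + a)" for n x
      using grad_affine[OF Cc_infinityD(1)[OF \<phi>(1)], of n 1 a x] by simp
    ultimately show "(\<lambda>n. L2n (\<lambda>x. G (x + a) - grad (\<lambda>x. \<phi> n (x + a)) x)) \<longlonglongrightarrow> 0"
      using \<phi>(3) by simp
  qed auto
qed

lemma square_integrable_locally_integrable:
  fixes G :: "real^3 \<Rightarrow> real^3"
  assumes [measurable]: "G \<in> borel_measurable borel" and "integrable lborel (\<lambda>x. (norm (G x))\<^sup>2)"
  shows "locally_integrable G"
  unfolding locally_integrable_def set_integrable_def
proof (intro allI impI)
  fix K :: "(real^3) set" assume K: "compact K"
  then have [measurable]: "K \<in> sets borel" by (simp add: borel_compact)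
  show "integrable lborel (\<lambda>x. indicat_real K x *\<^sub>R G x)"
  proof (rule Bochner_Integration.integrable_bound)
    show "integrable lborel (\<lambda>x. indicat_real K x + (norm (G x))\<^sup>2)"
      using emeasure_bounded_finite[OF compact_imp_bounded[OF K]]
      by (intro Bochner_Integration.integrable_add assms integrable_real_indicator) auto
    have "norm (indicat_real K x *\<^sub>R G x) \<le> norm (indicat_real K x + (norm (G x))\<^sup>2)" for x
    proof -
      have "norm (G x) \<le> 1 + (norm (G x))\<^sup>2"
        using sum_squares_bound[of "norm (G x)" 1] norm_ge_zero[of "G x"]
        by (simp del: norm_ge_zero)
      then show ?thesis by (simp add: indicator_def)
    qed
    then show "AE x in lborel. norm (indicat_real K x *\<^sub>R G x) \<le> norm (indicat_real K x + (norm (G x))\<^sup>2)"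
      by simp
  qed measurable
qed

text \<open>Integration by parts for test functions passes to the limit: \<open>u\<close> is
  approximated in mean and paired with a bounded derivative of \<open>\<psi>\<close>, the gradient
  is approximated in square mean and paired with the square integrable
  \<open>\<psi>\<close>.\<close>

lemma H1_has_weak_grad:
  assumes u: "H1 u G" shows "has_weak_grad u G"
proof -
  note [measurable] = H1_measurable[OF u]
  note iu = H1_integrable[OF u] note iG = H1_integrable_grad[OF u]
  have lu: "locally_integrable u"
    unfolding locally_integrable_def set_integrable_def
    by (intro allI impI integrable_mult_indicator iu) (simp add: borel_compact)
  have lG: "locally_integrable G"
    by (rule square_integrable_locally_integrable[OF _ iG]) measurable
  obtain \<phi> where \<phi>: "\<And>n. \<phi> n \<in> Cc_infinity" "(\<lambda>n. L1n (\<lambda>x. u x - \<phi> n x)) \<longlonglongrightarrow> 0"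
    "(\<lambda>n. L2n (\<lambda>x. G x - grad (\<phi> n) x)) \<longlonglongrightarrow> 0" using H1_seq[OF u] by blast
  note [measurable] = Cc_infinity_measurable[OF \<phi>(1)]
  have "(LINT x|lborel. u x * grad \<psi> x $ i) = - (LINT x|lborel. G x $ i * \<psi> x)"
    if \<psi>: "\<psi> \<in> Cc_infinity" for \<psi> i
  proof -
    note [measurable] = Cc_infinity_measurable[OF \<psi>]
    note gc = Cc_infinity_grad_nth[OF \<psi>, of i]
    obtain B where B: "\<And>x. \<bar>grad \<psi> x $ i\<bar> \<le> B"
      using Cc_infinity_bounded(1)[OF gc] unfolding bounded_iff by auto
    have "(\<lambda>n. LINT x|lborel. \<phi> n x * grad \<psi> x $ i) \<longlonglongrightarrow> (LINT x|lborel. u x * grad \<psi> x $ i)"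
    proof (rule tendsto_L1_int)
      show "integrable lborel (\<lambda>x. \<phi> n x * grad \<psi> x $ i)" for n
        by (intro Cc_infinity_integrable Cc_infinity_smooth_mult Cc_infinityD \<phi> gc)
      show "integrable lborel (\<lambda>x. u x * grad \<psi> x $ i)" by (rule locally_integrable_mult_Cc[OF lu gc])
      show "(\<lambda>n. \<integral>\<^sup>+x. norm (\<phi> n x * grad \<psi> x $ i - u x * grad \<psi> x $ i) \<partial>lborel) \<longlonglongrightarrow> 0"
      proof (rule tendsto_sandwich[OF _ _ tendsto_const])
        have "(\<integral>\<^sup>+x. norm (\<phi> n x * grad \<psi> x $ i - u x * grad \<psi> x $ i) \<partial>lborel)
            \<le> (\<integral>\<^sup>+x. ennreal B * ennreal \<bar>u x - \<phi> n x\<bar> \<partial>lborel)" for n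
        proof (intro nn_integral_mono)
          fix x
          have "norm (\<phi> n x * grad \<psi> x $ i - u x * grad \<psi> x $ i) = \<bar>grad \<psi> x $ i\<bar> * \<bar>u x - \<phi> n x\<bar>"
            by (simp add: left_diff_distrib[symmetric] abs_mult abs_minus_commute mult.commute)
          also have "\<dots> \<le> B * \<bar>u x - \<phi> n x\<bar>" by (intro mult_right_mono B) simp
          finally show "ennreal (norm (\<phi> n x * grad \<psi> x $ i - u x * grad \<psi> x $ i)) \<le> ennreal B * ennreal \<bar>u x - \<phi> n x\<bar>"
            using B[of 0] by (subst ennreal_mult[symmetric]) (auto intro: ennreal_leI)
        qed
        also have "(\<integral>\<^sup>+x. ennreal B * ennreal \<bar>u x - \<phi> n x\<bar> \<partial>lborel) = ennreal B * L1n (\<lambda>x. u x - \<phi> n x)" for n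
          by (rule nn_integral_cmult) measurable
        finally show "eventually (\<lambda>n. (\<integral>\<^sup>+x. norm (\<phi> n x * grad \<psi> x $ i - u x * grad \<psi> x $ i) \<partial>lborel)
            \<le> ennreal B * L1n (\<lambda>x. u x - \<phi> n x)) sequentially" by simp
        show "(\<lambda>n. ennreal B * L1n (\<lambda>x. u x - \<phi> n x)) \<longlonglongrightarrow> 0"
          using ennreal_tendsto_cmult[OF _ \<phi>(2), of "ennreal B"] by simp
      qed simp
    qed
    moreover have "(\<lambda>n. LINT x|lborel. grad (\<phi> n) x $ i * \<psi> x) \<longlonglongrightarrow> (LINT x|lborel. G x $ i * \<psi> x)"
    proof (rule tendsto_L1_int)
      show "integrable lborel (\<lambda>x. grad (\<phi> n) x $ i * \<psi> x)" for n
        by (intro Cc_infinity_integrable Cc_infinity_smooth_mult Cc_infinityD Cc_infinity_grad_nth \<phi> \<psi>)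
      show "integrable lborel (\<lambda>x. G x $ i * \<psi> x)"
        by (rule locally_integrable_mult_Cc[OF locally_integrable_vec_nth[OF lG] \<psi>])
      show "(\<lambda>n. \<integral>\<^sup>+x. norm (grad (\<phi> n) x $ i * \<psi> x - G x $ i * \<psi> x) \<partial>lborel) \<longlonglongrightarrow> 0"
      proof (rule tendsto_sandwich[OF _ _ tendsto_const])
        show "eventually (\<lambda>n. (\<integral>\<^sup>+x. norm (grad (\<phi> n) x $ i * \<psi> x - G x $ i * \<psi> x) \<partial>lborel)
            \<le> (\<integral>\<^sup>+x. ennreal (norm (G x - grad (\<phi> n) x) * norm (\<psi> x)) \<partial>lborel)) sequentially"
        proof (intro always_eventually allI nn_integral_mono ennreal_leI)
          fix n x
          have "norm (grad (\<phi> n) x $ i * \<psi> x - G x $ i * \<psi> x) = \<bar>(G x - grad (\<phi> n) x) $ i\<bar> * \<bar>\<psi> x\<bar>"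
            by (simp add: left_diff_distrib[symmetric] abs_mult abs_minus_commute)
          also have "\<dots> \<le> norm (G x - grad (\<phi> n) x) * norm (\<psi> x)"
            using component_le_norm_cart[of "G x - grad (\<phi> n) x" i] by (intro mult_mono) auto
          finally show "norm (grad (\<phi> n) x $ i * \<psi> x - G x $ i * \<psi> x) \<le> norm (G x - grad (\<phi> n) x) * norm (\<psi> x)" .
        qed
        have "integrable lborel (\<lambda>x. \<psi> x * \<psi> x)"
          by (intro Cc_infinity_integrable Cc_infinity_smooth_mult Cc_infinityD \<psi>)
        then have "L2n \<psi> < \<infinity>" by (simp add: integrable_iff_bounded power2_eq_square abs_mult)
        then show "(\<lambda>n. \<integral>\<^sup>+x. ennreal (norm (G x - grad (\<phi> n) x) * norm (\<psi> x)) \<partial>lborel) \<longlonglongrightarrow> 0"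
          by (intro L2n_pairing_tendsto_0 \<phi>) measurable
      qed simp
    qed
    then have "(\<lambda>n. - (LINT x|lborel. grad (\<phi> n) x $ i * \<psi> x)) \<longlonglongrightarrow> - (LINT x|lborel. G x $ i * \<psi> x)"
      by (rule tendsto_minus)
    ultimately show ?thesis
      using LIMSEQ_unique by (simp add: Cc_infinity_integration_by_parts[OF \<phi>(1) \<psi>])
  qed
  then show ?thesis using lu lG by (simp add: has_weak_grad_def)
qed

section \<open>The chosen weak gradient, and the agreement of \<open>H1\<close> with
  \<open>hat_H1\<close>\<close>

lemma has_weak_grad_weak_grad: "has_weak_grad u G \<Longrightarrow> has_weak_grad u (weak_grad u)"
  by (simp add: weak_grad_def someI[of "has_weak_grad u"])

lemma weak_grad_measurable: "has_weak_grad u G \<Longrightarrow> weak_grad u \<in> borel_measurable borel"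
  using has_weak_grad_weak_grad locally_integrable_measurable by (metis has_weak_grad_def)

lemma H1_weak_grad_AE:
  assumes "H1 u G" shows "AE x in lborel. weak_grad u x = G x"
  using H1_has_weak_grad[OF assms] has_weak_grad_unique has_weak_grad_weak_grad by blast

lemma H1_weak_grad_measurable: "H1 u G \<Longrightarrow> weak_grad u \<in> borel_measurable borel"
  by (rule weak_grad_measurable[OF H1_has_weak_grad])

lemma L1_norm_L1n: "u \<in> borel_measurable borel \<Longrightarrow> L1_norm u = enn2real (L1n u)"
  unfolding L1_norm_def by (subst integral_eq_nn_integral) auto

lemma H1_integral_weak_grad:
  assumes u: "H1 u G"
  shows "(LINT x|lborel. (norm (weak_grad u x))\<^sup>2) = enn2real (L2n G)"
proof -
  note [measurable] = H1_measurable[OF u] H1_weak_grad_measurable[OF u]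
  have "(LINT x|lborel. (norm (weak_grad u x))\<^sup>2) = (LINT x|lborel. (norm (G x))\<^sup>2)"
    using H1_weak_grad_AE[OF u] by (intro integral_cong_AE) auto
  also have "\<dots> = enn2real (L2n G)" by (subst integral_eq_nn_integral) auto
  finally show ?thesis .
qed

lemma hat_norm_H1: "H1 u G \<Longrightarrow> hat_norm u = enn2real (L1n u) + sqrt (enn2real (L2n G))"
  by (simp add: hat_norm_def H1_integral_weak_grad L1_norm_L1n H1_measurable)

lemma H1_imp_hat_H1:
  assumes u: "H1 u G" shows "u \<in> hat_H1"
proof -
  note [measurable] = H1_measurable[OF u] H1_weak_grad_measurable[OF u]
  have "integrable lborel (\<lambda>x. (norm (weak_grad u x))\<^sup>2)"
    using H1_integrable_grad[OF u]
    by (rule integrable_cong_AE_imp) (use H1_weak_grad_AE[OF u] in \<open>auto elim!: AE_mp\<close>)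
  then have 1: "u \<in> L1_grad_L2"
    using H1_integrable[OF u] H1_has_weak_grad[OF u] by (auto simp: L1_grad_L2_def)
  obtain \<phi> where \<phi>: "\<And>n. \<phi> n \<in> Cc_infinity" "(\<lambda>n. L1n (\<lambda>x. u x - \<phi> n x)) \<longlonglongrightarrow> 0"
    "(\<lambda>n. L2n (\<lambda>x. G x - grad (\<phi> n) x)) \<longlonglongrightarrow> 0" using H1_seq[OF u] by blast
  have z: "(\<lambda>n. enn2real (a n)) \<longlonglongrightarrow> 0" if "a \<longlonglongrightarrow> 0" for a
    using tendsto_enn2real[of a 0 sequentially] that by simp
  have "(\<lambda>n. hat_norm (\<lambda>x. u x - \<phi> n x)) \<longlonglongrightarrow> 0 + sqrt 0"
    unfolding hat_norm_H1[OF H1_diff[OF u H1_Cc[OF \<phi>(1)]]]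
    by (intro tendsto_add tendsto_real_sqrt z \<phi>)
  with 1 \<phi>(1) show ?thesis by (auto simp: hat_H1_def)
qed

text \<open>With \<open>H1_imp_hat_H1\<close> this identifies \<open>hat_H1\<close> with the first
  components of \<open>H1\<close>. The weak gradient chosen for \<open>u - \<phi> n\<close> agrees
  almost everywhere with the difference of the gradients.\<close>

lemma hat_H1_imp_H1:
  assumes u: "u \<in> hat_H1" shows "H1 u (weak_grad u)"
proof -
  let ?G = "weak_grad u"
  obtain \<phi> where \<phi>: "\<And>n. \<phi> n \<in> Cc_infinity" "(\<lambda>n. hat_norm (\<lambda>x. u x - \<phi> n x)) \<longlonglongrightarrow> 0"
    using u by (auto simp: hat_H1_def)
  have G: "integrable lborel u" "has_weak_grad u ?G" "integrable lborel (\<lambda>x. (norm (?G x))\<^sup>2)"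
    using u has_weak_grad_weak_grad by (auto simp: hat_H1_def L1_grad_L2_def)
  have [measurable]: "u \<in> borel_measurable borel" "?G \<in> borel_measurable borel"
    using G weak_grad_measurable by auto
  note [measurable] = Cc_infinity_measurable[OF \<phi>(1)]
  have w: "has_weak_grad (\<lambda>x. u x - \<phi> n x) (\<lambda>x. ?G x - grad (\<phi> n) x)" for n
    by (intro has_weak_grad_diff G H1_has_weak_grad H1_Cc \<phi>)
  note [measurable] = weak_grad_measurable[OF w]
  define a where "a n = L1_norm (\<lambda>x. u x - \<phi> n x)" for n
  define b where "b n = (LINT x|lborel. (norm (weak_grad (\<lambda>x. u x - \<phi> n x) x))\<^sup>2)" for n
  have ab: "a n \<ge> 0" "b n \<ge> 0" for n by (auto simp: a_def b_def L1_norm_def)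
  have l: "(\<lambda>n. a n + sqrt (b n)) \<longlonglongrightarrow> 0" using \<phi>(2) by (simp add: hat_norm_def a_def b_def)
  have la: "a \<longlonglongrightarrow> 0" by (rule tendsto_sandwich[OF _ _ tendsto_const l]) (auto simp: ab)
  have "(\<lambda>n. sqrt (b n)) \<longlonglongrightarrow> 0" by (rule tendsto_sandwich[OF _ _ tendsto_const l]) (auto simp: ab)
  then have "(\<lambda>n. (sqrt (b n))\<^sup>2) \<longlonglongrightarrow> 0\<^sup>2" by (rule tendsto_power)
  then have lb: "b \<longlonglongrightarrow> 0" using ab by simp
  have A: "L1n (\<lambda>x. u x - \<phi> n x) = ennreal (a n)" for n
    unfolding a_def L1_norm_def
    by (intro nn_integral_eq_integral integrable_abs Bochner_Integration.integrable_diff G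
        Cc_infinity_integrable \<phi>) simp
  have B: "L2n (\<lambda>x. ?G x - grad (\<phi> n) x) = ennreal (b n)" for n
  proof -
    have ae: "AE x in lborel. ?G x - grad (\<phi> n) x = weak_grad (\<lambda>x. u x - \<phi> n x) x"
      by (rule has_weak_grad_unique[OF w has_weak_grad_weak_grad[OF w]])
    \<comment> \<open>Integrability comes first: otherwise an integral could be the default value 0
      and carry no information about \<open>L2n\<close>.\<close>
    have "L2n (\<lambda>x. ?G x - grad (\<phi> n) x) \<le> 2 * L2n ?G + 2 * L2n (grad (\<phi> n))"
      by (rule L2n_triangle) (use norm_triangle_ineq4 in auto)
    also have "\<dots> < \<infinity>"
      using G(3) Cc_infinity_L_finite(2)[OF \<phi>(1), of n]
      by (auto simp: integrable_L2n ennreal_add_less_top ennreal_mult_less_top)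
    finally have "integrable lborel (\<lambda>x. (norm (?G x - grad (\<phi> n) x))\<^sup>2)" by (simp add: integrable_L2n)
    then have "L2n (\<lambda>x. ?G x - grad (\<phi> n) x) = ennreal (LINT x|lborel. (norm (?G x - grad (\<phi> n) x))\<^sup>2)"
      by (intro nn_integral_eq_integral) auto
    also have "(LINT x|lborel. (norm (?G x - grad (\<phi> n) x))\<^sup>2) = b n"
      unfolding b_def using ae by (intro integral_cong_AE) auto
    finally show ?thesis .
  qed
  show ?thesis
  proof (rule H1_closed_seq[OF H1_Cc[OF \<phi>(1)]])
    show "(\<lambda>n. L1n (\<lambda>x. u x - \<phi> n x)) \<longlonglongrightarrow> 0" unfolding A using tendsto_ennrealI[OF la] by simp
    show "(\<lambda>n. L2n (\<lambda>x. ?G x - grad (\<phi> n) x)) \<longlonglongrightarrow> 0" unfolding B using tendsto_ennrealI[OF lb] by simp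
  qed auto
qed

subsection \<open>Translation estimates and averages over cells\<close>

text \<open>Fatou's lemma along an almost everywhere convergent subsequence.\<close>

lemma L2n_le_of_L1_limit:
  assumes [measurable]: "\<And>n. f n \<in> borel_measurable borel" "g \<in> borel_measurable borel"
    and lim: "(\<lambda>n. L1n (\<lambda>x. f n x - g x)) \<longlonglongrightarrow> 0" and le: "eventually (\<lambda>n. L2n (f n) \<le> C) sequentially"
  shows "L2n g \<le> C"
proof -
  have "eventually (\<lambda>n. L1n (\<lambda>x. f n x - g x) < 1) sequentially"
    using order_tendstoD(2)[OF lim, of 1] by simp
  from eventually_conj[OF this le]
  obtain N where N: "\<And>n. n \<ge> N \<Longrightarrow> L1n (\<lambda>x. f n x - g x) < 1 \<and> L2n (f n) \<le> C"
    unfolding eventually_sequentially by blast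
  \<comment> \<open>The shift by \<open>N\<close> discards the indices at which the difference might
    fail to be integrable.\<close>
  have i: "integrable lborel (\<lambda>x. f (n + N) x - g x)" for n
    using N[of "n + N"] by (auto simp: integrable_L1n less_top[symmetric] intro: order_less_trans)
  have "(\<lambda>n. L1n (\<lambda>x. f (n + N) x - g x)) \<longlonglongrightarrow> ennreal 0"
    using LIMSEQ_ignore_initial_segment[OF lim, of N] by simp
  then have "(\<lambda>n. enn2real (L1n (\<lambda>x. f (n + N) x - g x))) \<longlonglongrightarrow> 0"
    by (rule tendsto_enn2real) simp
  then have "(\<lambda>n. LINT x|lborel. norm (f (n + N) x - g x)) \<longlonglongrightarrow> 0"
    by (subst integral_eq_nn_integral) auto
  from tendsto_L1_AE_subseq[OF i this] obtain r :: "nat \<Rightarrow> nat" where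
    r: "AE x in lborel. (\<lambda>n. f (r n + N) x - g x) \<longlonglongrightarrow> 0" by auto
  have "L2n g \<le> (\<integral>\<^sup>+x. liminf (\<lambda>n. ennreal ((norm (f (r n + N) x))\<^sup>2)) \<partial>lborel)"
  proof (rule nn_integral_mono_AE, rule AE_mp[OF r], intro AE_I2 impI)
    fix x assume "(\<lambda>n. f (r n + N) x - g x) \<longlonglongrightarrow> 0"
    then have "(\<lambda>n. f (r n + N) x) \<longlonglongrightarrow> g x" by (simp add: LIM_zero_iff)
    then have "(\<lambda>n. ennreal ((norm (f (r n + N) x))\<^sup>2)) \<longlonglongrightarrow> ennreal ((norm (g x))\<^sup>2)"
      by (intro tendsto_intros)
    from lim_imp_Liminf[OF _ this]
    show "ennreal ((norm (g x))\<^sup>2) \<le> liminf (\<lambda>n. ennreal ((norm (f (r n + N) x))\<^sup>2))"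
      by simp
  qed
  also have "\<dots> \<le> liminf (\<lambda>n. L2n (f (r n + N)))"
    by (rule nn_integral_liminf) measurable
  also have "\<dots> \<le> liminf (\<lambda>n. C)"
    by (intro Liminf_mono always_eventually allI conjunct2[OF N]) simp
  finally show ?thesis by (simp add: Liminf_const)
qed

text \<open>The factor 2, absent for test functions, enters when \<open>grad (\<phi> n)\<close> is
  replaced by \<open>G\<close> through \<open>L2n_triangle\<close>.\<close>

lemma H1_translation_estimate:
  assumes u: "H1 u G"
  shows "L2n (\<lambda>x. u (x + h) - u x) \<le> ennreal (2 * (norm h)\<^sup>2) * L2n G"
proof (rule ennreal_le_epsilon)
  note [measurable] = H1_measurable[OF u]
  obtain \<phi> where \<phi>: "\<And>n. \<phi> n \<in> Cc_infinity" "(\<lambda>n. L1n (\<lambda>x. u x - \<phi> n x)) \<longlonglongrightarrow> 0"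
    "(\<lambda>n. L2n (\<lambda>x. G x - grad (\<phi> n) x)) \<longlonglongrightarrow> 0" using H1_seq[OF u] by blast
  note [measurable] = Cc_infinity_measurable[OF \<phi>(1)]
  fix e :: real assume "0 < e"
  let ?D = "\<lambda>n x. \<phi> n (x + h) - \<phi> n x"
  show "L2n (\<lambda>x. u (x + h) - u x) \<le> ennreal (2 * (norm h)\<^sup>2) * L2n G + ennreal e"
  proof (rule L2n_le_of_L1_limit[of ?D])
    show "(\<lambda>n. L1n (\<lambda>x. ?D n x - (u (x + h) - u x))) \<longlonglongrightarrow> 0"
    proof (rule tendsto_sandwich[OF always_eventually always_eventually tendsto_const])
      show "\<forall>n. L1n (\<lambda>x. ?D n x - (u (x + h) - u x)) \<le> L1n (\<lambda>x. u x - \<phi> n x) + L1n (\<lambda>x. u x - \<phi> n x)"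
      proof
        fix n
        have "L1n (\<lambda>x. ?D n x - (u (x + h) - u x)) \<le> L1n (\<lambda>x. u (x + h) - \<phi> n (x + h)) + L1n (\<lambda>x. u x - \<phi> n x)"
          by (rule L1n_triangle) auto
        also have "L1n (\<lambda>x. u (x + h) - \<phi> n (x + h)) = L1n (\<lambda>x. u x - \<phi> n x)"
          by (rule nn_integral_lborel_translate) measurable
        finally show "L1n (\<lambda>x. ?D n x - (u (x + h) - u x)) \<le> L1n (\<lambda>x. u x - \<phi> n x) + L1n (\<lambda>x. u x - \<phi> n x)" .
      qed
      show "(\<lambda>n. L1n (\<lambda>x. u x - \<phi> n x) + L1n (\<lambda>x. u x - \<phi> n x)) \<longlonglongrightarrow> 0"
        using tendsto_add[OF \<phi>(2) \<phi>(2)] by simp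
    qed simp
    have z: "(\<lambda>n. ennreal (2 * (norm h)\<^sup>2) * L2n (\<lambda>x. G x - grad (\<phi> n) x)) \<longlonglongrightarrow> 0"
      using ennreal_tendsto_cmult[OF _ \<phi>(3), of "ennreal (2 * (norm h)\<^sup>2)"] by simp
    have ev: "eventually (\<lambda>n. ennreal (2 * (norm h)\<^sup>2) * L2n (\<lambda>x. G x - grad (\<phi> n) x) < ennreal e) sequentially"
      using order_tendstoD(2)[OF z, of "ennreal e"] \<open>0 < e\<close> by simp
    show "eventually (\<lambda>n. L2n (?D n) \<le> ennreal (2 * (norm h)\<^sup>2) * L2n G + ennreal e) sequentially"
    proof (rule eventually_mono[OF ev])
      fix n assume n: "ennreal (2 * (norm h)\<^sup>2) * L2n (\<lambda>x. G x - grad (\<phi> n) x) < ennreal e"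
      have "L2n (?D n) \<le> ennreal ((norm h)\<^sup>2) * L2n (grad (\<phi> n))"
        by (rule Cc_infinity_translation_estimate[OF \<phi>(1)])
      also have "\<dots> \<le> ennreal ((norm h)\<^sup>2) * (2 * L2n G + 2 * L2n (\<lambda>x. G x - grad (\<phi> n) x))"
        using norm_triangle_sub[of "grad (\<phi> n) _" "G _"]
        by (intro mult_left_mono L2n_triangle) (simp_all add: norm_minus_commute)
      also have "\<dots> = ennreal (2 * (norm h)\<^sup>2) * L2n G + ennreal (2 * (norm h)\<^sup>2) * L2n (\<lambda>x. G x - grad (\<phi> n) x)"
        by (simp add: distrib_left ennreal_mult mult_ac)
      also have "\<dots> \<le> ennreal (2 * (norm h)\<^sup>2) * L2n G + ennreal e" using n by (intro add_mono) auto
      finally show "L2n (?D n) \<le> ennreal (2 * (norm h)\<^sup>2) * L2n G + ennreal e" .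
    qed
  qed measurable
qed

section \<open>Grid cubes and averages over them\<close>

definition cell :: "real \<Rightarrow> real^3 \<Rightarrow> (real^3) set" where
  "cell r x = {y. \<forall>i. \<lfloor>y $ i / r\<rfloor> = \<lfloor>x $ i / r\<rfloor>}"

text \<open>Lying in the same half-open grid cube is an equivalence relation; its symmetry lets
  Fubini exchange the point and the variable of the average in
  \<open>L1n_cell_avg_le\<close>.\<close>

lemma cell_sym: "y \<in> cell r x \<longleftrightarrow> x \<in> cell r y"
  by (auto simp: cell_def)

lemma measurable_cell [measurable]: "Measurable.pred (borel \<Otimes>\<^sub>M borel) (\<lambda>(x, y). y \<in> cell r x)"
  unfolding cell_def by measurable

lemma indicator_cell_measurable [measurable]:
  "(\<lambda>(x, y). indicator (cell r x) y :: ennreal) \<in> borel_measurable (borel \<Otimes>\<^sub>M borel)"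
proof -
  have "(\<lambda>p. indicator {p. case p of (x, y) \<Rightarrow> y \<in> cell r x} p :: ennreal) \<in> borel_measurable (borel \<Otimes>\<^sub>M borel)"
    by (intro borel_measurable_indicator) (use measurable_cell[of r] in \<open>simp add: pred_def space_pair_measure\<close>)
  then show ?thesis by (simp add: indicator_def case_prod_unfold)
qed

lemma sets_cell [measurable]: "cell r x \<in> sets borel"
  unfolding cell_def by measurable

lemma cell_cbox:
  fixes x :: "real^3"
  assumes r: "r > 0"
  defines "a \<equiv> \<chi> i. r * real_of_int \<lfloor>x $ i / r\<rfloor>"
  shows "box a (a + (\<chi> i. r)) \<subseteq> cell r x" "cell r x \<subseteq> cbox a (a + (\<chi> i. r))"
proof -
  have *: "\<lfloor>y / r\<rfloor> = k \<longleftrightarrow> r * of_int k \<le> y \<and> y < r * of_int k + r" for y k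
    using r by (auto simp: floor_eq_iff field_simps)
  show "box a (a + (\<chi> i. r)) \<subseteq> cell r x" "cell r x \<subseteq> cbox a (a + (\<chi> i. r))"
    by (auto simp: cell_def mem_box_cart * a_def less_imp_le)
qed

lemma emeasure_cbox_cart:
  fixes a b :: "real^3"
  assumes "\<And>i. a $ i \<le> b $ i"
  shows "emeasure lborel (cbox a b) = ennreal (\<Prod>i\<in>UNIV. b $ i - a $ i)"
proof -
  have "measure lborel (cbox a b) = (\<Prod>i\<in>UNIV. b $ i - a $ i)"
    by (rule content_cbox_cart) (use assms in \<open>auto simp: interval_ne_empty_cart\<close>)
  then show ?thesis
    using emeasure_lborel_cbox_finite[of a b] by (simp add: emeasure_eq_ennreal_measure less_top)
qed

lemma emeasure_cell:
  assumes r: "r > 0" shows "emeasure lborel (cell r x) = ennreal (r ^ 3)"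
proof -
  define a :: "real^3" where "a = (\<chi> i. r * real_of_int \<lfloor>x $ i / r\<rfloor>)"
  have cb: "emeasure lborel (cbox a (a + (\<chi> i. r))) = ennreal (r ^ 3)"
    using r by (subst emeasure_cbox_cart) auto
  have b: "emeasure lborel (box a (a + (\<chi> i. r))) = ennreal (r ^ 3)"
    using cb by (simp add: emeasure_lborel_box_eq emeasure_lborel_cbox_eq)
  show ?thesis
    using emeasure_mono[OF cell_cbox(1)[OF r, of x], of lborel] emeasure_mono[OF cell_cbox(2)[OF r, of x], of lborel]
    by (simp add: a_def[symmetric] b cb antisym)
qed

lemma cell_diff:
  assumes r: "r > 0" and y: "y \<in> cell r x" shows "y - x \<in> cbox (\<chi> i. - r) (\<chi> i. r)"
proof -
  define a :: "real^3" where "a = (\<chi> i. r * real_of_int \<lfloor>x $ i / r\<rfloor>)"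
  have "x \<in> cell r x" by (simp add: cell_def)
  then have "x \<in> cbox a (a + (\<chi> i. r))" "y \<in> cbox a (a + (\<chi> i. r))"
    using cell_cbox(2)[OF r, of x] y unfolding a_def by blast+
  then have "a $ i \<le> x $ i" "x $ i \<le> a $ i + r" "a $ i \<le> y $ i" "y $ i \<le> a $ i + r" for i
    by (auto simp: mem_box_cart)
  then have "- r \<le> y $ i - x $ i" "y $ i - x $ i \<le> r" for i by (smt (verit))+
  then show ?thesis by (auto simp: mem_box_cart)
qed

definition cell_avg :: "real \<Rightarrow> (real^3 \<Rightarrow> real) \<Rightarrow> real^3 \<Rightarrow> real" where
  "cell_avg r f x = (LINT y|lborel. indicator (cell r x) y * f y) / r ^ 3"

lemma cell_avg_measurable [measurable]:
  assumes [measurable]: "f \<in> borel_measurable borel"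
  shows "cell_avg r f \<in> borel_measurable borel"
proof -
  have "(\<lambda>p. indicator {p. case p of (x, y) \<Rightarrow> y \<in> cell r x} p :: real) \<in> borel_measurable (borel \<Otimes>\<^sub>M borel)"
    by (intro borel_measurable_indicator) (use measurable_cell[of r] in \<open>simp add: pred_def space_pair_measure\<close>)
  then have [measurable]: "(\<lambda>(x, y). indicator (cell r x) y :: real) \<in> borel_measurable (borel \<Otimes>\<^sub>M borel)"
    by (simp add: indicator_def case_prod_unfold)
  have "(\<lambda>x. LINT y|lborel. indicator (cell r x) y * f y) \<in> borel_measurable borel"
    by (rule lborel.borel_measurable_lebesgue_integral) measurable
  then show ?thesis unfolding cell_avg_def[abs_def] by simp
qed

lemma integrable_cell:
  fixes f :: "real^3 \<Rightarrow> real"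
  shows "integrable lborel f \<Longrightarrow> integrable lborel (\<lambda>y. indicator (cell r x) y * f y)"
  using integrable_mult_indicator[of "cell r x" lborel f] by simp

lemma cell_avg_le:
  assumes r: "r > 0" and f: "integrable lborel f"
  shows "ennreal \<bar>cell_avg r f x\<bar> \<le> ennreal (1 / r ^ 3) * (\<integral>\<^sup>+y. indicator (cell r x) y * ennreal \<bar>f y\<bar> \<partial>lborel)"
proof -
  have "ennreal \<bar>cell_avg r f x\<bar> = ennreal (1 / r ^ 3) * ennreal (norm (LINT y|lborel. indicator (cell r x) y * f y))"
    using r by (simp add: cell_avg_def ennreal_mult[symmetric] abs_divide)
  also have "\<dots> \<le> ennreal (1 / r ^ 3) * (\<integral>\<^sup>+y. ennreal (norm (indicator (cell r x) y * f y)) \<partial>lborel)"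
    by (intro mult_left_mono integral_norm_bound_ennreal integrable_cell f) simp
  also have "(\<integral>\<^sup>+y. ennreal (norm (indicator (cell r x) y * f y)) \<partial>lborel)
      = (\<integral>\<^sup>+y. indicator (cell r x) y * ennreal \<bar>f y\<bar> \<partial>lborel)"
    by (intro nn_integral_cong) (auto simp: indicator_def)
  finally show ?thesis .
qed

lemma cell_avg_le_L1n:
  assumes r: "r > 0" and f: "integrable lborel f"
  shows "ennreal \<bar>cell_avg r f x\<bar> \<le> ennreal (1 / r ^ 3) * L1n f"
proof -
  have "(\<integral>\<^sup>+y. indicator (cell r x) y * ennreal \<bar>f y\<bar> \<partial>lborel) \<le> L1n f"
    by (intro nn_integral_mono) (auto simp: indicator_def)
  then show ?thesis using cell_avg_le[OF assms, of x] by (meson mult_left_mono order_trans zero_le)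
qed

lemma L1n_cell_avg_le:
  assumes r: "r > 0" and f: "integrable lborel f"
  shows "L1n (cell_avg r f) \<le> L1n f"
proof -
  have [measurable]: "f \<in> borel_measurable borel" using f by simp
  have "L1n (cell_avg r f) \<le> (\<integral>\<^sup>+x. ennreal (1 / r ^ 3) * (\<integral>\<^sup>+y. indicator (cell r x) y * ennreal \<bar>f y\<bar> \<partial>lborel) \<partial>lborel)"
    by (intro nn_integral_mono cell_avg_le assms)
  also have "\<dots> = ennreal (1 / r ^ 3) * (\<integral>\<^sup>+x. (\<integral>\<^sup>+y. indicator (cell r x) y * ennreal \<bar>f y\<bar> \<partial>lborel) \<partial>lborel)"
    by (rule nn_integral_cmult) measurable
  also have "(\<integral>\<^sup>+x. (\<integral>\<^sup>+y. indicator (cell r x) y * ennreal \<bar>f y\<bar> \<partial>lborel) \<partial>lborel)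
      = (\<integral>\<^sup>+y. (\<integral>\<^sup>+x. indicator (cell r x) y * ennreal \<bar>f y\<bar> \<partial>lborel) \<partial>lborel)"
    by (rule lborel_pair.Fubini') measurable
  also have "\<dots> = (\<integral>\<^sup>+y. ennreal (r ^ 3) * ennreal \<bar>f y\<bar> \<partial>lborel)"
  proof (intro nn_integral_cong)
    fix y
    have "(\<integral>\<^sup>+x. indicator (cell r x) y * ennreal \<bar>f y\<bar> \<partial>lborel)
        = (\<integral>\<^sup>+x. ennreal \<bar>f y\<bar> * indicator (cell r y) x \<partial>lborel)"
      by (intro nn_integral_cong) (auto simp: indicator_def cell_sym[of y])
    then show "(\<integral>\<^sup>+x. indicator (cell r x) y * ennreal \<bar>f y\<bar> \<partial>lborel) = ennreal (r ^ 3) * ennreal \<bar>f y\<bar>"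
      by (simp add: nn_integral_cmult_indicator emeasure_cell[OF r] mult.commute)
  qed
  also have "\<dots> = ennreal (r ^ 3) * L1n f" by (rule nn_integral_cmult) measurable
  also have "ennreal (1 / r ^ 3) * (ennreal (r ^ 3) * L1n f) = L1n f"
    using r by (simp add: mult.assoc[symmetric] ennreal_mult[symmetric])
  finally show ?thesis .
qed

text \<open>Up to sign the deviation is the average of \<open>f y - f x\<close> over the cell, so
  Cauchy-Schwarz against the indicator of the cell, of measure \<open>r ^ 3\<close>, gives the
  bound.\<close>

lemma cell_avg_deviation:
  assumes r: "r > 0" and f: "integrable lborel f"
  shows "ennreal ((f x - cell_avg r f x)\<^sup>2)
    \<le> ennreal (1 / r ^ 3) * (\<integral>\<^sup>+y. indicator (cell r x) y * ennreal ((f y - f x)\<^sup>2) \<partial>lborel)"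
proof -
  have [measurable]: "f \<in> borel_measurable borel" using f by simp
  have fin: "emeasure lborel (cell r x) < \<infinity>" by (simp add: emeasure_cell[OF r])
  have ind: "integrable lborel (\<lambda>y. indicator (cell r x) y * f x)"
    using fin by (intro integrable_mult_left integrable_real_indicator) auto
  have "(LINT y|lborel. indicator (cell r x) y * (f y - f x))
      = (LINT y|lborel. indicator (cell r x) y * f y) - (LINT y|lborel. indicator (cell r x) y * f x)"
    using integrable_cell[OF f, of r x] ind by (simp add: right_diff_distrib)
  also have "(LINT y|lborel. indicator (cell r x) y * f x) = r ^ 3 * f x"
    using fin r by (simp add: measure_def emeasure_cell[OF r])
  finally have eq: "f x - cell_avg r f x = - (LINT y|lborel. indicator (cell r x) y * (f y - f x)) / r ^ 3"
    using r unfolding cell_avg_def by (simp add: diff_divide_distrib)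
  have i: "integrable lborel (\<lambda>y. indicator (cell r x) y * (f y - f x))"
    using integrable_cell[OF f, of r x] ind by (simp add: right_diff_distrib)
  let ?I = "\<integral>\<^sup>+y. indicator (cell r x) y * ennreal \<bar>f y - f x\<bar> \<partial>lborel"
  let ?J = "\<integral>\<^sup>+y. indicator (cell r x) y * ennreal ((f y - f x)\<^sup>2) \<partial>lborel"
  have "ennreal \<bar>f x - cell_avg r f x\<bar>
      = ennreal (1 / r ^ 3) * ennreal (norm (LINT y|lborel. indicator (cell r x) y * (f y - f x)))"
    using r by (simp add: eq ennreal_mult[symmetric] abs_divide)
  also have "\<dots> \<le> ennreal (1 / r ^ 3) * (\<integral>\<^sup>+y. ennreal (norm (indicator (cell r x) y * (f y - f x))) \<partial>lborel)"
    by (intro mult_left_mono integral_norm_bound_ennreal i) simp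
  also have "(\<integral>\<^sup>+y. ennreal (norm (indicator (cell r x) y * (f y - f x))) \<partial>lborel) = ?I"
    by (intro nn_integral_cong) (auto simp: indicator_def)
  finally have 1: "ennreal \<bar>f x - cell_avg r f x\<bar> \<le> ennreal (1 / r ^ 3) * ?I" .
  have "?I\<^sup>2 \<le> (\<integral>\<^sup>+y. (indicator (cell r x) y)\<^sup>2 \<partial>lborel)
      * (\<integral>\<^sup>+y. (indicator (cell r x) y * ennreal \<bar>f y - f x\<bar>)\<^sup>2 \<partial>lborel)"
  proof -
    have "?I = (\<integral>\<^sup>+y. indicator (cell r x) y * (indicator (cell r x) y * ennreal \<bar>f y - f x\<bar>) \<partial>lborel)"
      by (intro nn_integral_cong) (auto simp: indicator_def)
    then show ?thesis by (simp only:) (rule Cauchy_Schwarz_nn_integral; measurable)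
  qed
  also have "(\<integral>\<^sup>+y. (indicator (cell r x) y)\<^sup>2 \<partial>lborel) = ennreal (r ^ 3)"
  proof -
    have "(\<integral>\<^sup>+y. (indicator (cell r x) y :: ennreal)\<^sup>2 \<partial>lborel) = (\<integral>\<^sup>+y. indicator (cell r x) y \<partial>lborel)"
      by (intro nn_integral_cong) (auto simp: indicator_def)
    then show ?thesis by (simp add: emeasure_cell[OF r])
  qed
  also have "(\<integral>\<^sup>+y. (indicator (cell r x) y * ennreal \<bar>f y - f x\<bar>)\<^sup>2 \<partial>lborel) = ?J"
    by (intro nn_integral_cong) (auto simp: indicator_def ennreal_power)
  finally have 2: "?I\<^sup>2 \<le> ennreal (r ^ 3) * ?J" .
  have "ennreal ((f x - cell_avg r f x)\<^sup>2) = (ennreal \<bar>f x - cell_avg r f x\<bar>)\<^sup>2"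
    by (simp add: ennreal_power)
  also have "\<dots> \<le> (ennreal (1 / r ^ 3) * ?I)\<^sup>2" by (intro power_mono 1) simp
  also have "\<dots> = ennreal (1 / r ^ 3) * (ennreal (1 / r ^ 3) * ?I\<^sup>2)"
    by (simp add: power2_eq_square mult_ac)
  also have "\<dots> \<le> ennreal (1 / r ^ 3) * (ennreal (1 / r ^ 3) * (ennreal (r ^ 3) * ?J))"
    by (intro mult_left_mono 2) auto
  also have "ennreal (1 / r ^ 3) * (ennreal (r ^ 3) * ?J) = ?J"
    using r by (simp add: mult.assoc[symmetric] ennreal_mult[symmetric])
  finally show ?thesis .
qed

text \<open>The average over the cell of \<open>x\<close> is enlarged to all shifts \<open>h\<close>
  in a cube of half side \<open>r\<close>, whose volume is \<open>8 * r ^ 3\<close>. There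
  \<open>(norm h)\<^sup>2 \<le> 3 * r\<^sup>2\<close>, so the translation estimate costs
  \<open>6 * r\<^sup>2\<close>; dividing by \<open>r ^ 3\<close> leaves the constant 48.\<close>

lemma H1_poincare:
  assumes u: "H1 u G" and r: "r > 0"
  shows "L2n (\<lambda>x. u x - cell_avg r u x) \<le> ennreal (48 * r\<^sup>2) * L2n G"
proof -
  note [measurable] = H1_measurable[OF u]
  let ?Q = "cbox (\<chi> i. - r) (\<chi> i. r) :: (real^3) set"
  have Q: "norm h \<le> sqrt 3 * r" "(norm h)\<^sup>2 \<le> 3 * r\<^sup>2" if "h \<in> ?Q" for h
  proof -
    have c: "(h $ i)\<^sup>2 \<le> r\<^sup>2" for i
      using that by (intro power2_le_iff_abs_le[THEN iffD2]) (use r in \<open>auto simp: mem_box_cart abs_le_iff minus_le_iff\<close>)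
    have "(norm h)\<^sup>2 = (\<Sum>i\<in>UNIV. (h $ i)\<^sup>2)"
      by (simp add: norm_vec_def L2_set_def sum_nonneg)
    also have "\<dots> \<le> (\<Sum>i\<in>(UNIV::3 set). r\<^sup>2)" by (intro sum_mono c)
    finally show "(norm h)\<^sup>2 \<le> 3 * r\<^sup>2" by simp
    then have "norm h \<le> sqrt (3 * r\<^sup>2)" by (rule real_le_rsqrt)
    then show "norm h \<le> sqrt 3 * r" using r by (simp add: real_sqrt_mult)
  qed
  have vol: "emeasure lborel ?Q = ennreal ((2 * r) ^ 3)"
    using r by (subst emeasure_cbox_cart) (auto simp: minus_le_iff)
  have "L2n (\<lambda>x. u x - cell_avg r u x)
      \<le> (\<integral>\<^sup>+x. ennreal (1 / r ^ 3) * (\<integral>\<^sup>+h. indicator ?Q h * ennreal ((u (x + h) - u x)\<^sup>2) \<partial>lborel) \<partial>lborel)"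
  proof (intro nn_integral_mono)
    fix x
    have "ennreal ((norm (u x - cell_avg r u x))\<^sup>2)
        \<le> ennreal (1 / r ^ 3) * (\<integral>\<^sup>+y. indicator (cell r x) y * ennreal ((u y - u x)\<^sup>2) \<partial>lborel)"
      using cell_avg_deviation[OF r H1_integrable[OF u]] by simp
    also have "(\<integral>\<^sup>+y. indicator (cell r x) y * ennreal ((u y - u x)\<^sup>2) \<partial>lborel)
        = (\<integral>\<^sup>+h. indicator (cell r x) (h + x) * ennreal ((u (h + x) - u x)\<^sup>2) \<partial>lborel)"
      by (rule nn_integral_lborel_translate[symmetric]) measurable
    also have "\<dots> \<le> (\<integral>\<^sup>+h. indicator ?Q h * ennreal ((u (x + h) - u x)\<^sup>2) \<partial>lborel)"
      using cell_diff[OF r, of _ x] by (intro nn_integral_mono) (force simp: indicator_def add.commute)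
    finally show "ennreal ((norm (u x - cell_avg r u x))\<^sup>2)
        \<le> ennreal (1 / r ^ 3) * (\<integral>\<^sup>+h. indicator ?Q h * ennreal ((u (x + h) - u x)\<^sup>2) \<partial>lborel)"
      by (simp add: mult_left_mono)
  qed
  also have "\<dots> = ennreal (1 / r ^ 3) * (\<integral>\<^sup>+x. (\<integral>\<^sup>+h. indicator ?Q h * ennreal ((u (x + h) - u x)\<^sup>2) \<partial>lborel) \<partial>lborel)"
    by (rule nn_integral_cmult) measurable
  also have "(\<integral>\<^sup>+x. (\<integral>\<^sup>+h. indicator ?Q h * ennreal ((u (x + h) - u x)\<^sup>2) \<partial>lborel) \<partial>lborel)
      = (\<integral>\<^sup>+h. (\<integral>\<^sup>+x. indicator ?Q h * ennreal ((u (x + h) - u x)\<^sup>2) \<partial>lborel) \<partial>lborel)"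
    by (rule lborel_pair.Fubini') measurable
  also have "\<dots> \<le> (\<integral>\<^sup>+h. (ennreal (6 * r\<^sup>2) * L2n G) * indicator ?Q h \<partial>lborel)"
  proof (intro nn_integral_mono)
    fix h
    show "(\<integral>\<^sup>+x. indicator ?Q h * ennreal ((u (x + h) - u x)\<^sup>2) \<partial>lborel) \<le> (ennreal (6 * r\<^sup>2) * L2n G) * indicator ?Q h"
    proof (cases "h \<in> ?Q")
      case True
      have "L2n (\<lambda>x. u (x + h) - u x) \<le> ennreal (2 * (norm h)\<^sup>2) * L2n G"
        by (rule H1_translation_estimate[OF u])
      also have "\<dots> \<le> ennreal (6 * r\<^sup>2) * L2n G"
        using Q(2)[OF True] by (intro mult_right_mono ennreal_leI) auto
      finally show ?thesis using True by simp
    qed simp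
  qed
  also have "\<dots> = (ennreal (6 * r\<^sup>2) * L2n G) * ennreal ((2 * r) ^ 3)"
    by (subst nn_integral_cmult_indicator) (auto simp: vol)
  finally have "L2n (\<lambda>x. u x - cell_avg r u x)
      \<le> ennreal (1 / r ^ 3) * ((ennreal (6 * r\<^sup>2) * L2n G) * ennreal ((2 * r) ^ 3))"
    by (simp add: mult_left_mono)
  also have "\<dots> = (ennreal (1 / r ^ 3) * ennreal (6 * r\<^sup>2) * ennreal ((2 * r) ^ 3)) * L2n G"
    by (simp only: mult_ac)
  also have "ennreal (1 / r ^ 3) * ennreal (6 * r\<^sup>2) * ennreal ((2 * r) ^ 3) = ennreal (48 * r\<^sup>2)"
    using r by (simp add: ennreal_mult[symmetric] power_mult_distrib power_eq_if)
  finally show ?thesis .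
qed

text \<open>An L2 bound from mass and gradient, in the spirit of Nash's inequality: the gradient
  controls the deviation from averages over unit cells, and these averages are bounded pointwise by
  the mass.\<close>

lemma H1_nash:
  assumes u: "H1 u G"
  shows "L2n u \<le> 96 * L2n G + 2 * (L1n u)\<^sup>2"
proof -
  note [measurable] = H1_measurable[OF u]
  note i = H1_integrable[OF u]
  have "L2n u \<le> 2 * L2n (\<lambda>x. u x - cell_avg 1 u x) + 2 * L2n (cell_avg 1 u)"
    by (rule L2n_triangle) auto
  also have "\<dots> \<le> 2 * (ennreal 48 * L2n G) + 2 * (L1n u)\<^sup>2"
  proof (intro add_mono mult_left_mono)
    show "L2n (\<lambda>x. u x - cell_avg 1 u x) \<le> ennreal 48 * L2n G"
      using H1_poincare[OF u, of 1] by simp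
    have "L2n (cell_avg 1 u) \<le> (\<integral>\<^sup>+x. L1n u * ennreal \<bar>cell_avg 1 u x\<bar> \<partial>lborel)"
    proof (intro nn_integral_mono)
      fix x
      have "ennreal ((norm (cell_avg 1 u x))\<^sup>2) = ennreal \<bar>cell_avg 1 u x\<bar> * ennreal \<bar>cell_avg 1 u x\<bar>"
        by (simp add: ennreal_mult[symmetric] power2_eq_square)
      also have "\<dots> \<le> L1n u * ennreal \<bar>cell_avg 1 u x\<bar>"
        using cell_avg_le_L1n[OF _ i, of 1 x] by (intro mult_right_mono) auto
      finally show "ennreal ((norm (cell_avg 1 u x))\<^sup>2) \<le> L1n u * ennreal \<bar>cell_avg 1 u x\<bar>" .
    qed
    also have "\<dots> = L1n u * L1n (cell_avg 1 u)" by (rule nn_integral_cmult) measurable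
    also have "\<dots> \<le> L1n u * L1n u" by (intro mult_left_mono L1n_cell_avg_le i) auto
    finally show "L2n (cell_avg 1 u) \<le> (L1n u)\<^sup>2" by (simp add: power2_eq_square)
  qed auto
  also have "2 * (ennreal 48 * L2n G) = 96 * L2n G"
    by (simp add: mult.assoc[symmetric] ennreal_numeral[symmetric] ennreal_mult[symmetric] del: ennreal_numeral)
  finally show ?thesis .
qed

text \<open>The product rule contains \<open>u x *\<^sub>R grad \<eta> x\<close>, so convergence in
  mean is too weak; \<open>H1_nash\<close> upgrades it to square mean.\<close>

lemma H1_mult_smooth:
  assumes u: "H1 u G" and \<eta>: "smooth \<eta>" and b: "\<And>x. \<bar>\<eta> x\<bar> \<le> b" "\<And>x. norm (grad \<eta> x) \<le> b"
  shows "H1 (\<lambda>x. \<eta> x * u x) (\<lambda>x. \<eta> x *\<^sub>R G x + u x *\<^sub>R grad \<eta> x)"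
proof -
  note [measurable] = H1_measurable[OF u]
  have b0: "b \<ge> 0" using b(1)[of 0] by linarith
  have [measurable]: "\<eta> \<in> borel_measurable borel" "grad \<eta> \<in> borel_measurable borel"
    using \<eta> by (auto intro!: borel_measurable_continuous_onI smooth_continuous_on smooth_continuous_on_grad)
  obtain \<phi> where \<phi>: "\<And>n. \<phi> n \<in> Cc_infinity" "(\<lambda>n. L1n (\<lambda>x. u x - \<phi> n x)) \<longlonglongrightarrow> 0"
    "(\<lambda>n. L2n (\<lambda>x. G x - grad (\<phi> n) x)) \<longlonglongrightarrow> 0" using H1_seq[OF u] by blast
  note [measurable] = Cc_infinity_measurable[OF \<phi>(1)]
  have l2: "(\<lambda>n. L2n (\<lambda>x. u x - \<phi> n x)) \<longlonglongrightarrow> 0"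
  proof (rule tendsto_sandwich[OF always_eventually always_eventually tendsto_const])
    show "\<forall>n. L2n (\<lambda>x. u x - \<phi> n x) \<le> 96 * L2n (\<lambda>x. G x - grad (\<phi> n) x) + 2 * (L1n (\<lambda>x. u x - \<phi> n x))\<^sup>2"
      using H1_nash[OF H1_diff[OF u H1_Cc[OF \<phi>(1)]]] by blast
    have sq: "(\<lambda>n. (L1n (\<lambda>x. u x - \<phi> n x))\<^sup>2) \<longlonglongrightarrow> 0"
      unfolding power2_eq_square using tendsto_mult_ennreal[OF \<phi>(2) \<phi>(2)] by simp
    show "(\<lambda>n. 96 * L2n (\<lambda>x. G x - grad (\<phi> n) x) + 2 * (L1n (\<lambda>x. u x - \<phi> n x))\<^sup>2) \<longlonglongrightarrow> 0"
      using tendsto_add[OF ennreal_tendsto_cmult[OF _ \<phi>(3), of 96] ennreal_tendsto_cmult[OF _ sq, of 2]] by simp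
  qed simp
  show ?thesis
  proof (rule H1_closed_seq[OF H1_Cc[OF Cc_infinity_smooth_mult[OF \<phi>(1) \<eta>]]])
    show "(\<lambda>n. L1n (\<lambda>x. \<eta> x * u x - \<eta> x * \<phi> n x)) \<longlonglongrightarrow> 0"
    proof (rule tendsto_sandwich[OF always_eventually always_eventually tendsto_const])
      show "\<forall>n. L1n (\<lambda>x. \<eta> x * u x - \<eta> x * \<phi> n x) \<le> ennreal \<bar>b\<bar> * L1n (\<lambda>x. u x - \<phi> n x)"
      proof
        fix n
        have "L1n (\<lambda>x. \<eta> x * u x - \<eta> x * \<phi> n x) \<le> L1n (\<lambda>x. b * (u x - \<phi> n x))"
          using b(1) b0
          by (intro nn_integral_mono ennreal_leI) (auto simp: right_diff_distrib[symmetric] abs_mult intro: mult_right_mono)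
        then show "L1n (\<lambda>x. \<eta> x * u x - \<eta> x * \<phi> n x) \<le> ennreal \<bar>b\<bar> * L1n (\<lambda>x. u x - \<phi> n x)"
          by (simp add: L1n_cmult)
      qed
      show "(\<lambda>n. ennreal \<bar>b\<bar> * L1n (\<lambda>x. u x - \<phi> n x)) \<longlonglongrightarrow> 0"
        using ennreal_tendsto_cmult[OF _ \<phi>(2), of "ennreal \<bar>b\<bar>"] by simp
    qed simp
    have g: "grad (\<lambda>x. \<eta> x * \<phi> n x) x = \<eta> x *\<^sub>R grad (\<phi> n) x + \<phi> n x *\<^sub>R grad \<eta> x" for n x
      by (rule grad_mult) (auto simp: smooth_differentiable Cc_infinityD[OF \<phi>(1)] \<eta>)
    show "(\<lambda>n. L2n (\<lambda>x. \<eta> x *\<^sub>R G x + u x *\<^sub>R grad \<eta> x - grad (\<lambda>x. \<eta> x * \<phi> n x) x)) \<longlonglongrightarrow> 0"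
    proof (rule tendsto_sandwich[OF always_eventually always_eventually tendsto_const])
      show "\<forall>n. L2n (\<lambda>x. \<eta> x *\<^sub>R G x + u x *\<^sub>R grad \<eta> x - grad (\<lambda>x. \<eta> x * \<phi> n x) x)
        \<le> 2 * (ennreal (b\<^sup>2) * L2n (\<lambda>x. G x - grad (\<phi> n) x)) + 2 * (ennreal (b\<^sup>2) * L2n (\<lambda>x. u x - \<phi> n x))"
      proof
        fix n
        \<comment> \<open>The unit vector \<open>axis 1 1\<close> turns the scalar bound into a
          vector field, since both summands in \<open>L2n_triangle\<close> have the same
          type.\<close>
        have "L2n (\<lambda>x. \<eta> x *\<^sub>R G x + u x *\<^sub>R grad \<eta> x - grad (\<lambda>x. \<eta> x * \<phi> n x) x)
            \<le> 2 * L2n (\<lambda>x. b *\<^sub>R (G x - grad (\<phi> n) x)) + 2 * L2n (\<lambda>x. b *\<^sub>R (u x - \<phi> n x) *\<^sub>R (axis 1 1 :: real^3))"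
        proof (rule L2n_triangle)
          fix x
          have "norm (\<eta> x *\<^sub>R G x + u x *\<^sub>R grad \<eta> x - grad (\<lambda>x. \<eta> x * \<phi> n x) x)
              = norm (\<eta> x *\<^sub>R (G x - grad (\<phi> n) x) + (u x - \<phi> n x) *\<^sub>R grad \<eta> x)"
            by (simp add: g algebra_simps)
          also have "\<dots> \<le> \<bar>\<eta> x\<bar> * norm (G x - grad (\<phi> n) x) + \<bar>u x - \<phi> n x\<bar> * norm (grad \<eta> x)"
            by (rule order_trans[OF norm_triangle_ineq]) simp
          also have "\<dots> \<le> b * norm (G x - grad (\<phi> n) x) + \<bar>u x - \<phi> n x\<bar> * b"
            by (intro add_mono mult_mono b) (auto simp: b0)
          finally show "norm (\<eta> x *\<^sub>R G x + u x *\<^sub>R grad \<eta> x - grad (\<lambda>x. \<eta> x * \<phi> n x) x)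
              \<le> norm (b *\<^sub>R (G x - grad (\<phi> n) x)) + norm (b *\<^sub>R (u x - \<phi> n x) *\<^sub>R (axis 1 1 :: real^3))"
            using b0 by (simp add: mult.commute)
        qed measurable
        also have "L2n (\<lambda>x. b *\<^sub>R (u x - \<phi> n x) *\<^sub>R (axis 1 1 :: real^3)) = L2n (\<lambda>x. b *\<^sub>R (u x - \<phi> n x))"
          by simp
        finally show "L2n (\<lambda>x. \<eta> x *\<^sub>R G x + u x *\<^sub>R grad \<eta> x - grad (\<lambda>x. \<eta> x * \<phi> n x) x)
            \<le> 2 * (ennreal (b\<^sup>2) * L2n (\<lambda>x. G x - grad (\<phi> n) x)) + 2 * (ennreal (b\<^sup>2) * L2n (\<lambda>x. u x - \<phi> n x))"
          using L2n_cmult[of "\<lambda>x. G x - grad (\<phi> n) x" b] L2n_cmult[of "\<lambda>x. u x - \<phi> n x" b] by simp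
      qed
      have "(\<lambda>n. 2 * (ennreal (b\<^sup>2) * L2n (\<lambda>x. G x - grad (\<phi> n) x))) \<longlonglongrightarrow> 2 * (ennreal (b\<^sup>2) * 0)"
        by (intro ennreal_tendsto_cmult \<phi>) auto
      moreover have "(\<lambda>n. 2 * (ennreal (b\<^sup>2) * L2n (\<lambda>x. u x - \<phi> n x))) \<longlonglongrightarrow> 2 * (ennreal (b\<^sup>2) * 0)"
        by (intro ennreal_tendsto_cmult l2) auto
      ultimately show "(\<lambda>n. 2 * (ennreal (b\<^sup>2) * L2n (\<lambda>x. G x - grad (\<phi> n) x))
          + 2 * (ennreal (b\<^sup>2) * L2n (\<lambda>x. u x - \<phi> n x))) \<longlonglongrightarrow> 0"
        using tendsto_add by fastforce
    qed simp
  qed measurable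
qed

subsection \<open>Compactness\<close>

lemma tendsto_0_if_eventually_le:
  fixes f :: "'a \<Rightarrow> ennreal"
  assumes "\<And>\<epsilon>::real. \<epsilon> > 0 \<Longrightarrow> eventually (\<lambda>n. f n \<le> ennreal \<epsilon>) F"
  shows "(f \<longlongrightarrow> 0) F"
proof (rule order_tendstoI)
  fix a :: ennreal assume "0 < a"
  then obtain b where b: "0 < b" "b < a" using dense by blast
  then have "b \<noteq> top" by auto
  then obtain e where e: "b = ennreal e" "e \<ge> 0" by (cases b) auto
  with b have "e > 0" by auto
  from assms[OF this] show "eventually (\<lambda>n. f n < a) F"
    by (rule eventually_mono) (use b e in auto)
qed simp

text \<open>Riesz-Fischer on all balls at once: the index \<open>r N\<close> is taken so late that
  later differences are at most \<open>(1/2) ^ N\<close> on the ball of radius \<open>N\<close>, so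
  one subsequence has summable increments on every ball.\<close>

lemma local_L1_complete:
  fixes v :: "nat \<Rightarrow> real^3 \<Rightarrow> 'b::euclidean_space"
  assumes [measurable]: "\<And>n. v n \<in> borel_measurable borel"
    and cauchy: "\<And>N \<epsilon>. \<epsilon> > 0 \<Longrightarrow> \<exists>n0. \<forall>n\<ge>n0. \<forall>m\<ge>n0.
      (\<integral>\<^sup>+x. indicator (ball 0 (real N)) x * ennreal (norm (v n x - v m x)) \<partial>lborel) \<le> ennreal \<epsilon>"
  obtains r u where "strict_mono r" "u \<in> borel_measurable borel"
    "AE x in lborel. (\<lambda>n. v (r n) x) \<longlonglongrightarrow> u x"
    "\<forall>N. (\<lambda>n. \<integral>\<^sup>+x. indicator (ball 0 (real N)) x * ennreal (norm (v n x - u x)) \<partial>lborel) \<longlonglongrightarrow> 0"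
proof -
  have [measurable]: "ball (0::real^3) (real N) \<in> sets borel" for N by simp
  let ?d = "\<lambda>N n m. \<integral>\<^sup>+x. indicator (ball 0 (real N)) x * ennreal (norm (v n x - v m x)) \<partial>lborel"
  have "\<forall>N. \<exists>n0. \<forall>n\<ge>n0. \<forall>m\<ge>n0. ?d N n m \<le> ennreal ((1/2) ^ N)" by (intro allI cauchy) simp
  from choice[OF this] obtain n0 where "\<forall>N. \<forall>n\<ge>n0 N. \<forall>m\<ge>n0 N. ?d N n m \<le> ennreal ((1/2) ^ N)" ..
  then have n0: "?d N n m \<le> ennreal ((1/2) ^ N)" if "n \<ge> n0 N" "m \<ge> n0 N" for N n m using that by simp
  define r where "r = rec_nat (n0 0) (\<lambda>N p. Suc (max p (n0 (Suc N))))"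
  have rS: "r (Suc N) = Suc (max (r N) (n0 (Suc N)))" for N by (simp add: r_def)
  have r: "strict_mono r" by (rule strict_mono_Suc_iff[THEN iffD2]) (simp add: rS less_Suc_eq_le)
  have rn: "n0 N \<le> r N" for N by (cases N) (auto simp: rS r_def le_SucI)
  have dr: "?d N (r k) (r (Suc k)) \<le> ennreal ((1/2) ^ k)" if "N \<le> k" for N k
  proof -
    have "?d N (r k) (r (Suc k)) \<le> ?d k (r k) (r (Suc k))"
      using that by (intro nn_integral_mono) (auto simp: indicator_def)
    also have "\<dots> \<le> ennreal ((1/2) ^ k)"
      using rn[of k] r[THEN strict_monoD, of k "Suc k"] by (intro n0) auto
    finally show ?thesis .
  qed
  have cv: "AE x in lborel. x \<in> ball 0 (real N) \<longrightarrow> convergent (\<lambda>k. v (r k) x)" for N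
  proof -
    have "(\<integral>\<^sup>+x. (\<Sum>k. indicator (ball 0 (real N)) x * ennreal (norm (v (r (k + N)) x - v (r (Suc (k + N))) x))) \<partial>lborel)
      = (\<Sum>k. ?d N (r (k + N)) (r (Suc (k + N))))"
      by (rule nn_integral_suminf) measurable
    also have "\<dots> \<le> (\<Sum>k. ennreal ((1/2) ^ k))"
    proof (intro suminf_le summableI)
      fix k
      have "?d N (r (k + N)) (r (Suc (k + N))) \<le> ennreal ((1/2) ^ (k + N))" by (rule dr) simp
      also have "\<dots> \<le> ennreal ((1/2) ^ k)" by (intro ennreal_leI power_decreasing) auto
      finally show "?d N (r (k + N)) (r (Suc (k + N))) \<le> ennreal ((1/2) ^ k)" .
    qed
    also have "\<dots> < \<infinity>"
      by (subst suminf_ennreal2) (auto intro!: summable_geometric)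
    finally have "AE x in lborel. (\<Sum>k. indicator (ball 0 (real N)) x
        * ennreal (norm (v (r (k + N)) x - v (r (Suc (k + N))) x))) \<noteq> \<infinity>"
      by (intro nn_integral_PInf_AE) auto
    then show ?thesis
    proof (rule AE_mp, intro AE_I2 impI)
      fix x assume fin: "(\<Sum>k. indicator (ball 0 (real N)) x
        * ennreal (norm (v (r (k + N)) x - v (r (Suc (k + N))) x))) \<noteq> \<infinity>" and x: "x \<in> ball 0 (real N)"
      have "summable (\<lambda>k. norm (v (r (k + N)) x - v (r (Suc (k + N))) x))"
        using fin x by (intro summable_suminf_not_top) auto
      then have "summable (\<lambda>k. norm (v (r (Suc (k + N))) x - v (r (k + N)) x))"
        by (simp add: norm_minus_commute)
      then have "summable (\<lambda>k. v (r (Suc (k + N))) x - v (r (k + N)) x)" by (rule summable_norm_cancel)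
      then have "convergent (\<lambda>n. \<Sum>k<n. v (r (Suc (k + N))) x - v (r (k + N)) x)"
        by (simp add: summable_iff_convergent)
      then have "convergent (\<lambda>n. v (r (n + N)) x - v (r N) x)"
        using sum_lessThan_telescope[of "\<lambda>k. v (r (k + N)) x"] by simp
      then have "convergent (\<lambda>n. v (r (n + N)) x)"
        using convergent_diff_const_right_iff by blast
      then show "convergent (\<lambda>k. v (r k) x)"
        by (subst (asm) convergent_ignore_initial_segment)
    qed
  qed
  have cvall: "AE x in lborel. convergent (\<lambda>k. v (r k) x)"
  proof -
    have "AE x in lborel. \<forall>N. x \<in> ball 0 (real N) \<longrightarrow> convergent (\<lambda>k. v (r k) x)"
      using cv by (subst AE_all_countable) blast
    then show ?thesis
    proof (rule AE_mp, intro AE_I2 impI)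
      fix x :: "real^3" assume *: "\<forall>N. x \<in> ball 0 (real N) \<longrightarrow> convergent (\<lambda>k. v (r k) x)"
      obtain N where "norm x < real N" using reals_Archimedean2 by blast
      with * show "convergent (\<lambda>k. v (r k) x)" by auto
    qed
  qed
  \<comment> \<open>The default 0 off the set of convergence keeps the limit measurable.\<close>
  define u where "u x = (if convergent (\<lambda>k. v (r k) x) then lim (\<lambda>k. v (r k) x) else 0)" for x
  have um [measurable]: "u \<in> borel_measurable borel"
  proof -
    have [measurable]: "Measurable.pred borel (\<lambda>x. convergent (\<lambda>k. v (r k) x))"
      unfolding Cauchy_convergent_iff[symmetric] by measurable
    have "(\<lambda>x. if convergent (\<lambda>k. v (r k) x) then v (r k) x else 0) \<in> borel_measurable borel" for k
      by measurable
    then show ?thesis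
    proof (rule borel_measurable_LIMSEQ_metric)
      show "(\<lambda>k. if convergent (\<lambda>k. v (r k) x) then v (r k) x else 0) \<longlonglongrightarrow> u x" for x
        by (auto simp: u_def convergent_LIMSEQ_iff[symmetric])
    qed
  qed
  have ae: "AE x in lborel. (\<lambda>n. v (r n) x) \<longlonglongrightarrow> u x"
    using cvall by (rule AE_mp) (auto simp: u_def convergent_LIMSEQ_iff)
  have "(\<lambda>n. \<integral>\<^sup>+x. indicator (ball 0 (real N)) x * ennreal (norm (v n x - u x)) \<partial>lborel) \<longlonglongrightarrow> 0" for N
  proof (rule tendsto_0_if_eventually_le)
    fix \<epsilon> :: real assume "\<epsilon> > 0"
    then obtain n1 where n1: "\<And>n m. n \<ge> n1 \<Longrightarrow> m \<ge> n1 \<Longrightarrow> ?d N n m \<le> ennreal \<epsilon>"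
      using cauchy by blast
    have "(\<integral>\<^sup>+x. indicator (ball 0 (real N)) x * ennreal (norm (v n x - u x)) \<partial>lborel) \<le> ennreal \<epsilon>"
      if n: "n \<ge> n1" for n
    proof -
      have "(\<integral>\<^sup>+x. indicator (ball 0 (real N)) x * ennreal (norm (v n x - u x)) \<partial>lborel)
        \<le> (\<integral>\<^sup>+x. liminf (\<lambda>k. indicator (ball 0 (real N)) x * ennreal (norm (v n x - v (r k) x))) \<partial>lborel)"
      proof (rule nn_integral_mono_AE, rule AE_mp[OF ae], intro AE_I2 impI)
        fix x assume l: "(\<lambda>n. v (r n) x) \<longlonglongrightarrow> u x"
        have "(\<lambda>k. indicator (ball 0 (real N)) x * ennreal (norm (v n x - v (r k) x)))
          \<longlonglongrightarrow> indicator (ball 0 (real N)) x * ennreal (norm (v n x - u x))"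
          by (intro ennreal_tendsto_cmult tendsto_ennrealI tendsto_norm tendsto_diff tendsto_const l)
             (simp add: indicator_def)
        from lim_imp_Liminf[OF _ this]
        show "indicator (ball 0 (real N)) x * ennreal (norm (v n x - u x))
          \<le> liminf (\<lambda>k. indicator (ball 0 (real N)) x * ennreal (norm (v n x - v (r k) x)))" by simp
      qed
      also have "\<dots> \<le> liminf (\<lambda>k. ?d N n (r k))" by (rule nn_integral_liminf) measurable
      also have "\<dots> \<le> liminf (\<lambda>k::nat. ennreal \<epsilon>)"
      proof (rule Liminf_mono)
        show "eventually (\<lambda>k. ?d N n (r k) \<le> ennreal \<epsilon>) sequentially"
          using n seq_suble[OF r] by (intro eventually_sequentiallyI[of n1] n1) (auto intro: order_trans)
      qed
      finally show ?thesis by (simp add: Liminf_const)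
    qed
    then show "eventually (\<lambda>n. (\<integral>\<^sup>+x. indicator (ball 0 (real N)) x * ennreal (norm (v n x - u x)) \<partial>lborel) \<le> ennreal \<epsilon>) sequentially"
      by (rule eventually_sequentiallyI)
  qed
  then show ?thesis by (intro that[OF r um ae] allI)
qed

text \<open>Square mean controls the local mean at the price of a volume term, which
  \<open>\<delta>\<close> can make small.\<close>

lemma local_L1_le_L2n:
  fixes f :: "real^3 \<Rightarrow> 'b::euclidean_space"
  assumes [measurable]: "f \<in> borel_measurable borel" "B \<in> sets borel" and \<delta>: "\<delta> > 0"
  shows "(\<integral>\<^sup>+x. indicator B x * ennreal (norm (f x)) \<partial>lborel)
    \<le> ennreal \<delta> * emeasure lborel B + ennreal (1 / \<delta>) * L2n f"
proof -
  have "norm (f x) \<le> \<delta> + 1 / \<delta> * (norm (f x))\<^sup>2" for x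
  proof -
    have "0 \<le> norm (f x) * \<delta>" using \<delta> by simp
    moreover have "2 * (norm (f x) * \<delta>) \<le> (norm (f x))\<^sup>2 + \<delta>\<^sup>2"
      using sum_squares_bound[of "norm (f x)" \<delta>] by (simp only: mult.assoc)
    ultimately have "norm (f x) * \<delta> \<le> \<delta>\<^sup>2 + (norm (f x))\<^sup>2" by linarith
    then show ?thesis using \<delta> by (simp add: field_simps power2_eq_square)
  qed
  then have "(\<integral>\<^sup>+x. indicator B x * ennreal (norm (f x)) \<partial>lborel)
      \<le> (\<integral>\<^sup>+x. ennreal \<delta> * indicator B x + ennreal (1 / \<delta>) * ennreal ((norm (f x))\<^sup>2) \<partial>lborel)"
    using \<delta> by (intro nn_integral_mono)
      (auto simp: indicator_def ennreal_mult[symmetric] ennreal_plus[symmetric] simp del: ennreal_plus intro!: ennreal_leI)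
  also have "\<dots> = ennreal \<delta> * emeasure lborel B + ennreal (1 / \<delta>) * L2n f"
    by (subst nn_integral_add) (auto simp: nn_integral_cmult)
  finally show ?thesis .
qed

lemma emeasure_lborel_ball_real:
  "emeasure lborel (ball (a::real^3) r) = ennreal (measure lborel (ball a r))"
  using emeasure_lborel_ball_finite[of a r] by (simp add: emeasure_eq_ennreal_measure less_top)

lemma L2n_complete:
  fixes H :: "nat \<Rightarrow> real^3 \<Rightarrow> 'b::euclidean_space"
  assumes [measurable]: "\<And>n. H n \<in> borel_measurable borel"
    and cauchy: "\<And>\<epsilon>. \<epsilon> > 0 \<Longrightarrow> \<exists>n0. \<forall>n\<ge>n0. \<forall>m\<ge>n0. L2n (\<lambda>x. H n x - H m x) \<le> ennreal \<epsilon>"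
  obtains G r where "G \<in> borel_measurable borel" "strict_mono r"
    "AE x in lborel. (\<lambda>n. H (r n) x) \<longlonglongrightarrow> G x" "(\<lambda>n. L2n (\<lambda>x. G x - H n x)) \<longlonglongrightarrow> 0"
proof -
  have "\<exists>n0. \<forall>n\<ge>n0. \<forall>m\<ge>n0.
      (\<integral>\<^sup>+x. indicator (ball 0 (real N)) x * ennreal (norm (H n x - H m x)) \<partial>lborel) \<le> ennreal \<epsilon>"
    if e: "\<epsilon> > 0" for N \<epsilon>
  proof -
    define b where "b = measure lborel (ball (0::real^3) (real N))"
    have b: "b \<ge> 0" by (simp add: b_def)
    \<comment> \<open>The volume term becomes at most \<open>\<epsilon> / 2\<close>, and the summand
      1 covers \<open>b = 0\<close>. The bound \<open>\<delta> * \<epsilon> / 2\<close> required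
      next makes the other term \<open>\<epsilon> / 2\<close> as well.\<close>
    define \<delta> where "\<delta> = \<epsilon> / (2 * (b + 1))"
    have \<delta>: "\<delta> > 0" "\<delta> * b \<le> \<epsilon> / 2" using e b by (auto simp: \<delta>_def field_simps)
    obtain n0 where n0: "\<And>n m. n \<ge> n0 \<Longrightarrow> m \<ge> n0 \<Longrightarrow> L2n (\<lambda>x. H n x - H m x) \<le> ennreal (\<delta> * \<epsilon> / 2)"
      using cauchy[of "\<delta> * \<epsilon> / 2"] e \<delta> by auto
    have "(\<integral>\<^sup>+x. indicator (ball 0 (real N)) x * ennreal (norm (H n x - H m x)) \<partial>lborel) \<le> ennreal \<epsilon>"
      if nm: "n \<ge> n0" "m \<ge> n0" for n m
    proof -
      have "(\<integral>\<^sup>+x. indicator (ball 0 (real N)) x * ennreal (norm (H n x - H m x)) \<partial>lborel)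
        \<le> ennreal \<delta> * ennreal b + ennreal (1 / \<delta>) * L2n (\<lambda>x. H n x - H m x)"
        unfolding b_def emeasure_lborel_ball_real[symmetric] by (rule local_L1_le_L2n) (auto simp: \<delta>)
      also have "\<dots> \<le> ennreal \<delta> * ennreal b + ennreal (1 / \<delta>) * ennreal (\<delta> * \<epsilon> / 2)"
        by (intro add_mono mult_left_mono n0 nm) auto
      also have "\<dots> = ennreal (\<delta> * b + \<epsilon> / 2)"
        using \<delta> b e by (simp add: ennreal_mult[symmetric] ennreal_plus[symmetric] del: ennreal_plus)
      also have "\<dots> \<le> ennreal \<epsilon>" using \<delta> by (intro ennreal_leI) simp
      finally show ?thesis .
    qed
    then show ?thesis by blast
  qed
  then obtain r G where r: "strict_mono r" and [measurable]: "G \<in> borel_measurable borel"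
    and ae: "AE x in lborel. (\<lambda>n. H (r n) x) \<longlonglongrightarrow> G x"
    and "\<forall>N. (\<lambda>n. \<integral>\<^sup>+x. indicator (ball 0 (real N)) x * ennreal (norm (H n x - G x)) \<partial>lborel) \<longlonglongrightarrow> 0"
    by (rule local_L1_complete[of H, OF assms(1)])
  have l2: "(\<lambda>n. L2n (\<lambda>x. G x - H n x)) \<longlonglongrightarrow> 0"
  proof (rule tendsto_0_if_eventually_le)
    fix \<epsilon> :: real assume "\<epsilon> > 0"
    then obtain n0 where n0: "\<And>n m. n \<ge> n0 \<Longrightarrow> m \<ge> n0 \<Longrightarrow> L2n (\<lambda>x. H n x - H m x) \<le> ennreal \<epsilon>"
      using cauchy by blast
    have "L2n (\<lambda>x. G x - H n x) \<le> ennreal \<epsilon>" if n: "n \<ge> n0" for n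
    proof -
      have "L2n (\<lambda>x. G x - H n x) \<le> (\<integral>\<^sup>+x. liminf (\<lambda>k. ennreal ((norm (H (r k) x - H n x))\<^sup>2)) \<partial>lborel)"
      proof (rule nn_integral_mono_AE, rule AE_mp[OF ae], intro AE_I2 impI)
        fix x assume l: "(\<lambda>n. H (r n) x) \<longlonglongrightarrow> G x"
        have "(\<lambda>k. ennreal ((norm (H (r k) x - H n x))\<^sup>2)) \<longlonglongrightarrow> ennreal ((norm (G x - H n x))\<^sup>2)"
          by (intro tendsto_intros l)
        from lim_imp_Liminf[OF _ this]
        show "ennreal ((norm (G x - H n x))\<^sup>2) \<le> liminf (\<lambda>k. ennreal ((norm (H (r k) x - H n x))\<^sup>2))" by simp
      qed
      also have "\<dots> \<le> liminf (\<lambda>k. L2n (\<lambda>x. H (r k) x - H n x))" by (rule nn_integral_liminf) measurable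
      also have "\<dots> \<le> liminf (\<lambda>k::nat. ennreal \<epsilon>)"
      proof (rule Liminf_mono)
        show "eventually (\<lambda>k. L2n (\<lambda>x. H (r k) x - H n x) \<le> ennreal \<epsilon>) sequentially"
          using n seq_suble[OF r] by (intro eventually_sequentiallyI[of n0] n0) (auto intro: order_trans)
      qed
      finally show ?thesis by (simp add: Liminf_const)
    qed
    then show "eventually (\<lambda>n. L2n (\<lambda>x. G x - H n x) \<le> ennreal \<epsilon>) sequentially"
      by (rule eventually_sequentiallyI)
  qed
  show ?thesis by (rule that[OF _ r ae l2]) measurable
qed

lemma cell_avg_diff:
  assumes "integrable lborel f" "integrable lborel g"
  shows "cell_avg r (\<lambda>x. f x - g x) x = cell_avg r f x - cell_avg r g x"
  using integrable_cell[OF assms(1), of r x] integrable_cell[OF assms(2), of r x]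
  by (simp add: cell_avg_def right_diff_distrib diff_divide_distrib)

text \<open>Over all scales \<open>1 / 2 ^ j\<close> there are only countably many cells, indexed by
  \<open>j\<close> and three integers, and the integrals over them are bounded by \<open>A\<close>;
  a diagonal argument gives one subsequence for all of them.\<close>

lemma cell_avg_subsequence:
  fixes f :: "nat \<Rightarrow> real^3 \<Rightarrow> real"
  assumes f: "\<And>n. integrable lborel (f n)" and A: "\<And>n. L1n (f n) \<le> ennreal A" "A \<ge> 0"
  obtains k where "strict_mono (k::nat \<Rightarrow> nat)"
    "\<forall>j x. convergent (\<lambda>n. cell_avg (1 / 2 ^ j) (f (k n)) x)"
proof -
  define I :: "nat \<times> int \<times> int \<times> int \<Rightarrow> (real^3) set" where
    "I = (\<lambda>(j, a, b, c). {y. \<lfloor>y $ 1 / (1 / 2 ^ j)\<rfloor> = a \<and> \<lfloor>y $ 2 / (1 / 2 ^ j)\<rfloor> = b \<and> \<lfloor>y $ 3 / (1 / 2 ^ j)\<rfloor> = c})"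
  have cell: "cell (1 / 2 ^ j) x = I (j, \<lfloor>x $ 1 / (1 / 2 ^ j)\<rfloor>, \<lfloor>x $ 2 / (1 / 2 ^ j)\<rfloor>, \<lfloor>x $ 3 / (1 / 2 ^ j)\<rfloor>)" for j x
    by (simp add: cell_def I_def forall_3)
  have [measurable]: "I p \<in> sets borel" for p
    by (cases p) (simp add: I_def)
  have bd: "norm (LINT y|lborel. indicator (I p) y * f n y) \<le> A" for n p
  proof -
    have "ennreal (norm (LINT y|lborel. indicator (I p) y * f n y))
        \<le> (\<integral>\<^sup>+y. ennreal (norm (indicator (I p) y * f n y)) \<partial>lborel)"
      using integrable_mult_indicator[of "I p" lborel "f n"] f by (intro integral_norm_bound_ennreal) simp
    also have "\<dots> \<le> L1n (f n)" by (intro nn_integral_mono) (auto simp: indicator_def)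
    also have "\<dots> \<le> ennreal A" by (rule A)
    finally show ?thesis using A(2) by (simp add: ennreal_le_iff)
  qed
  obtain k where k: "strict_mono k"
    and l: "\<And>p. p \<in> UNIV \<Longrightarrow> \<exists>l. (\<lambda>n. LINT y|lborel. indicator (I p) y * f (k n) y) \<longlonglongrightarrow> l"
    using function_convergent_subsequence[of UNIV "\<lambda>n p. LINT y|lborel. indicator (I p) y * f n y" A, OF _ bd]
    by auto
  have "convergent (\<lambda>n. cell_avg (1 / 2 ^ j) (f (k n)) x)" for j x
  proof -
    obtain L where "(\<lambda>n. LINT y|lborel. indicator (cell (1 / 2 ^ j) x) y * f (k n) y) \<longlonglongrightarrow> L"
      unfolding cell using l[OF UNIV_I] by blast
    then have "(\<lambda>n. cell_avg (1 / 2 ^ j) (f (k n)) x) \<longlonglongrightarrow> L / (1 / 2 ^ j) ^ 3"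
      unfolding cell_avg_def by (intro tendsto_divide tendsto_const) auto
    then show ?thesis by (rule convergentI)
  qed
  then show ?thesis by (intro that[OF k] allI)
qed

lemma local_L1_triangle:
  fixes f g h :: "real^3 \<Rightarrow> real"
  assumes [measurable]: "f \<in> borel_measurable borel" "g \<in> borel_measurable borel" "B \<in> sets borel"
    and le: "\<And>x. \<bar>h x\<bar> \<le> \<bar>f x\<bar> + \<bar>g x\<bar>"
  shows "(\<integral>\<^sup>+x. indicator B x * ennreal \<bar>h x\<bar> \<partial>lborel)
    \<le> (\<integral>\<^sup>+x. indicator B x * ennreal \<bar>f x\<bar> \<partial>lborel) + (\<integral>\<^sup>+x. indicator B x * ennreal \<bar>g x\<bar> \<partial>lborel)"
proof -
  have "(\<integral>\<^sup>+x. indicator B x * ennreal \<bar>h x\<bar> \<partial>lborel)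
      \<le> (\<integral>\<^sup>+x. indicator B x * ennreal \<bar>f x\<bar> + indicator B x * ennreal \<bar>g x\<bar> \<partial>lborel)"
    using le by (intro nn_integral_mono) (auto simp: indicator_def ennreal_plus[symmetric] simp del: ennreal_plus intro!: ennreal_leI)
  also have "\<dots> = (\<integral>\<^sup>+x. indicator B x * ennreal \<bar>f x\<bar> \<partial>lborel) + (\<integral>\<^sup>+x. indicator B x * ennreal \<bar>g x\<bar> \<partial>lborel)"
    by (rule nn_integral_add) measurable
  finally show ?thesis .
qed

text \<open>Rellich's theorem through grid averages: at a fine scale \<open>H1_poincare\<close>
  makes the averages close to the functions uniformly in \<open>n\<close>, and along the subsequence
  the averages converge boundedly at every point.\<close>

lemma H1_rellich:
  fixes u :: "nat \<Rightarrow> real^3 \<Rightarrow> real" and G :: "nat \<Rightarrow> real^3 \<Rightarrow> real^3"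
  assumes u: "\<And>n. H1 (u n) (G n)" and A: "\<And>n. L1n (u n) \<le> ennreal A" "A \<ge> 0"
    and B: "\<And>n. L2n (G n) \<le> ennreal B" "B \<ge> 0"
  obtains r w where "strict_mono r" "w \<in> borel_measurable borel"
    "AE x in lborel. (\<lambda>n. u (r n) x) \<longlonglongrightarrow> w x"
    "\<forall>N. (\<lambda>n. \<integral>\<^sup>+x. indicator (ball 0 (real N)) x * ennreal (norm (u (r n) x - w x)) \<partial>lborel) \<longlonglongrightarrow> 0"
proof -
  note [measurable] = H1_measurable[OF u]
  have [measurable]: "ball (0::real^3) (real N) \<in> sets borel" for N by simp
  note iu = H1_integrable[OF u]
  obtain k where k: "strict_mono (k::nat \<Rightarrow> nat)"
    and cv: "\<forall>j x. convergent (\<lambda>n. cell_avg (1 / 2 ^ j) (u (k n)) x)"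
    by (rule cell_avg_subsequence[OF iu A])
  define v where "v n = u (k n)" for n
  have [measurable]: "v n \<in> borel_measurable borel" for n by (simp add: v_def)
  have "\<exists>n0. \<forall>n\<ge>n0. \<forall>m\<ge>n0.
      (\<integral>\<^sup>+x. indicator (ball 0 (real N)) x * ennreal (norm (v n x - v m x)) \<partial>lborel) \<le> ennreal \<epsilon>"
    if e: "\<epsilon> > 0" for N \<epsilon>
  proof -
    define b where "b = measure lborel (ball (0::real^3) (real N))"
    have b: "b \<ge> 0" by (simp add: b_def)
    \<comment> \<open>The gradient of a difference has \<open>L2n\<close> at most
      \<open>4 * B\<close>, and \<open>48 * 4 = 192\<close>; the volume term and the Poincare term
      are then together at most \<open>r * c\<close>.\<close>
    define c where "c = b + 192 * B + 1"
    have c: "c > 0" using b B by (simp add: c_def)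
    obtain j where j: "(1/2) ^ j < \<epsilon> / (2 * c)"
      using real_arch_pow_inv[of "\<epsilon> / (2 * c)" "1/2"] e c by auto
    define r where "r = (1 / 2 ^ j :: real)"
    have r: "r > 0" "r * c \<le> \<epsilon> / 2" using j c by (auto simp: r_def power_one_over field_simps)
    define p where "p x = lim (\<lambda>n. cell_avg r (v n) x)" for x
    have lim: "(\<lambda>n. cell_avg r (v n) x) \<longlonglongrightarrow> p x" for x
      using cv unfolding p_def r_def v_def convergent_LIMSEQ_iff by blast
    have [measurable]: "p \<in> borel_measurable borel" unfolding p_def by measurable
    define q where "q n = (\<integral>\<^sup>+x. indicator (ball 0 (real N)) x * ennreal \<bar>cell_avg r (v n) x - p x\<bar> \<partial>lborel)" for n
    define C where "C = A / r ^ 3"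
    have C: "C \<ge> 0" using A r by (simp add: C_def)
    have avb: "\<bar>cell_avg r (v n) x\<bar> \<le> C" for n x
    proof -
      have "ennreal \<bar>cell_avg r (v n) x\<bar> \<le> ennreal (1 / r ^ 3) * ennreal A"
        unfolding v_def by (rule order_trans[OF cell_avg_le_L1n[OF r(1) iu]]) (intro mult_left_mono A; simp)
      then have "ennreal \<bar>cell_avg r (v n) x\<bar> \<le> ennreal C"
        using r A by (simp add: C_def ennreal_mult[symmetric])
      then show ?thesis using C by (simp add: ennreal_le_iff)
    qed
    have pb: "\<bar>p x\<bar> \<le> C" for x
      by (rule LIMSEQ_le_const2[OF tendsto_rabs[OF lim]]) (use avb in blast)
    have q0: "q \<longlonglongrightarrow> 0"
    proof -
      have "(\<lambda>n. \<integral>\<^sup>+x. indicator (ball 0 (real N)) x * ennreal \<bar>cell_avg r (v n) x - p x\<bar> \<partial>lborel)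
        \<longlonglongrightarrow> (\<integral>\<^sup>+x. 0 \<partial>(lborel :: (real^3) measure))"
      proof (rule nn_integral_dominated_convergence[where w="\<lambda>x. ennreal (2 * C) * indicator (ball 0 (real N)) x"])
        show "AE x in lborel. indicator (ball 0 (real N)) x * ennreal \<bar>cell_avg r (v n) x - p x\<bar>
            \<le> ennreal (2 * C) * indicator (ball 0 (real N)) x" for n
        proof (rule AE_I2)
          fix x
          have "\<bar>cell_avg r (v n) x - p x\<bar> \<le> 2 * C"
            using avb[of n x] pb[of x] by linarith
          then show "indicator (ball 0 (real N)) x * ennreal \<bar>cell_avg r (v n) x - p x\<bar>
            \<le> ennreal (2 * C) * indicator (ball 0 (real N)) x"
            by (auto simp: indicator_def intro: ennreal_leI)
        qed
        show "(\<integral>\<^sup>+x. ennreal (2 * C) * indicator (ball (0::real^3) (real N)) x \<partial>lborel) < \<infinity>"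
          by (simp add: nn_integral_cmult_indicator emeasure_lborel_ball_real ennreal_mult_less_top)
        show "AE x in lborel. (\<lambda>n. indicator (ball 0 (real N)) x * ennreal \<bar>cell_avg r (v n) x - p x\<bar>) \<longlonglongrightarrow> 0"
        proof (rule AE_I2)
          fix x :: "real^3"
          have "(\<lambda>n. ennreal \<bar>cell_avg r (v n) x - p x\<bar>) \<longlonglongrightarrow> ennreal \<bar>p x - p x\<bar>"
            by (intro tendsto_ennrealI tendsto_rabs tendsto_diff lim tendsto_const)
          then have "(\<lambda>n. indicator (ball 0 (real N)) x * ennreal \<bar>cell_avg r (v n) x - p x\<bar>)
              \<longlonglongrightarrow> indicator (ball 0 (real N)) x * ennreal \<bar>p x - p x\<bar>"
            by (intro ennreal_tendsto_cmult) (simp add: indicator_def)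
          then show "(\<lambda>n. indicator (ball 0 (real N)) x * ennreal \<bar>cell_avg r (v n) x - p x\<bar>) \<longlonglongrightarrow> 0" by simp
        qed
      qed measurable
      then show ?thesis by (simp add: q_def[abs_def])
    qed
    have "eventually (\<lambda>n. q n < ennreal (\<epsilon> / 4)) sequentially"
      using order_tendstoD(2)[OF q0, of "ennreal (\<epsilon> / 4)"] e by simp
    then obtain n0 where n0: "\<And>n. n \<ge> n0 \<Longrightarrow> q n \<le> ennreal (\<epsilon> / 4)"
      unfolding eventually_sequentially by (metis less_imp_le)
    have "(\<integral>\<^sup>+x. indicator (ball 0 (real N)) x * ennreal (norm (v n x - v m x)) \<partial>lborel) \<le> ennreal \<epsilon>"
      if nm: "n \<ge> n0" "m \<ge> n0" for n m
    proof -
      let ?w = "\<lambda>x. v n x - v m x" and ?L = "\<lambda>f. \<integral>\<^sup>+x. indicator (ball 0 (real N)) x * ennreal \<bar>f x\<bar> \<partial>lborel"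
      have Hw: "H1 ?w (\<lambda>x. G (k n) x - G (k m) x)" unfolding v_def by (intro H1_diff u)
      have "L2n (\<lambda>x. G (k n) x - G (k m) x) \<le> 2 * L2n (G (k n)) + 2 * L2n (G (k m))"
        by (rule L2n_triangle) (use norm_triangle_ineq4 in auto)
      also have "\<dots> \<le> 2 * ennreal B + 2 * ennreal B" by (intro add_mono mult_left_mono B) auto
      also have "\<dots> = ennreal (4 * B)"
        using B by (simp add: ennreal_mult[symmetric] ennreal_plus[symmetric] ennreal_numeral[symmetric]
            del: ennreal_plus ennreal_numeral)
      finally have g: "L2n (\<lambda>x. G (k n) x - G (k m) x) \<le> ennreal (4 * B)" .
      have "L2n (\<lambda>x. ?w x - cell_avg r ?w x) \<le> ennreal (48 * r\<^sup>2) * ennreal (4 * B)"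
        by (rule order_trans[OF H1_poincare[OF Hw r(1)]]) (intro mult_left_mono g; simp)
      then have p2: "L2n (\<lambda>x. ?w x - cell_avg r ?w x) \<le> ennreal (192 * r\<^sup>2 * B)"
        using B by (simp add: ennreal_mult[symmetric] mult.assoc)
      have "?L (\<lambda>x. ?w x - cell_avg r ?w x) \<le> ennreal r * emeasure lborel (ball (0::real^3) (real N))
          + ennreal (1 / r) * L2n (\<lambda>x. ?w x - cell_avg r ?w x)"
        using local_L1_le_L2n[of "\<lambda>x. ?w x - cell_avg r ?w x" "ball 0 (real N)" r] r by simp
      also have "\<dots> \<le> ennreal r * ennreal b + ennreal (1 / r) * ennreal (192 * r\<^sup>2 * B)"
        by (intro add_mono mult_left_mono p2) (auto simp: b_def emeasure_lborel_ball_real)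
      also have "\<dots> = ennreal (r * b + 192 * r * B)"
        using r b B by (simp add: ennreal_mult[symmetric] ennreal_plus[symmetric] power2_eq_square del: ennreal_plus)
      also have "\<dots> \<le> ennreal (\<epsilon> / 2)"
        using r by (intro ennreal_leI) (simp add: c_def algebra_simps)
      finally have 1: "?L (\<lambda>x. ?w x - cell_avg r ?w x) \<le> ennreal (\<epsilon> / 2)" .
      have ca: "cell_avg r ?w x = cell_avg r (v n) x - cell_avg r (v m) x" for x
        unfolding v_def by (intro cell_avg_diff iu)
      have "?L (cell_avg r ?w) \<le> q n + q m"
        unfolding q_def by (rule local_L1_triangle) (auto simp: ca)
      also have "\<dots> \<le> ennreal (\<epsilon> / 4) + ennreal (\<epsilon> / 4)" by (intro add_mono n0 nm)
      also have "\<dots> = ennreal (\<epsilon> / 2)" using e by (simp add: ennreal_plus[symmetric] del: ennreal_plus)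
      finally have 2: "?L (cell_avg r ?w) \<le> ennreal (\<epsilon> / 2)" .
      have "?L ?w \<le> ?L (\<lambda>x. ?w x - cell_avg r ?w x) + ?L (cell_avg r ?w)"
        by (rule local_L1_triangle) auto
      also have "\<dots> \<le> ennreal (\<epsilon> / 2) + ennreal (\<epsilon> / 2)" by (intro add_mono 1 2)
      also have "\<dots> = ennreal \<epsilon>" using e by (simp add: ennreal_plus[symmetric] del: ennreal_plus)
      finally show ?thesis by simp
    qed
    then show ?thesis by blast
  qed
  then obtain s w where s: "strict_mono s" and w: "w \<in> borel_measurable borel"
    and ae: "AE x in lborel. (\<lambda>n. v (s n) x) \<longlonglongrightarrow> w x"
    and l: "\<forall>N. (\<lambda>n. \<integral>\<^sup>+x. indicator (ball 0 (real N)) x * ennreal (norm (v n x - w x)) \<partial>lborel) \<longlonglongrightarrow> 0"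
    by (rule local_L1_complete[of v, rotated]) measurable
  show ?thesis
  proof (rule that[of "k \<circ> s" w])
    show "strict_mono (k \<circ> s)" by (rule strict_mono_o[OF k s])
    show "AE x in lborel. (\<lambda>n. u ((k \<circ> s) n) x) \<longlonglongrightarrow> w x" using ae by (simp add: v_def)
    show "\<forall>N. (\<lambda>n. \<integral>\<^sup>+x. indicator (ball 0 (real N)) x * ennreal (norm (u ((k \<circ> s) n) x - w x)) \<partial>lborel) \<longlonglongrightarrow> 0"
      using LIMSEQ_subseq_LIMSEQ[OF l[rule_format] s] by (simp add: v_def comp_def)
  qed fact
qed

text \<open>Mazur's argument, done by hand: near-minimisers of the Dirichlet integral over the convex
  sets of functions that are \<open>1 / (n + 1)\<close>-close to the limit in mean have strongly convergent
  gradients, by the parallelogram identity.\<close>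

lemma H1_weak_closed:
  assumes f: "\<And>k. H1 (f k) (F k)" and [measurable]: "g \<in> borel_measurable borel"
    and lim: "(\<lambda>k. L1n (\<lambda>x. g x - f k x)) \<longlonglongrightarrow> 0" and K: "\<And>k. L2n (F k) \<le> ennreal K" "K \<ge> 0"
  obtains G where "H1 g G" "L2n G \<le> ennreal K"
proof -
  define e where "e n = 1 / real (Suc n)" for n
  have e: "e n > 0" "n \<le> m \<Longrightarrow> e m \<le> e n" for n m by (auto simp: e_def frac_le)
  have e0: "e \<longlonglongrightarrow> 0" unfolding e_def by (rule LIMSEQ_Suc[OF lim_1_over_n])
  define C where "C n = {(v, H). H1 v H \<and> L1n (\<lambda>x. g x - v x) \<le> ennreal (e n)}" for n
  define D where "D H = enn2real (L2n H)" for H :: "real^3 \<Rightarrow> real^3"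
  have D: "L2n H = ennreal (D H)" if "H1 v H" for v H
    using H1_finite(2)[OF that] by (simp add: D_def)
  have D0: "D H \<ge> 0" for H by (simp add: D_def)
  define d where "d n = Inf ((\<lambda>(v, H). D H) ` C n)" for n
  have ne: "\<exists>k. (f k, F k) \<in> C n" for n
  proof -
    have "eventually (\<lambda>k. L1n (\<lambda>x. g x - f k x) < ennreal (e n)) sequentially"
      using order_tendstoD(2)[OF lim, of "ennreal (e n)"] e by simp
    then obtain k where "L1n (\<lambda>x. g x - f k x) < ennreal (e n)" by (auto simp: eventually_sequentially)
    then show ?thesis using f[of k] by (auto simp: C_def intro!: exI[of _ k])
  qed
  have bdd: "bdd_below ((\<lambda>(v, H). D H) ` C n)" for n
    by (intro bdd_belowI[of _ 0]) (auto simp: D0)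
  have dle: "d n \<le> D H" if "(v, H) \<in> C n" for n v H
    unfolding d_def using that by (intro cInf_lower bdd) (auto intro!: image_eqI[of _ _ "(v, H)"])
  have dK: "d n \<le> K" for n
  proof -
    obtain k where k: "(f k, F k) \<in> C n" using ne by blast
    have "ennreal (D (F k)) \<le> ennreal K" using K(1)[of k] D[OF f[of k]] by simp
    then have "D (F k) \<le> K" using K(2) by (simp add: ennreal_le_iff)
    with dle[OF k] show ?thesis by linarith
  qed
  have Cmono: "C m \<subseteq> C n" if "n \<le> m" for n m
    using e(2)[OF that] by (auto simp: C_def intro: order_trans ennreal_leI)
  have dmono: "d n \<le> d m" if "n \<le> m" for n m
    unfolding d_def by (intro cInf_superset_mono bdd image_mono Cmono that) (use ne[of m] in auto)
  \<comment> \<open>The sets \<open>C n\<close> shrink, so the infima increase; they stay below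
    \<open>K\<close> because the given pairs enter every \<open>C n\<close>.\<close>
  have dinc: "incseq d" by (simp add: incseq_def dmono)
  obtain l where "d \<longlonglongrightarrow> l"
    using incseq_convergent[OF dinc, of K] dK by blast
  then have dC: "Cauchy d" by (rule LIMSEQ_imp_Cauchy)
  have "\<forall>n. \<exists>p. p \<in> C n \<and> D (snd p) < d n + e n"
  proof
    fix n
    have "\<exists>y\<in>(\<lambda>(v, H). D H) ` C n. y < d n + e n"
      unfolding d_def by (intro cInf_lessD) (use ne[of n] e[of n] in auto)
    then show "\<exists>p. p \<in> C n \<and> D (snd p) < d n + e n" by force
  qed
  from choice[OF this] obtain p where p: "\<forall>n. p n \<in> C n \<and> D (snd (p n)) < d n + e n" ..
  define v where "v n = fst (p n)" for n
  define H where "H n = snd (p n)" for n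
  have vH: "H1 (v n) (H n)" "L1n (\<lambda>x. g x - v n x) \<le> ennreal (e n)" "D (H n) < d n + e n" for n
    using p[rule_format, of n] by (auto simp: C_def v_def H_def split: prod.splits)
  note [measurable] = H1_measurable[OF vH(1)]
  have key: "L2n (\<lambda>x. H n x - H m x) \<le> ennreal (2 * (d m - d n) + 4 * e n)" if nm: "n \<le> m" for n m
  proof -
    \<comment> \<open>The midpoint lies in the larger set \<open>C n\<close>, so its Dirichlet
      integral is at least \<open>d n\<close>, while those of the two ends are nearly
      \<open>d n\<close> and \<open>d m\<close>; the parallelogram identity leaves little for the
      difference.\<close>
    define a where "a x = (1/2) * (v n x + v m x)" for x
    define W where "W x = (1/2) *\<^sub>R (H n x + H m x)" for x
    have aW: "H1 a W" unfolding a_def W_def by (intro H1_cmult H1_add vH)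
    note [measurable] = H1_measurable[OF aW]
    have "L1n (\<lambda>x. g x - a x) \<le> L1n (\<lambda>x. (1/2) * (g x - v n x)) + L1n (\<lambda>x. (1/2) * (g x - v m x))"
    proof (rule L1n_triangle)
      show "\<bar>g x - a x\<bar> \<le> \<bar>(1/2) * (g x - v n x)\<bar> + \<bar>(1/2) * (g x - v m x)\<bar>" for x
        using abs_triangle_ineq[of "(1/2) * (g x - v n x)" "(1/2) * (g x - v m x)"]
        by (simp add: a_def field_simps)
    qed measurable
    also have "\<dots> = ennreal (1/2) * L1n (\<lambda>x. g x - v n x) + ennreal (1/2) * L1n (\<lambda>x. g x - v m x)"
      by (subst (1 2) L1n_cmult) auto
    also have "\<dots> \<le> ennreal (1/2) * ennreal (e n) + ennreal (1/2) * ennreal (e n)"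
      using e(2)[OF nm] by (intro add_mono mult_left_mono order_trans[OF vH(2)] ennreal_leI) auto
    also have "\<dots> = ennreal (e n)"
    proof -
      have h: "ennreal (1/2) * ennreal (e n) = ennreal (e n / 2)"
        using e(1)[of n] by (subst ennreal_mult[symmetric]) auto
      show ?thesis unfolding h using e(1)[of n] by (subst ennreal_plus[symmetric]) auto
    qed
    finally have "(a, W) \<in> C n" using aW by (simp add: C_def)
    then have dW: "d n \<le> D W" by (rule dle)
    have "L2n (\<lambda>x. H n x - H m x) + 4 * L2n W = 2 * L2n (H n) + 2 * L2n (H m)"
    proof -
      have "L2n (\<lambda>x. H n x - H m x) + 4 * L2n W
          = (\<integral>\<^sup>+x. ennreal ((norm (H n x - H m x))\<^sup>2) + 4 * ennreal ((norm (W x))\<^sup>2) \<partial>lborel)"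
        by (subst nn_integral_add) (auto simp: nn_integral_cmult)
      also have "\<dots> = (\<integral>\<^sup>+x. 2 * ennreal ((norm (H n x))\<^sup>2) + 2 * ennreal ((norm (H m x))\<^sup>2) \<partial>lborel)"
      proof (intro nn_integral_cong)
        fix x
        have "(norm (H n x - H m x))\<^sup>2 + 4 * (norm (W x))\<^sup>2 = 2 * (norm (H n x))\<^sup>2 + 2 * (norm (H m x))\<^sup>2"
          by (simp add: W_def power_mult_distrib power_divide)
             (simp add: power2_norm_eq_inner inner_diff inner_add inner_commute)
        then show "ennreal ((norm (H n x - H m x))\<^sup>2) + 4 * ennreal ((norm (W x))\<^sup>2)
            = 2 * ennreal ((norm (H n x))\<^sup>2) + 2 * ennreal ((norm (H m x))\<^sup>2)"
          by (simp add: ennreal_mult[symmetric] ennreal_plus[symmetric] ennreal_numeral[symmetric]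
              del: ennreal_plus ennreal_numeral)
      qed
      also have "\<dots> = 2 * L2n (H n) + 2 * L2n (H m)"
        by (subst nn_integral_add) (auto simp: nn_integral_cmult)
      finally show ?thesis .
    qed
    moreover have Hd: "H1 (\<lambda>x. v n x - v m x) (\<lambda>x. H n x - H m x)" by (intro H1_diff vH)
    ultimately have "ennreal (D (\<lambda>x. H n x - H m x) + 4 * D W) = ennreal (2 * D (H n) + 2 * D (H m))"
      using D0 by (simp add: D[OF aW] D[OF vH(1)] D[OF Hd] ennreal_mult[symmetric] ennreal_plus[symmetric]
          ennreal_numeral[symmetric] del: ennreal_plus ennreal_numeral)
    then have "D (\<lambda>x. H n x - H m x) + 4 * D W = 2 * D (H n) + 2 * D (H m)"
      using D0 by (subst (asm) ennreal_inj) auto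
    moreover have "X \<le> 2 * (b - a) + 4 * en"
      if "X + 4 * w = 2 * hn + 2 * hm" "a \<le> w" "hn < a + en" "hm < b + em" "em \<le> en"
      for X w hn hm a b en em :: real using that by argo
    ultimately have "D (\<lambda>x. H n x - H m x) \<le> 2 * (d m - d n) + 4 * e n"
      using dW vH(3)[of n] vH(3)[of m] e(2)[OF nm] by blast
    then show ?thesis unfolding D[OF Hd] by (rule ennreal_leI)
  qed
  have "\<exists>n0. \<forall>n\<ge>n0. \<forall>m\<ge>n0. L2n (\<lambda>x. H n x - H m x) \<le> ennreal \<epsilon>" if eps: "\<epsilon> > 0" for \<epsilon>
  proof -
    obtain n1 where n1: "\<And>n m. n \<ge> n1 \<Longrightarrow> m \<ge> n1 \<Longrightarrow> \<bar>d m - d n\<bar> < \<epsilon> / 4"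
      using CauchyD[OF dC, of "\<epsilon> / 4"] eps by (auto simp: abs_minus_commute)
    obtain n2 where n2: "\<And>n. n \<ge> n2 \<Longrightarrow> e n < \<epsilon> / 8"
      using order_tendstoD(2)[OF e0, of "\<epsilon> / 8"] eps by (auto simp: eventually_sequentially)
    have "L2n (\<lambda>x. H n x - H m x) \<le> ennreal \<epsilon>" if "n \<ge> max n1 n2" "m \<ge> n" for n m
    proof -
      have "\<bar>d m - d n\<bar> < \<epsilon> / 4" "e n < \<epsilon> / 8" using n1[of n m] n2[of n] that by simp_all
      then have "2 * (d m - d n) + 4 * e n \<le> \<epsilon>" using abs_ge_self[of "d m - d n"] by argo
      then show ?thesis using key[OF that(2)] by (meson ennreal_leI order_trans)
    qed
    note le = this
    have "L2n (\<lambda>x. H n x - H m x) \<le> ennreal \<epsilon>" if nm: "n \<ge> max n1 n2" "m \<ge> max n1 n2" for n m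
    proof (cases "n \<le> m")
      case True
      then show ?thesis by (rule le[OF nm(1)])
    next
      case False
      have "L2n (\<lambda>x. H n x - H m x) = L2n (\<lambda>x. H m x - H n x)" by (simp only: norm_minus_commute)
      also have "\<dots> \<le> ennreal \<epsilon>" by (rule le[OF nm(2)]) (use False in simp)
      finally show ?thesis .
    qed
    then show ?thesis by blast
  qed
  then obtain G r where G [measurable]: "G \<in> borel_measurable borel" and r: "strict_mono r"
    and ae: "AE x in lborel. (\<lambda>n. H (r n) x) \<longlonglongrightarrow> G x" and l2: "(\<lambda>n. L2n (\<lambda>x. G x - H n x)) \<longlonglongrightarrow> 0"
    by (rule L2n_complete[of H, rotated]) measurable
  have "H1 g G"
  proof (rule H1_closed_seq[OF vH(1)])
    show "(\<lambda>n. L1n (\<lambda>x. g x - v n x)) \<longlonglongrightarrow> 0"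
      by (rule tendsto_sandwich[OF always_eventually always_eventually tendsto_const])
         (use vH(2) tendsto_ennrealI[OF e0] in auto)
  qed (use l2 in auto)
  moreover have "L2n G \<le> ennreal K"
  proof -
    have "L2n G \<le> (\<integral>\<^sup>+x. liminf (\<lambda>k. ennreal ((norm (H (r k) x))\<^sup>2)) \<partial>lborel)"
    proof (rule nn_integral_mono_AE, rule AE_mp[OF ae], intro AE_I2 impI)
      fix x assume l: "(\<lambda>n. H (r n) x) \<longlonglongrightarrow> G x"
      have "(\<lambda>k. ennreal ((norm (H (r k) x))\<^sup>2)) \<longlonglongrightarrow> ennreal ((norm (G x))\<^sup>2)"
        by (intro tendsto_intros l)
      from lim_imp_Liminf[OF _ this]
      show "ennreal ((norm (G x))\<^sup>2) \<le> liminf (\<lambda>k. ennreal ((norm (H (r k) x))\<^sup>2))" by simp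
    qed
    also have "\<dots> \<le> liminf (\<lambda>k. L2n (H (r k)))" by (rule nn_integral_liminf) measurable
    also have "\<dots> \<le> liminf (\<lambda>k. ennreal (K + e k))"
    proof (intro Liminf_mono always_eventually allI)
      fix k
      have "D (H (r k)) \<le> K + e k"
        using vH(3)[of "r k"] dK[of "r k"] e(2)[OF seq_suble[OF r, of k]] by linarith
      then show "L2n (H (r k)) \<le> ennreal (K + e k)" unfolding D[OF vH(1)] by (rule ennreal_leI)
    qed
    also have "\<dots> = ennreal (K + 0)"
      by (intro lim_imp_Liminf tendsto_ennrealI tendsto_add tendsto_const e0) simp
    finally show ?thesis by simp
  qed
  ultimately show ?thesis by (rule that)
qed

subsection \<open>The energy of nonnegative functions\<close>

text \<open>Where \<open>norm x\<close> lies between \<open>1 / 2 ^ Suc k\<close> and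
  \<open>1 / 2 ^ k\<close>, the integrand is at most \<open>4 ^ Suc k\<close>, and the ball of
  radius \<open>1 / 2 ^ k\<close> sits in a cube of volume \<open>8 / 8 ^ k\<close>. The products
  \<open>32 * (1/2) ^ k\<close> are summable.\<close>

lemma inverse_square_finite:
  "(\<integral>\<^sup>+x. indicator (ball 0 1) x * ennreal (1 / (norm (x::real^3))\<^sup>2) \<partial>lborel) < \<infinity>"
proof -
  have [measurable]: "ball (0::real^3) r \<in> sets borel" for r by simp
  have le: "indicator (ball 0 1) x * ennreal (1 / (norm x)\<^sup>2)
      \<le> (\<Sum>k. ennreal (4 ^ Suc k) * indicator (ball 0 (1 / 2 ^ k)) x)" for x :: "real^3"
  proof (cases "x \<in> ball 0 1 \<and> x \<noteq> 0")
    case True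
    then have x: "0 < norm x" "norm x < 1" by auto
    obtain n where n: "(1/2) ^ n < norm x" using real_arch_pow_inv[OF x(1), of "1/2"] by auto
    \<comment> \<open>The index of the dyadic shell of \<open>x\<close>; minimality gives the upper
      bound on the norm, and for \<open>k = 0\<close> it is \<open>norm x < 1\<close>.\<close>
    define k where "k = (LEAST k. (1/2) ^ Suc k \<le> norm x)"
    have "(1/2::real) ^ Suc n \<le> norm x"
      by (rule order_trans[OF power_decreasing less_imp_le[OF n]]) auto
    then have k1: "(1/2) ^ Suc k \<le> norm x" unfolding k_def by (rule LeastI)
    have k2: "norm x < (1/2) ^ k"
    proof (cases k)
      case 0
      then show ?thesis using x by simp
    next
      case (Suc j)
      then have "\<not> (1/2) ^ Suc j \<le> norm x" using not_less_Least[of j "\<lambda>k. (1/2) ^ Suc k \<le> norm x"] k_def by simp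
      then show ?thesis using Suc by simp
    qed
    have "1 / (norm x)\<^sup>2 \<le> 4 ^ Suc k"
    proof -
      have "((1/2) ^ Suc k)\<^sup>2 \<le> (norm x)\<^sup>2" by (intro power_mono k1) simp
      then have "1 / (norm x)\<^sup>2 \<le> 1 / ((1/2) ^ Suc k)\<^sup>2" by (intro divide_left_mono) (use x in auto)
      also have "1 / ((1/2::real) ^ Suc k)\<^sup>2 = 4 ^ Suc k"
        by (simp add: power_mult_distrib power_one_over power2_eq_square) (simp add: power_mult_distrib[symmetric])
      finally show ?thesis .
    qed
    then have "indicator (ball 0 1) x * ennreal (1 / (norm x)\<^sup>2)
        \<le> ennreal (4 ^ Suc k) * indicator (ball 0 (1 / 2 ^ k)) x"
      using True k2 by (simp add: power_one_over ennreal_leI)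
    also have "\<dots> = (\<Sum>i\<in>{k}. ennreal (4 ^ Suc i) * indicator (ball 0 (1 / 2 ^ i)) x)"
    proof -
      have "sum f {k} = f k" for f :: "nat \<Rightarrow> ennreal" by simp
      then show ?thesis by (simp only:)
    qed
    also have "\<dots> \<le> (\<Sum>k. ennreal (4 ^ Suc k) * indicator (ball 0 (1 / 2 ^ k)) x)"
      by (rule sum_le_suminf) auto
    finally show ?thesis .
  qed auto
  have "(\<integral>\<^sup>+x. indicator (ball 0 1) x * ennreal (1 / (norm (x::real^3))\<^sup>2) \<partial>lborel)
      \<le> (\<integral>\<^sup>+x. (\<Sum>k. ennreal (4 ^ Suc k) * indicator (ball (0::real^3) (1 / 2 ^ k)) x) \<partial>lborel)"
    by (intro nn_integral_mono le)
  also have "\<dots> = (\<Sum>k. \<integral>\<^sup>+x. ennreal (4 ^ Suc k) * indicator (ball (0::real^3) (1 / 2 ^ k)) x \<partial>lborel)"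
    by (rule nn_integral_suminf) measurable
  also have "\<dots> \<le> (\<Sum>k. ennreal (32 * (1/2) ^ k))"
  proof (intro suminf_le summableI)
    fix k
    let ?r = "1 / 2 ^ k :: real"
    have "ball (0::real^3) ?r \<subseteq> cbox (\<chi> i. - ?r) (\<chi> i. ?r)"
    proof
      fix x :: "real^3" assume "x \<in> ball 0 ?r"
      then have "\<bar>x $ i\<bar> \<le> ?r" for i using component_le_norm_cart[of x i] by simp
      then show "x \<in> cbox (\<chi> i. - ?r) (\<chi> i. ?r)" by (auto simp: mem_box_cart abs_le_iff minus_le_iff)
    qed
    then have "emeasure lborel (ball (0::real^3) ?r) \<le> emeasure lborel (cbox (\<chi> i. - ?r) (\<chi> i. ?r) :: (real^3) set)"
      by (rule emeasure_mono) simp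
    also have "\<dots> = ennreal ((2 * ?r) ^ 3)" by (subst emeasure_cbox_cart) auto
    finally have "ennreal (4 ^ Suc k) * emeasure lborel (ball (0::real^3) ?r) \<le> ennreal (4 ^ Suc k) * ennreal ((2 * ?r) ^ 3)"
      by (intro mult_left_mono) auto
    also have "\<dots> = ennreal (4 ^ Suc k * (2 * ?r) ^ 3)" by (subst ennreal_mult[symmetric]) auto
    also have "4 ^ Suc k * (2 * ?r) ^ 3 = 32 * (1/2) ^ k"
    proof -
      have "(2 ^ k :: real) ^ 3 = 4 ^ k * 2 ^ k"
        by (simp add: power_mult_distrib[symmetric] power3_eq_cube)
      then show ?thesis by (simp add: power_mult_distrib power_divide power_one_over)
    qed
    finally show "(\<integral>\<^sup>+x. ennreal (4 ^ Suc k) * indicator (ball (0::real^3) ?r) x \<partial>lborel) \<le> ennreal (32 * (1/2) ^ k)"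
      by (simp add: nn_integral_cmult_indicator)
  qed
  also have "\<dots> < \<infinity>" by (subst suminf_ennreal2) (auto intro!: summable_mult summable_geometric)
  finally show ?thesis .
qed

text \<open>In closed form 4 pi; it bounds the contribution of the singularity to a Coulomb
  potential.\<close>

definition newton_const :: real where
  "newton_const = enn2real (\<integral>\<^sup>+x. indicator (ball 0 1) x * ennreal (1 / (norm (x::real^3))\<^sup>2) \<partial>lborel)"

lemma newton_const: "0 \<le> newton_const"
  "(\<integral>\<^sup>+x. indicator (ball 0 1) x * ennreal (1 / (norm (x::real^3))\<^sup>2) \<partial>lborel) = ennreal newton_const"
  using inverse_square_finite by (auto simp: newton_const_def)

lemma integrable_inverse_square:
  "integrable lborel (\<lambda>x::real^3. indicator (ball 0 1) x * (1 / (norm x)\<^sup>2))"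
  "(LINT x|lborel. indicator (ball 0 1) (x::real^3) * (1 / (norm x)\<^sup>2)) = newton_const"
proof -
  have [measurable]: "ball (0::real^3) r \<in> sets borel" for r by simp
  have e: "(\<integral>\<^sup>+x. ennreal (indicator (ball 0 1) (x::real^3) * (1 / (norm x)\<^sup>2)) \<partial>lborel) = ennreal newton_const"
    unfolding newton_const(2)[symmetric] by (intro nn_integral_cong) (auto simp: indicator_def)
  show "integrable lborel (\<lambda>x::real^3. indicator (ball 0 1) x * (1 / (norm x)\<^sup>2))"
    by (rule integrableI_nonneg) (unfold e, auto)
  show "(LINT x|lborel. indicator (ball 0 1) (x::real^3) * (1 / (norm x)\<^sup>2)) = newton_const"
    by (subst integral_eq_nn_integral) (unfold e, auto simp: newton_const(1))
qed

text \<open>A bound uniform in \<open>x\<close>: at distance at least 1 the kernel is at most 1, and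
  nearer a product is at most the sum of the squares of its factors.\<close>

lemma potential_le:
  assumes [measurable]: "f \<in> borel_measurable borel" and f: "\<And>x. 0 \<le> f x"
  shows "(\<integral>\<^sup>+y. ennreal (f y / norm (x - y)) \<partial>lborel) \<le> L1n f + L2n f + ennreal newton_const"
proof -
  have [measurable]: "ball (0::real^3) r \<in> sets borel" for r by simp
  have pw: "f y / norm (x - y) \<le> \<bar>f y\<bar> + (norm (f y))\<^sup>2 + indicator (ball 0 1) (y - x) * (1 / (norm (y - x))\<^sup>2)" for y
  proof (cases "y - x \<in> ball 0 1")
    case True
    have "2 * (f y * (1 / norm (y - x))) \<le> (f y)\<^sup>2 + (1 / norm (y - x))\<^sup>2"
      using sum_squares_bound[of "f y" "1 / norm (y - x)"] by (simp only: mult.assoc)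
    moreover have "0 \<le> f y * (1 / norm (y - x))" using f[of y] by simp
    ultimately have "f y * (1 / norm (y - x)) \<le> (f y)\<^sup>2 + (1 / norm (y - x))\<^sup>2" by linarith
    then show ?thesis using True f[of y] by (simp add: norm_minus_commute power_divide)
  next
    case False
    then have "f y / norm (x - y) \<le> f y / 1"
      using f[of y] by (intro divide_left_mono) (auto simp: norm_minus_commute)
    then show ?thesis using False f[of y] by (simp add: add_increasing2)
  qed
  have "(\<integral>\<^sup>+y. ennreal (f y / norm (x - y)) \<partial>lborel) \<le> (\<integral>\<^sup>+y. (ennreal \<bar>f y\<bar> + ennreal ((norm (f y))\<^sup>2))
      + indicator (ball 0 1) (y + - x) * ennreal (1 / (norm (y + - x))\<^sup>2) \<partial>lborel)"
  proof (intro nn_integral_mono)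
    fix y
    have "ennreal (f y / norm (x - y)) \<le> ennreal (\<bar>f y\<bar> + (norm (f y))\<^sup>2 + indicator (ball 0 1) (y - x) * (1 / (norm (y - x))\<^sup>2))"
      by (intro ennreal_leI pw)
    also have "\<dots> = ennreal \<bar>f y\<bar> + ennreal ((norm (f y))\<^sup>2) + ennreal (indicator (ball 0 1) (y - x) * (1 / (norm (y - x))\<^sup>2))"
      by (subst ennreal_plus; simp)+
    also have "ennreal (indicator (ball 0 1) (y - x) * (1 / (norm (y - x))\<^sup>2))
        = indicator (ball 0 1) (y + - x) * ennreal (1 / (norm (y + - x))\<^sup>2)"
      by (auto simp: indicator_def)
    finally show "ennreal (f y / norm (x - y)) \<le> (ennreal \<bar>f y\<bar> + ennreal ((norm (f y))\<^sup>2))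
      + indicator (ball 0 1) (y + - x) * ennreal (1 / (norm (y + - x))\<^sup>2)" .
  qed
  also have "\<dots> = (L1n f + L2n f) + (\<integral>\<^sup>+y. indicator (ball 0 1) (y + - x) * ennreal (1 / (norm (y + - x))\<^sup>2) \<partial>lborel)"
    by (subst nn_integral_add, measurable, subst nn_integral_add, measurable)
  also have "(\<integral>\<^sup>+y. indicator (ball 0 1) (y + - x) * ennreal (1 / (norm (y + - x))\<^sup>2) \<partial>lborel) = ennreal newton_const"
    unfolding newton_const(2)[symmetric] by (rule nn_integral_lborel_translate) measurable
  finally show ?thesis .
qed

section \<open>The double well and the powers that it controls\<close>

definition dwell :: "real \<Rightarrow> real" where
  "dwell s = (1/2) * s\<^sup>2 * (1 - s)\<^sup>2"

lemma dwell_nonneg: "0 \<le> dwell s" by (simp add: dwell_def)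

lemma dwell_continuous: "continuous_on S dwell"
  unfolding dwell_def[abs_def] by (intro continuous_intros)

lemma dwell_measurable [measurable]: "dwell \<in> borel_measurable borel"
  by (intro borel_measurable_continuous_onI dwell_continuous)

text \<open>The well vanishes at 1, so a linear term, which integrates to the mass, is added; for
  \<open>s > 2\<close> the factor \<open>(1 - s)\<^sup>2\<close> is at least 1. With the bounds on
  third and fourth powers below, finite mass and finite double-well energy give integrability of all
  these powers.\<close>

lemma square_le_dwell: assumes "0 \<le> s" shows "s\<^sup>2 \<le> 2 * s + 2 * dwell s"
proof (cases "s \<le> 2")
  case True
  then have "s\<^sup>2 \<le> 2 * s" using assms by (simp add: power2_eq_square mult_right_mono)
  then show ?thesis using dwell_nonneg[of s] by linarith
next
  case False
  then have "1 \<le> (1 - s)\<^sup>2" using one_le_power[of "s - 1" 2] by (simp add: power2_commute)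
  then have "s\<^sup>2 * 1 \<le> s\<^sup>2 * (1 - s)\<^sup>2" by (intro mult_left_mono) auto
  then show ?thesis using assms by (simp add: dwell_def)
qed

lemma fourth_power_le_dwell: assumes "0 \<le> s" shows "s ^ 4 \<le> 8 * s + 8 * dwell s"
proof (cases "s \<le> 2")
  case True
  then have "s ^ 3 \<le> 2 ^ 3" using assms by (intro power_mono)
  then have "s * s ^ 3 \<le> s * 8" using assms by (intro mult_left_mono) auto
  moreover have "s * s ^ 3 = s ^ 4" by (simp add: power_eq_if)
  ultimately show ?thesis using dwell_nonneg[of s] by linarith
next
  case False
  then have "(s / 2)\<^sup>2 \<le> (s - 1)\<^sup>2" by (intro power_mono) auto
  then have "s\<^sup>2 * (s / 2)\<^sup>2 \<le> s\<^sup>2 * (1 - s)\<^sup>2" by (intro mult_left_mono) (auto simp: power2_commute)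
  moreover have "s\<^sup>2 * (s / 2)\<^sup>2 = s ^ 4 / 4" by (simp add: power_divide power2_eq_square power_eq_if)
  ultimately show ?thesis using assms by (simp add: dwell_def)
qed

lemma cube_le_dwell: assumes "0 \<le> s" shows "s ^ 3 \<le> 5 * s + 5 * dwell s"
proof -
  have "2 * s * s\<^sup>2 \<le> s\<^sup>2 + (s\<^sup>2)\<^sup>2" by (rule sum_squares_bound)
  moreover have "2 * s * s\<^sup>2 = 2 * s ^ 3" "(s\<^sup>2)\<^sup>2 = s ^ 4" by (simp_all add: power2_eq_square power_eq_if)
  ultimately show ?thesis using square_le_dwell[OF assms] fourth_power_le_dwell[OF assms] by linarith
qed

text \<open>In the unit ball \<open>Z * (s / norm x)\<close> is at most
  \<open>s\<^sup>2 / 4 + Z\<^sup>2 / (norm x)\<^sup>2\<close>. The quarter is chosen so that only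
  half of the double well is spent and the other half remains for coercivity.\<close>

lemma potential_dwell_bound:
  assumes "0 \<le> s" "0 \<le> Z"
  shows "Z * (s / norm x) \<le> dwell s / 2 + (Z + 1/2) * s + Z\<^sup>2 * (indicator (ball 0 1) x * (1 / (norm x)\<^sup>2))"
proof (cases "x \<in> ball 0 1")
  case True
  have "2 * (s / 2) * (Z * (1 / norm x)) \<le> (s / 2)\<^sup>2 + (Z * (1 / norm x))\<^sup>2" by (rule sum_squares_bound)
  then have "Z * (s / norm x) \<le> s\<^sup>2 / 4 + Z\<^sup>2 * (1 / (norm x)\<^sup>2)"
    by (simp add: power_mult_distrib power_divide mult.commute)
  also have "s\<^sup>2 / 4 \<le> s / 2 + dwell s / 2" using square_le_dwell[OF assms(1)] by linarith
  finally show ?thesis using True mult_nonneg_nonneg[OF assms] by (simp add: algebra_simps)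
next
  case False
  then have "s / norm x \<le> s / 1" using assms by (intro divide_left_mono) auto
  then have "Z * (s / norm x) \<le> Z * s" using assms by (intro mult_left_mono) auto
  then show ?thesis using False dwell_nonneg[of s] assms by (simp add: algebra_simps)
qed

text \<open>Valued in \<open>ennreal\<close>, so that Fubini and Fatou apply directly. Since
  \<open>ennreal\<close> truncates negative numbers, this is the Coulomb energy for nonnegative
  densities.\<close>

definition coul :: "(real^3 \<Rightarrow> real) \<Rightarrow> (real^3 \<Rightarrow> real) \<Rightarrow> ennreal" where
  "coul u v = (\<integral>\<^sup>+x. (\<integral>\<^sup>+y. ennreal (u x * v y / norm (x - y)) \<partial>lborel) \<partial>lborel)"

text \<open>Competitors of finite energy with their gradient recorded; on them \<open>energy\<close>
  is \<open>tot_energy\<close>.\<close>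

definition admissible :: "(real^3 \<Rightarrow> real) \<Rightarrow> (real^3 \<Rightarrow> real^3) \<Rightarrow> bool" where
  "admissible u G \<longleftrightarrow> H1 u G \<and> (\<forall>x. 0 \<le> u x) \<and> integrable lborel (\<lambda>x. dwell (u x))"

text \<open>The charge is a parameter because a piece moved to infinity keeps the energy with charge
  0.\<close>

definition loc_energy :: "real \<Rightarrow> (real^3 \<Rightarrow> real) \<Rightarrow> (real^3 \<Rightarrow> real^3) \<Rightarrow> real" where
  "loc_energy Z u G = (LINT x|lborel. (norm (G x))\<^sup>2) / 2 + (LINT x|lborel. dwell (u x)) - Z * (LINT x|lborel. u x / norm x)"

definition tot_energy :: "real \<Rightarrow> (real^3 \<Rightarrow> real) \<Rightarrow> (real^3 \<Rightarrow> real^3) \<Rightarrow> real" where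
  "tot_energy Z u G = loc_energy Z u G + enn2real (coul u u) / 2"

lemma coul_le:
  assumes [measurable]: "u \<in> borel_measurable borel" "v \<in> borel_measurable borel"
    and pos: "\<And>x. 0 \<le> u x" "\<And>x. 0 \<le> v x"
  shows "coul u v \<le> L1n u * (L1n v + L2n v + ennreal newton_const)"
proof -
  have "coul u v \<le> (\<integral>\<^sup>+x. ennreal \<bar>u x\<bar> * (L1n v + L2n v + ennreal newton_const) \<partial>lborel)"
    unfolding coul_def
  proof (intro nn_integral_mono)
    fix x
    have "(\<integral>\<^sup>+y. ennreal (u x * v y / norm (x - y)) \<partial>lborel) = (\<integral>\<^sup>+y. ennreal (u x) * ennreal (v y / norm (x - y)) \<partial>lborel)"
      using pos by (simp add: ennreal_mult[symmetric])
    also have "\<dots> = ennreal (u x) * (\<integral>\<^sup>+y. ennreal (v y / norm (x - y)) \<partial>lborel)"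
      by (rule nn_integral_cmult) measurable
    also have "\<dots> \<le> ennreal (u x) * (L1n v + L2n v + ennreal newton_const)"
      by (intro mult_left_mono potential_le pos) auto
    finally show "(\<integral>\<^sup>+y. ennreal (u x * v y / norm (x - y)) \<partial>lborel) \<le> ennreal \<bar>u x\<bar> * (L1n v + L2n v + ennreal newton_const)"
      using pos by simp
  qed
  also have "\<dots> = L1n u * (L1n v + L2n v + ennreal newton_const)"
    by (rule nn_integral_multc) measurable
  finally show ?thesis .
qed

lemma coul_sym:
  assumes [measurable]: "u \<in> borel_measurable borel" "v \<in> borel_measurable borel"
  shows "coul u v = coul v u"
proof -
  have "coul u v = (\<integral>\<^sup>+y. (\<integral>\<^sup>+x. ennreal (u x * v y / norm (x - y)) \<partial>lborel) \<partial>lborel)"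
    unfolding coul_def by (rule lborel_pair.Fubini'[symmetric]) measurable
  also have "\<dots> = coul v u"
    unfolding coul_def by (simp add: norm_minus_commute mult.commute)
  finally show ?thesis .
qed

lemma coul_add_right:
  assumes [measurable]: "u \<in> borel_measurable borel" "v \<in> borel_measurable borel" "w \<in> borel_measurable borel"
    and pos: "\<And>x. 0 \<le> u x" "\<And>x. 0 \<le> v x" "\<And>x. 0 \<le> w x"
  shows "coul u (\<lambda>x. v x + w x) = coul u v + coul u w"
proof -
  have "coul u (\<lambda>x. v x + w x) = (\<integral>\<^sup>+x. (\<integral>\<^sup>+y. ennreal (u x * v y / norm (x - y)) \<partial>lborel)
      + (\<integral>\<^sup>+y. ennreal (u x * w y / norm (x - y)) \<partial>lborel) \<partial>lborel)"
    unfolding coul_def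
  proof (intro nn_integral_cong)
    fix x
    have "(\<integral>\<^sup>+y. ennreal (u x * (v y + w y) / norm (x - y)) \<partial>lborel)
      = (\<integral>\<^sup>+y. ennreal (u x * v y / norm (x - y)) + ennreal (u x * w y / norm (x - y)) \<partial>lborel)"
      using pos by (intro nn_integral_cong) (simp add: ennreal_plus[symmetric] distrib_left add_divide_distrib del: ennreal_plus)
    also have "\<dots> = (\<integral>\<^sup>+y. ennreal (u x * v y / norm (x - y)) \<partial>lborel) + (\<integral>\<^sup>+y. ennreal (u x * w y / norm (x - y)) \<partial>lborel)"
      by (rule nn_integral_add) measurable
    finally show "(\<integral>\<^sup>+y. ennreal (u x * (v y + w y) / norm (x - y)) \<partial>lborel)
      = (\<integral>\<^sup>+y. ennreal (u x * v y / norm (x - y)) \<partial>lborel) + (\<integral>\<^sup>+y. ennreal (u x * w y / norm (x - y)) \<partial>lborel)" .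
  qed
  also have "\<dots> = coul u v + coul u w"
    unfolding coul_def by (rule nn_integral_add) measurable
  finally show ?thesis .
qed

lemma coul_add:
  assumes [measurable]: "u \<in> borel_measurable borel" "v \<in> borel_measurable borel"
    and pos: "\<And>x. 0 \<le> u x" "\<And>x. 0 \<le> v x"
  shows "coul (\<lambda>x. u x + v x) (\<lambda>x. u x + v x) = coul u u + 2 * coul u v + coul v v"
proof -
  have "coul (\<lambda>x. u x + v x) (\<lambda>x. u x + v x) = coul (\<lambda>x. u x + v x) u + coul (\<lambda>x. u x + v x) v"
    by (rule coul_add_right) (use pos in auto)
  also have "coul (\<lambda>x. u x + v x) u = coul u (\<lambda>x. u x + v x)" by (rule coul_sym) measurable
  also have "\<dots> = coul u u + coul u v" by (rule coul_add_right) (use pos in auto)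
  also have "coul (\<lambda>x. u x + v x) v = coul v (\<lambda>x. u x + v x)" by (rule coul_sym) measurable
  also have "\<dots> = coul v u + coul v v" by (rule coul_add_right) (use pos in auto)
  also have "coul v u = coul u v" by (rule coul_sym) measurable
  finally show ?thesis by (simp add: mult_2 ac_simps)
qed

lemma admissibleD:
  assumes g: "admissible u G"
  shows "H1 u G" "\<And>x. 0 \<le> u x" "integrable lborel (\<lambda>x. dwell (u x))" "integrable lborel u"
    "integrable lborel (\<lambda>x. (norm (G x))\<^sup>2)" "u \<in> borel_measurable borel" "G \<in> borel_measurable borel"
    "integrable lborel (\<lambda>x. (u x)\<^sup>2)" "integrable lborel (\<lambda>x. (u x) ^ 3)" "integrable lborel (\<lambda>x. (u x) ^ 4)"
    "integrable lborel (\<lambda>x. u x / norm x)"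
proof -
  show H: "H1 u G" and pos: "\<And>x. 0 \<le> u x" and D: "integrable lborel (\<lambda>x. dwell (u x))"
    using g by (auto simp: admissible_def)
  show I: "integrable lborel u" and "integrable lborel (\<lambda>x. (norm (G x))\<^sup>2)"
    by (rule H1_integrable[OF H], rule H1_integrable_grad[OF H])
  show [measurable]: "u \<in> borel_measurable borel" "G \<in> borel_measurable borel" by (rule H1_measurable[OF H])+
  have s: "integrable lborel (\<lambda>x. a * u x + b * dwell (u x))" for a b
    by (intro Bochner_Integration.integrable_add integrable_mult_right I D)
  show "integrable lborel (\<lambda>x. (u x)\<^sup>2)"
    by (rule Bochner_Integration.integrable_bound[OF s[of 2 2]])
       (use square_le_dwell[OF pos] pos in \<open>auto intro!: order_trans[OF _ abs_ge_self]\<close>)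
  show "integrable lborel (\<lambda>x. (u x) ^ 3)"
    by (rule Bochner_Integration.integrable_bound[OF s[of 5 5]])
       (use cube_le_dwell[OF pos] pos in \<open>auto intro!: order_trans[OF _ abs_ge_self]\<close>)
  show "integrable lborel (\<lambda>x. (u x) ^ 4)"
    by (rule Bochner_Integration.integrable_bound[OF s[of 8 8]])
       (use fourth_power_le_dwell[OF pos] pos in \<open>auto intro!: order_trans[OF _ abs_ge_self]\<close>)
  have "integrable lborel (\<lambda>x. (1/2) * dwell (u x) + (1 + 1/2) * u x + 1\<^sup>2 * (indicator (ball 0 1) x * (1 / (norm x)\<^sup>2)))"
    by (intro Bochner_Integration.integrable_add integrable_mult_right I D integrable_inverse_square)
  then show "integrable lborel (\<lambda>x. u x / norm x)"
    by (rule Bochner_Integration.integrable_bound)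
       (use potential_dwell_bound[OF pos, of 1] pos in \<open>auto intro!: order_trans[OF _ abs_ge_self]\<close>)
qed

lemma admissible_L1n: "admissible u G \<Longrightarrow> L1n u = ennreal (LINT x|lborel. u x)"
  using admissibleD(2,4)[of u G] by (subst nn_integral_eq_integral) auto

lemma admissible_L2n: "admissible u G \<Longrightarrow> L2n u = ennreal (LINT x|lborel. (u x)\<^sup>2)"
  using admissibleD(8)[of u G] by (subst nn_integral_eq_integral) auto

lemma admissible_L2n_grad: "admissible u G \<Longrightarrow> L2n G = ennreal (LINT x|lborel. (norm (G x))\<^sup>2)"
  using admissibleD(5)[of u G] by (subst nn_integral_eq_integral) auto

lemma admissible_coul_finite:
  assumes "admissible u G" "admissible v H" shows "coul u v < \<infinity>"
proof -
  have "coul u v \<le> L1n u * (L1n v + L2n v + ennreal newton_const)"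
    by (intro coul_le admissibleD(6)[OF assms(1)] admissibleD(6)[OF assms(2)] admissibleD(2)[OF assms(1)] admissibleD(2)[OF assms(2)])
  also have "\<dots> < \<infinity>"
    unfolding admissible_L1n[OF assms(1)] admissible_L1n[OF assms(2)] admissible_L2n[OF assms(2)]
    by (simp add: ennreal_mult_less_top ennreal_add_less_top)
  finally show ?thesis .
qed

lemma potential_finite:
  assumes "admissible u G" shows "(\<integral>\<^sup>+y. ennreal (u y / norm (x - y)) \<partial>lborel) < \<infinity>"
proof -
  have "(\<integral>\<^sup>+y. ennreal (u y / norm (x - y)) \<partial>lborel) \<le> L1n u + L2n u + ennreal newton_const"
    by (intro potential_le admissibleD(6)[OF assms] admissibleD(2)[OF assms])
  also have "\<dots> < \<infinity>"
    unfolding admissible_L1n[OF assms] admissible_L2n[OF assms] by (simp add: ennreal_add_less_top)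
  finally show ?thesis .
qed

lemma energy_admissible:
  assumes g: "admissible u G" shows "energy Z u = tot_energy Z u G"
proof -
  note d = admissibleD[OF g]
  note [measurable] = d(6,7) H1_weak_grad_measurable[OF d(1)]
  have "(LINT x|lborel. (1/2) * (norm (weak_grad u x))\<^sup>2 + (1/2) * (u x)\<^sup>2 * (1 - u x)\<^sup>2 - V Z x * u x)
      = (LINT x|lborel. (1/2) * (norm (G x))\<^sup>2 + dwell (u x) - Z * (u x / norm x))"
    using H1_weak_grad_AE[OF d(1)]
    by (intro integral_cong_AE) (auto simp: dwell_def V_def elim!: AE_mp)
  also have "\<dots> = (1/2) * (LINT x|lborel. (norm (G x))\<^sup>2) + (LINT x|lborel. dwell (u x)) - Z * (LINT x|lborel. u x / norm x)"
    by (subst Bochner_Integration.integral_diff, (intro Bochner_Integration.integrable_add integrable_mult_right d)+,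
        subst Bochner_Integration.integral_add, (intro integrable_mult_right d)+, simp only: integral_mult_right_zero)
  also have "\<dots> = loc_energy Z u G" by (simp add: loc_energy_def)
  finally have 1: "(LINT x|lborel. (1/2) * (norm (weak_grad u x))\<^sup>2 + (1/2) * (u x)\<^sup>2 * (1 - u x)\<^sup>2 - V Z x * u x)
      = loc_energy Z u G" .
  have in1: "(LINT y|lborel. u x * u y / norm (x - y)) = enn2real (\<integral>\<^sup>+y. ennreal (u x * u y / norm (x - y)) \<partial>lborel)" for x
    by (subst integral_eq_nn_integral) (auto simp: d(2))
  \<comment> \<open>Finiteness at every \<open>x\<close> allows \<open>enn2real\<close> to be undone
    under the outer integral.\<close>
  have fin: "(\<integral>\<^sup>+y. ennreal (u x * u y / norm (x - y)) \<partial>lborel) < \<infinity>" for x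
  proof -
    have "(\<integral>\<^sup>+y. ennreal (u x * u y / norm (x - y)) \<partial>lborel) = ennreal (u x) * (\<integral>\<^sup>+y. ennreal (u y / norm (x - y)) \<partial>lborel)"
      using d(2) by (subst nn_integral_cmult[symmetric]) (auto simp: ennreal_mult[symmetric])
    then show ?thesis using potential_finite[OF g, of x] by (simp add: ennreal_mult_less_top)
  qed
  have "(LINT x|lborel. (LINT y|lborel. u x * u y / norm (x - y))) = enn2real (coul u u)"
    unfolding in1 coul_def
    by (subst integral_eq_nn_integral) (simp_all add: ennreal_enn2real[OF fin[unfolded infinity_ennreal_def]])
  with 1 show ?thesis by (simp add: energy_def tot_energy_def)
qed

text \<open>Coercivity: the attraction is absorbed by half of the double well, a multiple of the
  mass and a constant.\<close>

lemma energy_lower_bound: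
  assumes g: "admissible u G" and Z: "0 \<le> Z"
  shows "(LINT x|lborel. (norm (G x))\<^sup>2) / 2 + (LINT x|lborel. dwell (u x)) / 2 + enn2real (coul u u) / 2
    \<le> tot_energy Z u G + (Z + 1/2) * (LINT x|lborel. u x) + Z\<^sup>2 * newton_const"
proof -
  note d = admissibleD[OF g]
  have "Z * (LINT x|lborel. u x / norm x) = (LINT x|lborel. Z * (u x / norm x))"
    by (rule integral_mult_right_zero[symmetric])
  also have "\<dots> \<le> (LINT x|lborel. dwell (u x) / 2 + (Z + 1/2) * u x + Z\<^sup>2 * (indicator (ball 0 1) x * (1 / (norm x)\<^sup>2)))"
    by (intro integral_mono potential_dwell_bound d Z Bochner_Integration.integrable_add integrable_mult_right
        integrable_divide integrable_inverse_square)
  also have "\<dots> = (LINT x|lborel. dwell (u x)) / 2 + (Z + 1/2) * (LINT x|lborel. u x) + Z\<^sup>2 * newton_const"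
    by (subst Bochner_Integration.integral_add,
        (intro Bochner_Integration.integrable_add integrable_mult_right integrable_divide d integrable_inverse_square)+,
        subst Bochner_Integration.integral_add, (intro integrable_mult_right integrable_divide d)+,
        simp only: integral_mult_right_zero integral_divide_zero integrable_inverse_square(2))
  finally show ?thesis by (simp add: tot_energy_def loc_energy_def)
qed

text \<open>\<open>weak_grad u\<close> and \<open>weak_grad v\<close> may be different choices, but
  both agree with \<open>G\<close> almost everywhere.\<close>

lemma energy_cong_AE:
  assumes u: "H1 u G" and [measurable]: "v \<in> borel_measurable borel" and ae: "AE x in lborel. u x = v x"
  shows "H1 v G" "energy Z u = energy Z v"
proof -
  note [measurable] = H1_measurable[OF u]
  show v: "H1 v G" by (rule H1_cong_AE[OF u]) (use ae in auto)
  note [measurable] = H1_weak_grad_measurable[OF u] H1_weak_grad_measurable[OF v]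
  have "(LINT x|lborel. (1/2) * (norm (weak_grad u x))\<^sup>2 + (1/2) * (u x)\<^sup>2 * (1 - u x)\<^sup>2 - V Z x * u x)
      = (LINT x|lborel. (1/2) * (norm (weak_grad v x))\<^sup>2 + (1/2) * (v x)\<^sup>2 * (1 - v x)\<^sup>2 - V Z x * v x)"
  proof (rule integral_cong_AE)
    show "AE x in lborel. (1/2) * (norm (weak_grad u x))\<^sup>2 + (1/2) * (u x)\<^sup>2 * (1 - u x)\<^sup>2 - V Z x * u x
      = (1/2) * (norm (weak_grad v x))\<^sup>2 + (1/2) * (v x)\<^sup>2 * (1 - v x)\<^sup>2 - V Z x * v x"
      using ae H1_weak_grad_AE[OF u] H1_weak_grad_AE[OF v] by eventually_elim simp
  qed (unfold V_def[abs_def], measurable)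
  moreover have "(LINT x|lborel. (LINT y|lborel. u x * u y / norm (x - y)))
      = (LINT x|lborel. (LINT y|lborel. v x * v y / norm (x - y)))"
  proof (rule integral_cong_AE)
    show "AE x in lborel. (LINT y|lborel. u x * u y / norm (x - y)) = (LINT y|lborel. v x * v y / norm (x - y))"
      using ae
    proof eventually_elim
      case (elim x)
      show ?case
        by (rule integral_cong_AE, measurable) (use ae elim in \<open>auto elim!: AE_mp\<close>)
    qed
  qed measurable
  ultimately show "energy Z u = energy Z v" by (simp add: energy_def)
qed

text \<open>By the Sobolev inequality the double well is always integrable. This is not needed: were it
  not, the first Bochner integral in \<^const>\<open>energy\<close> would be 0, and the energy could not beat that of 0.\<close>

lemma junk_energy_nonneg:
  assumes u: "H1 u G" and pos: "\<And>x. 0 \<le> u x" and ng: "\<not> admissible u G" and Z: "0 \<le> Z"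
  shows "0 \<le> energy Z u"
proof -
  note [measurable] = H1_measurable[OF u] H1_weak_grad_measurable[OF u]
  have ni: "\<not> integrable lborel (\<lambda>x. (1/2) * (norm (weak_grad u x))\<^sup>2 + (1/2) * (u x)\<^sup>2 * (1 - u x)\<^sup>2 - V Z x * u x)"
  proof
    assume i: "integrable lborel (\<lambda>x. (1/2) * (norm (weak_grad u x))\<^sup>2 + (1/2) * (u x)\<^sup>2 * (1 - u x)\<^sup>2 - V Z x * u x)"
    \<comment> \<open>\<open>potential_dwell_bound\<close> leaves half of the double well below the
      energy density, hence the factors 2 in this majorant.\<close>
    let ?b = "\<lambda>x. 2 * ((1/2) * (norm (weak_grad u x))\<^sup>2 + (1/2) * (u x)\<^sup>2 * (1 - u x)\<^sup>2 - V Z x * u x)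
        + 2 * ((Z + 1/2) * u x) + 2 * (Z\<^sup>2 * (indicator (ball 0 1) x * (1 / (norm x)\<^sup>2)))"
    have b: "integrable lborel ?b"
      by (intro Bochner_Integration.integrable_add integrable_mult_right i H1_integrable[OF u] integrable_inverse_square)
    have "integrable lborel (\<lambda>x. dwell (u x))"
    proof (rule Bochner_Integration.integrable_bound[OF b])
      have "dwell (u x) \<le> ?b x" for x
      proof -
        have "V Z x * u x = Z * (u x / norm x)" by (simp add: V_def)
        then show ?thesis
          using potential_dwell_bound[OF pos Z, of x x] zero_le_power2[of "norm (weak_grad u x)"]
          unfolding dwell_def[symmetric] by argo
      qed
      then show "AE x in lborel. norm (dwell (u x)) \<le> norm (?b x)"
        using dwell_nonneg by (auto intro!: AE_I2 order_trans[OF _ abs_ge_self])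
    qed measurable
    with ng u pos show False by (simp add: admissible_def)
  qed
  have "0 \<le> (LINT x|lborel. (LINT y|lborel. u x * u y / norm (x - y)))"
    by (intro Bochner_Integration.integral_nonneg divide_nonneg_nonneg mult_nonneg_nonneg pos) auto
  then show ?thesis unfolding energy_def using not_integrable_integral_eq[OF ni] by simp
qed

text \<open>Reduces the minimisation to admissible pairs: the positive part repairs a null set, and
  \<open>junk_energy_nonneg\<close> covers what is not admissible.\<close>

lemma hat_H_representative:
  assumes v: "v \<in> hat_H M" and Z: "0 \<le> Z"
  obtains (junk) "0 \<le> energy Z v"
  | (admissible) u G where "admissible u G" "(LINT x|lborel. u x) = M" "energy Z v = tot_energy Z u G"
proof -
  from v have H: "H1 v (weak_grad v)" and ae: "AE x in lborel. v x \<ge> 0" and M: "L1_norm v = M"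
    using hat_H1_imp_H1 by (auto simp: hat_H_def)
  note [measurable] = H1_measurable[OF H]
  define u where "u x = max 0 (v x)" for x
  have [measurable]: "u \<in> borel_measurable borel" unfolding u_def by measurable
  have uv: "AE x in lborel. v x = u x" using ae by eventually_elim (simp add: u_def)
  have c: "H1 u (weak_grad v)" "energy Z v = energy Z u"
    by (rule energy_cong_AE[OF H _ uv]; measurable)+
  have "(LINT x|lborel. u x) = (LINT x|lborel. \<bar>v x\<bar>)"
    using ae by (intro integral_cong_AE) (auto simp: u_def elim!: AE_mp)
  then have M': "(LINT x|lborel. u x) = M" using M by (simp add: L1_norm_def)
  show thesis
  proof (cases "admissible u (weak_grad v)")
    case True
    show thesis by (rule admissible[OF True M']) (simp add: c(2) energy_admissible[OF True])
  next
    case False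
    have "0 \<le> energy Z u" by (rule junk_energy_nonneg[OF c(1) _ False Z]) (auto simp: u_def)
    then show thesis by (intro junk) (simp add: c(2))
  qed
qed

lemma admissible_hat_H:
  assumes g: "admissible u G" shows "u \<in> hat_H (LINT x|lborel. u x)"
  using H1_imp_hat_H1[OF admissibleD(1)[OF g]] admissibleD(2)[OF g] by (simp add: hat_H_def L1_norm_def)

lemma has_minimizer_iff:
  "has_minimizer Z M \<longleftrightarrow> (\<exists>u\<in>hat_H M. \<forall>v\<in>hat_H M. energy Z u \<le> energy Z v)"
proof -
  have "ereal (energy Z u) = I_inf Z M \<longleftrightarrow> (\<forall>v\<in>hat_H M. energy Z u \<le> energy Z v)" if u: "u \<in> hat_H M" for u
  proof
    assume e: "ereal (energy Z u) = I_inf Z M"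
    show "\<forall>v\<in>hat_H M. energy Z u \<le> energy Z v"
    proof
      fix v assume "v \<in> hat_H M"
      then have "I_inf Z M \<le> ereal (energy Z v)" unfolding I_inf_def by (rule INF_lower)
      then show "energy Z u \<le> energy Z v" by (simp add: e[symmetric])
    qed
  next
    assume "\<forall>v\<in>hat_H M. energy Z u \<le> energy Z v"
    then show "ereal (energy Z u) = I_inf Z M"
      unfolding I_inf_def by (intro antisym INF_greatest INF_lower u) auto
  qed
  then show ?thesis unfolding has_minimizer_def by blast
qed

subsection \<open>Test functions spread over large balls\<close>

lemma dwell_le: assumes "0 \<le> s" shows "dwell s \<le> s\<^sup>2 / 2 + s ^ 4 / 2"
proof -
  have "(1 - s)\<^sup>2 \<le> 1 + s\<^sup>2" using assms by (simp add: power2_diff)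
  then have "s\<^sup>2 * (1 - s)\<^sup>2 \<le> s\<^sup>2 * (1 + s\<^sup>2)" by (intro mult_left_mono) auto
  moreover have "s\<^sup>2 * (1 + s\<^sup>2) = s\<^sup>2 + s ^ 4" by (simp add: distrib_left power2_eq_square power_eq_if)
  ultimately show ?thesis by (simp add: dwell_def)
qed

lemma admissibleI:
  assumes H: "H1 v H" and pos: "\<And>x. 0 \<le> v x"
    and i: "integrable lborel (\<lambda>x. (v x)\<^sup>2)" "integrable lborel (\<lambda>x. (v x) ^ 4)"
  shows "admissible v H"
  unfolding admissible_def
proof (intro conjI allI H pos)
  note [measurable] = H1_measurable[OF H]
  have "integrable lborel (\<lambda>x. (v x)\<^sup>2 / 2 + (v x) ^ 4 / 2)"
    by (intro Bochner_Integration.integrable_add integrable_divide i)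
  then show "integrable lborel (\<lambda>x. dwell (v x))"
    by (rule Bochner_Integration.integrable_bound)
       (use dwell_le[OF pos] dwell_nonneg in \<open>auto intro!: order_trans[OF _ abs_ge_self]\<close>)
qed

text \<open>The double well is not subadditive, so the sum is treated through its second and fourth
  powers.\<close>

lemma admissible_add:
  assumes u: "admissible u G" and v: "admissible v H"
  shows "admissible (\<lambda>x. u x + v x) (\<lambda>x. G x + H x)"
proof (rule admissibleI)
  note du = admissibleD[OF u] and dv = admissibleD[OF v]
  note [measurable] = du(6) dv(6)
  show "H1 (\<lambda>x. u x + v x) (\<lambda>x. G x + H x)" by (intro H1_add du dv)
  show "0 \<le> u x + v x" for x using du(2) dv(2) by (simp add: add_nonneg_nonneg)
  have s: "(a + b)\<^sup>2 \<le> 2 * a\<^sup>2 + 2 * b\<^sup>2" for a b :: real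
    using sum_squares_bound[of a b] by (simp add: power2_sum)
  have f: "(a + b) ^ 4 \<le> 8 * a ^ 4 + 8 * b ^ 4" for a b :: real
  proof -
    have "(a + b) ^ 4 = ((a + b)\<^sup>2)\<^sup>2" by (simp add: power_mult[symmetric])
    also have "\<dots> \<le> (2 * a\<^sup>2 + 2 * b\<^sup>2)\<^sup>2" by (intro power_mono s) simp
    also have "\<dots> \<le> 2 * (2 * a\<^sup>2)\<^sup>2 + 2 * (2 * b\<^sup>2)\<^sup>2" by (rule s)
    finally show ?thesis by (simp add: power_mult_distrib power_mult[symmetric])
  qed
  have "integrable lborel (\<lambda>x. 2 * (u x)\<^sup>2 + 2 * (v x)\<^sup>2)"
    by (intro Bochner_Integration.integrable_add integrable_mult_right du dv)
  then show "integrable lborel (\<lambda>x. (u x + v x)\<^sup>2)"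
    by (rule Bochner_Integration.integrable_bound) (use s in \<open>auto intro!: order_trans[OF _ abs_ge_self]\<close>)
  have "integrable lborel (\<lambda>x. 8 * (u x) ^ 4 + 8 * (v x) ^ 4)"
    by (intro Bochner_Integration.integrable_add integrable_mult_right du dv)
  then show "integrable lborel (\<lambda>x. (u x + v x) ^ 4)"
    by (rule Bochner_Integration.integrable_bound) (use f in \<open>auto intro!: order_trans[OF _ abs_ge_self]\<close>)
qed

lemma admissible_Cc:
  assumes \<phi>: "\<phi> \<in> Cc_infinity" "\<And>x. 0 \<le> \<phi> x" shows "admissible \<phi> (grad \<phi>)"
proof (rule admissibleI[OF H1_Cc[OF \<phi>(1)] \<phi>(2)])
  have p: "(\<lambda>x. (\<phi> x) ^ n * \<phi> x) \<in> Cc_infinity" for n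
    by (intro Cc_infinity_smooth_mult smooth_power Cc_infinityD \<phi>)
  show "integrable lborel (\<lambda>x. (\<phi> x)\<^sup>2)" using Cc_infinity_integrable(1)[OF p[of 1]] by (simp add: power2_eq_square)
  show "integrable lborel (\<lambda>x. (\<phi> x) ^ 4)" using Cc_infinity_integrable(1)[OF p[of 3]] by (simp add: power_eq_if mult_ac)
qed

lemma dwell_add:
  "dwell (a + b) = dwell a + dwell b + a * b - 3 * a * b * (a + b) + 2 * a ^ 3 * b + 3 * a\<^sup>2 * b\<^sup>2 + 2 * a * b ^ 3"
  by (simp add: dwell_def power2_eq_square power3_eq_cube algebra_simps add_divide_distrib)

text \<open>Besides \<open>dwell a\<close>, every term kept from \<open>dwell_add\<close> carries a
  factor \<open>s\<close>; the negative term is dropped. Bounding the powers of \<open>a\<close> by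
  the double well, the linear coefficients add up to \<open>1 + 10 + 6 + 2 = 19\<close> and those of
  the well to \<open>10 + 6 = 16\<close>.\<close>

lemma dwell_add_le:
  assumes a: "0 \<le> a" and s: "0 \<le> s" "s \<le> \<kappa>" "\<kappa> \<le> 1"
  shows "dwell (a + s) \<le> dwell a + \<kappa> * (19 * a + 16 * dwell a + s)"
proof -
  have s1: "s \<le> 1" using s by linarith
  have "0 \<le> 3 * a * s * (a + s)" using a s by simp
  moreover have "3 * a\<^sup>2 * s\<^sup>2 \<le> s * (3 * a\<^sup>2)"
    using mult_left_mono[OF mult_left_le[OF s1 s(1)], of "3 * a\<^sup>2"] by (simp add: power2_eq_square mult_ac)
  moreover have "2 * a * s ^ 3 \<le> s * (2 * a)"
  proof -
    have "s ^ 3 \<le> s" using power_le_one[of s 2] s s1 mult_left_le[of "s\<^sup>2" s] by (simp add: power_eq_if power2_eq_square)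
    from mult_left_mono[OF this, of "2 * a"] show ?thesis using a by (simp add: mult_ac)
  qed
  moreover have "dwell s \<le> s * s"
  proof -
    have "s ^ 4 \<le> s ^ 2" using s s1 by (intro power_decreasing) auto
    then show ?thesis using dwell_le[OF s(1)] by (simp add: power2_eq_square)
  qed
  moreover have "2 * a ^ 3 * s = s * (2 * a ^ 3)" "a * s = s * a" by (simp_all add: mult_ac)
  ultimately have "dwell (a + s) \<le> dwell a + s * (a + 2 * a ^ 3 + 3 * a\<^sup>2 + 2 * a + s)"
    unfolding dwell_add distrib_left by linarith
  also have "\<dots> \<le> dwell a + \<kappa> * (a + 2 * a ^ 3 + 3 * a\<^sup>2 + 2 * a + s)"
    using a s by (intro add_left_mono mult_right_mono) auto
  also have "\<dots> \<le> dwell a + \<kappa> * (19 * a + 16 * dwell a + s)"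
    using square_le_dwell[OF a] cube_le_dwell[OF a] s by (intro add_left_mono mult_left_mono) auto
  finally show ?thesis .
qed

text \<open>A dilation that preserves the integral: heights fall like 1 / R^3, the Dirichlet
  integral like 1 / R^5, the attraction by the nucleus and the Coulomb energy like 1 / R.\<close>

definition spread :: "real \<Rightarrow> (real^3 \<Rightarrow> real) \<Rightarrow> real^3 \<Rightarrow> real" where
  "spread R \<phi> x = (1 / R ^ 3) * \<phi> (x /\<^sub>R R)"

lemma integral_lborel_scale:
  assumes [measurable]: "f \<in> borel_measurable borel" and R: "R > 0" and pos: "\<And>x. 0 \<le> f x"
  shows "(LINT x|lborel. f ((x::real^3) /\<^sub>R R)) = R ^ 3 * (LINT x|lborel. f x)"
proof -
  have "(LINT x|lborel. f (x /\<^sub>R R)) = enn2real (\<integral>\<^sup>+x. ennreal (f (x /\<^sub>R R)) \<partial>lborel)"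
    using pos by (intro integral_eq_nn_integral) auto
  also have "(\<integral>\<^sup>+x. ennreal (f (x /\<^sub>R R)) \<partial>lborel) = ennreal (R ^ 3) * (\<integral>\<^sup>+x. ennreal (f x) \<partial>lborel)"
    by (rule nn_integral_lborel_scale) (use R in auto)
  also have "enn2real \<dots> = R ^ 3 * enn2real (\<integral>\<^sup>+x. ennreal (f x) \<partial>lborel)"
    using R by (simp add: enn2real_mult)
  also have "enn2real (\<integral>\<^sup>+x. ennreal (f x) \<partial>lborel) = (LINT x|lborel. f x)"
    using pos by (intro integral_eq_nn_integral[symmetric]) auto
  finally show ?thesis .
qed

lemma spread_Cc:
  assumes \<phi>: "\<phi> \<in> Cc_infinity" and R: "R > 0"
  shows "spread R \<phi> \<in> Cc_infinity" "grad (spread R \<phi>) x = (1 / R ^ 4) *\<^sub>R grad \<phi> (x /\<^sub>R R)"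
proof -
  have a: "(\<lambda>x. \<phi> (inverse R *\<^sub>R x + 0)) \<in> Cc_infinity" by (rule Cc_infinity_affine[OF \<phi>]) (use R in simp)
  show "spread R \<phi> \<in> Cc_infinity"
    using Cc_infinity_cmult[OF a, of "1 / R ^ 3"] by (simp add: spread_def[abs_def])
  have "grad (\<lambda>x. (1 / R ^ 3) * \<phi> (inverse R *\<^sub>R x + 0)) x = (1 / R ^ 3) *\<^sub>R (inverse R *\<^sub>R grad \<phi> (inverse R *\<^sub>R x + 0))"
    using grad_affine[OF Cc_infinityD(1)[OF \<phi>], of "inverse R" 0]
    by (subst grad_mult) (auto simp: grad_const smooth_differentiable Cc_infinityD(1)[OF a, simplified])
  then show "grad (spread R \<phi>) x = (1 / R ^ 4) *\<^sub>R grad \<phi> (x /\<^sub>R R)"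
    by (simp add: spread_def[abs_def] power_eq_if inverse_eq_divide)
qed

text \<open>The substitution \<open>y = R *\<^sub>R z\<close> expresses the potential of the spread
  function by that of \<open>\<phi>\<close> at the rescaled point.\<close>

lemma coul_spread:
  assumes [measurable]: "u \<in> borel_measurable borel" "\<phi> \<in> borel_measurable borel"
    and R: "R > 0" and pos: "\<And>x. 0 \<le> u x" "\<And>x. 0 \<le> \<phi> x"
  shows "coul u (spread R \<phi>) = (\<integral>\<^sup>+x. ennreal (u x / R) * (\<integral>\<^sup>+y. ennreal (\<phi> y / norm (x /\<^sub>R R - y)) \<partial>lborel) \<partial>lborel)"
  unfolding coul_def
proof (intro nn_integral_cong)
  fix x
  let ?g = "\<lambda>z. ennreal (u x * ((1 / R ^ 3) * \<phi> z) / norm (x - R *\<^sub>R z))"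
  have "(\<integral>\<^sup>+y. ennreal (u x * spread R \<phi> y / norm (x - y)) \<partial>lborel) = (\<integral>\<^sup>+y. ?g (y /\<^sub>R R) \<partial>lborel)"
    using R by (simp add: spread_def)
  also have "\<dots> = ennreal (R ^ 3) * (\<integral>\<^sup>+z. ?g z \<partial>lborel)"
    by (rule nn_integral_lborel_scale) (use R in auto)
  also have "\<dots> = (\<integral>\<^sup>+z. ennreal (R ^ 3) * ?g z \<partial>lborel)" by (rule nn_integral_cmult[symmetric]) measurable
  also have "\<dots> = (\<integral>\<^sup>+z. ennreal (u x / R) * ennreal (\<phi> z / norm (x /\<^sub>R R - z)) \<partial>lborel)"
  proof (intro nn_integral_cong)
    fix z
    have "x - R *\<^sub>R z = R *\<^sub>R (x /\<^sub>R R - z)" using R by (simp add: scaleR_diff_right)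
    then have "norm (x - R *\<^sub>R z) = R * norm (x /\<^sub>R R - z)" using R by simp
    then have "R ^ 3 * (u x * ((1 / R ^ 3) * \<phi> z) / norm (x - R *\<^sub>R z)) = (u x / R) * (\<phi> z / norm (x /\<^sub>R R - z))"
      using R by simp
    then show "ennreal (R ^ 3) * ?g z = ennreal (u x / R) * ennreal (\<phi> z / norm (x /\<^sub>R R - z))"
      using R pos by (simp add: ennreal_mult[symmetric])
  qed
  also have "\<dots> = ennreal (u x / R) * (\<integral>\<^sup>+z. ennreal (\<phi> z / norm (x /\<^sub>R R - z)) \<partial>lborel)"
    by (rule nn_integral_cmult) measurable
  finally show "(\<integral>\<^sup>+y. ennreal (u x * spread R \<phi> y / norm (x - y)) \<partial>lborel)
    = ennreal (u x / R) * (\<integral>\<^sup>+y. ennreal (\<phi> y / norm (x /\<^sub>R R - y)) \<partial>lborel)" .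
qed

lemma coul_spread_spread:
  assumes [measurable]: "\<phi> \<in> borel_measurable borel" and R: "R > 0" and pos: "\<And>x. 0 \<le> \<phi> x"
  shows "coul (spread R \<phi>) (spread R \<phi>) = ennreal (1 / R) * coul \<phi> \<phi>"
proof -
  have [measurable]: "spread R \<phi> \<in> borel_measurable borel" unfolding spread_def[abs_def] by measurable
  let ?P = "\<lambda>z. \<integral>\<^sup>+y. ennreal (\<phi> y / norm (z - y)) \<partial>lborel"
  have "coul (spread R \<phi>) (spread R \<phi>) = (\<integral>\<^sup>+x. ennreal (spread R \<phi> x / R) * ?P (x /\<^sub>R R) \<partial>lborel)"
    by (rule coul_spread) (use R pos in \<open>auto simp: spread_def\<close>)
  also have "\<dots> = (\<integral>\<^sup>+x. (\<lambda>z. ennreal ((1 / R ^ 3) * \<phi> z / R) * ?P z) (x /\<^sub>R R) \<partial>lborel)"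
    by (simp add: spread_def)
  also have "\<dots> = ennreal (R ^ 3) * (\<integral>\<^sup>+z. ennreal ((1 / R ^ 3) * \<phi> z / R) * ?P z \<partial>lborel)"
    by (rule nn_integral_lborel_scale) (use R in auto)
  also have "\<dots> = (\<integral>\<^sup>+z. ennreal (R ^ 3) * (ennreal ((1 / R ^ 3) * \<phi> z / R) * ?P z) \<partial>lborel)"
    by (rule nn_integral_cmult[symmetric]) measurable
  also have "\<dots> = (\<integral>\<^sup>+z. ennreal (1 / R) * (ennreal (\<phi> z) * ?P z) \<partial>lborel)"
    using R pos by (simp add: ennreal_mult[symmetric] mult.assoc[symmetric])
  also have "\<dots> = ennreal (1 / R) * (\<integral>\<^sup>+z. ennreal (\<phi> z) * ?P z \<partial>lborel)"
    by (rule nn_integral_cmult) measurable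
  also have "(\<integral>\<^sup>+z. ennreal (\<phi> z) * ?P z \<partial>lborel) = coul \<phi> \<phi>"
    unfolding coul_def using pos
    by (intro nn_integral_cong, subst nn_integral_cmult[symmetric]) (auto simp: ennreal_mult[symmetric])
  finally show ?thesis .
qed

text \<open>A shift of the variable keeps the singularity at the origin and moves the continuous
  \<open>\<phi>\<close> instead; a bounded function on a ball, divided by \<open>norm h\<close>,
  dominates.\<close>

lemma potential_tendsto:
  assumes \<phi>: "\<phi> \<in> Cc_infinity" "\<And>x. 0 \<le> \<phi> x" and z: "z \<longlonglongrightarrow> 0"
  shows "(\<lambda>n. \<integral>\<^sup>+y. ennreal (\<phi> y / norm (z n - y)) \<partial>lborel) \<longlonglongrightarrow> (\<integral>\<^sup>+y. ennreal (\<phi> y / norm y) \<partial>lborel)"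
proof -
  note [measurable] = Cc_infinity_measurable[OF \<phi>(1)]
  obtain B where B: "\<And>x. norm (\<phi> x) \<le> B" using Cc_infinity_bounded(1)[OF \<phi>(1)] unfolding bounded_iff by blast
  have B0: "0 \<le> B" using B[of 0] norm_ge_zero order_trans by blast
  obtain r where r: "\<And>x. \<phi> x \<noteq> 0 \<Longrightarrow> norm x \<le> r"
    using Cc_infinity_bounded_support[OF \<phi>(1)] by (auto simp: bounded_iff)
  obtain d where d: "\<And>n. norm (z n) \<le> d" using convergent_imp_bounded[OF z] by (auto simp: bounded_iff)
  define f where "f h = B * indicator (cball 0 (r + d)) h" for h :: "real^3"
  have [measurable]: "cball (0::real^3) (r + d) \<in> sets borel" by simp
  have [measurable]: "f \<in> borel_measurable borel" unfolding f_def by measurable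
  have tr: "(\<integral>\<^sup>+y. ennreal (\<phi> y / norm (z n - y)) \<partial>lborel) = (\<integral>\<^sup>+h. ennreal (\<phi> (h + z n) / norm h) \<partial>lborel)" for n
    by (subst nn_integral_lborel_translate[symmetric, of _ "z n"]) auto
  have "(\<lambda>n. \<integral>\<^sup>+h. ennreal (\<phi> (h + z n) / norm h) \<partial>lborel) \<longlonglongrightarrow> (\<integral>\<^sup>+h. ennreal (\<phi> h / norm h) \<partial>lborel)"
  proof (rule nn_integral_dominated_convergence[where w="\<lambda>h. ennreal (f h / norm (0 - h))"])
    have c: "emeasure lborel (cball (0::real^3) (r + d)) < \<infinity>" by (rule emeasure_lborel_cball_finite)
    have "integrable lborel f" "integrable lborel (\<lambda>x. (f x)\<^sup>2)"
    proof -
      show "integrable lborel f" unfolding f_def using c by (intro integrable_mult_right integrable_real_indicator) auto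
      have "integrable lborel (\<lambda>x. B\<^sup>2 * indicator (cball (0::real^3) (r + d)) x)"
        using c by (intro integrable_mult_right integrable_real_indicator) auto
      moreover have "(\<lambda>x. (f x)\<^sup>2) = (\<lambda>x. B\<^sup>2 * indicator (cball (0::real^3) (r + d)) x)"
        by (auto simp: f_def indicator_def)
      ultimately show "integrable lborel (\<lambda>x. (f x)\<^sup>2)" by simp
    qed
    then have "L1n f < \<infinity>" "L2n f < \<infinity>" by (auto simp: integrable_iff_bounded)
    then have "L1n f + L2n f + ennreal newton_const < \<infinity>" by (simp add: ennreal_add_less_top)
    then show "(\<integral>\<^sup>+h. ennreal (f h / norm (0 - h)) \<partial>lborel) < \<infinity>"
      by (rule le_less_trans[rotated]) (rule potential_le, auto simp: f_def B0)
    show "AE h in lborel. ennreal (\<phi> (h + z n) / norm h) \<le> ennreal (f h / norm (0 - h))" for n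
    proof (intro AE_I2 ennreal_leI)
      fix h
      have "\<phi> (h + z n) \<le> f h"
      proof (cases "\<phi> (h + z n) = 0")
        case True
        then show ?thesis using B0 by (simp add: f_def)
      next
        case False
        then have "norm (h + z n) \<le> r" by (rule r)
        moreover have "norm h \<le> norm (h + z n) + norm (z n)" using norm_triangle_ineq4[of "h + z n" "z n"] by simp
        ultimately have "h \<in> cball 0 (r + d)" using d[of n] by simp
        then show ?thesis using B[of "h + z n"] \<phi>(2) by (simp add: f_def)
      qed
      then show "\<phi> (h + z n) / norm h \<le> f h / norm (0 - h)" by (simp add: divide_right_mono)
    qed
    show "AE h in lborel. (\<lambda>n. ennreal (\<phi> (h + z n) / norm h)) \<longlonglongrightarrow> ennreal (\<phi> h / norm h)"
    proof (rule AE_I2)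
      fix h :: "real^3"
      have "(\<lambda>n. h + z n) \<longlonglongrightarrow> h + 0" by (intro tendsto_add tendsto_const z)
      then have "(\<lambda>n. \<phi> (h + z n)) \<longlonglongrightarrow> \<phi> h"
        using continuous_on_tendsto_compose[OF Cc_infinity_continuous(1)[OF \<phi>(1), of UNIV]] by simp
      then show "(\<lambda>n. ennreal (\<phi> (h + z n) / norm h)) \<longlonglongrightarrow> ennreal (\<phi> h / norm h)"
        unfolding divide_inverse by (intro tendsto_ennrealI tendsto_mult tendsto_const)
    qed
  qed measurable
  then show ?thesis unfolding tr .
qed

text \<open>On the scale \<open>R\<close> the mass of \<open>u\<close> concentrates at the origin,
  so to leading order it acts like a point charge there, as the nucleus does with the opposite sign.
  This is how the difference of mass and \<open>Z\<close> arises.\<close>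

lemma coul_spread_tendsto:
  assumes u: "admissible u G" and \<phi>: "\<phi> \<in> Cc_infinity" "\<And>x. 0 \<le> \<phi> x"
  defines "R \<equiv> \<lambda>n. real (Suc n)"
  shows "(\<lambda>n. R n * enn2real (coul u (spread (R n) \<phi>)))
    \<longlonglongrightarrow> (LINT x|lborel. u x) * (LINT x|lborel. \<phi> x / norm x)"
proof -
  note d = admissibleD[OF u] and gp = admissible_Cc[OF \<phi>]
  note dp = admissibleD[OF gp]
  note [measurable] = d(6) Cc_infinity_measurable[OF \<phi>(1)]
  let ?P = "\<lambda>z. \<integral>\<^sup>+y. ennreal (\<phi> y / norm (z - y)) \<partial>lborel"
  define Pm where "Pm = (LINT x|lborel. \<phi> x) + (LINT x|lborel. (\<phi> x)\<^sup>2) + newton_const"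
  have Pm: "?P z \<le> ennreal Pm" "0 \<le> Pm" for z
  proof -
    have i: "0 \<le> (LINT x|lborel. \<phi> x)" "0 \<le> (LINT x|lborel. (\<phi> x)\<^sup>2)"
      using \<phi>(2) by (auto intro!: Bochner_Integration.integral_nonneg)
    then show "0 \<le> Pm" using newton_const(1) by (simp add: Pm_def)
    have "?P z \<le> L1n \<phi> + L2n \<phi> + ennreal newton_const" by (rule potential_le) (use \<phi>(2) in auto)
    also have "\<dots> = ennreal Pm"
      unfolding Pm_def admissible_L1n[OF gp] admissible_L2n[OF gp] using i newton_const(1) by simp
    finally show "?P z \<le> ennreal Pm" .
  qed
  have R: "R n > 0" for n by (simp add: R_def)
  have P0: "(\<integral>\<^sup>+y. ennreal (\<phi> y / norm y) \<partial>lborel) = ennreal (LINT x|lborel. \<phi> x / norm x)"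
    by (rule nn_integral_eq_integral[OF dp(11)]) (use \<phi>(2) in auto)
  have p0: "0 \<le> (LINT x|lborel. \<phi> x / norm x)" using \<phi>(2) by (intro Bochner_Integration.integral_nonneg) auto
  have m0: "0 \<le> (LINT x|lborel. u x)" using d(2) by (intro Bochner_Integration.integral_nonneg) auto
  have iu: "(\<integral>\<^sup>+x. ennreal (u x) \<partial>lborel) = ennreal (LINT x|lborel. u x)"
    by (rule nn_integral_eq_integral[OF d(4)]) (use d(2) in auto)
  have "(\<lambda>n. \<integral>\<^sup>+x. ennreal (u x) * ?P (x /\<^sub>R R n) \<partial>lborel)
      \<longlonglongrightarrow> (\<integral>\<^sup>+x. ennreal (u x) * (\<integral>\<^sup>+y. ennreal (\<phi> y / norm y) \<partial>lborel) \<partial>lborel)"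
  proof (rule nn_integral_dominated_convergence[where w="\<lambda>x. ennreal (u x) * ennreal Pm"])
    show "(\<integral>\<^sup>+x. ennreal (u x) * ennreal Pm \<partial>lborel) < \<infinity>"
      by (subst nn_integral_multc) (auto simp: iu ennreal_mult_less_top)
    show "AE x in lborel. ennreal (u x) * ?P (x /\<^sub>R R n) \<le> ennreal (u x) * ennreal Pm" for n
      by (intro AE_I2 mult_left_mono Pm) simp
    show "AE x in lborel. (\<lambda>n. ennreal (u x) * ?P (x /\<^sub>R R n)) \<longlonglongrightarrow> ennreal (u x) * (\<integral>\<^sup>+y. ennreal (\<phi> y / norm y) \<partial>lborel)"
    proof (intro AE_I2 ennreal_tendsto_cmult potential_tendsto \<phi>)
      fix x :: "real^3"
      have "(\<lambda>n. inverse (real (Suc n))) \<longlonglongrightarrow> 0" by (rule LIMSEQ_inverse_real_of_nat)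
      from tendsto_scaleR[OF this tendsto_const[of x]] show "(\<lambda>n. x /\<^sub>R R n) \<longlonglongrightarrow> 0" by (simp add: R_def)
    qed simp
  qed measurable
  also have "(\<integral>\<^sup>+x. ennreal (u x) * (\<integral>\<^sup>+y. ennreal (\<phi> y / norm y) \<partial>lborel) \<partial>lborel)
      = ennreal ((LINT x|lborel. u x) * (LINT x|lborel. \<phi> x / norm x))"
    by (subst nn_integral_multc) (auto simp: iu P0 ennreal_mult m0 p0)
  finally have "(\<lambda>n. enn2real (\<integral>\<^sup>+x. ennreal (u x) * ?P (x /\<^sub>R R n) \<partial>lborel))
      \<longlonglongrightarrow> (LINT x|lborel. u x) * (LINT x|lborel. \<phi> x / norm x)"
    by (rule tendsto_enn2real) (simp add: m0 p0)
  moreover have "enn2real (\<integral>\<^sup>+x. ennreal (u x) * ?P (x /\<^sub>R R n) \<partial>lborel) = R n * enn2real (coul u (spread (R n) \<phi>))" for n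
  proof -
    have "coul u (spread (R n) \<phi>) = (\<integral>\<^sup>+x. ennreal (1 / R n) * (ennreal (u x) * ?P (x /\<^sub>R R n)) \<partial>lborel)"
      using R[of n] d(2) \<phi>(2)
      by (subst coul_spread) (auto simp: ennreal_mult[symmetric] mult.assoc[symmetric] intro!: nn_integral_cong)
    also have "\<dots> = ennreal (1 / R n) * (\<integral>\<^sup>+x. ennreal (u x) * ?P (x /\<^sub>R R n) \<partial>lborel)"
      by (rule nn_integral_cmult) measurable
    finally show ?thesis using R[of n] by (simp add: enn2real_mult)
  qed
  ultimately show ?thesis by simp
qed

lemma norm_add_square_le:
  fixes a b :: "real^3"
  assumes "\<delta> > 0"
  shows "(norm (a + b))\<^sup>2 \<le> (1 + \<delta>) * (norm a)\<^sup>2 + (1 + 1 / \<delta>) * (norm b)\<^sup>2"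
proof -
  have "(norm (a + b))\<^sup>2 \<le> (norm a + norm b)\<^sup>2" by (intro power_mono norm_triangle_ineq) simp
  also have "\<dots> = (norm a)\<^sup>2 + (norm b)\<^sup>2 + 2 * (sqrt \<delta> * norm a) * (norm b / sqrt \<delta>)"
    using assms by (simp add: power2_sum)
  also have "2 * (sqrt \<delta> * norm a) * (norm b / sqrt \<delta>) \<le> (sqrt \<delta> * norm a)\<^sup>2 + (norm b / sqrt \<delta>)\<^sup>2"
    by (rule sum_squares_bound)
  also have "\<dots> = \<delta> * (norm a)\<^sup>2 + (norm b)\<^sup>2 / \<delta>" using assms by (simp add: power_mult_distrib power_divide)
  finally show ?thesis by (simp add: algebra_simps)
qed

text \<open>Only the attraction and the two Coulomb terms are of order 1 / R; the changes of the
  gradient term and of the double well are bounded by multiples of 1 / R^2 and 1 / R^3.\<close>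

lemma spread_energy:
  assumes u: "admissible u G" and \<phi>: "\<phi> \<in> Cc_infinity" "\<And>x. 0 \<le> \<phi> x" and B: "\<And>x. \<phi> x \<le> B"
    and R: "R \<ge> 1" "B / R ^ 3 \<le> 1" and Z: "0 \<le> Z"
  defines "u' \<equiv> \<lambda>x. u x + spread R \<phi> x" and "G' \<equiv> \<lambda>x. G x + grad (spread R \<phi>) x"
  shows "admissible u' G'" "(LINT x|lborel. u' x) = (LINT x|lborel. u x) + (LINT x|lborel. \<phi> x)"
    "tot_energy Z u' G' \<le> tot_energy Z u G
      + ((LINT x|lborel. (norm (G x))\<^sup>2) / 2 + (LINT x|lborel. (norm (grad \<phi> x))\<^sup>2)) / R\<^sup>2
      + (B / R ^ 3) * (19 * (LINT x|lborel. u x) + 16 * (LINT x|lborel. dwell (u x)) + (LINT x|lborel. \<phi> x))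
      - Z * (LINT x|lborel. \<phi> x / norm x) / R + enn2real (coul u (spread R \<phi>)) + enn2real (coul \<phi> \<phi>) / (2 * R)"
proof -
  have R0: "R > 0" using R by simp
  note sc = spread_Cc[OF \<phi>(1) R0]
  have sp: "0 \<le> spread R \<phi> x" for x using R0 \<phi>(2) by (simp add: spread_def)
  have gs: "admissible (spread R \<phi>) (grad (spread R \<phi>))" by (rule admissible_Cc[OF sc(1) sp])
  have gp: "admissible \<phi> (grad \<phi>)" by (rule admissible_Cc[OF \<phi>])
  show g': "admissible u' G'" unfolding u'_def G'_def by (rule admissible_add[OF u gs])
  note d = admissibleD[OF u] and ds = admissibleD[OF gs] and dp = admissibleD[OF gp] and d' = admissibleD[OF g']
  note [measurable] = d(6,7) ds(6,7) dp(6,7)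
  have isp: "(LINT x|lborel. spread R \<phi> x) = (LINT x|lborel. \<phi> x)"
    using R0 integral_lborel_scale[OF dp(6) R0 \<phi>(2)] unfolding spread_def by simp
  show "(LINT x|lborel. u' x) = (LINT x|lborel. u x) + (LINT x|lborel. \<phi> x)"
    unfolding u'_def using d(4) ds(4) by (simp add: isp)
  have ig: "(LINT x|lborel. (norm (grad (spread R \<phi>) x))\<^sup>2) = (LINT x|lborel. (norm (grad \<phi> x))\<^sup>2) / R ^ 5"
  proof -
    have "(LINT x|lborel. (norm (grad (spread R \<phi>) x))\<^sup>2) = (LINT x|lborel. (1 / R ^ 8) * (\<lambda>z. (norm (grad \<phi> z))\<^sup>2) (x /\<^sub>R R))"
      using R0 by (simp add: sc(2) power_mult_distrib power_divide power_mult[symmetric])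
    also have "\<dots> = (1 / R ^ 8) * (LINT x|lborel. (\<lambda>z. (norm (grad \<phi> z))\<^sup>2) (x /\<^sub>R R))"
      by (rule integral_mult_right_zero)
    also have "\<dots> = (1 / R ^ 8) * (R ^ 3 * (LINT x|lborel. (norm (grad \<phi> x))\<^sup>2))"
      by (subst integral_lborel_scale) (use R0 in auto)
    also have "\<dots> = (LINT x|lborel. (norm (grad \<phi> x))\<^sup>2) / R ^ 5" using R0 by (simp add: power_eq_if)
    finally show ?thesis .
  qed
  have ip: "(LINT x|lborel. spread R \<phi> x / norm x) = (LINT x|lborel. \<phi> x / norm x) / R"
  proof -
    have "(LINT x|lborel. spread R \<phi> x / norm x) = (LINT x|lborel. (1 / R ^ 4) * (\<lambda>z. \<phi> z / norm z) (x /\<^sub>R R))"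
      using R0 by (intro Bochner_Integration.integral_cong) (auto simp: spread_def power_eq_if field_simps)
    also have "\<dots> = (1 / R ^ 4) * (LINT x|lborel. (\<lambda>z. \<phi> z / norm z) (x /\<^sub>R R))"
      by (rule integral_mult_right_zero)
    also have "\<dots> = (1 / R ^ 4) * (R ^ 3 * (LINT x|lborel. \<phi> x / norm x))"
      by (subst integral_lborel_scale) (use R0 \<phi>(2) in auto)
    also have "\<dots> = (LINT x|lborel. \<phi> x / norm x) / R" using R0 by (simp add: power_eq_if)
    finally show ?thesis .
  qed
  let ?g = "LINT x|lborel. (norm (G x))\<^sup>2" and ?h = "LINT x|lborel. (norm (grad \<phi> x))\<^sup>2"
  \<comment> \<open>Young's inequality with weight \<open>1 / R\<^sup>2\<close>: the Dirichlet
    integral of the spread function is of order 1 / R^5, so the factor \<open>1 + R\<^sup>2\<close>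
    is affordable.\<close>
  have "(LINT x|lborel. (norm (G' x))\<^sup>2)
      \<le> (LINT x|lborel. (1 + 1 / R\<^sup>2) * (norm (G x))\<^sup>2 + (1 + 1 / (1 / R\<^sup>2)) * (norm (grad (spread R \<phi>) x))\<^sup>2)"
    unfolding G'_def using R0
    by (intro integral_mono norm_add_square_le d'[unfolded G'_def] Bochner_Integration.integrable_add
        integrable_mult_right d ds) auto
  also have "\<dots> = (1 + 1 / R\<^sup>2) * ?g + (1 + R\<^sup>2) * (?h / R ^ 5)"
    using d(5) ds(5) by (simp add: ig)
  also have "(1 + R\<^sup>2) * (?h / R ^ 5) \<le> 2 * ?h / R\<^sup>2"
  proof -
    have "1 \<le> R\<^sup>2" "1 \<le> R" using R by (simp_all add: one_le_power)
    then have "(1 + R\<^sup>2) * 1 \<le> (2 * R\<^sup>2) * R" using R0 by (intro mult_mono) auto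
    then have "(1 + R\<^sup>2) / R ^ 5 \<le> (2 * R\<^sup>2) * R / R ^ 5" using R0 by (intro divide_right_mono) auto
    also have "(2 * R\<^sup>2) * R / R ^ 5 = 2 / R\<^sup>2" using R0 by (simp add: power_eq_if)
    finally have "((1 + R\<^sup>2) / R ^ 5) * ?h \<le> (2 / R\<^sup>2) * ?h" by (intro mult_right_mono) auto
    then show ?thesis by simp
  qed
  finally have "(LINT x|lborel. (norm (G' x))\<^sup>2) \<le> (1 + 1 / R\<^sup>2) * ?g + 2 * ?h / R\<^sup>2" by simp
  moreover have "(1 + 1 / R\<^sup>2) * ?g = ?g + ?g / R\<^sup>2" "2 * ?h / R\<^sup>2 = 2 * (?h / R\<^sup>2)"
    "(?g / 2 + ?h) / R\<^sup>2 = (?g / R\<^sup>2) / 2 + ?h / R\<^sup>2"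
    by (simp_all add: distrib_right add_divide_distrib)
  ultimately have 1: "(LINT x|lborel. (norm (G' x))\<^sup>2) / 2 \<le> ?g / 2 + (?g / 2 + ?h) / R\<^sup>2" by argo
  have "(LINT x|lborel. dwell (u' x))
      \<le> (LINT x|lborel. dwell (u x) + (B / R ^ 3) * (19 * u x + 16 * dwell (u x) + spread R \<phi> x))"
  proof (rule integral_mono[OF d'(3)])
    show "integrable lborel (\<lambda>x. dwell (u x) + (B / R ^ 3) * (19 * u x + 16 * dwell (u x) + spread R \<phi> x))"
      by (intro Bochner_Integration.integrable_add integrable_mult_right d ds)
    show "dwell (u' x) \<le> dwell (u x) + (B / R ^ 3) * (19 * u x + 16 * dwell (u x) + spread R \<phi> x)" for x
      unfolding u'_def
    proof (rule dwell_add_le[OF d(2) sp _ R(2)])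
      show "spread R \<phi> x \<le> B / R ^ 3" using B[of "x /\<^sub>R R"] R0 by (simp add: spread_def divide_right_mono)
    qed
  qed
  also have "\<dots> = (LINT x|lborel. dwell (u x))
      + (B / R ^ 3) * (19 * (LINT x|lborel. u x) + 16 * (LINT x|lborel. dwell (u x)) + (LINT x|lborel. \<phi> x))"
    using d(3,4) ds(4) by (simp add: isp)
  finally have 2: "(LINT x|lborel. dwell (u' x)) \<le> \<dots>" .
  have 3: "(LINT x|lborel. u' x / norm x) = (LINT x|lborel. u x / norm x) + (LINT x|lborel. \<phi> x / norm x) / R"
    unfolding u'_def using d(11) ds(11) by (simp add: add_divide_distrib ip)
  have "coul u' u' = coul u u + 2 * coul u (spread R \<phi>) + coul (spread R \<phi>) (spread R \<phi>)"
    unfolding u'_def by (rule coul_add) (use d(2) sp in auto)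
  then have 4: "enn2real (coul u' u') = enn2real (coul u u) + 2 * enn2real (coul u (spread R \<phi>)) + enn2real (coul \<phi> \<phi>) / R"
    using admissible_coul_finite[OF u u] admissible_coul_finite[OF u gs] admissible_coul_finite[OF gp gp] R0
    by (simp add: coul_spread_spread[OF dp(6) R0 \<phi>(2)] enn2real_plus enn2real_mult ennreal_mult_less_top ennreal_add_less_top)
  have "Z * (LINT x|lborel. u' x / norm x) = Z * (LINT x|lborel. u x / norm x) + Z * (LINT x|lborel. \<phi> x / norm x) / R"
    unfolding 3 by (simp add: distrib_left)
  moreover have "enn2real (coul \<phi> \<phi>) / R / 2 = enn2real (coul \<phi> \<phi>) / (2 * R)" by simp
  ultimately show "tot_energy Z u' G' \<le> tot_energy Z u G + (?g / 2 + ?h) / R\<^sup>2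
      + (B / R ^ 3) * (19 * (LINT x|lborel. u x) + 16 * (LINT x|lborel. dwell (u x)) + (LINT x|lborel. \<phi> x))
      - Z * (LINT x|lborel. \<phi> x / norm x) / R + enn2real (coul u (spread R \<phi>)) + enn2real (coul \<phi> \<phi>) / (2 * R)"
    using 1 2 4 unfolding tot_energy_def loc_energy_def by argo
qed

subsection \<open>Minimisers of the relaxed problem\<close>

lemma smooth_cutoff:
  obtains \<eta> where "\<eta> \<in> Cc_infinity" "\<eta> 0 = 1" "\<forall>x. 0 \<le> \<eta> x \<and> \<eta> x \<le> 1 \<and> (1 \<le> norm x \<longrightarrow> \<eta> x = 0)"
proof -
  \<comment> \<open>The factor \<open>exp 1\<close> normalises the value at 0, where
    \<open>flat_exp 1 1 = exp (- 1)\<close>.\<close>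
  define \<eta> where "\<eta> x = exp 1 * flat_exp 1 (1 - x \<bullet> x)" for x :: "real^3"
  have "smooth \<eta>"
    unfolding \<eta>_def inner_vec_def sum_3 inner_real_def
    by (intro smooth_cmult smooth_flat_exp smooth_diff smooth_add smooth_mult smooth_coord smooth_const)
  have z: "\<eta> x = 0" if "norm x \<ge> 1" for x
  proof -
    have "1 \<le> x \<bullet> x" using one_le_power[OF that, of 2] by (simp add: power2_norm_eq_inner)
    then show ?thesis by (simp add: \<eta>_def flat_exp_def)
  qed
  show thesis
  proof (rule that[of \<eta>])
    show "\<eta> \<in> Cc_infinity"
      by (rule Cc_infinityI[OF \<open>smooth \<eta>\<close> _ bounded_cball[of 0 1]]) (use z in force)
    have "0 \<le> \<eta> x" for x by (simp add: \<eta>_def flat_exp_1)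
    moreover have "\<eta> x \<le> 1" for x
    proof (cases "1 - x \<bullet> x > 0")
      case True
      then have "1 \<le> 1 / (1 - x \<bullet> x)" by simp
      then show ?thesis using True by (simp add: \<eta>_def flat_exp_def exp_minus field_simps)
    qed (simp add: \<eta>_def flat_exp_def)
    ultimately show "\<forall>x. 0 \<le> \<eta> x \<and> \<eta> x \<le> 1 \<and> (1 \<le> norm x \<longrightarrow> \<eta> x = 0)" using z by blast
    show "\<eta> 0 = 1" by (simp add: \<eta>_def flat_exp_def exp_minus)
  qed
qed

lemma ennreal_lincomb:
  "0 \<le> a \<Longrightarrow> 0 \<le> b \<Longrightarrow> 0 \<le> c \<Longrightarrow> 0 \<le> d \<Longrightarrow> ennreal a * ennreal b + ennreal c * ennreal d = ennreal (a * b + c * d)"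
  by (simp add: ennreal_mult)

text \<open>The convergence is only local, so cutoffs of scale \<open>Suc N\<close> come before
  \<open>H1_weak_closed\<close>. Young's inequality with a small \<open>\<delta>\<close> renders the
  gradient of the cutoff harmless while the constant \<open>K\<close> stays sharp, as lower
  semicontinuity of the Dirichlet integral demands.\<close>

lemma H1_local_limit:
  assumes u: "\<And>n. H1 (u n) (G n)" and S: "\<And>n. L2n (u n) \<le> ennreal S" "S \<ge> 0"
    and K: "\<And>n. L2n (G n) \<le> ennreal K" "K \<ge> 0"
    and [measurable]: "w \<in> borel_measurable borel" and w: "L1n w < \<infinity>"
    and lim: "\<And>N. (\<lambda>n. \<integral>\<^sup>+x. indicator (ball 0 (real N)) x * ennreal (norm (u n x - w x)) \<partial>lborel) \<longlonglongrightarrow> 0"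
  shows "H1 w (weak_grad w)" "L2n (weak_grad w) \<le> ennreal K"
proof -
  obtain \<eta> where \<eta>': "\<eta> \<in> Cc_infinity" "\<eta> 0 = 1" "\<forall>x. 0 \<le> \<eta> x \<and> \<eta> x \<le> 1 \<and> (1 \<le> norm x \<longrightarrow> \<eta> x = 0)"
    by (rule smooth_cutoff)
  then have \<eta>: "\<eta> \<in> Cc_infinity" "0 \<le> \<eta> x" "\<eta> x \<le> 1" "\<eta> 0 = 1" "norm x \<ge> 1 \<Longrightarrow> \<eta> x = 0" for x by blast+
  obtain b where b: "\<And>x. norm (grad \<eta> x) \<le> b" using Cc_infinity_bounded(2)[OF \<eta>(1)] unfolding bounded_iff by blast
  have b0: "0 \<le> b" using b[of 0] norm_ge_zero order_trans by blast
  define c where "c N x = \<eta> (x /\<^sub>R real (Suc N))" for N x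
  have cC: "c N \<in> Cc_infinity" for N
    using Cc_infinity_affine[OF \<eta>(1), of "inverse (real (Suc N))" 0] by (simp add: c_def[abs_def])
  note [measurable] = H1_measurable[OF u] Cc_infinity_measurable[OF cC]
  have gc: "norm (grad (c N) x) \<le> b / real (Suc N)" for N x
  proof -
    have "grad (c N) x = inverse (real (Suc N)) *\<^sub>R grad \<eta> (x /\<^sub>R real (Suc N))"
      using grad_affine[OF Cc_infinityD(1)[OF \<eta>(1)], of "inverse (real (Suc N))" 0] by (simp add: c_def[abs_def])
    then have "norm (grad (c N) x) = norm (grad \<eta> (x /\<^sub>R real (Suc N))) / real (Suc N)" by (simp add: inverse_eq_divide)
    then show ?thesis using b by (simp add: divide_right_mono)
  qed
  have c01: "\<bar>c N x\<bar> \<le> 1" for N x using \<eta> by (simp add: c_def)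
  have cut: "\<exists>F. H1 (\<lambda>x. c N x * w x) F \<and> L2n F \<le> ennreal ((1 + \<delta>) * K + (1 + 1 / \<delta>) * ((b / real (Suc N))\<^sup>2 * S))"
    if \<delta>: "\<delta> > 0" for N \<delta>
  proof -
    let ?K = "(1 + \<delta>) * K + (1 + 1 / \<delta>) * ((b / real (Suc N))\<^sup>2 * S)"
    have K0: "0 \<le> ?K" using \<delta> K S by simp
    have H: "H1 (\<lambda>x. c N x * u n x) (\<lambda>x. c N x *\<^sub>R G n x + u n x *\<^sub>R grad (c N) x)" for n
      by (rule H1_mult_smooth[OF u Cc_infinityD(1)[OF cC], of _ "max 1 (b / real (Suc N))"])
         (rule order_trans[OF c01 max.cobounded1], rule order_trans[OF gc max.cobounded2])
    have l: "(\<lambda>n. L1n (\<lambda>x. c N x * w x - c N x * u n x)) \<longlonglongrightarrow> 0"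
    proof (rule tendsto_sandwich[OF always_eventually always_eventually tendsto_const lim[of "Suc N"]], safe)
      fix n
      show "L1n (\<lambda>x. c N x * w x - c N x * u n x)
          \<le> (\<integral>\<^sup>+x. indicator (ball 0 (real (Suc N))) x * ennreal (norm (u n x - w x)) \<partial>lborel)"
      proof (intro nn_integral_mono)
        fix x
        show "ennreal \<bar>c N x * w x - c N x * u n x\<bar> \<le> indicator (ball 0 (real (Suc N))) x * ennreal (norm (u n x - w x))"
        proof (cases "norm x < real (Suc N)")
          case True
          have "\<bar>c N x * w x - c N x * u n x\<bar> = \<bar>c N x\<bar> * \<bar>u n x - w x\<bar>"
            by (simp add: right_diff_distrib[symmetric] abs_mult abs_minus_commute)
          also have "\<dots> \<le> 1 * \<bar>u n x - w x\<bar>" by (intro mult_right_mono c01) simp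
          finally show ?thesis using True by (simp add: ennreal_leI)
        next
          case False
          then have "c N x = 0" unfolding c_def by (intro \<eta>(5)) (simp add: field_simps)
          then show ?thesis by simp
        qed
      qed
    qed simp
    have le: "L2n (\<lambda>x. c N x *\<^sub>R G n x + u n x *\<^sub>R grad (c N) x) \<le> ennreal ?K" for n
    proof -
      have pw: "(norm (c N x *\<^sub>R G n x + u n x *\<^sub>R grad (c N) x))\<^sup>2
          \<le> (1 + \<delta>) * (norm (G n x))\<^sup>2 + (1 + 1 / \<delta>) * ((b / real (Suc N))\<^sup>2 * (norm (u n x))\<^sup>2)" for x
      proof -
        have "(norm (c N x *\<^sub>R G n x))\<^sup>2 \<le> (norm (G n x))\<^sup>2"
          using c01[of N x] by (intro power_mono) (auto intro: mult_left_le_one_le)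
        moreover have "(norm (u n x *\<^sub>R grad (c N) x))\<^sup>2 \<le> (b / real (Suc N))\<^sup>2 * (norm (u n x))\<^sup>2"
          unfolding power_mult_distrib[symmetric] using mult_right_mono[OF gc[of N x], of "\<bar>u n x\<bar>"]
          by (intro power_mono) (simp_all add: mult.commute)
        ultimately have "(1 + \<delta>) * (norm (c N x *\<^sub>R G n x))\<^sup>2 + (1 + 1 / \<delta>) * (norm (u n x *\<^sub>R grad (c N) x))\<^sup>2
          \<le> (1 + \<delta>) * (norm (G n x))\<^sup>2 + (1 + 1 / \<delta>) * ((b / real (Suc N))\<^sup>2 * (norm (u n x))\<^sup>2)"
          using \<delta> by (intro add_mono mult_left_mono) auto
        then show ?thesis using norm_add_square_le[OF \<delta>] order_trans by blast
      qed
      have "L2n (\<lambda>x. c N x *\<^sub>R G n x + u n x *\<^sub>R grad (c N) x)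
          \<le> (\<integral>\<^sup>+x. ennreal (1 + \<delta>) * ennreal ((norm (G n x))\<^sup>2)
            + ennreal ((1 + 1 / \<delta>) * (b / real (Suc N))\<^sup>2) * ennreal ((norm (u n x))\<^sup>2) \<partial>lborel)"
      proof (intro nn_integral_mono)
        fix x
        have "ennreal (1 + \<delta>) * ennreal ((norm (G n x))\<^sup>2) + ennreal ((1 + 1 / \<delta>) * (b / real (Suc N))\<^sup>2) * ennreal ((norm (u n x))\<^sup>2)
          = ennreal ((1 + \<delta>) * (norm (G n x))\<^sup>2 + (1 + 1 / \<delta>) * ((b / real (Suc N))\<^sup>2 * (norm (u n x))\<^sup>2))"
          using \<delta> by (subst ennreal_lincomb) (simp_all only: mult.assoc, simp_all)
        then show "ennreal ((norm (c N x *\<^sub>R G n x + u n x *\<^sub>R grad (c N) x))\<^sup>2) \<le> ennreal (1 + \<delta>) * ennreal ((norm (G n x))\<^sup>2)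
            + ennreal ((1 + 1 / \<delta>) * (b / real (Suc N))\<^sup>2) * ennreal ((norm (u n x))\<^sup>2)"
          using ennreal_leI[OF pw[of x]] by simp
      qed
      also have "\<dots> = ennreal (1 + \<delta>) * L2n (G n) + ennreal ((1 + 1 / \<delta>) * (b / real (Suc N))\<^sup>2) * L2n (u n)"
        by (subst nn_integral_add, measurable, subst (1 2) nn_integral_cmult, measurable)
      also have "\<dots> \<le> ennreal (1 + \<delta>) * ennreal K + ennreal ((1 + 1 / \<delta>) * (b / real (Suc N))\<^sup>2) * ennreal S"
        by (intro add_mono mult_left_mono K S) auto
      also have "\<dots> = ennreal ?K"
        using \<delta> K S by (subst ennreal_lincomb) (simp_all only: mult.assoc, simp_all)
      finally show ?thesis .
    qed
    show ?thesis
      by (rule H1_weak_closed[OF H _ l le K0]) auto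
  qed
  have c1: "(\<lambda>N. c N x) \<longlonglongrightarrow> 1" for x
  proof -
    have "(\<lambda>N. inverse (real (Suc N)) *\<^sub>R x) \<longlonglongrightarrow> 0 *\<^sub>R x"
      by (intro tendsto_scaleR tendsto_const LIMSEQ_inverse_real_of_nat)
    then have "(\<lambda>N. \<eta> (inverse (real (Suc N)) *\<^sub>R x)) \<longlonglongrightarrow> \<eta> (0 *\<^sub>R x)"
      by (intro continuous_on_tendsto_compose[OF Cc_infinity_continuous(1)[OF \<eta>(1), of UNIV]]) auto
    then show ?thesis using \<eta>(4) by (simp add: c_def)
  qed
  have lw: "(\<lambda>N. L1n (\<lambda>x. w x - c N x * w x)) \<longlonglongrightarrow> 0"
  proof -
    have "(\<lambda>N. L1n (\<lambda>x. w x - c N x * w x)) \<longlonglongrightarrow> (\<integral>\<^sup>+x. 0 \<partial>(lborel :: (real^3) measure))"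
    proof (rule nn_integral_dominated_convergence[where w="\<lambda>x. 2 * ennreal \<bar>w x\<bar>"])
      show "(\<integral>\<^sup>+x. 2 * ennreal \<bar>w x\<bar> \<partial>lborel) < \<infinity>"
        using w by (subst nn_integral_cmult) (auto simp: ennreal_mult_less_top)
      show "AE x in lborel. ennreal \<bar>w x - c N x * w x\<bar> \<le> 2 * ennreal \<bar>w x\<bar>" for N
      proof (rule AE_I2)
        fix x
        have "\<bar>w x - c N x * w x\<bar> = \<bar>1 - c N x\<bar> * \<bar>w x\<bar>" by (simp add: abs_mult[symmetric] left_diff_distrib)
        also have "\<dots> \<le> 2 * \<bar>w x\<bar>" using c01[of N x] by (intro mult_right_mono) auto
        finally show "ennreal \<bar>w x - c N x * w x\<bar> \<le> 2 * ennreal \<bar>w x\<bar>"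
          by (simp add: ennreal_mult[symmetric] ennreal_numeral[symmetric] ennreal_leI del: ennreal_numeral)
      qed
      show "AE x in lborel. (\<lambda>N. ennreal \<bar>w x - c N x * w x\<bar>) \<longlonglongrightarrow> 0"
      proof (rule AE_I2)
        fix x
        have "(\<lambda>N. ennreal \<bar>w x - c N x * w x\<bar>) \<longlonglongrightarrow> ennreal \<bar>w x - 1 * w x\<bar>"
          by (intro tendsto_ennrealI tendsto_rabs tendsto_diff tendsto_mult tendsto_const c1)
        then show "(\<lambda>N. ennreal \<bar>w x - c N x * w x\<bar>) \<longlonglongrightarrow> 0" by simp
      qed
    qed measurable
    then show ?thesis by simp
  qed
  have main: "\<exists>F. H1 w F \<and> L2n F \<le> ennreal ((1 + \<delta>) * K + \<delta>)" if \<delta>: "\<delta> > 0" for \<delta>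
  proof -
    have "(\<lambda>N. (1 + 1 / \<delta>) * ((b * inverse (real (Suc N)))\<^sup>2 * S)) \<longlonglongrightarrow> (1 + 1 / \<delta>) * ((b * 0)\<^sup>2 * S)"
      by (intro tendsto_mult tendsto_power tendsto_const LIMSEQ_inverse_real_of_nat)
    then have "eventually (\<lambda>N. (1 + 1 / \<delta>) * ((b * inverse (real (Suc N)))\<^sup>2 * S) < \<delta>) sequentially"
      using \<delta> by (intro order_tendstoD(2)[where y=0]) auto
    then obtain N0 where N0: "\<And>N. N \<ge> N0 \<Longrightarrow> (1 + 1 / \<delta>) * ((b / real (Suc N))\<^sup>2 * S) \<le> \<delta>"
      unfolding eventually_sequentially divide_inverse by (meson less_imp_le)
    have "\<forall>k. \<exists>F. H1 (\<lambda>x. c (k + N0) x * w x) F \<and> L2n F \<le> ennreal ((1 + \<delta>) * K + \<delta>)"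
    proof
      fix k
      obtain F where F: "H1 (\<lambda>x. c (k + N0) x * w x) F"
        "L2n F \<le> ennreal ((1 + \<delta>) * K + (1 + 1 / \<delta>) * ((b / real (Suc (k + N0)))\<^sup>2 * S))"
        using cut[OF \<delta>] by blast
      have "(1 + 1 / \<delta>) * ((b / real (Suc (k + N0)))\<^sup>2 * S) \<le> \<delta>" by (rule N0) simp
      then have "ennreal ((1 + \<delta>) * K + (1 + 1 / \<delta>) * ((b / real (Suc (k + N0)))\<^sup>2 * S)) \<le> ennreal ((1 + \<delta>) * K + \<delta>)"
        by (intro ennreal_leI add_left_mono)
      with F show "\<exists>F. H1 (\<lambda>x. c (k + N0) x * w x) F \<and> L2n F \<le> ennreal ((1 + \<delta>) * K + \<delta>)"
        using order_trans by blast
    qed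
    from choice[OF this] obtain F where
      F: "\<forall>k. H1 (\<lambda>x. c (k + N0) x * w x) (F k) \<and> L2n (F k) \<le> ennreal ((1 + \<delta>) * K + \<delta>)" ..
    have "(\<lambda>k. L1n (\<lambda>x. w x - c (k + N0) x * w x)) \<longlonglongrightarrow> 0"
      by (rule LIMSEQ_ignore_initial_segment[OF lw])
    moreover have "0 \<le> (1 + \<delta>) * K + \<delta>" using \<delta> K by simp
    ultimately obtain H where "H1 w H" "L2n H \<le> ennreal ((1 + \<delta>) * K + \<delta>)"
      using H1_weak_closed[of "\<lambda>k x. c (k + N0) x * w x" F w "(1 + \<delta>) * K + \<delta>"] F assms(6) by blast
    then show ?thesis by blast
  qed
  obtain F where "H1 w F" using main[of 1] by auto
  have "w \<in> hat_H1" by (rule H1_imp_hat_H1) fact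
  then show H: "H1 w (weak_grad w)" by (rule hat_H1_imp_H1)
  show "L2n (weak_grad w) \<le> ennreal K"
  proof (rule ennreal_le_epsilon)
    fix e :: real assume e: "0 < e"
    \<comment> \<open>Chosen so that \<open>(1 + \<delta>) * K + \<delta>\<close> is
      \<open>K + e\<close>.\<close>
    define \<delta> where "\<delta> = e / (K + 1)"
    have "\<delta> * (K + 1) = e" using K by (simp add: \<delta>_def)
    moreover have "(1 + \<delta>) * K + \<delta> = K + \<delta> * (K + 1)" by (simp add: algebra_simps)
    ultimately have \<delta>: "\<delta> > 0" "(1 + \<delta>) * K + \<delta> = K + e" using e K by (simp_all add: \<delta>_def)
    obtain F where F: "H1 w F" "L2n F \<le> ennreal (K + e)" using main[OF \<delta>(1)] \<delta>(2) by auto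
    have "L2n (weak_grad w) = L2n F"
      by (rule nn_integral_cong_AE) (use H1_weak_grad_AE[OF F(1)] in \<open>auto elim!: AE_mp\<close>)
    with F(2) show "L2n (weak_grad w) \<le> ennreal K + ennreal e" using K e by simp
  qed
qed

section \<open>Lower semicontinuity of the remaining energy terms\<close>

lemma liminf_eventually_le:
  assumes "ennreal a \<le> liminf (\<lambda>n. ennreal (b n))" "\<And>n. 0 \<le> b n" "\<epsilon> > 0"
  shows "eventually (\<lambda>n. a \<le> b n + \<epsilon>) sequentially"
proof (cases "a \<le> \<epsilon>")
  case True
  then show ?thesis using assms(2) by (intro always_eventually allI) (simp add: add_increasing)
next
  case False
  then have "ennreal (a - \<epsilon>) < ennreal a" using assms(3) by (intro ennreal_lessI) auto
  also note assms(1)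
  finally have "eventually (\<lambda>n. ennreal (a - \<epsilon>) < ennreal (b n)) sequentially" by (rule less_LiminfD)
  then show ?thesis
    by (rule eventually_mono) (use False assms(2) in \<open>simp add: ennreal_less_iff\<close>)
qed

text \<open>Fatou's lemma, for the inner and then for the outer integral.\<close>

lemma coul_lower_semicontinuous:
  assumes [measurable]: "\<And>n. v n \<in> borel_measurable borel" "w \<in> borel_measurable borel"
    and ae: "AE x in lborel. (\<lambda>n. v n x) \<longlonglongrightarrow> w x"
  shows "coul w w \<le> liminf (\<lambda>n. coul (v n) (v n))"
proof -
  have "coul w w \<le> (\<integral>\<^sup>+x. liminf (\<lambda>n. \<integral>\<^sup>+y. ennreal (v n x * v n y / norm (x - y)) \<partial>lborel) \<partial>lborel)"
    unfolding coul_def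
  proof (rule nn_integral_mono_AE, rule AE_mp[OF ae], intro AE_I2 impI)
    fix x assume x: "(\<lambda>n. v n x) \<longlonglongrightarrow> w x"
    have "(\<integral>\<^sup>+y. ennreal (w x * w y / norm (x - y)) \<partial>lborel)
        \<le> (\<integral>\<^sup>+y. liminf (\<lambda>n. ennreal (v n x * v n y / norm (x - y))) \<partial>lborel)"
    proof (rule nn_integral_mono_AE, rule AE_mp[OF ae], intro AE_I2 impI)
      fix y assume y: "(\<lambda>n. v n y) \<longlonglongrightarrow> w y"
      have "(\<lambda>n. ennreal (v n x * v n y / norm (x - y))) \<longlonglongrightarrow> ennreal (w x * w y / norm (x - y))"
        unfolding divide_inverse by (intro tendsto_ennrealI tendsto_mult tendsto_const x y)
      from lim_imp_Liminf[OF _ this]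
      show "ennreal (w x * w y / norm (x - y)) \<le> liminf (\<lambda>n. ennreal (v n x * v n y / norm (x - y)))" by simp
    qed
    also have "\<dots> \<le> liminf (\<lambda>n. \<integral>\<^sup>+y. ennreal (v n x * v n y / norm (x - y)) \<partial>lborel)"
      by (rule nn_integral_liminf) measurable
    finally show "(\<integral>\<^sup>+y. ennreal (w x * w y / norm (x - y)) \<partial>lborel)
        \<le> liminf (\<lambda>n. \<integral>\<^sup>+y. ennreal (v n x * v n y / norm (x - y)) \<partial>lborel)" .
  qed
  also have "\<dots> \<le> liminf (\<lambda>n. coul (v n) (v n))"
    unfolding coul_def by (rule nn_integral_liminf) measurable
  finally show ?thesis .
qed

lemma fatou_continuous:
  assumes [measurable]: "\<And>n. v n \<in> borel_measurable borel" "(\<lambda>(s, x). T s x) \<in> borel_measurable (borel \<Otimes>\<^sub>M borel)"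
    and ae: "AE x in lborel. (\<lambda>n. v n x) \<longlonglongrightarrow> w x" and T: "\<And>x. isCont (\<lambda>s. T s x) (w x)"
  shows "(\<integral>\<^sup>+x. ennreal (T (w x) x) \<partial>lborel) \<le> liminf (\<lambda>n. \<integral>\<^sup>+x. ennreal (T (v n x :: real) (x::real^3)) \<partial>lborel)"
proof -
  have "(\<integral>\<^sup>+x. ennreal (T (w x) x) \<partial>lborel) \<le> (\<integral>\<^sup>+x. liminf (\<lambda>n. ennreal (T (v n x) x)) \<partial>lborel)"
  proof (rule nn_integral_mono_AE, rule AE_mp[OF ae], intro AE_I2 impI)
    fix x assume "(\<lambda>n. v n x) \<longlonglongrightarrow> w x"
    then have "(\<lambda>n. ennreal (T (v n x) x)) \<longlonglongrightarrow> ennreal (T (w x) x)"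
      by (intro tendsto_ennrealI isCont_tendsto_compose[OF T])
    from lim_imp_Liminf[OF _ this] show "ennreal (T (w x) x) \<le> liminf (\<lambda>n. ennreal (T (v n x) x))" by simp
  qed
  also have "\<dots> \<le> liminf (\<lambda>n. \<integral>\<^sup>+x. ennreal (T (v n x) x) \<partial>lborel)"
    by (rule nn_integral_liminf) measurable
  finally show ?thesis .
qed

text \<open>Fatou's lemma wants a nonnegative integrand; the added function is independent of
  \<open>s\<close>, so its integral cancels afterwards. Truncating the attraction to a ball makes
  the constant \<open>(Z + 1)\<^sup>2\<close>, which absorbs the linear term, integrable.\<close>

lemma truncated_energy_nonneg:
  assumes "0 \<le> s" "0 \<le> Z"
  shows "0 \<le> dwell s - Z * (s / norm x * indicator (ball 0 R) x)
    + ((Z + 1)\<^sup>2 * indicator (ball 0 R) x + Z\<^sup>2 * (indicator (ball 0 1) x * (1 / (norm x)\<^sup>2)))"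
proof (cases "x \<in> ball 0 R")
  case True
  have "2 * (s / 2) * (Z + 1) \<le> (s / 2)\<^sup>2 + (Z + 1)\<^sup>2" by (rule sum_squares_bound)
  then have "s * (Z + 1) \<le> s\<^sup>2 / 4 + (Z + 1)\<^sup>2" by (simp add: power_divide)
  then have "(Z + 1/2) * s \<le> dwell s / 2 + (Z + 1)\<^sup>2"
    using square_le_dwell[OF assms(1)] by (simp add: algebra_simps)
  then show ?thesis using potential_dwell_bound[OF assms, of x] True by simp
next
  case False
  then show ?thesis using dwell_nonneg[of s] by (simp add: add_nonneg_nonneg)
qed

text \<open>Outside the ball \<open>1 / norm x\<close> is at most \<open>1 / R\<close>, so the
  truncation costs at most mass over \<open>R\<close>, uniformly along a minimising
  sequence.\<close>

lemma potential_tail: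
  assumes g: "admissible u G" and R: "R > 0"
  shows "integrable lborel (\<lambda>x. u x / norm x * indicator (ball 0 R) x)"
    "(LINT x|lborel. u x / norm x) - (LINT x|lborel. u x) / R \<le> (LINT x|lborel. u x / norm x * indicator (ball 0 R) x)"
    "(LINT x|lborel. u x / norm x * indicator (ball 0 R) x) \<le> (LINT x|lborel. u x / norm x)"
proof -
  note d = admissibleD[OF g]
  have [measurable]: "ball (0::real^3) R \<in> sets borel" by simp
  show i: "integrable lborel (\<lambda>x. u x / norm x * indicator (ball 0 R) x)"
    using integrable_mult_indicator[of "ball 0 R" lborel, OF _ d(11)] by (simp add: mult.commute)
  have "(LINT x|lborel. u x / norm x) - (LINT x|lborel. u x) / R = (LINT x|lborel. u x / norm x - u x / R)"
    using d(4,11) by simp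
  also have "\<dots> \<le> (LINT x|lborel. u x / norm x * indicator (ball 0 R) x)"
  proof (rule integral_mono[OF _ i])
    show "integrable lborel (\<lambda>x. u x / norm x - u x / R)" using d(4,11) by simp
    show "u x / norm x - u x / R \<le> u x / norm x * indicator (ball 0 R) x" for x
    proof (cases "x \<in> ball 0 R")
      case False
      then have "R \<le> norm x" by simp
      then have "u x / norm x \<le> u x / R" using d(2) R by (intro divide_left_mono mult_pos_pos) auto
      then show ?thesis using False by simp
    qed (use d(2) R in simp)
  qed
  finally show "(LINT x|lborel. u x / norm x) - (LINT x|lborel. u x) / R \<le> (LINT x|lborel. u x / norm x * indicator (ball 0 R) x)" .
  show "(LINT x|lborel. u x / norm x * indicator (ball 0 R) x) \<le> (LINT x|lborel. u x / norm x)"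
    by (rule integral_mono[OF i d(11)]) (use d(2) in \<open>auto simp: indicator_def\<close>)
qed

text \<open>Mass may escape along the sequence, and Fatou only bounds the mass of the limit from
  above; the constraint with an inequality survives this.\<close>

lemma relaxed_minimizer:
  assumes Z: "0 \<le> Z" and M: "0 \<le> M"
  obtains u G where "admissible u G" "(LINT x|lborel. u x) \<le> M"
    "\<forall>v H. admissible v H \<longrightarrow> (LINT x|lborel. v x) \<le> M \<longrightarrow> tot_energy Z u G \<le> tot_energy Z v H"
proof -
  define A where "A = {(v, H). admissible v H \<and> (LINT x|lborel. v x) \<le> M}"
  define e where "e = (\<lambda>(v, H). tot_energy Z v H)"
  define C where "C = (Z + 1/2) * M + Z\<^sup>2 * newton_const"
  have lb: "(LINT x|lborel. (norm (H x))\<^sup>2) / 2 + (LINT x|lborel. dwell (v x)) / 2 \<le> tot_energy Z v H + C"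
    if "admissible v H" "(LINT x|lborel. v x) \<le> M" for v H
  proof -
    have "(Z + 1/2) * (LINT x|lborel. v x) \<le> (Z + 1/2) * M" using that Z by (intro mult_left_mono) auto
    moreover have "0 \<le> enn2real (coul v v)" by simp
    ultimately show ?thesis using energy_lower_bound[OF that(1) Z] unfolding C_def by argo
  qed
  have i0: "0 \<le> (LINT x|lborel. (norm (H x))\<^sup>2)" "0 \<le> (LINT x|lborel. dwell (v x))" for H :: "real^3 \<Rightarrow> real^3" and v :: "real^3 \<Rightarrow> real"
    by (auto intro!: Bochner_Integration.integral_nonneg dwell_nonneg)
  have bdd: "bdd_below (e ` A)"
  proof (rule bdd_belowI[of _ "- C"])
    fix y assume "y \<in> e ` A"
    then obtain v H where "admissible v H" "(LINT x|lborel. v x) \<le> M" "y = tot_energy Z v H" by (auto simp: A_def e_def)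
    then show "- C \<le> y" using lb[of v H] i0(1)[of H] i0(2)[of v] by linarith
  qed
  have "admissible (\<lambda>x. 0) (grad (\<lambda>x. 0))"
    by (rule admissible_Cc) (auto intro: Cc_infinityI[OF smooth_const, of _ "{}"])
  then have "(\<lambda>x. 0, grad (\<lambda>x. 0)) \<in> A" using M by (simp add: A_def)
  then have ne: "A \<noteq> {}" by blast
  define J where "J = Inf (e ` A)"
  have J: "J \<le> tot_energy Z v H" if "admissible v H" "(LINT x|lborel. v x) \<le> M" for v H
    unfolding J_def using that by (intro cInf_lower bdd) (auto simp: A_def e_def intro!: image_eqI[of _ _ "(v, H)"])
  have "\<forall>n. \<exists>p. p \<in> A \<and> e p < J + 1 / real (Suc n)"
  proof
    fix n
    have "\<exists>y\<in>e ` A. y < J + 1 / real (Suc n)" unfolding J_def by (intro cInf_lessD) (use ne in auto)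
    then show "\<exists>p. p \<in> A \<and> e p < J + 1 / real (Suc n)" by blast
  qed
  from choice[OF this] obtain p where p: "\<forall>n. p n \<in> A \<and> e (p n) < J + 1 / real (Suc n)" ..
  define u where "u n = fst (p n)" for n
  define G where "G n = snd (p n)" for n
  have u: "admissible (u n) (G n)" "(LINT x|lborel. u n x) \<le> M" "tot_energy Z (u n) (G n) < J + 1 / real (Suc n)" for n
    using p[rule_format, of n] by (auto simp: A_def u_def G_def e_def split: prod.splits)
  define K where "K = 2 * (J + 1 + C)"
  have E1: "tot_energy Z (u n) (G n) \<le> J + 1" for n
    using u(3)[of n] by (rule less_imp_le[OF less_le_trans]) simp
  have gK: "(LINT x|lborel. (norm (G n x))\<^sup>2) \<le> K" "(LINT x|lborel. dwell (u n x)) \<le> K" for n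
  proof -
    have "a \<le> K \<and> b \<le> K" if "a / 2 + b / 2 \<le> t + C" "t \<le> J + 1" "0 \<le> a" "0 \<le> b" for a b t
      using that unfolding K_def by auto
    from this[OF lb[OF u(1,2)] E1 i0] show "(LINT x|lborel. (norm (G n x))\<^sup>2) \<le> K" "(LINT x|lborel. dwell (u n x)) \<le> K"
      by blast+
  qed
  have K0: "0 \<le> K" using gK(1)[of 0] i0(1)[of "G 0"] by linarith
  have L1: "L1n (u n) \<le> ennreal M" for n unfolding admissible_L1n[OF u(1)] by (intro ennreal_leI u)
  have L2: "L2n (G n) \<le> ennreal K" for n unfolding admissible_L2n_grad[OF u(1)] by (intro ennreal_leI gK)
  have L2u: "L2n (u n) \<le> ennreal (2 * M + 2 * K)" for n
  proof -
    have "(LINT x|lborel. (u n x)\<^sup>2) \<le> (LINT x|lborel. 2 * u n x + 2 * dwell (u n x))"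
      by (intro integral_mono square_le_dwell admissibleD[OF u(1)] Bochner_Integration.integrable_add integrable_mult_right)
    also have "\<dots> = 2 * (LINT x|lborel. u n x) + 2 * (LINT x|lborel. dwell (u n x))"
      using admissibleD(3,4)[OF u(1), of n] by simp
    also have "\<dots> \<le> 2 * M + 2 * K" using u(2)[of n] gK(2)[of n] by linarith
    finally show ?thesis unfolding admissible_L2n[OF u(1)] by (rule ennreal_leI)
  qed
  obtain r w0 where r: "strict_mono r" and [measurable]: "w0 \<in> borel_measurable borel"
    and ae0: "AE x in lborel. (\<lambda>n. u (r n) x) \<longlonglongrightarrow> w0 x"
    and loc0: "\<forall>N. (\<lambda>n. \<integral>\<^sup>+x. indicator (ball 0 (real N)) x * ennreal (norm (u (r n) x - w0 x)) \<partial>lborel) \<longlonglongrightarrow> 0"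
    by (rule H1_rellich[of u G M K, OF admissibleD(1)[OF u(1)] L1 M L2 K0])
  \<comment> \<open>A further subsequence makes the Dirichlet integrals converge, so that their
    limit can be compared with the Dirichlet integral of \<open>w\<close>.\<close>
  have "bounded (range (\<lambda>n. LINT x|lborel. (norm (G (r n) x))\<^sup>2))"
    unfolding bounded_iff using gK(1) i0(1) by (auto intro!: exI[of _ K])
  from bounded_imp_convergent_subsequence[OF this]
  obtain \<gamma> s where s: "strict_mono s" and gam: "(\<lambda>n. LINT x|lborel. (norm (G (r (s n)) x))\<^sup>2) \<longlonglongrightarrow> \<gamma>"
    by (auto simp: comp_def)
  define v where "v n = u (r (s n))" for n
  define H where "H n = G (r (s n))" for n
  have v: "admissible (v n) (H n)" for n by (simp add: v_def H_def u)
  note dv = admissibleD[OF v]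
  note [measurable] = dv(6,7)
  define w where "w x = max 0 (w0 x)" for x
  have [measurable]: "w \<in> borel_measurable borel" unfolding w_def by measurable
  have wpos: "0 \<le> w x" for x by (simp add: w_def)
  have ae: "AE x in lborel. (\<lambda>n. v n x) \<longlonglongrightarrow> w x"
    using ae0
  proof (rule AE_mp, intro AE_I2 impI)
    fix x assume l: "(\<lambda>n. u (r n) x) \<longlonglongrightarrow> w0 x"
    then have "0 \<le> w0 x" by (rule LIMSEQ_le_const) (use admissibleD(2)[OF u(1)] in blast)
    with LIMSEQ_subseq_LIMSEQ[OF l s] show "(\<lambda>n. v n x) \<longlonglongrightarrow> w x" by (simp add: v_def w_def comp_def)
  qed
  have loc: "(\<lambda>n. \<integral>\<^sup>+x. indicator (ball 0 (real N)) x * ennreal (norm (v n x - w x)) \<partial>lborel) \<longlonglongrightarrow> 0" for N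
  proof (rule tendsto_sandwich[OF always_eventually always_eventually tendsto_const LIMSEQ_subseq_LIMSEQ[OF loc0[rule_format, of N] s]], safe)
    fix n
    have "norm (v n x - w x) \<le> norm (v n x - w0 x)" for x
      using dv(2)[of n x] by (auto simp: w_def max_def)
    then show "(\<integral>\<^sup>+x. indicator (ball 0 (real N)) x * ennreal (norm (v n x - w x)) \<partial>lborel)
      \<le> ((\<lambda>n. \<integral>\<^sup>+x. indicator (ball 0 (real N)) x * ennreal (norm (u (r n) x - w0 x)) \<partial>lborel) \<circ> s) n"
      unfolding comp_def v_def by (intro nn_integral_mono mult_left_mono ennreal_leI) auto
  qed simp
  have mass: "L1n w \<le> ennreal M"
  proof -
    have "(\<integral>\<^sup>+x. ennreal (w x) \<partial>lborel) \<le> liminf (\<lambda>n. \<integral>\<^sup>+x. ennreal (v n x) \<partial>lborel)"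
      by (rule fatou_continuous[of v "\<lambda>s x. s", OF _ _ ae]) auto
    also have "\<dots> \<le> liminf (\<lambda>n. ennreal M)"
    proof (intro Liminf_mono always_eventually allI)
      show "(\<integral>\<^sup>+x. ennreal (v n x) \<partial>lborel) \<le> ennreal M" for n
        using L1[of "r (s n)"] dv(2)[of n] by (simp add: v_def)
    qed
    finally show ?thesis using wpos by (simp add: Liminf_const)
  qed
  have dw: "integrable lborel (\<lambda>x. dwell (w x))"
  proof (rule integrableI_nonneg)
    have "(\<integral>\<^sup>+x. ennreal (dwell (w x)) \<partial>lborel) \<le> liminf (\<lambda>n. \<integral>\<^sup>+x. ennreal (dwell (v n x)) \<partial>lborel)"
      by (rule fatou_continuous[of v "\<lambda>s x. dwell s", OF _ _ ae])
         (use dwell_continuous[of UNIV] in \<open>auto simp: continuous_on_eq_continuous_at\<close>)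
    also have "\<dots> \<le> liminf (\<lambda>n. ennreal K)"
    proof (intro Liminf_mono always_eventually allI)
      fix n
      have "(\<integral>\<^sup>+x. ennreal (dwell (v n x)) \<partial>lborel) = ennreal (LINT x|lborel. dwell (v n x))"
        by (rule nn_integral_eq_integral[OF dv(3)]) (simp add: dwell_nonneg)
      also have "\<dots> \<le> ennreal K" unfolding v_def by (intro ennreal_leI gK)
      finally show "(\<integral>\<^sup>+x. ennreal (dwell (v n x)) \<partial>lborel) \<le> ennreal K" .
    qed
    finally show "(\<integral>\<^sup>+x. ennreal (dwell (w x)) \<partial>lborel) < \<infinity>" by (simp add: Liminf_const le_less_trans)
  qed (auto simp: dwell_nonneg)
  have L1w: "L1n w < \<infinity>" using mass by (rule le_less_trans) simp
  have S0: "0 \<le> 2 * M + 2 * K" using M K0 by simp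
  define W where "W = weak_grad w"
  have "H1 w W" unfolding W_def
    by (rule H1_local_limit(1)[of v H "2 * M + 2 * K" K, OF dv(1) _ S0 _ K0 _ L1w loc])
       (auto simp: v_def H_def L2 simp del: real_norm_def intro!: L2u)
  then have gw: "admissible w W" using wpos dw by (simp add: admissible_def)
  note dw' = admissibleD[OF gw]
  have "ennreal (LINT x|lborel. w x) \<le> ennreal M" using mass unfolding admissible_L1n[OF gw] .
  then have mw: "(LINT x|lborel. w x) \<le> M" using M by (simp add: ennreal_le_iff)
  have g0: "0 \<le> \<gamma>" by (rule LIMSEQ_le_const[OF gam]) (use i0 in blast)
  have grad: "(LINT x|lborel. (norm (W x))\<^sup>2) \<le> \<gamma> + \<epsilon>" if "\<epsilon> > 0" for \<epsilon>
  proof -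
    have "eventually (\<lambda>n. (LINT x|lborel. (norm (H n x))\<^sup>2) < \<gamma> + \<epsilon>) sequentially"
      unfolding H_def by (rule order_tendstoD(2)[OF gam]) (use that in simp)
    then obtain N where N: "\<And>n. n \<ge> N \<Longrightarrow> (LINT x|lborel. (norm (H n x))\<^sup>2) \<le> \<gamma> + \<epsilon>"
      unfolding eventually_sequentially by (meson less_imp_le)
    have "L2n W \<le> ennreal (\<gamma> + \<epsilon>)" unfolding W_def
    proof (rule H1_local_limit(2)[of "\<lambda>n. v (n + N)" "\<lambda>n. H (n + N)" "2 * M + 2 * K" "\<gamma> + \<epsilon>", OF dv(1) _ S0 _ _ _ L1w])
      show "L2n (v (n + N)) \<le> ennreal (2 * M + 2 * K)" for n unfolding v_def by (rule L2u)
      show "L2n (H (n + N)) \<le> ennreal (\<gamma> + \<epsilon>)" for n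
        unfolding admissible_L2n_grad[OF v] by (intro ennreal_leI N) simp
      show "0 \<le> \<gamma> + \<epsilon>" using g0 that by simp
      show "(\<lambda>n. \<integral>\<^sup>+x. indicator (ball 0 (real N')) x * ennreal (norm (v (n + N) x - w x)) \<partial>lborel) \<longlonglongrightarrow> 0" for N'
        by (rule LIMSEQ_ignore_initial_segment[OF loc])
    qed measurable
    then show ?thesis unfolding admissible_L2n_grad[OF gw] using g0 that by (simp add: ennreal_le_iff del: ennreal_plus)
  qed
  have coulw: "eventually (\<lambda>n. enn2real (coul w w) \<le> enn2real (coul (v n) (v n)) + \<epsilon>) sequentially" if "\<epsilon> > 0" for \<epsilon>
  proof (rule liminf_eventually_le[OF _ _ that])
    have f: "ennreal (enn2real (coul (v n) (v n))) = coul (v n) (v n)" "ennreal (enn2real (coul w w)) = coul w w" for n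
      using admissible_coul_finite[OF v v] admissible_coul_finite[OF gw gw] by (auto intro!: ennreal_enn2real)
    show "ennreal (enn2real (coul w w)) \<le> liminf (\<lambda>n. ennreal (enn2real (coul (v n) (v n))))"
      unfolding f by (rule coul_lower_semicontinuous[OF _ _ ae]) measurable
  qed simp
  have potw: "eventually (\<lambda>n. (LINT x|lborel. dwell (w x)) - Z * (LINT x|lborel. w x / norm x)
      \<le> (LINT x|lborel. dwell (v n x)) - Z * (LINT x|lborel. v n x / norm x) + Z * M / R + \<epsilon>) sequentially"
    if e: "\<epsilon> > 0" and R: "R > 0" for \<epsilon> R
  proof -
    have [measurable]: "ball (0::real^3) R \<in> sets borel" for R by simp
    let ?T = "\<lambda>s x. dwell s - Z * (s / norm x * indicator (ball 0 R) x)
      + ((Z + 1)\<^sup>2 * indicator (ball 0 R) x + Z\<^sup>2 * (indicator (ball 0 1) x * (1 / (norm x)\<^sup>2)))"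
    define k where "k = (LINT x|lborel. (Z + 1)\<^sup>2 * indicator (ball (0::real^3) R) x + Z\<^sup>2 * (indicator (ball 0 1) x * (1 / (norm x)\<^sup>2)))"
    have ki: "integrable lborel (\<lambda>x. (Z + 1)\<^sup>2 * indicator (ball (0::real^3) R) x + Z\<^sup>2 * (indicator (ball 0 1) x * (1 / (norm x)\<^sup>2)))"
      using emeasure_lborel_ball_finite[of "0::real^3" R]
      by (intro Bochner_Integration.integrable_add integrable_mult_right integrable_inverse_square integrable_real_indicator) auto
    have T: "(\<integral>\<^sup>+x. ennreal (?T (f x) x) \<partial>lborel)
        = ennreal ((LINT x|lborel. dwell (f x)) - Z * (LINT x|lborel. f x / norm x * indicator (ball 0 R) x) + k)"
      "0 \<le> (LINT x|lborel. dwell (f x)) - Z * (LINT x|lborel. f x / norm x * indicator (ball 0 R) x) + k"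
      if f: "admissible f F" for f F
    proof -
      note pt = potential_tail(1)[OF f R]
      have i: "integrable lborel (\<lambda>x. ?T (f x) x)"
        by (rule Bochner_Integration.integrable_add[OF Bochner_Integration.integrable_diff[OF admissibleD(3)[OF f] integrable_mult_right[OF pt]] ki])
      have I: "(LINT x|lborel. ?T (f x) x) = (LINT x|lborel. dwell (f x)) - Z * (LINT x|lborel. f x / norm x * indicator (ball 0 R) x) + k"
        unfolding k_def
        by (subst Bochner_Integration.integral_add[OF Bochner_Integration.integrable_diff[OF admissibleD(3)[OF f] integrable_mult_right[OF pt]] ki],
            subst Bochner_Integration.integral_diff[OF admissibleD(3)[OF f] integrable_mult_right[OF pt]], simp only: integral_mult_right_zero)
      have pos: "0 \<le> ?T (f x) x" for x by (rule truncated_energy_nonneg[OF admissibleD(2)[OF f] Z])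
      show "(\<integral>\<^sup>+x. ennreal (?T (f x) x) \<partial>lborel)
          = ennreal ((LINT x|lborel. dwell (f x)) - Z * (LINT x|lborel. f x / norm x * indicator (ball 0 R) x) + k)"
        unfolding I[symmetric] by (rule nn_integral_eq_integral[OF i]) (use pos in simp)
      show "0 \<le> (LINT x|lborel. dwell (f x)) - Z * (LINT x|lborel. f x / norm x * indicator (ball 0 R) x) + k"
        unfolding I[symmetric] by (rule Bochner_Integration.integral_nonneg[OF pos])
    qed
    have "(\<integral>\<^sup>+x. ennreal (?T (w x) x) \<partial>lborel) \<le> liminf (\<lambda>n. \<integral>\<^sup>+x. ennreal (?T (v n x) x) \<partial>lborel)"
    proof (rule fatou_continuous[of v ?T, OF _ _ ae])
      have "isCont dwell s" for s using dwell_continuous[of UNIV] by (auto simp: continuous_on_eq_continuous_at)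
      then show "isCont (\<lambda>s. ?T s x) (w x)" for x
        unfolding divide_inverse by (intro continuous_intros)
    qed measurable
    then have "eventually (\<lambda>n. (LINT x|lborel. dwell (w x)) - Z * (LINT x|lborel. w x / norm x * indicator (ball 0 R) x) + k
      \<le> (LINT x|lborel. dwell (v n x)) - Z * (LINT x|lborel. v n x / norm x * indicator (ball 0 R) x) + k + \<epsilon>) sequentially"
      unfolding T(1)[OF gw] T(1)[OF v] by (rule liminf_eventually_le[OF _ T(2)[OF v] e])
    then show ?thesis
    proof (rule eventually_mono)
      fix n assume *: "(LINT x|lborel. dwell (w x)) - Z * (LINT x|lborel. w x / norm x * indicator (ball 0 R) x) + k
        \<le> (LINT x|lborel. dwell (v n x)) - Z * (LINT x|lborel. v n x / norm x * indicator (ball 0 R) x) + k + \<epsilon>"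
      have "(LINT x|lborel. v n x) / R \<le> M / R" using u(2) R by (simp add: v_def divide_right_mono)
      then have "(LINT x|lborel. v n x / norm x) - M / R \<le> (LINT x|lborel. v n x / norm x * indicator (ball 0 R) x)"
        using potential_tail(2)[OF v R, of n] by linarith
      from mult_left_mono[OF this Z] mult_left_mono[OF potential_tail(3)[OF gw R] Z] *
      show "(LINT x|lborel. dwell (w x)) - Z * (LINT x|lborel. w x / norm x)
        \<le> (LINT x|lborel. dwell (v n x)) - Z * (LINT x|lborel. v n x / norm x) + Z * M / R + \<epsilon>"
        by (simp add: right_diff_distrib)
    qed
  qed
  have "tot_energy Z w W \<le> J"
  proof (rule field_le_epsilon)
    fix e :: real assume e: "0 < e"
    \<comment> \<open>The gradient, the truncation, Fatou for the potential part and the minimising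
      sequence each lose at most one \<open>\<epsilon>\<close>, the Coulomb part half of
      one.\<close>
    define \<epsilon> where "\<epsilon> = e / 5"
    have eps: "\<epsilon> > 0" using e by (simp add: \<epsilon>_def)
    \<comment> \<open>Makes the truncation error \<open>Z * M / R\<close> at most
      \<open>\<epsilon>\<close>; the summand 1 keeps \<open>R\<close> positive when
      \<open>Z * M\<close> is 0.\<close>
    define R where "R = (Z * M + 1) / \<epsilon>"
    have ZM: "0 \<le> Z * M" using Z M by simp
    then have R: "R > 0" using eps by (simp add: R_def)
    have "Z * M / R = (Z * M / (Z * M + 1)) * \<epsilon>" by (simp add: R_def)
    also have "\<dots> \<le> 1 * \<epsilon>" using ZM eps by (intro mult_right_mono) auto
    finally have R: "R > 0" "Z * M / R \<le> \<epsilon>" using R by simp_all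
    have "eventually (\<lambda>n. \<gamma> - \<epsilon> < (LINT x|lborel. (norm (H n x))\<^sup>2)) sequentially"
      unfolding H_def by (rule order_tendstoD(1)[OF gam]) (use eps in simp)
    moreover have "eventually (\<lambda>n. 1 / real (Suc n) < \<epsilon>) sequentially"
      using order_tendstoD(2)[OF LIMSEQ_Suc[OF lim_1_over_n] eps] .
    ultimately have "eventually (\<lambda>n. tot_energy Z w W \<le> J + e) sequentially"
      using coulw[OF eps] potw[OF eps R(1)]
    proof eventually_elim
      case (elim n)
      have "n \<le> r (s n)" using seq_suble[OF s, of n] seq_suble[OF r, of "s n"] by linarith
      then have "1 / real (Suc (r (s n))) \<le> 1 / real (Suc n)" by (simp add: frac_le)
      then have "tot_energy Z (v n) (H n) \<le> J + \<epsilon>" using u(3)[of "r (s n)"] elim(2) unfolding v_def H_def by linarith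
      then show ?case using elim(1,3,4) R(2) grad[OF eps] e
        unfolding tot_energy_def loc_energy_def \<epsilon>_def by argo
    qed
    then show "tot_energy Z w W \<le> J + e" by (auto simp: eventually_sequentially)
  qed
  then have "\<forall>v H. admissible v H \<longrightarrow> (LINT x|lborel. v x) \<le> M \<longrightarrow> tot_energy Z w W \<le> tot_energy Z v H"
    using J order_trans by blast
  then show thesis by (rule that[OF gw mw])
qed

subsection \<open>Lowering the energy by adding mass far away\<close>

lemma unit_bump:
  obtains \<phi> where "\<phi> \<in> Cc_infinity" "\<forall>x. 0 \<le> \<phi> x" "(LINT x|lborel. \<phi> x) = 1"
proof -
  define \<beta> where "\<beta> = box_bump (\<chi> i. - 1) (\<chi> i. 1)"
  have \<beta>: "\<beta> \<in> Cc_infinity" "\<And>x. 0 \<le> \<beta> x" by (simp_all add: \<beta>_def box_bump_Cc box_bump_nonneg)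
  note i = Cc_infinity_integrable(1)[OF \<beta>(1)]
  have "(LINT x|lborel. \<beta> x) \<noteq> 0"
  proof
    assume "(LINT x|lborel. \<beta> x) = 0"
    then have "AE x in lborel. \<beta> x = 0"
      using integral_nonneg_eq_0_iff_AE[OF i] \<beta>(2) by simp
    then have "AE x in lborel. x \<notin> (box (\<chi> i. - 1) (\<chi> i. 1) :: (real^3) set)"
      by (rule AE_mp) (auto simp: \<beta>_def box_bump_pos[symmetric])
    then have "(box (\<chi> i. - 1) (\<chi> i. 1) :: (real^3) set) \<in> null_sets lborel"
      by (subst AE_iff_null_sets) auto
    then have "emeasure lborel (box (\<chi> i. - 1) (\<chi> i. 1) :: (real^3) set) = 0" by (rule null_setsD1)
    moreover have "emeasure lborel (cbox (\<chi> i. - 1) (\<chi> i. 1) :: (real^3) set) = ennreal 8"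
      by (subst emeasure_cbox_cart) auto
    ultimately show False by (simp add: emeasure_lborel_box_eq emeasure_lborel_cbox_eq)
  qed
  then have pos: "(LINT x|lborel. \<beta> x) > 0"
    using \<beta>(2) Bochner_Integration.integral_nonneg[of lborel \<beta>] by (simp add: less_le)
  show thesis
  proof (rule that[of "\<lambda>x. (1 / (LINT x|lborel. \<beta> x)) * \<beta> x"])
    show "(\<lambda>x. (1 / (LINT x|lborel. \<beta> x)) * \<beta> x) \<in> Cc_infinity" by (rule Cc_infinity_cmult[OF \<beta>(1)])
    show "\<forall>x. 0 \<le> (1 / (LINT x|lborel. \<beta> x)) * \<beta> x" using pos \<beta>(2) by simp
    show "(LINT x|lborel. (1 / (LINT x|lborel. \<beta> x)) * \<beta> x) = 1" using pos by simp
  qed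
qed

text \<open>Multiplied by \<open>R = real (Suc n)\<close>, the bound of \<open>spread_energy\<close>
  on the change converges to the stated coefficient without \<open>\<epsilon>\<close>.\<close>

lemma far_mass:
  assumes u: "admissible u G" and \<phi>: "\<phi> \<in> Cc_infinity" "\<And>x. 0 \<le> \<phi> x" and Z: "0 \<le> Z" and \<epsilon>: "\<epsilon> > 0"
  shows "eventually (\<lambda>n. \<exists>u' G'. admissible u' G' \<and> (LINT x|lborel. u' x) = (LINT x|lborel. u x) + (LINT x|lborel. \<phi> x)
    \<and> tot_energy Z u' G' \<le> tot_energy Z u G
      + (((LINT x|lborel. u x) - Z) * (LINT x|lborel. \<phi> x / norm x) + enn2real (coul \<phi> \<phi>) / 2 + \<epsilon>) / real (Suc n)) sequentially"
proof -
  obtain B0 where "\<And>x. norm (\<phi> x) \<le> B0" using Cc_infinity_bounded(1)[OF \<phi>(1)] unfolding bounded_iff by blast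
  then have B: "\<phi> x \<le> max 1 B0" for x by (metis abs_le_D1 max.coboundedI2 real_norm_def)
  define B where "B = max 1 B0"
  define p where "p = (LINT x|lborel. \<phi> x / norm x)"
  define c where "c = enn2real (coul \<phi> \<phi>)"
  define a where "a = (LINT x|lborel. (norm (G x))\<^sup>2) / 2 + (LINT x|lborel. (norm (grad \<phi> x))\<^sup>2)"
  define b where "b = 19 * (LINT x|lborel. u x) + 16 * (LINT x|lborel. dwell (u x)) + (LINT x|lborel. \<phi> x)"
  let ?i = "\<lambda>n. inverse (real (Suc n))"
  have i0: "?i \<longlonglongrightarrow> 0" by (rule LIMSEQ_inverse_real_of_nat)
  have "(\<lambda>n. a * ?i n + B * b * (?i n)\<^sup>2 + real (Suc n) * enn2real (coul u (spread (real (Suc n)) \<phi>)))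
      \<longlonglongrightarrow> a * 0 + B * b * 0\<^sup>2 + (LINT x|lborel. u x) * p"
    unfolding p_def
    by (intro tendsto_add[OF tendsto_add coul_spread_tendsto[OF u \<phi>]] tendsto_mult tendsto_const tendsto_power i0)
  then have "eventually (\<lambda>n. a * ?i n + B * b * (?i n)\<^sup>2 + real (Suc n) * enn2real (coul u (spread (real (Suc n)) \<phi>))
      < (LINT x|lborel. u x) * p + \<epsilon>) sequentially"
    by (rule order_tendstoD(2)) (use \<epsilon> in simp)
  moreover have "eventually (\<lambda>n. B * (?i n) ^ 3 < 1) sequentially"
  proof -
    have "(\<lambda>n. B * (?i n) ^ 3) \<longlonglongrightarrow> B * 0 ^ 3" by (intro tendsto_mult tendsto_const tendsto_power i0)
    then show ?thesis by (rule order_tendstoD(2)) simp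
  qed
  ultimately show ?thesis
  proof eventually_elim
    case (elim n)
    define R where "R = real (Suc n)"
    have R: "R \<ge> 1" by (simp add: R_def)
    have "B / R ^ 3 \<le> 1" using elim(2) by (simp add: R_def divide_inverse power_inverse)
    note se = spread_energy[OF u \<phi> B[folded B_def] R this Z]
    have "a / R\<^sup>2 + (B / R ^ 3) * b - Z * p / R + enn2real (coul u (spread R \<phi>)) + c / (2 * R)
      = (a * inverse R + B * b * (inverse R)\<^sup>2 + R * enn2real (coul u (spread R \<phi>)) - Z * p + c / 2) / R"
      using R by (simp add: field_simps power2_eq_square power3_eq_cube)
    also have "\<dots> \<le> (((LINT x|lborel. u x) - Z) * p + c / 2 + \<epsilon>) / R"
      using elim(1) R by (intro divide_right_mono) (auto simp: R_def left_diff_distrib)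
    finally have "a / R\<^sup>2 + (B / R ^ 3) * b - Z * p / R + enn2real (coul u (spread R \<phi>)) + c / (2 * R)
      \<le> (((LINT x|lborel. u x) - Z) * p + c / 2 + \<epsilon>) / R" .
    with se(3) have "tot_energy Z (\<lambda>x. u x + spread R \<phi> x) (\<lambda>x. G x + grad (spread R \<phi>) x)
      \<le> tot_energy Z u G + (((LINT x|lborel. u x) - Z) * p + c / 2 + \<epsilon>) / R"
      unfolding a_def[symmetric] b_def[symmetric] p_def[symmetric] c_def[symmetric] by argo
    with se(1,2) show ?case unfolding p_def c_def R_def by blast
  qed
qed

lemma coul_cmult:
  assumes [measurable]: "u \<in> borel_measurable borel" and t: "0 \<le> t" and pos: "\<And>x. 0 \<le> u x"
  shows "coul (\<lambda>x. t * u x) (\<lambda>x. t * u x) = ennreal (t\<^sup>2) * coul u u"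
proof -
  have "coul (\<lambda>x. t * u x) (\<lambda>x. t * u x) = (\<integral>\<^sup>+x. ennreal (t\<^sup>2) * (\<integral>\<^sup>+y. ennreal (u x * u y / norm (x - y)) \<partial>lborel) \<partial>lborel)"
    unfolding coul_def
  proof (intro nn_integral_cong)
    fix x
    have "(\<integral>\<^sup>+y. ennreal (t * u x * (t * u y) / norm (x - y)) \<partial>lborel) = (\<integral>\<^sup>+y. ennreal (t\<^sup>2) * ennreal (u x * u y / norm (x - y)) \<partial>lborel)"
      using pos by (intro nn_integral_cong) (simp add: ennreal_mult[symmetric] power2_eq_square mult_ac)
    also have "\<dots> = ennreal (t\<^sup>2) * (\<integral>\<^sup>+y. ennreal (u x * u y / norm (x - y)) \<partial>lborel)"
      by (rule nn_integral_cmult) measurable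
    finally show "(\<integral>\<^sup>+y. ennreal (t * u x * (t * u y) / norm (x - y)) \<partial>lborel)
      = ennreal (t\<^sup>2) * (\<integral>\<^sup>+y. ennreal (u x * u y / norm (x - y)) \<partial>lborel)" .
  qed
  also have "\<dots> = ennreal (t\<^sup>2) * coul u u" unfolding coul_def by (rule nn_integral_cmult) measurable
  finally show ?thesis .
qed

text \<open>For an added mass \<open>t\<close> the coefficient of 1 / R is
  \<open>t * (t * c / 2 - k)\<close>, where \<open>k\<close> is the net attraction on a unit bump
  and \<open>c\<close> its Coulomb energy: the gain is linear in \<open>t\<close>, the
  self-repulsion quadratic.\<close>

lemma lower_energy_by_far_mass:
  assumes u: "admissible u G" and Z: "0 \<le> Z" and mZ: "(LINT x|lborel. u x) < Z" and d: "d > 0"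
  obtains t u' G' where "0 < t" "t \<le> d" "admissible u' G'" "(LINT x|lborel. u' x) = (LINT x|lborel. u x) + t"
    "tot_energy Z u' G' < tot_energy Z u G"
proof -
  obtain \<phi> where \<phi>': "\<phi> \<in> Cc_infinity" "\<forall>x. 0 \<le> \<phi> x" and i: "(LINT x|lborel. \<phi> x) = 1"
    by (rule unit_bump)
  then have \<phi>: "\<phi> \<in> Cc_infinity" "0 \<le> \<phi> x" for x by blast+
  have gp: "admissible \<phi> (grad \<phi>)" by (rule admissible_Cc[OF \<phi>])
  note dp = admissibleD[OF gp]
  define p where "p = (LINT x|lborel. \<phi> x / norm x)"
  define c where "c = enn2real (coul \<phi> \<phi>)"
  have c0: "0 \<le> c" by (simp add: c_def)
  have p0: "p > 0"
  proof -
    obtain r where r: "r > 0" "\<And>x. \<phi> x \<noteq> 0 \<Longrightarrow> norm x \<le> r"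
      using Cc_infinity_bounded_support[OF \<phi>(1)] by (auto simp: bounded_pos)
    have "AE x in lborel. x \<noteq> (0 :: real^3)" by (rule AE_lborel_singleton)
    then have "(LINT x|lborel. \<phi> x / r) \<le> p"
      unfolding p_def
    proof (intro integral_mono_AE integrable_divide dp, elim AE_mp, intro AE_I2 impI)
      fix x :: "real^3" assume "x \<noteq> 0"
      then show "\<phi> x / r \<le> \<phi> x / norm x"
        using r(2)[of x] \<phi>(2)[of x] r(1) by (cases "\<phi> x = 0") (auto intro!: divide_left_mono)
    qed
    then show ?thesis using r(1) i by (auto intro: less_le_trans[rotated])
  qed
  let ?m = "LINT x|lborel. u x"
  define k where "k = (Z - ?m) * p"
  have k: "k > 0" using mZ p0 by (simp add: k_def)
  \<comment> \<open>Gives \<open>t * c < k\<close>, so the self-repulsion consumes less than half of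
    the gain; the summand 1 covers \<open>c = 0\<close>.\<close>
  define t where "t = min d (k / (c + 1))"
  have t: "0 < t" "t \<le> d" "t * c < k"
  proof -
    show "0 < t" "t \<le> d" using d k c0 by (auto simp: t_def)
    have "t \<le> k / (c + 1)" by (simp add: t_def)
    then have "t * (c + 1) \<le> k" using c0 by (subst (asm) pos_le_divide_eq) auto
    then show "t * c < k" using \<open>0 < t\<close> by (simp add: distrib_left)
  qed
  define \<psi> where "\<psi> x = t * \<phi> x" for x
  have \<psi>: "\<psi> \<in> Cc_infinity" "0 \<le> \<psi> x" for x
    using Cc_infinity_cmult[OF \<phi>(1), of t] \<phi>(2) t by (auto simp: \<psi>_def[abs_def])
  have ip: "(LINT x|lborel. \<psi> x) = t" "(LINT x|lborel. \<psi> x / norm x) = t * p" "enn2real (coul \<psi> \<psi>) = t\<^sup>2 * c"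
    using i t coul_cmult[OF dp(6), of t] \<phi>(2) integral_mult_right_zero[of lborel t "\<lambda>x. \<phi> x / norm x"]
    by (simp_all add: \<psi>_def[abs_def] p_def c_def enn2real_mult)
  \<comment> \<open>A quarter of the gain \<open>t * k\<close>; with less than a half lost to
    repulsion the total stays negative.\<close>
  define \<epsilon> where "\<epsilon> = t * (k / 4)"
  have eps: "\<epsilon> > 0" using t k by (simp add: \<epsilon>_def)
  obtain n u' G' where *: "admissible u' G'" "(LINT x|lborel. u' x) = ?m + t"
    "tot_energy Z u' G' \<le> tot_energy Z u G + ((?m - Z) * (t * p) + t\<^sup>2 * c / 2 + \<epsilon>) / real (Suc n)"
    using eventually_happens'[OF sequentially_bot far_mass[OF u \<psi> Z eps]] unfolding ip by blast
  have "(?m - Z) * (t * p) + t\<^sup>2 * c / 2 + \<epsilon> = t * (t * c / 2 + k / 4 - k)"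
    by (simp add: \<epsilon>_def k_def power2_eq_square algebra_simps)
  also have "\<dots> < 0"
  proof (rule mult_pos_neg[OF t(1)])
    show "t * c / 2 + k / 4 - k < 0" using t(3) k by linarith
  qed
  finally have "((?m - Z) * (t * p) + t\<^sup>2 * c / 2 + \<epsilon>) / real (Suc n) < 0" by (intro divide_neg_pos) auto
  with *(3) have "tot_energy Z u' G' < tot_energy Z u G" by linarith
  with that[OF t(1,2) *(1,2)] show thesis by blast
qed

text \<open>The cost of a fixed mass is bounded by a constant over \<open>R\<close>, hence
  arbitrarily small; this fills a competitor up to a prescribed mass.\<close>

lemma energy_far_mass_le:
  assumes u: "admissible u G" and Z: "0 \<le> Z" and s: "0 \<le> s" and e: "e > 0"
  obtains u' G' where "admissible u' G'" "(LINT x|lborel. u' x) = (LINT x|lborel. u x) + s"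
    "tot_energy Z u' G' \<le> tot_energy Z u G + e"
proof -
  obtain \<phi> where \<phi>: "\<phi> \<in> Cc_infinity" "\<forall>x. 0 \<le> \<phi> x" and i: "(LINT x|lborel. \<phi> x) = 1"
    by (rule unit_bump)
  define \<psi> where "\<psi> x = s * \<phi> x" for x
  have \<psi>: "\<psi> \<in> Cc_infinity" "0 \<le> \<psi> x" for x
    using Cc_infinity_cmult[OF \<phi>(1), of s] \<phi>(2) s by (auto simp: \<psi>_def[abs_def])
  have ip: "(LINT x|lborel. \<psi> x) = s" using i by (simp add: \<psi>_def)
  let ?k = "((LINT x|lborel. u x) - Z) * (LINT x|lborel. \<psi> x / norm x) + enn2real (coul \<psi> \<psi>) / 2 + 1"
  have "(\<lambda>n. ?k * inverse (real (Suc n))) \<longlonglongrightarrow> ?k * 0"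
    by (intro tendsto_mult tendsto_const LIMSEQ_inverse_real_of_nat)
  then have "eventually (\<lambda>n. ?k * inverse (real (Suc n)) < e) sequentially"
    by (rule order_tendstoD(2)) (use e in simp)
  from eventually_happens'[OF sequentially_bot eventually_conj[OF this far_mass[OF u \<psi> Z zero_less_one]]]
  obtain n u' G' where "?k * inverse (real (Suc n)) < e" "admissible u' G'" "(LINT x|lborel. u' x) = (LINT x|lborel. u x) + s"
    "tot_energy Z u' G' \<le> tot_energy Z u G + ?k / real (Suc n)" unfolding ip by blast
  then have "tot_energy Z u' G' \<le> tot_energy Z u G + e" unfolding divide_inverse by linarith
  with \<open>admissible u' G'\<close> \<open>(LINT x|lborel. u' x) = (LINT x|lborel. u x) + s\<close> show thesis by (rule that)
qed

lemma admissible_zero: "admissible (\<lambda>x. 0) (grad (\<lambda>x. 0))" "tot_energy Z (\<lambda>x. 0) (grad (\<lambda>x. 0)) = 0"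
proof -
  show "admissible (\<lambda>x. 0) (grad (\<lambda>x. 0))"
    by (rule admissible_Cc) (auto intro: Cc_infinityI[OF smooth_const, of _ "{}"])
  show "tot_energy Z (\<lambda>x. 0) (grad (\<lambda>x. 0)) = 0"
    by (simp add: tot_energy_def loc_energy_def coul_def grad_const dwell_def)
qed

text \<open>A small mass added to the zero function gives negative energy, and the rest of
  \<open>M\<close> is added far away for at most half of that gain.\<close>

lemma negative_energy:
  assumes Z: "0 < Z" and M: "0 < M"
  obtains u G where "admissible u G" "(LINT x|lborel. u x) = M" "tot_energy Z u G < 0"
proof -
  have m0: "(LINT x|(lborel :: (real^3) measure). (0::real)) < Z" using Z by simp
  obtain t u G where t: "0 < t" "t \<le> M" and g: "admissible u G" "(LINT x|lborel. u x) = (LINT x|(lborel :: (real^3) measure). (0::real)) + t"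
    and e: "tot_energy Z u G < tot_energy Z (\<lambda>x. 0) (grad (\<lambda>x. 0))"
    by (rule lower_energy_by_far_mass[OF admissible_zero(1) less_imp_le[OF Z] m0 M])
  have e': "0 < - tot_energy Z u G / 2" using e by (simp add: admissible_zero(2))
  have "0 \<le> M - t" using t by simp
  then obtain v H where "admissible v H" "(LINT x|lborel. v x) = (LINT x|lborel. u x) + (M - t)"
    "tot_energy Z v H \<le> tot_energy Z u G + (- tot_energy Z u G / 2)"
    by (rule energy_far_mass_le[OF g(1) less_imp_le[OF Z] _ e'])
  then show thesis by (intro that[of v H]) (use g e' in auto)
qed

subsection \<open>Cutting along smoothed half-spaces\<close>

definition logistic :: "real \<Rightarrow> real" where
  "logistic t = 1 / (1 + exp (- t))"

lemma logistic_bounds: "0 < logistic t" "logistic t < 1"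
  by (auto simp: logistic_def add_pos_pos)

lemma logistic_deriv: "(logistic has_field_derivative logistic t * (1 - logistic t)) (at t)"
proof -
  have e: "1 + exp (- t) \<noteq> 0" using exp_gt_zero[of "- t"] by linarith
  have "((\<lambda>t. 1 / (1 + exp (- t))) has_field_derivative exp (- t) / (1 + exp (- t))\<^sup>2) (at t)"
    using e by (auto intro!: derivative_eq_intros simp: power2_eq_square)
  moreover have "exp (- t) / (1 + exp (- t))\<^sup>2 = logistic t * (1 - logistic t)"
    using e by (simp add: logistic_def divide_simps power2_eq_square)
  ultimately show ?thesis unfolding logistic_def[abs_def] by simp
qed

text \<open>All derivatives are polynomials in \<open>logistic t\<close>: differentiating multiplies
  the derivative of the polynomial by \<open>logistic t * (1 - logistic t)\<close>, which is the
  factor \<open>[:0, 1, - 1:]\<close>.\<close>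

lemma smooth_logistic: assumes "smooth p" shows "smooth (\<lambda>x. logistic (p x))"
proof -
  define q :: "nat \<Rightarrow> real poly" where "q n = ((\<lambda>q. [:0, 1, - 1:] * pderiv q) ^^ n) [:0, 1:]" for n
  define h where "h n t = poly (q n) (logistic t)" for n t
  have "(h n has_field_derivative h (Suc n) t) (at t)" for n t
  proof -
    have "((\<lambda>t. poly (q n) (logistic t)) has_field_derivative poly (pderiv (q n)) (logistic t) * (logistic t * (1 - logistic t))) (at t)"
      by (rule DERIV_chain2[OF poly_DERIV logistic_deriv])
    moreover have "poly (pderiv (q n)) (logistic t) * (logistic t * (1 - logistic t)) = h (Suc n) t"
      by (simp add: h_def q_def algebra_simps)
    ultimately show ?thesis unfolding h_def[abs_def] by simp
  qed
  from smooth_compose[of h p 0, OF this assms] show ?thesis by (simp add: h_def q_def)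
qed

text \<open>A sign \<open>\<sigma>\<close> and a coordinate \<open>i\<close> encode one of the six
  directions, and \<open>l\<close> is the offset along it. The piece beyond the offset receives the
  factor \<open>cut\<close>.\<close>

definition cut :: "real \<Rightarrow> 3 \<Rightarrow> real \<Rightarrow> real^3 \<Rightarrow> real" where
  "cut \<sigma> i l x = logistic (\<sigma> * x $ i - l)"

lemma cut_bounds: "0 < cut \<sigma> i l x" "cut \<sigma> i l x < 1"
  by (simp_all add: cut_def logistic_bounds)

lemma smooth_cut: "smooth (cut \<sigma> i l)"
  unfolding cut_def[abs_def] by (intro smooth_logistic smooth_diff smooth_cmult smooth_coord smooth_const)

lemma grad_cut:
  assumes "\<bar>\<sigma>\<bar> = 1" shows "norm (grad (cut \<sigma> i l) x) = cut \<sigma> i l x * (1 - cut \<sigma> i l x)"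
proof -
  have s: "smooth (\<lambda>x. \<sigma> * x $ i - l)" by (intro smooth_diff smooth_cmult smooth_coord smooth_const)
  have "((\<lambda>x. \<sigma> * x $ i - l) has_derivative (\<lambda>h. (\<sigma> *\<^sub>R axis i 1) \<bullet> h)) (at x)"
    by (auto intro!: derivative_eq_intros bounded_linear_imp_has_derivative bounded_linear_vec_nth simp: inner_axis')
  then have g: "grad (\<lambda>x. \<sigma> * x $ i - l) x = \<sigma> *\<^sub>R axis i 1" by (rule grad_eqI)
  have "grad (cut \<sigma> i l) x = (cut \<sigma> i l x * (1 - cut \<sigma> i l x)) *\<^sub>R \<sigma> *\<^sub>R axis i 1"
    unfolding cut_def[abs_def] g[symmetric] by (rule grad_compose[OF logistic_deriv smooth_differentiable[OF s]])
  then show ?thesis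
    using assms cut_bounds[of \<sigma> i l x] by (simp add: abs_mult)
qed

lemma admissible_mult:
  assumes u: "admissible u G" and \<chi>: "smooth f" "\<And>x. 0 \<le> f x" "\<And>x. f x \<le> 1" "\<And>x. norm (grad f x) \<le> 1"
  shows "admissible (\<lambda>x. f x * u x) (\<lambda>x. f x *\<^sub>R G x + u x *\<^sub>R grad f x)"
proof (rule admissibleI)
  note d = admissibleD[OF u]
  have [measurable]: "f \<in> borel_measurable borel"
    by (intro borel_measurable_continuous_onI smooth_continuous_on \<chi>)
  note [measurable] = d(6)
  show "H1 (\<lambda>x. f x * u x) (\<lambda>x. f x *\<^sub>R G x + u x *\<^sub>R grad f x)"
    by (rule H1_mult_smooth[OF d(1) \<chi>(1) _ \<chi>(4)]) (use \<chi> in simp)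
  show "0 \<le> f x * u x" for x using d(2) \<chi>(2) by simp
  have le: "(f x * u x) ^ n \<le> u x ^ n" for x n
    using d(2) \<chi>(2,3) by (intro power_mono) (auto intro: mult_left_le_one_le)
  show "integrable lborel (\<lambda>x. (f x * u x)\<^sup>2)"
    by (rule Bochner_Integration.integrable_bound[OF d(8)]) (use le in auto)
  show "integrable lborel (\<lambda>x. (f x * u x) ^ 4)"
    by (rule Bochner_Integration.integrable_bound[OF d(10)]) (use le d(2) \<chi>(2) in auto)
qed

text \<open>If \<open>b \<le> \<delta> * a\<close>, each of the three products is at most
  \<open>\<delta> * a ^ 4\<close>; otherwise \<open>a\<close> is below \<open>b / \<delta>\<close>
  and each is at most \<open>b ^ 4 / \<delta> ^ 3\<close>. The 7 is
  \<open>2 + 3 + 2\<close>.\<close>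

lemma quartic_cross_le:
  fixes a b \<delta> :: real
  assumes "0 \<le> a" "0 \<le> b" "0 < \<delta>" "\<delta> \<le> 1"
  shows "2 * a ^ 3 * b + 3 * a\<^sup>2 * b\<^sup>2 + 2 * a * b ^ 3 \<le> 7 * (\<delta> * a ^ 4 + b ^ 4 / \<delta> ^ 3)"
proof (cases "b \<le> \<delta> * a")
  case True
  have ba: "b \<le> a" using True mult_left_le_one_le[of a \<delta>] assms by linarith
  have 1: "a ^ 3 * b \<le> \<delta> * a ^ 4" using mult_left_mono[OF True, of "a ^ 3"] assms by (simp add: power_eq_if mult_ac)
  have "a\<^sup>2 * b\<^sup>2 \<le> a ^ 3 * b" using mult_left_mono[OF ba, of "a\<^sup>2 * b"] assms by (simp add: power_eq_if mult_ac)
  moreover have "a * b ^ 3 \<le> a\<^sup>2 * b\<^sup>2" using mult_left_mono[OF ba, of "a * b\<^sup>2"] assms by (simp add: power_eq_if mult_ac)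
  moreover have "0 \<le> b ^ 4 / \<delta> ^ 3" using assms by simp
  ultimately show ?thesis using 1 by (simp add: mult.assoc)
next
  case False
  define c where "c = b / \<delta>"
  have c: "a \<le> c" "b \<le> c" "0 \<le> c" "b = \<delta> * c"
    using False assms mult_left_le_one_le[of b \<delta>] by (auto simp: c_def field_simps)
  have q: "b ^ 4 / \<delta> ^ 3 = c ^ 3 * b" using assms by (simp add: c_def power_eq_if)
  have "a ^ 3 * b \<le> c ^ 3 * b" using c assms by (intro mult_right_mono power_mono) auto
  moreover have "a\<^sup>2 * b * b \<le> c\<^sup>2 * c * b" using c assms by (intro mult_mono power_mono mult_nonneg_nonneg) auto
  moreover have "a * b\<^sup>2 * b \<le> c * c\<^sup>2 * b" using c assms by (intro mult_mono power_mono mult_nonneg_nonneg) auto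
  moreover have "0 \<le> \<delta> * a ^ 4" using assms by simp
  ultimately show ?thesis unfolding q by (simp add: power_eq_if mult_ac)
qed

subsection \<open>Moving one piece to infinity\<close>

text \<open>The density that dominates the gradient and double-well interaction of two overlapping
  functions in \<open>cross_le\<close>.\<close>

definition local_density :: "(real^3 \<Rightarrow> real) \<Rightarrow> (real^3 \<Rightarrow> real^3) \<Rightarrow> real^3 \<Rightarrow> real" where
  "local_density u G x = (norm (G x))\<^sup>2 + (u x)\<^sup>2 + (u x) ^ 4"

lemma product_le_weighted:
  fixes a b \<delta> :: real
  assumes "0 < \<delta>" "\<delta> \<le> 1" "0 \<le> a" "0 \<le> b"
  shows "a * b \<le> \<delta> * a\<^sup>2 + b\<^sup>2 / \<delta> ^ 3"
proof -
  have "2 * (\<delta> * a) * b \<le> (\<delta> * a)\<^sup>2 + b\<^sup>2" by (rule sum_squares_bound)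
  moreover have "0 \<le> \<delta> * (a * b)" using assms by simp
  ultimately have "\<delta> * (a * b) \<le> \<delta> * (\<delta> * a\<^sup>2) + b\<^sup>2" by (simp add: power2_eq_square mult_ac)
  then have "a * b \<le> \<delta> * a\<^sup>2 + b\<^sup>2 / \<delta>" using assms by (simp add: field_simps)
  also have "b\<^sup>2 / \<delta> \<le> b\<^sup>2 / \<delta> ^ 3"
    using assms power_decreasing[of 1 3 \<delta>] by (intro divide_left_mono) auto
  finally show ?thesis by simp
qed

text \<open>The asymmetry is deliberate: at a given point the function that is in its tail takes the
  factor \<open>1 / \<delta> ^ 3\<close>, and the other pays only \<open>\<delta>\<close>.\<close>

lemma cross_le:
  fixes g h :: "real^3"
  assumes "0 \<le> a" "0 \<le> b" "0 < \<delta>" "\<delta> \<le> 1"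
  shows "g \<bullet> h + (a * b + 2 * a ^ 3 * b + 3 * a\<^sup>2 * b\<^sup>2 + 2 * a * b ^ 3)
    \<le> 7 * (\<delta> * ((norm g)\<^sup>2 + a\<^sup>2 + a ^ 4) + ((norm h)\<^sup>2 + b\<^sup>2 + b ^ 4) / \<delta> ^ 3)"
proof -
  have "g \<bullet> h \<le> norm g * norm h" by (rule norm_cauchy_schwarz)
  also have "\<dots> \<le> \<delta> * (norm g)\<^sup>2 + (norm h)\<^sup>2 / \<delta> ^ 3" by (rule product_le_weighted) (use assms in auto)
  finally have 1: "g \<bullet> h \<le> \<delta> * (norm g)\<^sup>2 + (norm h)\<^sup>2 / \<delta> ^ 3" .
  have 2: "a * b \<le> \<delta> * a\<^sup>2 + b\<^sup>2 / \<delta> ^ 3" by (rule product_le_weighted) (use assms in auto)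
  note 3 = quartic_cross_le[OF assms]
  have "0 \<le> \<delta> * (norm g)\<^sup>2" "0 \<le> (norm h)\<^sup>2 / \<delta> ^ 3" "0 \<le> \<delta> * a\<^sup>2" "0 \<le> b\<^sup>2 / \<delta> ^ 3" using assms by auto
  with 1 2 3 show ?thesis unfolding distrib_left add_divide_distrib by linarith
qed

lemma tail_tendsto_0:
  assumes F: "integrable lborel F" and r: "filterlim r at_top sequentially"
  shows "(\<lambda>n. LINT x|lborel. indicator {x. r n \<le> norm (x::real^3)} x * F x) \<longlonglongrightarrow> (0::real)"
proof -
  have [measurable]: "F \<in> borel_measurable borel" using F by simp
  have "(\<lambda>n. LINT x|lborel. indicator {x. r n \<le> norm (x::real^3)} x * F x) \<longlonglongrightarrow> (LINT x|(lborel :: (real^3) measure). 0)"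
  proof (rule integral_dominated_convergence[where w="\<lambda>x. \<bar>F x\<bar>"])
    show "AE x in lborel. (\<lambda>n. indicator {x. r n \<le> norm (x::real^3)} x * F x) \<longlonglongrightarrow> 0"
    proof (intro AE_I2 tendsto_eventually)
      fix x :: "real^3"
      have "eventually (\<lambda>n. norm x < r n) sequentially" using r by (simp add: filterlim_at_top_dense)
      then show "eventually (\<lambda>n. indicator {x. r n \<le> norm (x::real^3)} x * F x = 0) sequentially"
        by (rule eventually_mono) (simp add: indicator_def)
    qed
  qed (use F in \<open>auto simp: indicator_def\<close>)
  then show ?thesis by simp
qed

lemma admissible_translate:
  assumes g: "admissible u G"
  shows "admissible (\<lambda>x. u (x + a)) (\<lambda>x. G (x + a))"
    "(LINT x|lborel. u (x + a)) = (LINT x|lborel. u x)"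
    "coul (\<lambda>x. u (x + a)) (\<lambda>x. u (x + a)) = coul u u"
proof -
  note d = admissibleD[OF g]
  note [measurable] = d(6,7)
  have i: "integrable lborel (\<lambda>x. f (x + a))" if "integrable lborel f" for f :: "real^3 \<Rightarrow> real"
  proof -
    have [measurable]: "f \<in> borel_measurable borel" using that by simp
    show ?thesis using that nn_integral_lborel_translate[of "\<lambda>x. ennreal (norm (f x))" a]
      by (simp add: integrable_iff_bounded)
  qed
  show "admissible (\<lambda>x. u (x + a)) (\<lambda>x. G (x + a))"
    by (rule admissibleI[OF H1_translate[OF d(1)] d(2) i[OF d(8)] i[OF d(10)]])
  show "(LINT x|lborel. u (x + a)) = (LINT x|lborel. u x)" by (rule integral_lborel_translate) measurable
  have "coul (\<lambda>x. u (x + a)) (\<lambda>x. u (x + a))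
      = (\<integral>\<^sup>+x. (\<integral>\<^sup>+y. ennreal (u (x + a) * u y / norm (x + a - y)) \<partial>lborel) \<partial>lborel)"
    unfolding coul_def
  proof (rule nn_integral_cong)
    fix x
    show "(\<integral>\<^sup>+y. ennreal (u (x + a) * u (y + a) / norm (x - y)) \<partial>lborel)
      = (\<integral>\<^sup>+y. ennreal (u (x + a) * u y / norm (x + a - y)) \<partial>lborel)"
      using nn_integral_lborel_translate[of "\<lambda>y. ennreal (u (x + a) * u y / norm (x + a - y))" a] by simp
  qed
  also have "\<dots> = coul u u"
    unfolding coul_def by (rule nn_integral_lborel_translate[of "\<lambda>x. \<integral>\<^sup>+y. ennreal (u x * u y / norm (x - y)) \<partial>lborel" a]) measurable
  finally show "coul (\<lambda>x. u (x + a)) (\<lambda>x. u (x + a)) = coul u u" .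
qed

lemma local_density_integrable: "admissible u G \<Longrightarrow> integrable lborel (local_density u G)"
  unfolding local_density_def[abs_def] by (intro Bochner_Integration.integrable_add admissibleD)

text \<open>With a shift of length \<open>3 * r\<close>, either \<open>x\<close> or
  \<open>y + a\<close> lies outside the ball of radius \<open>r\<close>, or \<open>x\<close> and
  \<open>y\<close> are at distance at least \<open>r\<close>. The first two cases are tails, handled
  by the uniform bound on potentials.\<close>

lemma coul_far_le:
  assumes u: "admissible u G" and v: "admissible v H" and r: "r > 0" and a: "norm a = 3 * r"
  defines "P \<equiv> \<lambda>w. (LINT x|lborel. w x) + (LINT x|lborel. (w x)\<^sup>2) + newton_const"
    and "T \<equiv> \<lambda>w. LINT x|lborel. indicator {x. r \<le> norm (x::real^3)} x * w x"
  shows "enn2real (coul u (\<lambda>x. v (x + a)))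
    \<le> T u * P v + T v * P u + (LINT x|lborel. u x) * (LINT x|lborel. v x) * (1 / r)"
proof -
  note du = admissibleD[OF u] and dv = admissibleD[OF v]
  note [measurable] = du(6) dv(6)
  define v' where "v' x = v (x + a)" for x
  have gv': "admissible v' (\<lambda>x. H (x + a))" unfolding v'_def by (rule admissible_translate[OF v])
  note dv' = admissibleD[OF gv']
  note [measurable] = dv'(6)
  define t1 where "t1 x = indicator {x. r \<le> norm x} x * u x" for x
  define t2 where "t2 x = indicator {x. r \<le> norm x} (x + a) * v (x + a)" for x
  have [measurable]: "t1 \<in> borel_measurable borel" "t2 \<in> borel_measurable borel" unfolding t1_def t2_def by measurable
  have t: "0 \<le> t1 x" "0 \<le> t2 x" for x using du(2) dv(2) by (auto simp: t1_def t2_def)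
  have L: "L1n w + L2n w + ennreal newton_const = ennreal (P w)" "0 \<le> P w" if "admissible w W" for w W
  proof -
    have "0 \<le> (LINT x|lborel. w x)" "0 \<le> (LINT x|lborel. (w x)\<^sup>2)"
      using admissibleD(2)[OF that] by (auto intro!: Bochner_Integration.integral_nonneg)
    then show "L1n w + L2n w + ennreal newton_const = ennreal (P w)" "0 \<le> P w"
      unfolding admissible_L1n[OF that] admissible_L2n[OF that] P_def using newton_const(1) by simp_all
  qed
  have Pv': "P v' = P v"
    unfolding P_def v'_def using integral_lborel_translate[of v a] integral_lborel_translate[of "\<lambda>x. (v x)\<^sup>2" a] by simp
  have T: "0 \<le> T w" "L1n (\<lambda>x. indicator {x. r \<le> norm x} x * w x) = ennreal (T w)" if w: "admissible w W" for w W
  proof -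
    note dw = admissibleD[OF w]
    show "0 \<le> T w" unfolding T_def using dw(2) by (intro Bochner_Integration.integral_nonneg) simp
    have "integrable lborel (\<lambda>x. indicator {x. r \<le> norm x} x *\<^sub>R w x)" by (rule integrable_mult_indicator[OF _ dw(4)]) measurable
    then show "L1n (\<lambda>x. indicator {x. r \<le> norm x} x * w x) = ennreal (T w)"
      unfolding T_def using dw(2) by (subst nn_integral_eq_integral) (auto simp: abs_mult)
  qed
  have T2: "L1n t2 = ennreal (T v)"
    unfolding T(2)[OF v, symmetric] t2_def by (rule nn_integral_lborel_translate) measurable
  have m: "0 \<le> (LINT x|lborel. u x)" "0 \<le> (LINT x|lborel. v x)"
    using du(2) dv(2) by (auto intro!: Bochner_Integration.integral_nonneg)
  have prod: "(\<integral>\<^sup>+x. (\<integral>\<^sup>+y. ennreal (1 / r) * (ennreal (u x) * ennreal (v' y)) \<partial>lborel) \<partial>lborel)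
      = ennreal ((LINT x|lborel. u x) * (LINT x|lborel. v x) * (1 / r))"
  proof -
    have iu: "(\<integral>\<^sup>+x. ennreal (u x) \<partial>lborel) = ennreal (LINT x|lborel. u x)"
      "(\<integral>\<^sup>+x. ennreal (v' x) \<partial>lborel) = ennreal (LINT x|lborel. v x)"
      using admissible_L1n[OF u] admissible_L1n[OF gv'] du(2) dv'(2) admissible_translate(2)[OF v, of a] by (simp_all add: v'_def)
    show ?thesis
      using m r by (simp add: nn_integral_cmult nn_integral_multc iu) (simp add: ennreal_mult[symmetric] mult_ac)
  qed
  have "coul u v' \<le> (\<integral>\<^sup>+x. (\<integral>\<^sup>+y. ennreal (t1 x * v' y / norm (x - y)) + ennreal (u x * t2 y / norm (x - y))
      + ennreal (1 / r) * (ennreal (u x) * ennreal (v' y)) \<partial>lborel) \<partial>lborel)"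
    unfolding coul_def
  proof (intro nn_integral_mono)
    fix x y
    have pos: "0 \<le> t1 x * v' y / norm (x - y)" "0 \<le> u x * t2 y / norm (x - y)" "0 \<le> (1 / r) * (u x * v' y)"
      using t du(2) dv'(2) r by auto
    have "u x * v' y / norm (x - y) \<le> t1 x * v' y / norm (x - y) + u x * t2 y / norm (x - y) + (1 / r) * (u x * v' y)"
    proof (cases "r \<le> norm x \<or> r \<le> norm (y + a)")
      case True
      then show ?thesis using pos by (auto simp: t1_def t2_def v'_def)
    next
      case False
      have "norm a \<le> norm (y + a) + norm (x - y) + norm x"
        using norm_triangle_ineq4[of "y + a" y] norm_triangle_ineq4[of x "x - y"] by simp
      then have "r \<le> norm (x - y)" using False a by linarith
      then have "u x * v' y / norm (x - y) \<le> u x * v' y / r"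
        using du(2) dv'(2) r by (intro divide_left_mono mult_nonneg_nonneg mult_pos_pos) auto
      then show ?thesis using pos by simp
    qed
    from ennreal_leI[OF this]
    have "ennreal (u x * v' y / norm (x - y)) \<le> ennreal (t1 x * v' y / norm (x - y)) + ennreal (u x * t2 y / norm (x - y))
      + ennreal ((1 / r) * (u x * v' y))"
      by (simp only: ennreal_plus[OF add_nonneg_nonneg[OF pos(1,2)] pos(3)] ennreal_plus[OF pos(1,2)])
    also have "ennreal ((1 / r) * (u x * v' y)) = ennreal (1 / r) * ennreal (u x * v' y)"
      by (rule ennreal_mult) (use r du(2) dv'(2) in auto)
    also have "ennreal (u x * v' y) = ennreal (u x) * ennreal (v' y)" by (rule ennreal_mult[OF du(2) dv'(2)])
    finally show "ennreal (u x * v' y / norm (x - y)) \<le> ennreal (t1 x * v' y / norm (x - y)) + ennreal (u x * t2 y / norm (x - y))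
      + ennreal (1 / r) * (ennreal (u x) * ennreal (v' y))" .
  qed
  also have "\<dots> = coul t1 v' + coul u t2 + ennreal ((LINT x|lborel. u x) * (LINT x|lborel. v x) * (1 / r))"
    unfolding coul_def prod[symmetric] by (simp add: nn_integral_add)
  also have "coul u t2 = coul t2 u" by (rule coul_sym) measurable
  also have "coul t1 v' \<le> ennreal (T u) * ennreal (P v)"
  proof -
    have "coul t1 v' \<le> L1n t1 * (L1n v' + L2n v' + ennreal newton_const)" by (rule coul_le[OF _ _ t(1) dv'(2)]) measurable
    moreover have "L1n t1 = ennreal (T u)" unfolding t1_def by (rule T(2)[OF u])
    ultimately show ?thesis by (simp only: L(1)[OF gv'] Pv')
  qed
  also have "coul t2 u \<le> ennreal (T v) * ennreal (P u)"
  proof -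
    have "coul t2 u \<le> L1n t2 * (L1n u + L2n u + ennreal newton_const)" by (rule coul_le[OF _ _ t(2) du(2)]) measurable
    then show ?thesis by (simp only: L(1)[OF u] T2)
  qed
  finally have "coul u v' \<le> ennreal (T u) * ennreal (P v) + ennreal (T v) * ennreal (P u)
      + ennreal ((LINT x|lborel. u x) * (LINT x|lborel. v x) * (1 / r))" by (simp add: add_mono)
  also have "\<dots> = ennreal (T u * P v + T v * P u + (LINT x|lborel. u x) * (LINT x|lborel. v x) * (1 / r))"
    using T(1)[OF u] T(1)[OF v] L(2)[OF u] L(2)[OF v] m r by (simp add: ennreal_plus ennreal_mult)
  finally show ?thesis
    unfolding v'_def by (rule enn2real_leI[rotated]) (use T(1)[OF u] T(1)[OF v] L(2)[OF u] L(2)[OF v] m r in simp)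
qed

text \<open>At every point one of the functions is in its tail, since \<open>x\<close> and
  \<open>x + a\<close> cannot both lie in the ball of radius \<open>r\<close>. The attraction of the
  second piece and the negative cubic interaction are dropped, so that piece appears with charge
  0.\<close>

lemma join_local_le:
  assumes u: "admissible u G" and v: "admissible v H" and Z: "0 \<le> Z" and r: "r > 0" and a: "norm a = 3 * r"
    and \<delta>: "0 < \<delta>" "\<delta> \<le> 1"
  defines "T \<equiv> \<lambda>F. LINT x|lborel. indicator {x. r \<le> norm (x::real^3)} x * F x"
  shows "loc_energy Z (\<lambda>x. u x + v (x + a)) (\<lambda>x. G x + H (x + a)) \<le> loc_energy Z u G + loc_energy 0 v H
    + 7 * (\<delta> * ((LINT x|lborel. local_density u G x) + (LINT x|lborel. local_density v H x))
      + (T (local_density u G) + T (local_density v H)) / \<delta> ^ 3)"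
proof -
  let ?F = "local_density u G" and ?E = "\<lambda>x. local_density v H (x + a)"
  define v' where "v' x = v (x + a)" for x
  define H' where "H' x = H (x + a)" for x
  have gv': "admissible v' H'" unfolding v'_def H'_def by (rule admissible_translate[OF v])
  note du = admissibleD[OF u] and dv = admissibleD[OF v] and dv' = admissibleD[OF gv'] and ds = admissibleD[OF admissible_add[OF u gv']]
  note [measurable] = du(6,7) dv(6,7) dv'(6,7)
  have Fi: "integrable lborel ?F" "integrable lborel (local_density v H)" "integrable lborel ?E"
    using local_density_integrable[OF u] local_density_integrable[OF v] local_density_integrable[OF gv']
    unfolding v'_def H'_def local_density_def by simp_all
  have [measurable]: "local_density v H \<in> borel_measurable borel" using Fi(2) by simp
  let ?i = "\<lambda>x. indicator {x. r \<le> norm (x::real^3)} x :: real"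
  have ti: "integrable lborel (\<lambda>x. ?i x * ?F x)" "integrable lborel (\<lambda>x. ?i (x + a) * ?E x)"
  proof -
    have "integrable lborel (\<lambda>x. ?i x *\<^sub>R ?F x)" by (rule integrable_mult_indicator[OF _ Fi(1)]) measurable
    then show "integrable lborel (\<lambda>x. ?i x * ?F x)" by simp
    show "integrable lborel (\<lambda>x. ?i (x + a) * ?E x)"
      by (rule Bochner_Integration.integrable_bound[OF Fi(3)]) (auto simp: indicator_def)
  qed
  have nn: "0 \<le> ?F x" "0 \<le> ?E x" for x by (auto simp: local_density_def)
  have cross: "G x \<bullet> H' x + (u x * v' x + 2 * (u x) ^ 3 * v' x + 3 * (u x)\<^sup>2 * (v' x)\<^sup>2 + 2 * u x * (v' x) ^ 3)
    \<le> 7 * (\<delta> * (?F x + ?E x) + (?i x * ?F x + ?i (x + a) * ?E x) / \<delta> ^ 3)" for x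
  proof (cases "r \<le> norm x")
    case True
    have "G x \<bullet> H' x + (u x * v' x + 2 * (u x) ^ 3 * v' x + 3 * (u x)\<^sup>2 * (v' x)\<^sup>2 + 2 * u x * (v' x) ^ 3)
      \<le> 7 * (\<delta> * ?E x + ?F x / \<delta> ^ 3)"
      using cross_le[OF dv'(2) du(2) \<delta>, of "H' x" "G x" x x]
      by (simp add: local_density_def v'_def H'_def inner_commute mult_ac add_ac)
    also have "\<dots> \<le> 7 * (\<delta> * (?F x + ?E x) + (?i x * ?F x + ?i (x + a) * ?E x) / \<delta> ^ 3)"
      using True nn[of x] \<delta> by (intro mult_left_mono add_mono divide_right_mono) auto
    finally show ?thesis .
  next
    case False
    have "norm a \<le> norm (x + a) + norm x" using norm_triangle_ineq4[of "x + a" x] by simp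
    then have *: "r \<le> norm (x + a)" using False a r by linarith
    have "G x \<bullet> H' x + (u x * v' x + 2 * (u x) ^ 3 * v' x + 3 * (u x)\<^sup>2 * (v' x)\<^sup>2 + 2 * u x * (v' x) ^ 3)
      \<le> 7 * (\<delta> * ?F x + ?E x / \<delta> ^ 3)"
      using cross_le[OF du(2) dv'(2) \<delta>, of "G x" "H' x" x x] by (simp add: local_density_def v'_def H'_def)
    also have "\<dots> \<le> 7 * (\<delta> * (?F x + ?E x) + (?i x * ?F x + ?i (x + a) * ?E x) / \<delta> ^ 3)"
      using * nn[of x] \<delta> by (intro mult_left_mono add_mono divide_right_mono) auto
    finally show ?thesis .
  qed
  let ?R = "\<lambda>x. 7 * (\<delta> * (?F x + ?E x) + (?i x * ?F x + ?i (x + a) * ?E x) / \<delta> ^ 3)"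
  have Ri: "integrable lborel ?R"
    by (intro integrable_mult_right Bochner_Integration.integrable_add integrable_divide Fi ti)
  have sc: "LINT x|lborel. ?i (x + a) * ?E x = T (local_density v H)" "(LINT x|lborel. ?E x) = (LINT x|lborel. local_density v H x)"
    unfolding T_def by (rule integral_lborel_translate; measurable)+
  have RI: "(LINT x|lborel. ?R x) = 7 * (\<delta> * ((LINT x|lborel. local_density u G x) + (LINT x|lborel. local_density v H x))
      + (T (local_density u G) + T (local_density v H)) / \<delta> ^ 3)"
    using Fi ti by (simp add: sc T_def)
  have k: "(norm (G x + H' x))\<^sup>2 / 2 + dwell (u x + v' x)
      \<le> ((norm (G x))\<^sup>2 / 2 + dwell (u x)) + ((norm (H' x))\<^sup>2 / 2 + dwell (v' x)) + ?R x" for x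
  proof -
    have "(norm (G x + H' x))\<^sup>2 = (norm (G x))\<^sup>2 + (norm (H' x))\<^sup>2 + 2 * (G x \<bullet> H' x)"
      by (simp add: power2_norm_eq_inner inner_add_left inner_add_right inner_commute)
    moreover have "0 \<le> 3 * u x * v' x * (u x + v' x)" using du(2) dv'(2) by simp
    ultimately show ?thesis using cross[of x] unfolding dwell_add by linarith
  qed
  have "(LINT x|lborel. (norm (G x + H' x))\<^sup>2 / 2 + dwell (u x + v' x))
      \<le> (LINT x|lborel. ((norm (G x))\<^sup>2 / 2 + dwell (u x)) + ((norm (H' x))\<^sup>2 / 2 + dwell (v' x)) + ?R x)"
    by (rule integral_mono[OF _ _ k]; intro Bochner_Integration.integrable_add integrable_divide du dv' ds Ri)
  also have "\<dots> = (LINT x|lborel. (norm (G x))\<^sup>2 / 2 + dwell (u x)) + (LINT x|lborel. (norm (H' x))\<^sup>2 / 2 + dwell (v' x)) + (LINT x|lborel. ?R x)"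
    by (subst Bochner_Integration.integral_add, (intro Bochner_Integration.integrable_add integrable_divide du dv' Ri)+,
        subst Bochner_Integration.integral_add, (intro Bochner_Integration.integrable_add integrable_divide du dv')+, simp only:)
  finally have 1: "(LINT x|lborel. (norm (G x + H' x))\<^sup>2) / 2 + (LINT x|lborel. dwell (u x + v' x))
      \<le> (LINT x|lborel. (norm (G x))\<^sup>2) / 2 + (LINT x|lborel. dwell (u x)) + ((LINT x|lborel. (norm (H' x))\<^sup>2) / 2 + (LINT x|lborel. dwell (v' x))) + (LINT x|lborel. ?R x)"
    using du dv' ds by simp
  have tr: "(LINT x|lborel. (norm (H' x))\<^sup>2) = (LINT x|lborel. (norm (H x))\<^sup>2)" "(LINT x|lborel. dwell (v' x)) = (LINT x|lborel. dwell (v x))"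
    unfolding H'_def v'_def by (rule integral_lborel_translate; measurable)+
  have "(LINT x|lborel. u x / norm x) \<le> (LINT x|lborel. (u x + v' x) / norm x)"
    by (rule integral_mono[OF du(11) ds(11)]) (use dv'(2) in \<open>simp add: divide_right_mono\<close>)
  from mult_left_mono[OF this Z] 1 show ?thesis
    unfolding loc_energy_def RI tr v'_def[symmetric] H'_def[symmetric] by simp
qed

text \<open>First \<open>\<delta>\<close> makes the bulk part \<open>7 * (\<delta> * I)\<close> at
  most \<open>\<epsilon> / 2\<close>; then a large \<open>r\<close> disposes of the tails and of the
  Coulomb interaction. This order is forced by the factor \<open>1 / \<delta> ^ 3\<close> on the
  tails.\<close>

lemma join_far:
  assumes u: "admissible u G" and v: "admissible v H" and Z: "0 \<le> Z" and \<epsilon>: "\<epsilon> > 0"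
  obtains w W where "admissible w W" "(LINT x|lborel. w x) = (LINT x|lborel. u x) + (LINT x|lborel. v x)"
    "tot_energy Z w W \<le> tot_energy Z u G + tot_energy 0 v H + \<epsilon>"
proof -
  define I where "I = (LINT x|lborel. local_density u G x) + (LINT x|lborel. local_density v H x)"
  have I0: "0 \<le> I" unfolding I_def local_density_def by (intro add_nonneg_nonneg Bochner_Integration.integral_nonneg) auto
  define \<delta> where "\<delta> = min 1 (\<epsilon> / (14 * (I + 1)))"
  have \<delta>: "0 < \<delta>" "\<delta> \<le> 1" using \<epsilon> I0 by (auto simp: \<delta>_def)
  have "\<delta> \<le> \<epsilon> / (14 * (I + 1))" by (simp add: \<delta>_def)
  then have "\<delta> * (14 * (I + 1)) \<le> \<epsilon>" using I0 by (subst (asm) pos_le_divide_eq) auto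
  then have dI: "7 * (\<delta> * I) \<le> \<epsilon> / 2" using \<delta>(1) by (simp add: distrib_left)
  define r where "r n = real (Suc n)" for n
  have rl: "filterlim r at_top sequentially"
    unfolding r_def by (rule filterlim_compose[OF filterlim_real_sequentially filterlim_Suc])
  define T where "T n F = (LINT x|lborel. indicator {x. r n \<le> norm (x::real^3)} x * F x :: real)" for n F
  define P where "P w = (LINT x|lborel. w x) + (LINT x|lborel. (w x)\<^sup>2) + newton_const" for w :: "real^3 \<Rightarrow> real"
  have T: "(\<lambda>n. T n F) \<longlonglongrightarrow> 0" if "integrable lborel F" for F
    unfolding T_def by (rule tail_tendsto_0[OF that rl])
  have i: "(\<lambda>n. 1 / r n) \<longlonglongrightarrow> 0" unfolding r_def by (rule LIMSEQ_Suc[OF lim_1_over_n])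
  have "(\<lambda>n. 7 * ((T n (local_density u G) + T n (local_density v H)) / \<delta> ^ 3)
      + (T n u * P v + T n v * P u + (LINT x|lborel. u x) * (LINT x|lborel. v x) * (1 / r n)))
    \<longlonglongrightarrow> 7 * ((0 + 0) / \<delta> ^ 3) + (0 * P v + 0 * P u + (LINT x|lborel. u x) * (LINT x|lborel. v x) * 0)"
    by (intro tendsto_add tendsto_mult tendsto_divide tendsto_const T i local_density_integrable u v admissibleD(4)[OF u] admissibleD(4)[OF v])
       (use \<delta> in simp)
  then have "eventually (\<lambda>n. 7 * ((T n (local_density u G) + T n (local_density v H)) / \<delta> ^ 3)
      + (T n u * P v + T n v * P u + (LINT x|lborel. u x) * (LINT x|lborel. v x) * (1 / r n)) < \<epsilon> / 2) sequentially"
    by (rule order_tendstoD(2)) (use \<epsilon> in simp)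
  from eventually_happens'[OF sequentially_bot this] obtain n where
    n: "7 * ((T n (local_density u G) + T n (local_density v H)) / \<delta> ^ 3)
      + (T n u * P v + T n v * P u + (LINT x|lborel. u x) * (LINT x|lborel. v x) * (1 / r n)) < \<epsilon> / 2" by blast
  define a where "a = (3 * r n) *\<^sub>R (axis 1 1 :: real^3)"
  have rn: "r n > 0" by (simp add: r_def)
  have a: "norm a = 3 * r n" using rn by (simp add: a_def)
  let ?v = "\<lambda>x. v (x + a)" and ?H = "\<lambda>x. H (x + a)"
  note gt = admissible_translate[OF v, of a]
  have C: "enn2real (coul (\<lambda>x. u x + ?v x) (\<lambda>x. u x + ?v x)) = enn2real (coul u u) + 2 * enn2real (coul u ?v) + enn2real (coul v v)"
    using admissible_coul_finite[OF u u] admissible_coul_finite[OF u gt(1)] admissible_coul_finite[OF v v]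
    by (subst coul_add[OF admissibleD(6)[OF u] admissibleD(6)[OF gt(1)] admissibleD(2)[OF u] admissibleD(2)[OF gt(1)]])
       (simp add: gt(3) enn2real_plus enn2real_mult ennreal_mult_less_top ennreal_add_less_top)
  have cf: "enn2real (coul u ?v) \<le> T n u * P v + T n v * P u + (LINT x|lborel. u x) * (LINT x|lborel. v x) * (1 / r n)"
    unfolding T_def P_def by (rule coul_far_le[OF u v rn a])
  have lf: "loc_energy Z (\<lambda>x. u x + ?v x) (\<lambda>x. G x + ?H x) \<le> loc_energy Z u G + loc_energy 0 v H
    + 7 * (\<delta> * I + (T n (local_density u G) + T n (local_density v H)) / \<delta> ^ 3)"
    unfolding T_def I_def by (rule join_local_le[OF u v Z rn a \<delta>])
  show thesis
  proof (rule that[OF admissible_add[OF u gt(1)]])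
    show "(LINT x|lborel. u x + ?v x) = (LINT x|lborel. u x) + (LINT x|lborel. v x)"
      using admissibleD(4)[OF u] admissibleD(4)[OF gt(1)] gt(2) by simp
    show "tot_energy Z (\<lambda>x. u x + ?v x) (\<lambda>x. G x + ?H x) \<le> tot_energy Z u G + tot_energy 0 v H + \<epsilon>"
      using lf cf n dI unfolding tot_energy_def C distrib_left by argo
  qed
qed

subsection \<open>The mass of a minimiser\<close>

lemma grad_one_minus: assumes "smooth f" shows "grad (\<lambda>x. 1 - f x) x = - grad f x"
  by (rule grad_eqI) (auto intro!: derivative_eq_intros smooth_has_derivative assms)

text \<open>The logistic function is chosen because \<open>c' = c (1 - c)\<close>: the interface terms are then controlled by
  \<open>c (1 - c)\<close>, whose integral over \<open>l\<close> is at most 1.\<close>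

lemma cut_gradient_le:
  fixes g \<xi> :: "real^3"
  assumes c: "0 < c" "c < 1" and \<xi>: "norm \<xi> = c * (1 - c)" and u: "0 \<le> u"
  shows "(norm ((1 - c) *\<^sub>R g + u *\<^sub>R (- \<xi>)))\<^sup>2 / 2 + (norm (c *\<^sub>R g + u *\<^sub>R \<xi>))\<^sup>2 / 2
    \<le> (norm g)\<^sup>2 / 2 + c * (1 - c) * u\<^sup>2"
proof -
  define \<kappa> where "\<kappa> = c * (1 - c)"
  have k: "0 \<le> \<kappa>" "\<kappa> \<le> 1 / 4"
    using c sum_squares_bound[of c "1 - c"] by (auto simp: \<kappa>_def power2_eq_square algebra_simps)
  have x2: "\<xi> \<bullet> \<xi> = \<kappa> * \<kappa>" using \<xi> by (simp add: \<kappa>_def power2_norm_eq_inner[symmetric] power2_eq_square)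
  \<comment> \<open>Since \<open>(1 - c)\<^sup>2 + c\<^sup>2 = 1 - 2 * \<kappa>\<close>, cutting
    lowers the sum of squares by \<open>2 * \<kappa> * (norm g)\<^sup>2\<close>; this absorbs the
    mixed term.\<close>
  have id: "(norm ((1 - c) *\<^sub>R g + u *\<^sub>R (- \<xi>)))\<^sup>2 + (norm (c *\<^sub>R g + u *\<^sub>R \<xi>))\<^sup>2
      = (norm g)\<^sup>2 - 2 * \<kappa> * (norm g)\<^sup>2 + 2 * ((2 * c - 1) * (u * (g \<bullet> \<xi>))) + 2 * (u\<^sup>2 * (\<xi> \<bullet> \<xi>))"
    by (simp only: power2_norm_eq_inner inner_add_left inner_add_right inner_scaleR_left inner_scaleR_right
        inner_minus_left inner_minus_right inner_commute[of \<xi> g])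
       (simp add: \<kappa>_def power2_eq_square algebra_simps)
  have "(2 * c - 1) * (u * (g \<bullet> \<xi>)) \<le> \<bar>2 * c - 1\<bar> * (u * \<bar>g \<bullet> \<xi>\<bar>)"
    using u abs_ge_self[of "(2 * c - 1) * (u * (g \<bullet> \<xi>))"] by (simp add: abs_mult)
  also have "\<dots> \<le> 1 * (u * (norm g * \<kappa>))"
    using c u Cauchy_Schwarz_ineq2[of g \<xi>] by (intro mult_mono mult_left_mono) (auto simp: \<xi> \<kappa>_def)
  also have "\<dots> = \<kappa> * (u * norm g)" by simp
  also have "\<dots> \<le> \<kappa> * (u\<^sup>2 / 4 + (norm g)\<^sup>2)"
    using sum_squares_bound[of "u / 2" "norm g"] k by (intro mult_left_mono) (auto simp: power_divide)
  finally have 1: "(2 * c - 1) * (u * (g \<bullet> \<xi>)) \<le> \<kappa> * (u\<^sup>2 / 4) + \<kappa> * (norm g)\<^sup>2" by (simp add: distrib_left)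
  have "\<kappa> * \<kappa> \<le> (1/4) * \<kappa>" using k by (intro mult_right_mono) auto
  then have "u\<^sup>2 * (\<kappa> * \<kappa>) \<le> u\<^sup>2 * ((1/4) * \<kappa>)" by (intro mult_left_mono) auto
  then have 2: "u\<^sup>2 * (\<xi> \<bullet> \<xi>) \<le> \<kappa> * (u\<^sup>2 / 4)" by (simp add: x2 mult_ac)
  have 3: "0 \<le> \<kappa> * u\<^sup>2" using k by simp
  have "\<kappa> * (u\<^sup>2 / 4) = (\<kappa> * u\<^sup>2) / 4" by simp
  then show ?thesis using id 1 2 3 unfolding \<kappa>_def[symmetric] by argo
qed

text \<open>Of the interaction terms in \<open>dwell_add\<close> only the cubic one is negative, and
  losing it is the cost of splitting.\<close>

lemma cut_dwell_le:
  assumes c: "0 < c" "c < 1" and u: "0 \<le> u"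
  shows "dwell ((1 - c) * u) + dwell (c * u) \<le> dwell u + 3 * (c * (1 - c) * u ^ 3)"
proof -
  have "dwell ((1 - c) * u + c * u) = dwell u" by (simp add: algebra_simps)
  moreover have "0 \<le> (1 - c) * u" "0 \<le> c * u" using c u by auto
  then have "0 \<le> (1 - c) * u * (c * u)" "0 \<le> 2 * ((1 - c) * u) ^ 3 * (c * u)" "0 \<le> 3 * ((1 - c) * u)\<^sup>2 * (c * u)\<^sup>2"
    "0 \<le> 2 * ((1 - c) * u) * (c * u) ^ 3" by simp_all
  moreover have "3 * ((1 - c) * u) * (c * u) * ((1 - c) * u + c * u) = 3 * (c * (1 - c) * u ^ 3)"
    by (simp add: power3_eq_cube algebra_simps)
  ultimately show ?thesis using dwell_add[of "(1 - c) * u" "c * u"] by linarith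
qed

lemma cut_inequality:
  fixes i :: 3 and l :: real
  assumes g: "admissible u G" and Z: "0 \<le> Z" and \<sigma>: "\<bar>\<sigma>\<bar> = 1"
    and minimal: "\<And>v H. admissible v H \<Longrightarrow> (LINT x|lborel. v x) = (LINT x|lborel. u x) \<Longrightarrow> tot_energy Z u G \<le> tot_energy Z v H"
  defines "c \<equiv> cut \<sigma> i l"
  shows "coul (\<lambda>x. (1 - c x) * u x) (\<lambda>x. c x * u x)
    \<le> (\<integral>\<^sup>+x. ennreal (c x * (1 - c x) * ((u x)\<^sup>2 + 3 * (u x) ^ 3)) + ennreal (Z * (c x * (u x / norm x))) \<partial>lborel)"
proof -
  note d = admissibleD[OF g]
  have c: "0 < c x" "c x < 1" "norm (grad c x) = c x * (1 - c x)" for x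
    unfolding c_def by (rule cut_bounds cut_bounds grad_cut[OF \<sigma>])+
  have sc: "smooth c" "smooth (\<lambda>x. 1 - c x)"
    unfolding c_def by (intro smooth_cut smooth_diff smooth_const)+
  have [measurable]: "c \<in> borel_measurable borel"
    by (intro borel_measurable_continuous_onI smooth_continuous_on sc)
  note [measurable] = d(6)
  have k1: "c x * (1 - c x) \<le> 1" for x using c[of x] by (intro mult_le_one) auto
  define a where "a x = (1 - c x) * u x" for x
  define b where "b x = c x * u x" for x
  define A where "A x = (1 - c x) *\<^sub>R G x + u x *\<^sub>R grad (\<lambda>x. 1 - c x) x" for x
  define B where "B x = c x *\<^sub>R G x + u x *\<^sub>R grad c x" for x
  have ga: "admissible a A" unfolding a_def A_def
    by (rule admissible_mult[OF g sc(2)]) (use c k1 in \<open>auto simp: grad_one_minus[OF sc(1)] less_imp_le\<close>)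
  have gb: "admissible b B" unfolding b_def B_def
    by (rule admissible_mult[OF g sc(1)]) (use c k1 in \<open>auto simp: less_imp_le\<close>)
  note da = admissibleD[OF ga] and db = admissibleD[OF gb]
  have ab: "(\<lambda>x. a x + b x) = u" by (auto simp: a_def b_def algebra_simps)
  have mass: "(LINT x|lborel. a x) + (LINT x|lborel. b x) = (LINT x|lborel. u x)"
    using da(4) db(4) by (subst Bochner_Integration.integral_add[symmetric]) (simp_all add: ab[unfolded fun_eq_iff])
  \<comment> \<open>The rejoined function has the mass of \<open>u\<close>, and
    \<open>join_far\<close> loses an arbitrarily small amount.\<close>
  have "tot_energy Z u G \<le> tot_energy Z a A + tot_energy 0 b B"
  proof (rule field_le_epsilon)
    fix e :: real assume "0 < e"
    then obtain w W where "admissible w W" "(LINT x|lborel. w x) = (LINT x|lborel. a x) + (LINT x|lborel. b x)"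
      "tot_energy Z w W \<le> tot_energy Z a A + tot_energy 0 b B + e"
      by (rule join_far[OF ga gb Z])
    then show "tot_energy Z u G \<le> tot_energy Z a A + tot_energy 0 b B + e" using minimal[of w W] mass by simp
  qed
  moreover have "enn2real (coul u u) = enn2real (coul a a) + 2 * enn2real (coul a b) + enn2real (coul b b)"
    using admissible_coul_finite[OF ga ga] admissible_coul_finite[OF ga gb] admissible_coul_finite[OF gb gb]
      coul_add[OF da(6) db(6) da(2) db(2)]
    by (simp add: ab enn2real_plus enn2real_mult ennreal_mult_less_top ennreal_add_less_top)
  \<comment> \<open>The factor 2 of the mixed term cancels the 1 / 2 in the energy; the left side is
    the repulsion saved by separating the pieces.\<close>
  ultimately have 1: "enn2real (coul a b) \<le> loc_energy Z a A + loc_energy 0 b B - loc_energy Z u G"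
    unfolding tot_energy_def by argo
  let ?k = "\<lambda>x. c x * (1 - c x) * ((u x)\<^sup>2 + 3 * (u x) ^ 3)"
  have ki: "integrable lborel ?k"
  proof (rule Bochner_Integration.integrable_bound)
    show "integrable lborel (\<lambda>x. (u x)\<^sup>2 + 3 * (u x) ^ 3)"
      by (intro Bochner_Integration.integrable_add integrable_mult_right d)
    show "AE x in lborel. norm (?k x) \<le> norm ((u x)\<^sup>2 + 3 * (u x) ^ 3)"
    proof (rule AE_I2)
      fix x
      have "0 \<le> (u x)\<^sup>2 + 3 * (u x) ^ 3" using d(2)[of x] by simp
      then show "norm (?k x) \<le> norm ((u x)\<^sup>2 + 3 * (u x) ^ 3)"
        using k1[of x] c[of x] by (simp add: abs_mult mult_left_le_one_le)
    qed
  qed measurable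
  have pw: "((norm (A x))\<^sup>2 / 2 + (norm (B x))\<^sup>2 / 2) + (dwell (a x) + dwell (b x)) \<le> ((norm (G x))\<^sup>2 / 2 + dwell (u x)) + ?k x" for x
    using cut_gradient_le[OF c[of x] d(2)[of x], of "G x"] cut_dwell_le[OF c(1,2)[of x] d(2)[of x]]
    unfolding A_def B_def a_def b_def grad_one_minus[OF sc(1)] distrib_left by argo
  have "(LINT x|lborel. ((norm (A x))\<^sup>2 / 2 + (norm (B x))\<^sup>2 / 2) + (dwell (a x) + dwell (b x)))
      \<le> (LINT x|lborel. ((norm (G x))\<^sup>2 / 2 + dwell (u x)) + ?k x)"
    by (rule integral_mono[OF _ _ pw]; intro Bochner_Integration.integrable_add integrable_divide da db d ki)
  also have "\<dots> = (LINT x|lborel. (norm (G x))\<^sup>2) / 2 + (LINT x|lborel. dwell (u x)) + (LINT x|lborel. ?k x)"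
    by (subst Bochner_Integration.integral_add, (intro Bochner_Integration.integrable_add integrable_divide d ki)+,
        subst Bochner_Integration.integral_add, (intro integrable_divide d)+, simp only: integral_divide_zero)
  finally have 2: "(LINT x|lborel. (norm (A x))\<^sup>2) / 2 + (LINT x|lborel. (norm (B x))\<^sup>2) / 2 + ((LINT x|lborel. dwell (a x)) + (LINT x|lborel. dwell (b x)))
      \<le> (LINT x|lborel. (norm (G x))\<^sup>2) / 2 + (LINT x|lborel. dwell (u x)) + (LINT x|lborel. ?k x)"
    using da db by simp
  have "(LINT x|lborel. a x / norm x) + (LINT x|lborel. b x / norm x) = (LINT x|lborel. u x / norm x)"
    using da(11) db(11)
    by (subst Bochner_Integration.integral_add[symmetric]) (simp_all add: add_divide_distrib[symmetric] ab[unfolded fun_eq_iff])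
  from arg_cong[OF this, of "\<lambda>t. Z * t"] have 3: "Z * (LINT x|lborel. a x / norm x) + Z * (LINT x|lborel. b x / norm x) = Z * (LINT x|lborel. u x / norm x)"
    by (simp add: distrib_left)
  have "enn2real (coul a b) \<le> (LINT x|lborel. ?k x) + Z * (LINT x|lborel. b x / norm x)"
    using 1 2 3 unfolding loc_energy_def by argo
  also have "\<dots> = (LINT x|lborel. ?k x + Z * (c x * (u x / norm x)))"
  proof -
    have bi: "integrable lborel (\<lambda>x. c x * (u x / norm x))" using db(11) by (simp add: b_def)
    have "(LINT x|lborel. ?k x + Z * (c x * (u x / norm x))) = (LINT x|lborel. ?k x) + Z * (LINT x|lborel. c x * (u x / norm x))"
      by (subst Bochner_Integration.integral_add[OF ki integrable_mult_right[OF bi]]) (simp only: integral_mult_right_zero)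
    then show ?thesis by (simp only: b_def times_divide_eq_right)
  qed
  finally have le: "enn2real (coul a b) \<le> (LINT x|lborel. ?k x + Z * (c x * (u x / norm x)))" .
  have nn: "0 \<le> ?k x" "0 \<le> Z * (c x * (u x / norm x))" for x
    using c[of x] d(2)[of x] Z by (auto intro!: mult_nonneg_nonneg add_nonneg_nonneg)
  have "coul a b = ennreal (enn2real (coul a b))"
    using admissible_coul_finite[OF ga gb] by (simp add: ennreal_enn2real)
  also have "\<dots> \<le> ennreal (LINT x|lborel. ?k x + Z * (c x * (u x / norm x)))" by (rule ennreal_leI[OF le])
  also have "\<dots> = (\<integral>\<^sup>+x. ennreal (?k x + Z * (c x * (u x / norm x))) \<partial>lborel)"
    by (rule nn_integral_eq_integral[symmetric])
       (use ki integrable_mult_right[OF db(11), of Z] nn in \<open>auto simp: b_def intro!: add_nonneg_nonneg\<close>)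
  also have "\<dots> = (\<integral>\<^sup>+x. ennreal (?k x) + ennreal (Z * (c x * (u x / norm x))) \<partial>lborel)"
    using nn by (intro nn_integral_cong ennreal_plus) auto
  finally show ?thesis unfolding a_def b_def .
qed

section \<open>Integration over the offset of the cut\<close>

lemma logistic_measurable [measurable]: "logistic \<in> borel_measurable borel"
  unfolding logistic_def[abs_def] by measurable

lemma nn_integral_logistic_layer:
  "(\<integral>\<^sup>+l. ennreal (logistic (t - l) * (1 - logistic (t - l))) * indicator {0..} l \<partial>lborel) \<le> 1"
proof -
  have lim: "((\<lambda>l. - logistic (t - l)) \<longlongrightarrow> - 0) at_top"
  proof (rule tendsto_minus)
    have "filterlim (\<lambda>l. 1 + exp (l - t)) at_top at_top"
      by (intro filterlim_tendsto_add_at_top[OF tendsto_const] filterlim_compose[OF exp_at_top])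
         (simp add: filterlim_tendsto_add_at_top[OF tendsto_const filterlim_ident, of "- t", simplified])
    from tendsto_divide_0[OF tendsto_const filterlim_at_top_imp_at_infinity[OF this], of 1]
    show "((\<lambda>l. logistic (t - l)) \<longlongrightarrow> 0) at_top" by (simp add: logistic_def)
  qed
  have "(\<integral>\<^sup>+l. ennreal (logistic (t - l) * (1 - logistic (t - l))) * indicator {0..} l \<partial>lborel) = - 0 - (- logistic (t - 0))"
  proof (rule nn_integral_FTC_atLeast[OF _ _ _ lim])
    have "((\<lambda>l. logistic (t - l)) has_field_derivative (logistic (t - l) * (1 - logistic (t - l))) * (0 - 1)) (at l)" for l
      by (rule DERIV_chain2[OF logistic_deriv]) (auto intro!: derivative_eq_intros)
    from DERIV_minus[OF this]
    show "((\<lambda>l. - logistic (t - l)) has_field_derivative logistic (t - l) * (1 - logistic (t - l))) (at l)" for l by simp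
  qed (use logistic_bounds in \<open>auto intro!: mult_nonneg_nonneg simp: less_imp_le\<close>)
  also have "\<dots> \<le> 1" using logistic_bounds(2)[of t] by simp
  finally show ?thesis .
qed

text \<open>The antiderivative is \<open>- ln (1 + exp (t - l))\<close>, and
  \<open>1 + exp t \<le> 2 * exp \<bar>t\<bar>\<close>. The growth in \<open>\<bar>t\<bar>\<close>
  will be cancelled by the factor \<open>1 / norm x\<close> of the attraction.\<close>

lemma nn_integral_logistic:
  "(\<integral>\<^sup>+l. ennreal (logistic (t - l)) * indicator {0..} l \<partial>lborel) \<le> ennreal (\<bar>t\<bar> + ln 2)"
proof -
  have lim: "((\<lambda>l. - ln (1 + exp (t - l))) \<longlongrightarrow> - ln (1 + 0)) at_top"
  proof (intro tendsto_minus tendsto_ln tendsto_add tendsto_const)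
    have "filterlim (\<lambda>l. t - l) at_bot at_top"
      unfolding filterlim_uminus_at_bot
      using filterlim_tendsto_add_at_top[OF tendsto_const filterlim_ident, of "- t"] by simp
    then show "((\<lambda>l. exp (t - l)) \<longlongrightarrow> 0) at_top" by (rule filterlim_compose[OF exp_at_bot])
  qed simp
  have p: "0 < 1 + exp (t - l)" for l using exp_gt_zero[of "t - l"] by linarith
  have e: "logistic (t - l) = exp (t - l) / (1 + exp (t - l))" for l
  proof -
    have q: "0 < 1 + exp (- (t - l))" using exp_gt_zero[of "- (t - l)"] by linarith
    have "1 + exp (t - l) = exp (t - l) * (1 + exp (- (t - l)))"
      using exp_minus_inverse[of "t - l"] by (simp only: distrib_left mult_1_right)
    then show ?thesis
      unfolding logistic_def using p[of l] q by (subst frac_eq_eq) (simp_all only: mult_1 less_imp_neq[symmetric] not_False_eq_True)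
  qed
  have "(\<integral>\<^sup>+l. ennreal (logistic (t - l)) * indicator {0..} l \<partial>lborel) = - ln (1 + 0) - (- ln (1 + exp (t - 0)))"
  proof (rule nn_integral_FTC_atLeast[OF _ _ _ lim])
    show "((\<lambda>l. - ln (1 + exp (t - l))) has_field_derivative logistic (t - l)) (at l)" for l
      unfolding e using p[of l] by (auto intro!: derivative_eq_intros)
  qed (use logistic_bounds in \<open>auto simp: less_imp_le\<close>)
  also have "\<dots> \<le> ennreal (\<bar>t\<bar> + ln 2)"
  proof (rule ennreal_leI)
    have "1 + exp t \<le> 2 * exp \<bar>t\<bar>" using one_le_exp_iff[of "\<bar>t\<bar>"] exp_le_cancel_iff[of t "\<bar>t\<bar>"] by linarith
    then have "ln (1 + exp t) \<le> ln (2 * exp \<bar>t\<bar>)" using p[of 0] by (subst ln_le_cancel_iff) auto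
    then show "- ln (1 + 0) - (- ln (1 + exp (t - 0))) \<le> \<bar>t\<bar> + ln 2" by (simp add: ln_mult)
  qed
  finally show ?thesis .
qed

text \<open>For \<open>l\<close> between the positive parts of \<open>b\<close> and \<open>a\<close>
  both factors are at least 1 / 2, which explains the 4. In the reversed order the left side is
  \<open>ennreal\<close> of a nonpositive number, hence 0.\<close>

lemma nn_integral_logistic_pair:
  "ennreal ((max a 0 - max b 0) / 4)
    \<le> (\<integral>\<^sup>+l. ennreal ((1 - logistic (b - l)) * logistic (a - l)) * indicator {0..} l \<partial>lborel)"
proof -
  have "ennreal ((max a 0 - max b 0) / 4) \<le> ennreal (1 / 4) * emeasure lborel {max b 0..max a 0}"
  proof (cases "max b 0 \<le> max a 0")
    case True
    then show ?thesis
      by (simp only: emeasure_lborel_Icc[OF True]) (subst ennreal_mult[symmetric]; simp)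
  next
    case False
    then have "(max a 0 - max b 0) / 4 \<le> 0"
      by (intro divide_nonpos_pos) (simp_all only: not_le diff_le_0_iff_le less_imp_le zero_less_numeral)
    then show ?thesis by (simp add: ennreal_neg)
  qed
  also have "\<dots> = (\<integral>\<^sup>+l. ennreal (1 / 4) * indicator {max b 0..max a 0} l \<partial>lborel)"
    by (subst nn_integral_cmult_indicator) auto
  also have "\<dots> \<le> (\<integral>\<^sup>+l. ennreal ((1 - logistic (b - l)) * logistic (a - l)) * indicator {0..} l \<partial>lborel)"
  proof (rule nn_integral_mono_AE)
    \<comment> \<open>At \<open>l = 0\<close> both positive parts can vanish while
      \<open>a < 0\<close>, and then the bound by 1 / 2 fails; a single point is negligible.\<close>
    have "AE l in lborel. l \<noteq> (0::real)" by (rule AE_lborel_singleton)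
    then show "AE l in lborel. ennreal (1 / 4) * indicator {max b 0..max a 0} l
        \<le> ennreal ((1 - logistic (b - l)) * logistic (a - l)) * indicator {0..} l"
    proof (rule AE_mp, intro AE_I2 impI)
      fix l :: real assume l0: "l \<noteq> 0"
      show "ennreal (1 / 4) * indicator {max b 0..max a 0} l
          \<le> ennreal ((1 - logistic (b - l)) * logistic (a - l)) * indicator {0..} l"
      proof (cases "l \<in> {max b 0..max a 0}")
        case True
        then have l: "0 < l" "b \<le> l" "l \<le> a" using l0 by (auto simp: max_def split: if_splits)
        have "1 / 2 \<le> logistic (a - l)" using l by (simp add: logistic_def field_simps add_pos_pos)
        moreover have "logistic (b - l) \<le> 1 / 2" using l by (simp add: logistic_def field_simps add_pos_pos)
        ultimately have "(1 / 2) * (1 / 2) \<le> (1 - logistic (b - l)) * logistic (a - l)"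
          by (intro mult_mono) auto
        then show ?thesis using True l by (simp add: ennreal_leI)
      qed simp
    qed
  qed
  finally show ?thesis .
qed

text \<open>\<open>cut_inequality\<close> integrated over \<open>l \<ge> 0\<close>. Fubini turns the
  left side into \<open>nn_integral_logistic_pair\<close>; on the right the interface integrates to
  at most 1, and \<open>\<bar>\<sigma> * x $ i\<bar> \<le> norm x\<close> reduces the attraction to
  a mass term and a potential term.\<close>

lemma cut_average:
  assumes g: "admissible u G" and Z: "0 \<le> Z" and \<sigma>: "\<bar>\<sigma>\<bar> = 1"
    and minimal: "\<And>v H. admissible v H \<Longrightarrow> (LINT x|lborel. v x) = (LINT x|lborel. u x) \<Longrightarrow> tot_energy Z u G \<le> tot_energy Z v H"
  shows "(\<integral>\<^sup>+x. (\<integral>\<^sup>+y. ennreal (u x * u y / norm (x - y) * ((max (\<sigma> * y $ i) 0 - max (\<sigma> * x $ i) 0) / 4)) \<partial>lborel) \<partial>lborel)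
    \<le> ennreal ((LINT x|lborel. (u x)\<^sup>2 + 3 * (u x) ^ 3) + (Z * (LINT x|lborel. u x) + Z * ln 2 * (LINT x|lborel. u x / norm x)))"
proof -
  note d = admissibleD[OF g]
  note [measurable] = d(6)
  have [measurable]: "(\<lambda>(l, x). cut \<sigma> i l x) \<in> borel_measurable (borel \<Otimes>\<^sub>M borel)" "(\<lambda>(x, l). cut \<sigma> i l x) \<in> borel_measurable (borel \<Otimes>\<^sub>M borel)"
    "cut \<sigma> i l \<in> borel_measurable borel" for l
    unfolding cut_def[abs_def] by measurable
  let ?w = "\<lambda>x y. ennreal (u x * u y / norm (x - y))"
  let ?p = "\<lambda>x y l. ennreal ((1 - cut \<sigma> i l x) * cut \<sigma> i l y) * indicator {0..} l"
  let ?F = "\<lambda>x. (u x)\<^sup>2 + 3 * (u x) ^ 3"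
  let ?k = "\<lambda>l x. ennreal (cut \<sigma> i l x * (1 - cut \<sigma> i l x) * ?F x) + ennreal (Z * (cut \<sigma> i l x * (u x / norm x)))"
  have F0: "0 \<le> ?F x" "0 \<le> Z * (u x / norm x)" for x using d(2)[of x] Z by auto
  have "(\<integral>\<^sup>+x. (\<integral>\<^sup>+y. ennreal (u x * u y / norm (x - y) * ((max (\<sigma> * y $ i) 0 - max (\<sigma> * x $ i) 0) / 4)) \<partial>lborel) \<partial>lborel)
    \<le> (\<integral>\<^sup>+x. (\<integral>\<^sup>+y. (\<integral>\<^sup>+l. ?w x y * ?p x y l \<partial>lborel) \<partial>lborel) \<partial>lborel)"
  proof (intro nn_integral_mono)
    fix x y
    have "ennreal (u x * u y / norm (x - y) * ((max (\<sigma> * y $ i) 0 - max (\<sigma> * x $ i) 0) / 4))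
        = ?w x y * ennreal ((max (\<sigma> * y $ i) 0 - max (\<sigma> * x $ i) 0) / 4)"
      by (rule ennreal_mult') (use d(2) in simp)
    also have "\<dots> \<le> ?w x y * (\<integral>\<^sup>+l. ?p x y l \<partial>lborel)"
      unfolding cut_def by (intro mult_left_mono nn_integral_logistic_pair) simp
    also have "\<dots> = (\<integral>\<^sup>+l. ?w x y * ?p x y l \<partial>lborel)" by (rule nn_integral_cmult[symmetric]) measurable
    finally show "ennreal (u x * u y / norm (x - y) * ((max (\<sigma> * y $ i) 0 - max (\<sigma> * x $ i) 0) / 4)) \<le> (\<integral>\<^sup>+l. ?w x y * ?p x y l \<partial>lborel)" .
  qed
  also have "\<dots> = (\<integral>\<^sup>+x. (\<integral>\<^sup>+l. (\<integral>\<^sup>+y. ?w x y * ?p x y l \<partial>lborel) \<partial>lborel) \<partial>lborel)"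
    by (rule nn_integral_cong, rule lborel_pair.Fubini') measurable
  also have "\<dots> = (\<integral>\<^sup>+l. (\<integral>\<^sup>+x. (\<integral>\<^sup>+y. ?w x y * ?p x y l \<partial>lborel) \<partial>lborel) \<partial>lborel)"
    by (rule lborel_pair.Fubini') measurable
  also have "\<dots> \<le> (\<integral>\<^sup>+l. (\<integral>\<^sup>+x. ?k l x * indicator {0..} l \<partial>lborel) \<partial>lborel)"
  proof (rule nn_integral_mono)
    fix l
    have "(\<integral>\<^sup>+x. (\<integral>\<^sup>+y. ?w x y * ?p x y l \<partial>lborel) \<partial>lborel)
        = (\<integral>\<^sup>+x. (\<integral>\<^sup>+y. ennreal ((1 - cut \<sigma> i l x) * u x * (cut \<sigma> i l y * u y) / norm (x - y)) * indicator {0..} l \<partial>lborel) \<partial>lborel)"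
    proof (intro nn_integral_cong)
      fix x y
      have w0: "0 \<le> u x * u y / norm (x - y)" using d(2) by simp
      have e: "u x * u y / norm (x - y) * ((1 - cut \<sigma> i l x) * cut \<sigma> i l y) = (1 - cut \<sigma> i l x) * u x * (cut \<sigma> i l y * u y) / norm (x - y)"
        by simp
      show "?w x y * ?p x y l = ennreal ((1 - cut \<sigma> i l x) * u x * (cut \<sigma> i l y * u y) / norm (x - y)) * indicator {0..} l"
        by (simp only: e[symmetric] ennreal_mult'[OF w0]) (simp only: mult.assoc)
    qed
    also have "\<dots> = coul (\<lambda>x. (1 - cut \<sigma> i l x) * u x) (\<lambda>x. cut \<sigma> i l x * u x) * indicator {0..} l"
      unfolding coul_def by (simp add: nn_integral_multc)
    also have "\<dots> \<le> (\<integral>\<^sup>+x. ?k l x \<partial>lborel) * indicator {0..} l"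
      by (intro mult_right_mono cut_inequality[OF g Z \<sigma> minimal]) auto
    also have "\<dots> = (\<integral>\<^sup>+x. ?k l x * indicator {0..} l \<partial>lborel)"
      by (rule nn_integral_multc[symmetric]) measurable
    finally show "(\<integral>\<^sup>+x. (\<integral>\<^sup>+y. ?w x y * ?p x y l \<partial>lborel) \<partial>lborel) \<le> (\<integral>\<^sup>+x. ?k l x * indicator {0..} l \<partial>lborel)" .
  qed
  also have "\<dots> = (\<integral>\<^sup>+x. (\<integral>\<^sup>+l. ?k l x * indicator {0..} l \<partial>lborel) \<partial>lborel)"
    by (rule lborel_pair.Fubini') measurable
  also have "\<dots> \<le> (\<integral>\<^sup>+x. ennreal (?F x + (Z * u x + Z * ln 2 * (u x / norm x))) \<partial>lborel)"
  proof (intro nn_integral_mono)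
    fix x
    have "(\<integral>\<^sup>+l. ?k l x * indicator {0..} l \<partial>lborel)
        = (\<integral>\<^sup>+l. ennreal (?F x) * (ennreal (logistic (\<sigma> * x $ i - l) * (1 - logistic (\<sigma> * x $ i - l))) * indicator {0..} l)
          + ennreal (Z * (u x / norm x)) * (ennreal (logistic (\<sigma> * x $ i - l)) * indicator {0..} l) \<partial>lborel)"
    proof (intro nn_integral_cong)
      fix l
      have "ennreal (cut \<sigma> i l x * (1 - cut \<sigma> i l x) * ?F x) = ennreal (?F x) * ennreal (cut \<sigma> i l x * (1 - cut \<sigma> i l x))"
        by (subst mult.commute) (rule ennreal_mult'[OF F0(1)])
      moreover have "ennreal (Z * (cut \<sigma> i l x * (u x / norm x))) = ennreal (Z * (u x / norm x)) * ennreal (cut \<sigma> i l x)"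
        by (subst ennreal_mult'[OF F0(2), symmetric]) (simp add: mult_ac)
      ultimately show "?k l x * indicator {0..} l = ennreal (?F x) * (ennreal (logistic (\<sigma> * x $ i - l) * (1 - logistic (\<sigma> * x $ i - l))) * indicator {0..} l)
          + ennreal (Z * (u x / norm x)) * (ennreal (logistic (\<sigma> * x $ i - l)) * indicator {0..} l)"
        by (simp only: cut_def distrib_right mult.assoc)
    qed
    also have "\<dots> = ennreal (?F x) * (\<integral>\<^sup>+l. ennreal (logistic (\<sigma> * x $ i - l) * (1 - logistic (\<sigma> * x $ i - l))) * indicator {0..} l \<partial>lborel)
        + ennreal (Z * (u x / norm x)) * (\<integral>\<^sup>+l. ennreal (logistic (\<sigma> * x $ i - l)) * indicator {0..} l \<partial>lborel)"
      by (subst nn_integral_add, measurable, subst (1 2) nn_integral_cmult, measurable)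
    also have "\<dots> \<le> ennreal (?F x) * 1 + ennreal (Z * (u x / norm x)) * ennreal (\<bar>\<sigma> * x $ i\<bar> + ln 2)"
      by (intro add_mono mult_left_mono nn_integral_logistic_layer nn_integral_logistic) auto
    also have "\<dots> = ennreal (?F x + Z * (u x / norm x) * (\<bar>\<sigma> * x $ i\<bar> + ln 2))"
    proof -
      have "ennreal (?F x + Z * (u x / norm x) * (\<bar>\<sigma> * x $ i\<bar> + ln 2))
          = ennreal (?F x) + ennreal (Z * (u x / norm x) * (\<bar>\<sigma> * x $ i\<bar> + ln 2))"
        by (rule ennreal_plus[OF F0(1)]) (intro mult_nonneg_nonneg[OF F0(2)] add_nonneg_nonneg; simp)
      then show ?thesis by (simp only: ennreal_mult'[OF F0(2)] mult_1_right)
    qed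
    also have "\<dots> \<le> ennreal (?F x + (Z * u x + Z * ln 2 * (u x / norm x)))"
    proof (intro ennreal_leI add_left_mono)
      have "\<bar>\<sigma> * x $ i\<bar> \<le> norm x" using component_le_norm_cart[of x i] \<sigma> by (simp add: abs_mult)
      then have "u x / norm x * \<bar>\<sigma> * x $ i\<bar> \<le> u x / norm x * norm x" using d(2)[of x] by (intro mult_left_mono) auto
      also have "\<dots> \<le> u x" using d(2)[of x] d(2)[of 0] by simp
      finally have "Z * (u x / norm x * \<bar>\<sigma> * x $ i\<bar>) \<le> Z * u x" using Z by (rule mult_left_mono)
      then show "Z * (u x / norm x) * (\<bar>\<sigma> * x $ i\<bar> + ln 2) \<le> Z * u x + Z * ln 2 * (u x / norm x)"
        by (simp add: distrib_left mult_ac)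
    qed
    finally show "(\<integral>\<^sup>+l. ?k l x * indicator {0..} l \<partial>lborel) \<le> ennreal (?F x + (Z * u x + Z * ln 2 * (u x / norm x)))" .
  qed
  also have "\<dots> = ennreal (LINT x|lborel. ?F x + (Z * u x + Z * ln 2 * (u x / norm x)))"
  proof (rule nn_integral_eq_integral)
    show "integrable lborel (\<lambda>x. ?F x + (Z * u x + Z * ln 2 * (u x / norm x)))"
      by (intro Bochner_Integration.integrable_add integrable_mult_right d)
    show "AE x in lborel. 0 \<le> ?F x + (Z * u x + Z * ln 2 * (u x / norm x))"
      using d(2) Z by (intro AE_I2 add_nonneg_nonneg) auto
  qed
  also have "(LINT x|lborel. ?F x + (Z * u x + Z * ln 2 * (u x / norm x)))
      = (LINT x|lborel. ?F x) + (Z * (LINT x|lborel. u x) + Z * ln 2 * (LINT x|lborel. u x / norm x))"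
    by (subst Bochner_Integration.integral_add, (intro Bochner_Integration.integrable_add integrable_mult_right d)+,
        subst Bochner_Integration.integral_add[of _ "\<lambda>x. Z * u x"], (intro integrable_mult_right d)+, simp only: integral_mult_right_zero)
  finally show ?thesis .
qed

text \<open>The positive parts for \<open>\<sigma> = 1\<close> and \<open>\<sigma> = - 1\<close>
  dominate \<open>\<bar>x $ i - y $ i\<bar>\<close>, and the sum over \<open>i\<close> dominates
  \<open>norm (x - y)\<close>, which cancels the Coulomb kernel. A quarter of the squared mass is
  then at most twelve copies of the bound.\<close>

lemma minimizer_mass_le:
  assumes g: "admissible u G" and Z: "0 \<le> Z"
    and minimal: "\<And>v H. admissible v H \<Longrightarrow> (LINT x|lborel. v x) = (LINT x|lborel. u x) \<Longrightarrow> tot_energy Z u G \<le> tot_energy Z v H"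
  shows "(LINT x|lborel. u x)\<^sup>2
    \<le> 48 * ((LINT x|lborel. (u x)\<^sup>2 + 3 * (u x) ^ 3) + (Z * (LINT x|lborel. u x) + Z * ln 2 * (LINT x|lborel. u x / norm x)))"
proof -
  note d = admissibleD[OF g]
  note [measurable] = d(6)
  let ?b = "(LINT x|lborel. (u x)\<^sup>2 + 3 * (u x) ^ 3) + (Z * (LINT x|lborel. u x) + Z * ln 2 * (LINT x|lborel. u x / norm x))"
  let ?M = "LINT x|lborel. u x"
  have M0: "0 \<le> ?M" using d(2) by (intro Bochner_Integration.integral_nonneg) auto
  have b0: "0 \<le> ?b" using d(2) Z M0
    by (intro add_nonneg_nonneg mult_nonneg_nonneg Bochner_Integration.integral_nonneg) auto
  define A where "A \<sigma> i x y = ennreal (u x * u y / norm (x - y) * ((max (\<sigma> * y $ i) 0 - max (\<sigma> * x $ i) 0) / 4))"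
    for \<sigma> and i :: 3 and x y
  have [measurable]: "(\<lambda>(x, y). A \<sigma> i x y) \<in> borel_measurable (borel \<Otimes>\<^sub>M borel)" "(\<lambda>(x, y). A \<sigma> i y x) \<in> borel_measurable (borel \<Otimes>\<^sub>M borel)" for \<sigma> i
    unfolding A_def by measurable
  define I where "I f = (\<integral>\<^sup>+x. (\<integral>\<^sup>+y. f x y \<partial>lborel) \<partial>lborel)" for f :: "real^3 \<Rightarrow> real^3 \<Rightarrow> ennreal"
  have IA: "I (A \<sigma> i) \<le> ennreal ?b" if "\<bar>\<sigma>\<bar> = 1" for \<sigma> i
    unfolding I_def A_def by (rule cut_average[OF g Z that minimal])
  have IA': "I (\<lambda>x y. A \<sigma> i y x) = I (A \<sigma> i)" for \<sigma> i
    unfolding I_def by (rule lborel_pair.Fubini') measurable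
  have Iadd: "I (\<lambda>x y. f x y + h x y) = I f + I h"
    if [measurable]: "(\<lambda>(x, y). f x y) \<in> borel_measurable (borel \<Otimes>\<^sub>M borel)" "(\<lambda>(x, y). h x y) \<in> borel_measurable (borel \<Otimes>\<^sub>M borel)" for f h
    unfolding I_def by (simp add: nn_integral_add)
  let ?S = "\<lambda>i x y. (A 1 i x y + A 1 i y x) + (A (- 1) i x y + A (- 1) i y x)"
  have S: "I (?S i) \<le> ennreal (4 * ?b)" for i
  proof -
    have "I (?S i) = (I (A 1 i) + I (A 1 i)) + (I (A (- 1) i) + I (A (- 1) i))"
      by (subst Iadd, measurable, subst Iadd, measurable, subst Iadd, measurable) (simp only: IA')
    also have "\<dots> \<le> (ennreal ?b + ennreal ?b) + (ennreal ?b + ennreal ?b)" by (intro add_mono IA) auto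
    also have "\<dots> = ennreal (4 * ?b)" using b0 by (simp add: ennreal_plus[symmetric] del: ennreal_plus)
    finally show ?thesis .
  qed
  \<comment> \<open>On the diagonal the quotient by \<open>norm (x - y)\<close> is 0, so the
    inequality can fail there.\<close>
  have pw: "ennreal (u x * u y / 4) \<le> (?S 1 x y + ?S 2 x y) + ?S 3 x y" if "x \<noteq> y" for x y
  proof -
    let ?w = "u x * u y / norm (x - y)"
    have w: "0 \<le> ?w" using d(2) by simp
    \<comment> \<open>One of the two orders is nonpositive and becomes 0 in \<open>ennreal\<close>,
      so the sum is the absolute difference.\<close>
    have AA: "A \<sigma> i x y + A \<sigma> i y x = ennreal (?w * (\<bar>max (\<sigma> * y $ i) 0 - max (\<sigma> * x $ i) 0\<bar> / 4))" for \<sigma> i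
    proof (cases "max (\<sigma> * x $ i) 0 \<le> max (\<sigma> * y $ i) 0")
      case True
      then have "A \<sigma> i y x = 0"
        unfolding A_def using d(2) by (intro ennreal_neg mult_nonneg_nonpos) auto
      then show ?thesis using True by (simp add: A_def)
    next
      case False
      then have "A \<sigma> i x y = 0"
        unfolding A_def using d(2) by (intro ennreal_neg mult_nonneg_nonpos) auto
      moreover have "A \<sigma> i y x = ennreal (?w * ((max (\<sigma> * x $ i) 0 - max (\<sigma> * y $ i) 0) / 4))"
        by (simp only: A_def norm_minus_commute[of y x] mult.commute[of "u y" "u x"])
      moreover have "\<bar>max (\<sigma> * y $ i) 0 - max (\<sigma> * x $ i) 0\<bar> = max (\<sigma> * x $ i) 0 - max (\<sigma> * y $ i) 0"
        using False by (simp only: abs_if not_le diff_less_0_iff_less if_True minus_diff_eq)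
      ultimately show ?thesis by (simp only: add_0)
    qed
    have Si: "ennreal (?w * (\<bar>x $ i - y $ i\<bar> / 4)) \<le> ?S i x y" for i
    proof -
      have "\<bar>x $ i - y $ i\<bar> \<le> \<bar>max (1 * y $ i) 0 - max (1 * x $ i) 0\<bar> + \<bar>max (- 1 * y $ i) 0 - max (- 1 * x $ i) 0\<bar>"
        by (auto simp: max_def abs_if)
      then have "?w * (\<bar>x $ i - y $ i\<bar> / 4) \<le> ?w * (\<bar>max (1 * y $ i) 0 - max (1 * x $ i) 0\<bar> / 4 + \<bar>max (- 1 * y $ i) 0 - max (- 1 * x $ i) 0\<bar> / 4)"
        using w by (intro mult_left_mono) auto
      moreover have nn: "0 \<le> ?w * (\<bar>t\<bar> / 4)" for t :: real
        by (rule mult_nonneg_nonneg[OF w]) simp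
      ultimately show ?thesis unfolding AA distrib_left by (subst ennreal_plus[symmetric, OF nn nn]) (rule ennreal_leI)
    qed
    have "norm (x - y) \<le> (\<Sum>i\<in>UNIV. \<bar>(x - y) $ i\<bar>)" by (rule norm_le_l1_cart)
    then have "norm (x - y) \<le> \<bar>x $ 1 - y $ 1\<bar> + \<bar>x $ 2 - y $ 2\<bar> + \<bar>x $ 3 - y $ 3\<bar>" by (simp add: sum_3)
    then have "?w * (norm (x - y) / 4) \<le> ?w * (\<bar>x $ 1 - y $ 1\<bar> / 4 + \<bar>x $ 2 - y $ 2\<bar> / 4 + \<bar>x $ 3 - y $ 3\<bar> / 4)"
      using w by (intro mult_left_mono) auto
    moreover have "?w * (norm (x - y) / 4) = u x * u y / 4" using that by simp
    ultimately have "ennreal (u x * u y / 4) \<le> ennreal (?w * (\<bar>x $ 1 - y $ 1\<bar> / 4) + ?w * (\<bar>x $ 2 - y $ 2\<bar> / 4) + ?w * (\<bar>x $ 3 - y $ 3\<bar> / 4))"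
      unfolding distrib_left by (intro ennreal_leI) simp
    also have "\<dots> = ennreal (?w * (\<bar>x $ 1 - y $ 1\<bar> / 4)) + ennreal (?w * (\<bar>x $ 2 - y $ 2\<bar> / 4)) + ennreal (?w * (\<bar>x $ 3 - y $ 3\<bar> / 4))"
      using w by (simp only: ennreal_plus[OF add_nonneg_nonneg] ennreal_plus mult_nonneg_nonneg divide_nonneg_pos abs_ge_zero zero_less_numeral)
    also have "\<dots> \<le> (?S 1 x y + ?S 2 x y) + ?S 3 x y" by (intro add_mono Si)
    finally show ?thesis .
  qed
  have "ennreal (?M\<^sup>2 / 4) = I (\<lambda>x y. ennreal (u x * u y / 4))"
  proof -
    have iu: "(\<integral>\<^sup>+x. ennreal (u x) \<partial>lborel) = ennreal ?M"
      by (rule nn_integral_eq_integral[OF d(4)]) (use d(2) in simp)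
    have "I (\<lambda>x y. ennreal (u x * u y / 4)) = I (\<lambda>x y. ennreal (u x) * (ennreal (u y) * ennreal (1 / 4)))"
      using d(2) by (simp add: ennreal_mult[symmetric])
    also have "\<dots> = ennreal ?M * (ennreal ?M * ennreal (1 / 4))"
      unfolding I_def by (simp add: nn_integral_cmult nn_integral_multc iu)
    finally show ?thesis using M0 by (simp add: ennreal_mult[symmetric] power2_eq_square)
  qed
  also have "\<dots> \<le> I (\<lambda>x y. (?S 1 x y + ?S 2 x y) + ?S 3 x y)"
    unfolding I_def
  proof (rule nn_integral_mono, rule nn_integral_mono_AE)
    fix x :: "real^3"
    have "AE y in lborel. y \<noteq> x" by (rule AE_lborel_singleton)
    then show "AE y in lborel. ennreal (u x * u y / 4) \<le> (?S 1 x y + ?S 2 x y) + ?S 3 x y"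
      by (rule AE_mp) (use pw[of x] in auto)
  qed
  also have "\<dots> = (I (?S 1) + I (?S 2)) + I (?S 3)"
    by (subst Iadd, measurable, subst Iadd, measurable)
  also have "\<dots> \<le> (ennreal (4 * ?b) + ennreal (4 * ?b)) + ennreal (4 * ?b)" by (intro add_mono S)
  also have "\<dots> = ennreal (12 * ?b)" using b0 by (simp add: ennreal_plus[symmetric] del: ennreal_plus)
  finally have "?M\<^sup>2 / 4 \<le> 12 * ?b" using b0 by (subst (asm) ennreal_le_iff) auto
  then show ?thesis by simp
qed

text \<open>Nonpositive energy and coercivity make the double well linear in the mass, up to a
  constant, and with it every term on the right of \<open>minimizer_mass_le\<close>.\<close>

lemma minimizer_mass_bound:
  assumes g: "admissible u G" and Z: "0 \<le> Z" and neg: "tot_energy Z u G \<le> 0"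
    and minimal: "\<And>v H. admissible v H \<Longrightarrow> (LINT x|lborel. v x) = (LINT x|lborel. u x) \<Longrightarrow> tot_energy Z u G \<le> tot_energy Z v H"
  shows "(LINT x|lborel. u x)\<^sup>2 \<le> 48 * ((35 + 1/2 + 38 * Z) * (LINT x|lborel. u x) + 37 * (Z\<^sup>2 * newton_const))"
proof -
  note d = admissibleD[OF g]
  define M where "M = (LINT x|lborel. u x)"
  define w where "w = (LINT x|lborel. dwell (u x))"
  define P where "P = (LINT x|lborel. u x / norm x)"
  define C where "C = Z\<^sup>2 * newton_const"
  have P0: "0 \<le> P" using d(2) unfolding P_def by (intro Bochner_Integration.integral_nonneg) auto
  have g0: "0 \<le> (LINT x|lborel. (norm (G x))\<^sup>2)" by (intro Bochner_Integration.integral_nonneg) auto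
  have c0: "0 \<le> enn2real (coul u u)" by simp
  have "(LINT x|lborel. (norm (G x))\<^sup>2) / 2 + w / 2 + enn2real (coul u u) / 2 \<le> tot_energy Z u G + (Z + 1/2) * M + C"
    unfolding w_def M_def C_def by (rule energy_lower_bound[OF g Z])
  then have w: "w \<le> 2 * ((Z + 1/2) * M + C)" using neg g0 c0 by argo
  have ZP: "Z * P \<le> w + ((Z + 1/2) * M + C)"
  proof -
    have "tot_energy Z u G = (LINT x|lborel. (norm (G x))\<^sup>2) / 2 + w - Z * P + enn2real (coul u u) / 2"
      by (simp add: tot_energy_def loc_energy_def w_def P_def)
    moreover have "Z * P = (LINT x|lborel. Z * (u x / norm x))" unfolding P_def by (rule integral_mult_right_zero[symmetric])
    moreover have "\<dots> \<le> (LINT x|lborel. dwell (u x) / 2 + (Z + 1/2) * u x + Z\<^sup>2 * (indicator (ball 0 1) x * (1 / (norm x)\<^sup>2)))"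
      by (intro integral_mono potential_dwell_bound d Z Bochner_Integration.integrable_add integrable_mult_right
          integrable_divide integrable_inverse_square)
    moreover have "\<dots> = w / 2 + (Z + 1/2) * M + C"
      unfolding w_def M_def C_def
      by (subst Bochner_Integration.integral_add,
          (intro Bochner_Integration.integrable_add integrable_mult_right integrable_divide d integrable_inverse_square)+,
          subst Bochner_Integration.integral_add, (intro integrable_mult_right integrable_divide d)+,
          simp only: integral_mult_right_zero integral_divide_zero integrable_inverse_square(2))
    moreover have "0 \<le> w" unfolding w_def by (intro Bochner_Integration.integral_nonneg dwell_nonneg)
    ultimately show ?thesis by argo
  qed
  have zl: "Z * ln 2 * P \<le> Z * P"
    using ln_2_less_1 Z P0 mult_left_le[of "ln 2" "Z * P"] by (simp add: mult_ac)
  \<comment> \<open>The 17 is \<open>2 + 3 * 5\<close>, from the bounds on squares and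
    cubes.\<close>
  have sq: "(LINT x|lborel. (u x)\<^sup>2 + 3 * (u x) ^ 3) \<le> 17 * M + 17 * w"
  proof -
    have "(LINT x|lborel. (u x)\<^sup>2 + 3 * (u x) ^ 3) \<le> (LINT x|lborel. 17 * u x + 17 * dwell (u x))"
    proof (rule integral_mono)
      show "(u x)\<^sup>2 + 3 * (u x) ^ 3 \<le> 17 * u x + 17 * dwell (u x)" for x
        using square_le_dwell[OF d(2), of x] cube_le_dwell[OF d(2), of x] by linarith
    qed (intro Bochner_Integration.integrable_add integrable_mult_right d)+
    then show ?thesis using d(3,4) by (simp add: M_def w_def)
  qed
  have "M\<^sup>2 \<le> 48 * ((LINT x|lborel. (u x)\<^sup>2 + 3 * (u x) ^ 3) + (Z * M + Z * ln 2 * P))"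
    unfolding M_def P_def by (rule minimizer_mass_le[OF g Z minimal])
  also have "\<dots> \<le> 48 * ((17 * M + 17 * w) + (Z * M + (w + ((Z + 1/2) * M + C))))"
    by (rule mult_left_mono) (intro add_mono sq order_refl order_trans[OF zl ZP], simp)
  finally have f1: "M\<^sup>2 \<le> 48 * ((17 * M + 17 * w) + (Z * M + (w + ((Z + 1/2) * M + C))))" .
  have f2: "(17 * M + 17 * w) + (Z * M + (w + ((Z + 1/2) * M + C)))
      \<le> (17 * M + 17 * (2 * ((Z + 1/2) * M + C))) + (Z * M + (2 * ((Z + 1/2) * M + C) + ((Z + 1/2) * M + C)))"
    using w by linarith
  \<comment> \<open>The coefficients are \<open>17 + 17 + 3/2\<close>, \<open>34 + 1 + 3\<close> and
    \<open>34 + 3\<close>.\<close>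
  have f3: "\<dots> = (35 + 1/2 + 38 * Z) * M + 37 * C" by (simp add: algebra_simps)
  have "M\<^sup>2 \<le> 48 * ((35 + 1/2 + 38 * Z) * M + 37 * C)"
    by (rule order_trans[OF f1 mult_left_mono[OF f2[unfolded f3]]]) simp
  then show ?thesis unfolding M_def C_def .
qed

theorem theorem1p1:
  fixes Z :: real
  assumes "Z > 0"
  shows "\<exists>M1 M2 :: real. 0 < Z \<and> Z \<le> M1 \<and> M1 \<le> M2 \<and>
    (\<forall>M\<ge>0. (M \<le> M1 \<longrightarrow> has_minimizer Z M) \<and> (M \<ge> M2 \<longrightarrow> \<not> has_minimizer Z M))"
proof -
  note Z = less_imp_le[OF assms]
  define \<alpha> where "\<alpha> = 35 + 1/2 + 38 * Z"
  define \<beta> where "\<beta> = 37 * (Z\<^sup>2 * newton_const)"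
  have "has_minimizer Z M" if M: "0 \<le> M" "M \<le> Z" for M
  proof -
    obtain u G where g: "admissible u G" and m: "(LINT x|lborel. u x) \<le> M"
      and min: "\<forall>v H. admissible v H \<longrightarrow> (LINT x|lborel. v x) \<le> M \<longrightarrow> tot_energy Z u G \<le> tot_energy Z v H"
      by (rule relaxed_minimizer[OF Z M(1)])
    have mass: "(LINT x|lborel. u x) = M"
    proof (rule ccontr)
      assume "(LINT x|lborel. u x) \<noteq> M"
      then have "(LINT x|lborel. u x) < Z" "0 < M - (LINT x|lborel. u x)" using m M by linarith+
      then obtain t v H where "t \<le> M - (LINT x|lborel. u x)" "admissible v H"
        "(LINT x|lborel. v x) = (LINT x|lborel. u x) + t" "tot_energy Z v H < tot_energy Z u G"
        by (rule lower_energy_by_far_mass[OF g Z])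
      then show False using min by force
    qed
    have "energy Z u \<le> energy Z v" if "v \<in> hat_H M" for v
      using that Z
    proof (cases rule: hat_H_representative)
      \<comment> \<open>Comparison with the zero function shows that the minimiser has nonpositive
        energy, so a default value cannot undercut it.\<close>
      case junk
      have "tot_energy Z u G \<le> 0"
        using min[rule_format, OF admissible_zero(1)] M(1) by (simp add: admissible_zero(2))
      then show ?thesis using junk by (simp add: energy_admissible[OF g])
    next
      case (admissible v' H)
      then show ?thesis using min by (simp add: energy_admissible[OF g])
    qed
    moreover have "u \<in> hat_H M" using admissible_hat_H[OF g] by (simp add: mass)
    ultimately show ?thesis unfolding has_minimizer_iff by blast
  qed
  moreover have "\<not> has_minimizer Z M" if M: "48 * (\<alpha> + \<bar>\<beta>\<bar>) + 1 \<le> M" for M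
  proof
    assume "has_minimizer Z M"
    then obtain u where u: "u \<in> hat_H M" and min: "\<And>v. v \<in> hat_H M \<Longrightarrow> energy Z u \<le> energy Z v"
      unfolding has_minimizer_iff by blast
    have min': "energy Z u \<le> tot_energy Z v H" if "admissible v H" "(LINT x|lborel. v x) = M" for v H
      using min[of v] admissible_hat_H[OF that(1)] that by (simp add: energy_admissible)
    have M1: "1 \<le> M" using M Z by (simp add: \<alpha>_def)
    then have "0 < M" by simp
    then obtain w W where "admissible w W" "(LINT x|lborel. w x) = M" "tot_energy Z w W < 0"
      by (rule negative_energy[OF assms])
    \<comment> \<open>Positive mass admits negative energy, which rules out the default branch for
      the minimiser itself.\<close>
    then have neg: "energy Z u < 0" using min'[of w W] by simp
    from u Z show False
    proof (cases rule: hat_H_representative)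
      case junk
      then show ?thesis using neg by simp
    next
      case (admissible v H)
      have "(LINT x|lborel. v x)\<^sup>2 \<le> 48 * ((35 + 1/2 + 38 * Z) * (LINT x|lborel. v x) + 37 * (Z\<^sup>2 * newton_const))"
        by (rule minimizer_mass_bound[OF admissible(1) Z]) (use neg min' admissible in auto)
      then have "M * M \<le> 48 * (\<alpha> * M + \<beta>)"
        unfolding admissible(2) \<alpha>_def \<beta>_def by (simp only: power2_eq_square)
      \<comment> \<open>As \<open>M \<ge> 1\<close>, the constant is at most a linear term; division
        by \<open>M\<close> then contradicts the threshold.\<close>
      also have "\<dots> \<le> 48 * (\<alpha> * M + \<bar>\<beta>\<bar> * M)"
        using mult_left_mono[OF M1, of "\<bar>\<beta>\<bar>"] by simp
      also have "\<dots> = (48 * (\<alpha> + \<bar>\<beta>\<bar>)) * M" by (simp add: algebra_simps)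
      finally have "M \<le> 48 * (\<alpha> + \<bar>\<beta>\<bar>)" using M1 by simp
      then show False using M by simp
    qed
  qed
  \<comment> \<open>The maximum with \<open>Z\<close> secures \<open>M1 \<le> M2\<close>.\<close>
  ultimately show ?thesis
    using assms by (intro exI[of _ Z] exI[of _ "max Z (48 * (\<alpha> + \<bar>\<beta>\<bar>) + 1)"]) auto
qed

end
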